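(* Let $H$ be a Lie group, $q:M\to M/H$ an $H$-principal bundle, $F$ a Dirac structure on $M/H$, and $E=q^!F$ the pullback Dirac structure on $M$. If $(\mathcal G,\omega)$ is an $H$-admissible pre-symplectic groupoid integrating $E$, then there is a unique pre-symplectic structure $\overline\omega$ on the quotient Lie groupoid $\overline{\mathcal G}=\mathcal G/(H\times H)$ over $M/H$ such that $p^*\overline\omega=\omega$, where $p:\mathcal G\to\overline{\mathcal G}$ is the quotient map, and $(\overline{\mathcal G},\overline\omega)$ is a pre-symplectic groupoid integrating $F$.
   Context: Dirac structures: on $\mathbb TM=TM\oplus T^*M$ consider the pairing $\langle(X,\alpha),(Y,\beta)\rangle=\beta(X)+\alpha(Y)$ and the Courant–Dorfman bracket $[\![(X,\alpha),(Y,\beta)]\!]=([X,Y],\mathcal L_X\beta-i_Yd\alpha)$. A Dirac structure on $M$ is a vector subbundle $E\subset\mathbb TM$, lagrangian for $\langle\cdot,\cdot\rangle$ and involutive for $[\![\cdot,\cdot]\!]$; it is a Lie algebroid with anchor the projection to $TM$ and the restricted bracket. For a Dirac structure $F$ on $M/H$, $q^!F=\{(X,q^*\beta)\mid(dq(X),\beta)\in F\}\subset\mathbb TM$. Pre-symplectic groupoids: for a Lie groupoid $\mathcal G\rightrightarrows M$ with Lie algebroid $A=\ker(d\mathbf s)|_M$ (bracket via right-invariant vector fields, anchor $\rho=d\mathbf t|_A$) and $\omega\in\Omega^2(\mathcal G)$, put $\mu_\omega(a)=(i_a\omega)|_{TM}$ and $\delta_\omega=(\rho,\mu_\omega):A\to\mathbb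 TM$. $\omega$ is multiplicative if $m^*\omega=\mathrm p_1^*\omega+\mathrm p_2^*\omega$ on composable pairs. $(\mathcal G,\omega)$ is a pre-symplectic groupoid (and $\omega$ a pre-symplectic structure on $\mathcal G$) if $\omega$ is closed and multiplicative, $\dim\mathcal G=2\dim M$ and $\delta_\omega$ is injective. It integrates the Dirac structure $E=\delta_\omega(A)$ (and then $\delta_\omega:A\to E$ is a Lie algebroid isomorphism). $H$-admissibility: let $\mathfrak h=\mathrm{Lie}(H)$ (bracket via right-invariant vector fields), $u_M|_x=\frac{d}{d\epsilon}|_{0}\exp(\epsilon u)\cdot x$, $\mathfrak h\ltimes M$ the action Lie algebroid, and $\psi:\mathfrak h\ltimes M\to E$, $\psi(u,x)=(u_M|_x,0)$, a Lie algebroid morphism. A pre-symplectic groupoid $(\mathcal G,\omega)$ integrating $E=q^!F$ is $H$-admissible if $\psi$ (with $A\cong E$ via $\delta_\omega$) integrates to a Lie groupoid morphism $\Psi:H\ltimes M\to\mathcal G$ over $\mathrm{id}_M$, where $H\ltimes M$ is the action groupoid (source $(h,x)\mapsto x$, target $(h,x)\mapsto h\cdot x$), and $\omega$ is invariant under the $(H\times H)$-action $(h_1,h_2)\cdot g=\Psi(h_1,\mathbf t(g))\,g\,\Psi(h_2,\mathbf s(g))^{-1}$ on $\mathcal G$. The orbit space $\overline{\mathcal G}=\mathcal G/(H\times H)$ carries the Lie groupoid structure over $M/H$ for which $p$ is a submersion and a groupoid morphism covering $q$. *)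

theory Defs
  imports "HOL-Analysis.Analysis" "HOL-Algebra.Group"
begin

section \<open>Smooth functions on open subsets of Euclidean space\<close>

text \<open>
  Dimensions are natural numbers that occur inside definitions (products, fibre products), so
  \<open>\<real>\<^sup>n\<close> is the library's \<^const>\<open>Euclidean_space\<close> \<open>n\<close>, whose points are the sequences
  \<open>x :: nat \<Rightarrow> real\<close> with \<open>x i = 0\<close> for \<open>i \<ge> n\<close>. This includes \<open>n = 0\<close>.
\<close>

definition partial :: "nat \<Rightarrow> ((nat \<Rightarrow> real) \<Rightarrow> real) \<Rightarrow> (nat \<Rightarrow> real) \<Rightarrow> real" where
  "partial i f x = deriv (\<lambda>t. f (x(i := t))) (x i)"

primrec Ck_on :: "nat \<Rightarrow> nat \<Rightarrow> (nat \<Rightarrow> real) set \<Rightarrow> ((nat \<Rightarrow> real) \<Rightarrow> real) \<Rightarrow> bool" where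
  "Ck_on n 0 S f \<longleftrightarrow> continuous_map (subtopology (Euclidean_space n) S) euclideanreal f"
| "Ck_on n (Suc k) S f \<longleftrightarrow>
     continuous_map (subtopology (Euclidean_space n) S) euclideanreal f \<and>
     (\<forall>i<n. (\<forall>x\<in>S. (\<lambda>t. f (x(i := t))) field_differentiable at (x i)) \<and>
            Ck_on n k S (partial i f))"

definition smooth_on :: "nat \<Rightarrow> (nat \<Rightarrow> real) set \<Rightarrow> ((nat \<Rightarrow> real) \<Rightarrow> real) \<Rightarrow> bool" where
  "smooth_on n S f \<longleftrightarrow> openin (Euclidean_space n) S \<and> (\<forall>k. Ck_on n k S f)"

definition jacobian ::
    "nat \<Rightarrow> ((nat \<Rightarrow> real) \<Rightarrow> nat \<Rightarrow> real) \<Rightarrow> (nat \<Rightarrow> real) \<Rightarrow> (nat \<Rightarrow> real) \<Rightarrow> nat \<Rightarrow> real" where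
  "jacobian n f x v = (\<lambda>j. \<Sum>i<n. v i * partial i (\<lambda>y. f y j) x)"

definition join :: "nat \<Rightarrow> (nat \<Rightarrow> real) \<Rightarrow> (nat \<Rightarrow> real) \<Rightarrow> nat \<Rightarrow> real" where
  "join n x y = (\<lambda>i. if i < n then x i else y (i - n))"


section \<open>Manifolds\<close>

text \<open>
  A chart is its domain together with its coordinate map; values of the coordinate map off the
  domain are irrelevant. Atlases need not be maximal. Manifolds are nonempty and have the same
  dimension everywhere, so that \<open>mdim\<close> is determined by the topology.
\<close>

type_synonym 'a chart = "'a set \<times> ('a \<Rightarrow> nat \<Rightarrow> real)"

record 'a manifold =
  mtop :: "'a topology"
  mdim :: nat
  atlas :: "'a chart set"

definition points :: "'a manifold \<Rightarrow> 'a set" where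
  "points M = topspace (mtop M)"

definition chart_inv :: "'a chart \<Rightarrow> (nat \<Rightarrow> real) \<Rightarrow> 'a" where
  "chart_inv c = inv_into (fst c) (snd c)"

definition chart_rep :: "'a chart \<Rightarrow> 'b chart \<Rightarrow> ('a \<Rightarrow> 'b) \<Rightarrow> (nat \<Rightarrow> real) \<Rightarrow> nat \<Rightarrow> real" where
  "chart_rep c d f = (\<lambda>y. snd d (f (chart_inv c y)))"

definition chart_on :: "'a topology \<Rightarrow> nat \<Rightarrow> 'a chart \<Rightarrow> bool" where
  "chart_on X n c \<longleftrightarrow> openin X (fst c) \<and> openin (Euclidean_space n) (snd c ` fst c) \<and>
     homeomorphic_map (subtopology X (fst c)) (subtopology (Euclidean_space n) (snd c ` fst c)) (snd c)"

definition smooth_atlas :: "'a manifold \<Rightarrow> bool" where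
  "smooth_atlas M \<longleftrightarrow> points M \<noteq> {} \<and>
     (\<forall>c\<in>atlas M. chart_on (mtop M) (mdim M) c) \<and>
     (\<Union>c\<in>atlas M. fst c) = points M \<and>
     (\<forall>c\<in>atlas M. \<forall>d\<in>atlas M. \<forall>j<mdim M.
        smooth_on (mdim M) (snd c ` (fst c \<inter> fst d)) (\<lambda>y. chart_rep c d id y j))"

definition smooth_manifold :: "'a manifold \<Rightarrow> bool" where
  "smooth_manifold M \<longleftrightarrow> smooth_atlas M \<and> Hausdorff_space (mtop M) \<and> second_countable (mtop M)"

definition smooth_map :: "'a manifold \<Rightarrow> 'b manifold \<Rightarrow> ('a \<Rightarrow> 'b) \<Rightarrow> bool" where
  "smooth_map M N f \<longleftrightarrow> continuous_map (mtop M) (mtop N) f \<and>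
     (\<forall>c\<in>atlas M. \<forall>d\<in>atlas N. \<forall>j<mdim N.
        smooth_on (mdim M) (snd c ` (fst c \<inter> f -` fst d)) (\<lambda>y. chart_rep c d f y j))"

definition smooth_fun_on :: "'a manifold \<Rightarrow> 'a set \<Rightarrow> ('a \<Rightarrow> real) \<Rightarrow> bool" where
  "smooth_fun_on M W f \<longleftrightarrow>
     (\<forall>c\<in>atlas M. smooth_on (mdim M) (snd c ` (fst c \<inter> W)) (\<lambda>y. f (chart_inv c y)))"

definition prod_manifold :: "'a manifold \<Rightarrow> 'b manifold \<Rightarrow> ('a \<times> 'b) manifold" where
  "prod_manifold M N =
     \<lparr>mtop = prod_topology (mtop M) (mtop N), mdim = mdim M + mdim N,
      atlas = {(fst c \<times> fst d, \<lambda>(x, y). join (mdim M) (snd c x) (snd d y)) |c d.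
                 c \<in> atlas M \<and> d \<in> atlas N}\<rparr>"

definition open_submanifold :: "'a manifold \<Rightarrow> 'a set \<Rightarrow> 'a manifold" where
  "open_submanifold M U =
     \<lparr>mtop = subtopology (mtop M) U, mdim = mdim M,
      atlas = {(fst c \<inter> U, snd c) |c. c \<in> atlas M}\<rparr>"

definition real_line :: "real manifold" where
  "real_line = \<lparr>mtop = euclideanreal, mdim = 1,
                atlas = {(UNIV, \<lambda>t i. if i = 0 then t else 0)}\<rparr>"

text \<open>
  The manifold structure of a subset \<open>S\<close> of \<open>N\<close> as an embedded submanifold of dimension \<open>k\<close>:
  all charts \<open>c\<close> of the subspace topology such that \<open>c\<close> extends locally to a smooth function on \<open>N\<close>
  and the inverse of \<open>c\<close> is smooth as a map to \<open>N\<close>. These charts are automatically compatible;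
  \<open>S\<close> is an embedded submanifold of dimension \<open>k\<close> precisely when they cover \<open>S\<close>.
\<close>

definition submanifold :: "'a manifold \<Rightarrow> 'a set \<Rightarrow> nat \<Rightarrow> 'a manifold" where
  "submanifold N S k =
     \<lparr>mtop = subtopology (mtop N) S, mdim = k,
      atlas = {c. chart_on (subtopology (mtop N) S) k c \<and>
        (\<forall>x\<in>fst c. \<exists>W f. openin (mtop N) W \<and> x \<in> W \<and>
            (\<forall>j<k. smooth_fun_on N W (\<lambda>y. f y j)) \<and> (\<forall>y\<in>W \<inter> fst c. f y = snd c y)) \<and>
        (\<forall>d\<in>atlas N. \<forall>j<mdim N.
            smooth_on k (snd c ` (fst c \<inter> fst d)) (\<lambda>y. snd d (chart_inv c y) j))}\<rparr>"


section \<open>Tangent vectors, vector fields and differential forms\<close>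

text \<open>
  A tangent vector at \<open>x\<close> assigns to every chart around \<open>x\<close> its coordinate vector, subject to
  the transformation rule; it is \<open>0\<close> on all other charts, so that tangent vectors are equal as soon
  as their coordinates are. Likewise covectors and forms are \<open>0\<close> outside their
  proper domain.
\<close>

type_synonym 'a tvec = "'a chart \<Rightarrow> nat \<Rightarrow> real"
type_synonym 'a covec = "'a tvec \<Rightarrow> real"
type_synonym 'a form2 = "'a \<Rightarrow> 'a tvec \<Rightarrow> 'a tvec \<Rightarrow> real"

definition charts_at :: "'a manifold \<Rightarrow> 'a \<Rightarrow> 'a chart set" where
  "charts_at M x = {c \<in> atlas M. x \<in> fst c}"

definition some_chart :: "'a manifold \<Rightarrow> 'a \<Rightarrow> 'a chart" where
  "some_chart M x = (SOME c. c \<in> charts_at M x)"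

definition tangent_space :: "'a manifold \<Rightarrow> 'a \<Rightarrow> 'a tvec set" where
  "tangent_space M x = {v.
     (\<forall>c. c \<notin> charts_at M x \<longrightarrow> v c = (\<lambda>_. 0)) \<and>
     (\<forall>c\<in>charts_at M x. v c \<in> topspace (Euclidean_space (mdim M))) \<and>
     (\<forall>c\<in>charts_at M x. \<forall>d\<in>charts_at M x.
        v d = jacobian (mdim M) (chart_rep c d id) (snd c x) (v c))}"

definition tzero :: "'a tvec" where "tzero = (\<lambda>c i. 0)"
definition tadd :: "'a tvec \<Rightarrow> 'a tvec \<Rightarrow> 'a tvec" where "tadd v w = (\<lambda>c i. v c i + w c i)"
definition tscale :: "real \<Rightarrow> 'a tvec \<Rightarrow> 'a tvec" where "tscale a v = (\<lambda>c i. a * v c i)"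

text \<open>The differential of \<open>f\<close> at \<open>x\<close>; by the chain rule it is independent of the chart at \<open>x\<close>.\<close>

definition tmap :: "'a manifold \<Rightarrow> 'b manifold \<Rightarrow> ('a \<Rightarrow> 'b) \<Rightarrow> 'a \<Rightarrow> 'a tvec \<Rightarrow> 'b tvec" where
  "tmap M N f x v = (\<lambda>d. if d \<in> charts_at N (f x)
     then (let c = some_chart M x in jacobian (mdim M) (chart_rep c d f) (snd c x) (v c))
     else (\<lambda>_. 0))"

definition submersion :: "'a manifold \<Rightarrow> 'b manifold \<Rightarrow> ('a \<Rightarrow> 'b) \<Rightarrow> bool" where
  "submersion M N f \<longleftrightarrow> smooth_map M N f \<and>
     (\<forall>x\<in>points M. tmap M N f x ` tangent_space M x = tangent_space N (f x))"

text \<open>\<open>velocity M \<gamma>\<close> is the derivative at \<open>0\<close> of the curve \<open>\<gamma>\<close>, that is, \<open>d\<gamma>(\<partial>/\<partial>t)\<close>.\<close>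

definition velocity :: "'a manifold \<Rightarrow> (real \<Rightarrow> 'a) \<Rightarrow> 'a tvec" where
  "velocity M \<gamma> = tmap real_line M \<gamma> 0
     (\<lambda>c i. if c \<in> atlas real_line \<and> i = 0 then 1 else 0)"

definition cotangent_space :: "'a manifold \<Rightarrow> 'a \<Rightarrow> 'a covec set" where
  "cotangent_space M x = {\<alpha>.
     (\<forall>v. v \<notin> tangent_space M x \<longrightarrow> \<alpha> v = 0) \<and>
     (\<forall>v\<in>tangent_space M x. \<forall>w\<in>tangent_space M x. \<alpha> (tadd v w) = \<alpha> v + \<alpha> w) \<and>
     (\<forall>a. \<forall>v\<in>tangent_space M x. \<alpha> (tscale a v) = a * \<alpha> v)}"

definition covec_pullback ::
    "'a manifold \<Rightarrow> 'b manifold \<Rightarrow> ('a \<Rightarrow> 'b) \<Rightarrow> 'a \<Rightarrow> 'b covec \<Rightarrow> 'a covec" where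
  "covec_pullback M N f x \<beta> = (\<lambda>v. if v \<in> tangent_space M x then \<beta> (tmap M N f x v) else 0)"

text \<open>The \<open>i\<close>-th coordinate vector field of the chart \<open>c\<close>.\<close>

definition coord_vec :: "'a manifold \<Rightarrow> 'a chart \<Rightarrow> nat \<Rightarrow> 'a \<Rightarrow> 'a tvec" where
  "coord_vec M c i x = (\<lambda>d. if d \<in> charts_at M x
     then jacobian (mdim M) (chart_rep c d id) (snd c x) (\<lambda>j. if j = i then 1 else 0)
     else (\<lambda>_. 0))"

text \<open>Coordinate components in a chart, as functions of the coordinates.\<close>

definition comp_vf :: "'a chart \<Rightarrow> ('a \<Rightarrow> 'a tvec) \<Rightarrow> nat \<Rightarrow> (nat \<Rightarrow> real) \<Rightarrow> real" where
  "comp_vf c X i y = X (chart_inv c y) c i"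

definition comp1 :: "'a manifold \<Rightarrow> 'a chart \<Rightarrow> ('a \<Rightarrow> 'a covec) \<Rightarrow> nat \<Rightarrow> (nat \<Rightarrow> real) \<Rightarrow> real" where
  "comp1 M c \<alpha> i y = (let x = chart_inv c y in \<alpha> x (coord_vec M c i x))"

definition comp2 :: "'a manifold \<Rightarrow> 'a chart \<Rightarrow> 'a form2 \<Rightarrow> nat \<Rightarrow> nat \<Rightarrow> (nat \<Rightarrow> real) \<Rightarrow> real" where
  "comp2 M c \<omega> i j y = (let x = chart_inv c y in \<omega> x (coord_vec M c i x) (coord_vec M c j x))"

definition vector_field_on :: "'a manifold \<Rightarrow> 'a set \<Rightarrow> ('a \<Rightarrow> 'a tvec) \<Rightarrow> bool" where
  "vector_field_on M U X \<longleftrightarrow> (\<forall>x\<in>U. X x \<in> tangent_space M x) \<and>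
     (\<forall>c\<in>atlas M. \<forall>i<mdim M. smooth_on (mdim M) (snd c ` (fst c \<inter> U)) (comp_vf c X i))"

definition form1_on :: "'a manifold \<Rightarrow> 'a set \<Rightarrow> ('a \<Rightarrow> 'a covec) \<Rightarrow> bool" where
  "form1_on M U \<alpha> \<longleftrightarrow> (\<forall>x\<in>U. \<alpha> x \<in> cotangent_space M x) \<and>
     (\<forall>c\<in>atlas M. \<forall>i<mdim M. smooth_on (mdim M) (snd c ` (fst c \<inter> U)) (comp1 M c \<alpha> i))"

definition is_form2 :: "'a manifold \<Rightarrow> 'a form2 \<Rightarrow> bool" where
  "is_form2 M \<omega> \<longleftrightarrow>
     (\<forall>x v w. x \<notin> points M \<or> v \<notin> tangent_space M x \<or> w \<notin> tangent_space M x \<longrightarrow> \<omega> x v w = 0) \<and>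
     (\<forall>x\<in>points M. \<forall>v\<in>tangent_space M x.
        \<omega> x v \<in> cotangent_space M x \<and> (\<forall>w\<in>tangent_space M x. \<omega> x w v = - \<omega> x v w)) \<and>
     (\<forall>c\<in>atlas M. \<forall>i<mdim M. \<forall>j<mdim M.
        smooth_on (mdim M) (snd c ` fst c) (comp2 M c \<omega> i j))"

definition form2_pullback ::
    "'a manifold \<Rightarrow> 'b manifold \<Rightarrow> ('a \<Rightarrow> 'b) \<Rightarrow> 'b form2 \<Rightarrow> 'a form2" where
  "form2_pullback M N f \<omega> = (\<lambda>x v w.
     if x \<in> points M \<and> v \<in> tangent_space M x \<and> w \<in> tangent_space M x
     then \<omega> (f x) (tmap M N f x v) (tmap M N f x w) else 0)"

text \<open>
  Differential operators, by their coordinate expressions (in Einstein notation)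
  \<open>[X,Y]\<^sup>j = X\<^sup>i \<partial>\<^sub>i Y\<^sup>j - Y\<^sup>i \<partial>\<^sub>i X\<^sup>j\<close>, \<open>(L\<^sub>X \<alpha>)\<^sub>j = X\<^sup>i \<partial>\<^sub>i \<alpha>\<^sub>j + \<alpha>\<^sub>i \<partial>\<^sub>j X\<^sup>i\<close>,
  \<open>d\<alpha>(u,v) = u\<^sup>i v\<^sup>j (\<partial>\<^sub>i \<alpha>\<^sub>j - \<partial>\<^sub>j \<alpha>\<^sub>i)\<close> and the cyclic formula for \<open>d\<omega>\<close>.
\<close>

definition lie_bracket ::
    "'a manifold \<Rightarrow> ('a \<Rightarrow> 'a tvec) \<Rightarrow> ('a \<Rightarrow> 'a tvec) \<Rightarrow> 'a \<Rightarrow> 'a tvec" where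
  "lie_bracket M X Y x = (\<lambda>c. if c \<in> charts_at M x
     then (\<lambda>j. \<Sum>i<mdim M. X x c i * partial i (comp_vf c Y j) (snd c x)
                         - Y x c i * partial i (comp_vf c X j) (snd c x))
     else (\<lambda>_. 0))"

definition lie_deriv1 :: "'a manifold \<Rightarrow> ('a \<Rightarrow> 'a tvec) \<Rightarrow> ('a \<Rightarrow> 'a covec) \<Rightarrow> 'a \<Rightarrow> 'a covec" where
  "lie_deriv1 M X \<alpha> x v = (let c = some_chart M x; y = snd c x; n = mdim M in
     \<Sum>j<n. v c j * (\<Sum>i<n. comp_vf c X i y * partial i (comp1 M c \<alpha> j) y
                           + comp1 M c \<alpha> i y * partial j (comp_vf c X i) y))"

definition ext_d1 :: "'a manifold \<Rightarrow> ('a \<Rightarrow> 'a covec) \<Rightarrow> 'a form2" where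
  "ext_d1 M \<alpha> x u v = (let c = some_chart M x; y = snd c x; n = mdim M in
     \<Sum>i<n. \<Sum>j<n. u c i * v c j * (partial i (comp1 M c \<alpha> j) y - partial j (comp1 M c \<alpha> i) y))"

definition ext_d2 :: "'a manifold \<Rightarrow> 'a form2 \<Rightarrow> 'a \<Rightarrow> 'a tvec \<Rightarrow> 'a tvec \<Rightarrow> 'a tvec \<Rightarrow> real" where
  "ext_d2 M \<omega> x u v w = (let c = some_chart M x; y = snd c x; n = mdim M in
     \<Sum>i<n. \<Sum>j<n. \<Sum>k<n. u c i * v c j * w c k *
       (partial i (comp2 M c \<omega> j k) y + partial j (comp2 M c \<omega> k i) y + partial k (comp2 M c \<omega> i j) y))"

definition closed_form2 :: "'a manifold \<Rightarrow> 'a form2 \<Rightarrow> bool" where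
  "closed_form2 M \<omega> \<longleftrightarrow> (\<forall>x\<in>points M. \<forall>u\<in>tangent_space M x. \<forall>v\<in>tangent_space M x.
     \<forall>w\<in>tangent_space M x. ext_d2 M \<omega> x u v w = 0)"


section \<open>Dirac structures\<close>

text \<open>A family of fibres \<open>E x \<subseteq> TM|\<^sub>x \<oplus> T\<^sup>*M|\<^sub>x\<close>; only its values at points of \<open>M\<close> matter.\<close>

type_synonym 'a family = "'a \<Rightarrow> ('a tvec \<times> 'a covec) set"

definition generalized_tangent :: "'a manifold \<Rightarrow> 'a family" where
  "generalized_tangent M x = tangent_space M x \<times> cotangent_space M x"

fun pairing :: "'a tvec \<times> 'a covec \<Rightarrow> 'a tvec \<times> 'a covec \<Rightarrow> real" where
  "pairing (X, \<alpha>) (Y, \<beta>) = \<beta> X + \<alpha> Y"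

fun courant_dorfman :: "'a manifold \<Rightarrow> ('a \<Rightarrow> 'a tvec) \<times> ('a \<Rightarrow> 'a covec) \<Rightarrow>
    ('a \<Rightarrow> 'a tvec) \<times> ('a \<Rightarrow> 'a covec) \<Rightarrow> 'a \<Rightarrow> 'a tvec \<times> 'a covec" where
  "courant_dorfman M (X, \<alpha>) (Y, \<beta>) x =
     (lie_bracket M X Y x,
      \<lambda>v. if v \<in> tangent_space M x then lie_deriv1 M X \<beta> x v - ext_d1 M \<alpha> x (Y x) v else 0)"

text \<open>Near every point there is a smooth frame \<open>(X\<^sub>i, \<alpha>\<^sub>i)\<^sub>i\<^sub><\<^sub>r\<close> of \<open>E\<close>.\<close>

definition vector_subbundle :: "'a manifold \<Rightarrow> 'a family \<Rightarrow> bool" where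
  "vector_subbundle M E \<longleftrightarrow> (\<forall>x\<in>points M. \<exists>U r X \<alpha>. openin (mtop M) U \<and> x \<in> U \<and>
     (\<forall>i<r. vector_field_on M U (X i) \<and> form1_on M U (\<alpha> i)) \<and>
     (\<forall>y\<in>U. bij_betw (\<lambda>a. (\<lambda>c k. \<Sum>i<r. a i * X i y c k, \<lambda>v. \<Sum>i<r. a i * \<alpha> i y v))
               (topspace (Euclidean_space r)) (E y)))"

definition lagrangian :: "'a manifold \<Rightarrow> 'a family \<Rightarrow> bool" where
  "lagrangian M E \<longleftrightarrow> (\<forall>x\<in>points M.
     E x = {e \<in> generalized_tangent M x. \<forall>e'\<in>E x. pairing e e' = 0})"

definition section_on ::
    "'a manifold \<Rightarrow> 'a set \<Rightarrow> 'a family \<Rightarrow> ('a \<Rightarrow> 'a tvec) \<times> ('a \<Rightarrow> 'a covec) \<Rightarrow> bool" where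
  "section_on M U E s \<longleftrightarrow> vector_field_on M U (fst s) \<and> form1_on M U (snd s) \<and>
     (\<forall>x\<in>U. (fst s x, snd s x) \<in> E x)"

definition involutive :: "'a manifold \<Rightarrow> 'a family \<Rightarrow> bool" where
  "involutive M E \<longleftrightarrow> (\<forall>U s s'. openin (mtop M) U \<and> section_on M U E s \<and> section_on M U E s' \<longrightarrow>
     (\<forall>x\<in>U. courant_dorfman M s s' x \<in> E x))"

definition dirac_structure :: "'a manifold \<Rightarrow> 'a family \<Rightarrow> bool" where
  "dirac_structure M E \<longleftrightarrow> vector_subbundle M E \<and> lagrangian M E \<and> involutive M E"

definition dirac_pullback :: "'a manifold \<Rightarrow> 'b manifold \<Rightarrow> ('a \<Rightarrow> 'b) \<Rightarrow> 'b family \<Rightarrow> 'a family" where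
  "dirac_pullback M B q F x = {(X, covec_pullback M B q x \<beta>) |X \<beta>.
     X \<in> tangent_space M x \<and> \<beta> \<in> cotangent_space B (q x) \<and> (tmap M B q x X, \<beta>) \<in> F (q x)}"


section \<open>Lie groups, actions and principal bundles\<close>

record 'h lie_group_data = "'h monoid" +
  gmanifold :: "'h manifold"

definition lie_group :: "'h lie_group_data \<Rightarrow> bool" where
  "lie_group H \<longleftrightarrow> group H \<and> smooth_manifold (gmanifold H) \<and> carrier H = points (gmanifold H) \<and>
     smooth_map (prod_manifold (gmanifold H) (gmanifold H)) (gmanifold H) (\<lambda>(h, k). h \<otimes>\<^bsub>H\<^esub> k) \<and>
     smooth_map (gmanifold H) (gmanifold H) (\<lambda>h. inv\<^bsub>H\<^esub> h)"

definition lie_algebra :: "'h lie_group_data \<Rightarrow> 'h tvec set" where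
  "lie_algebra H = tangent_space (gmanifold H) \<one>\<^bsub>H\<^esub>"

definition lie_exp :: "'h lie_group_data \<Rightarrow> 'h tvec \<Rightarrow> 'h" where
  "lie_exp H u = (THE \<gamma>. smooth_map real_line (gmanifold H) \<gamma> \<and>
     (\<forall>s t. \<gamma> (s + t) = \<gamma> s \<otimes>\<^bsub>H\<^esub> \<gamma> t) \<and> velocity (gmanifold H) \<gamma> = u) 1"

definition lie_action :: "'h lie_group_data \<Rightarrow> 'm manifold \<Rightarrow> ('h \<Rightarrow> 'm \<Rightarrow> 'm) \<Rightarrow> bool" where
  "lie_action H M act \<longleftrightarrow>
     smooth_map (prod_manifold (gmanifold H) M) M (\<lambda>(h, x). act h x) \<and>
     (\<forall>x\<in>points M. act \<one>\<^bsub>H\<^esub> x = x) \<and>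
     (\<forall>h\<in>carrier H. \<forall>k\<in>carrier H. \<forall>x\<in>points M. act (h \<otimes>\<^bsub>H\<^esub> k) x = act h (act k x))"

definition fundamental_field ::
    "'h lie_group_data \<Rightarrow> 'm manifold \<Rightarrow> ('h \<Rightarrow> 'm \<Rightarrow> 'm) \<Rightarrow> 'h tvec \<Rightarrow> 'm \<Rightarrow> 'm tvec" where
  "fundamental_field H M act u x = velocity M (\<lambda>\<epsilon>. act (lie_exp H (tscale \<epsilon> u)) x)"

text \<open>
  Principal bundles, for left actions: around every point of \<open>B\<close> there is an \<open>H\<close>-equivariant
  trivialization \<open>x \<mapsto> (q x, \<kappa> x)\<close>. In particular the action is free and \<open>q\<close> identifies \<open>B\<close> with \<open>M/H\<close>.
\<close>

definition principal_bundle ::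
    "'h lie_group_data \<Rightarrow> 'm manifold \<Rightarrow> ('h \<Rightarrow> 'm \<Rightarrow> 'm) \<Rightarrow> 'b manifold \<Rightarrow> ('m \<Rightarrow> 'b) \<Rightarrow> bool" where
  "principal_bundle H M act B q \<longleftrightarrow>
     smooth_manifold M \<and> smooth_manifold B \<and> lie_action H M act \<and> smooth_map M B q \<and>
     (\<forall>b\<in>points B. \<exists>U \<kappa>. openin (mtop B) U \<and> b \<in> U \<and>
        (let P = points M \<inter> q -` U; \<tau> = (\<lambda>x. (q x, \<kappa> x));
             MP = open_submanifold M P; UH = prod_manifold (open_submanifold B U) (gmanifold H) in
         bij_betw \<tau> P (U \<times> carrier H) \<and>
         smooth_map MP UH \<tau> \<and> smooth_map UH MP (inv_into P \<tau>) \<and>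
         (\<forall>h\<in>carrier H. \<forall>x\<in>P. q (act h x) = q x \<and> \<kappa> (act h x) = h \<otimes>\<^bsub>H\<^esub> \<kappa> x)))"


section \<open>Lie groupoids\<close>

text \<open>
  \<open>cmp G g h\<close> is the product \<open>gh\<close>, defined when \<open>src G g = tgt G h\<close>. As usual for Lie groupoids,
  the base is a Hausdorff second countable manifold but this is not required of the space of arrows.
\<close>

record ('g, 'm) groupoid_data =
  arrows :: "'g manifold"
  base :: "'m manifold"
  src :: "'g \<Rightarrow> 'm"
  tgt :: "'g \<Rightarrow> 'm"
  cmp :: "'g \<Rightarrow> 'g \<Rightarrow> 'g"
  unit_arr :: "'m \<Rightarrow> 'g"
  inv_arr :: "'g \<Rightarrow> 'g"

definition composable :: "('g, 'm) groupoid_data \<Rightarrow> ('g \<times> 'g) set" where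
  "composable G = {(g, h). g \<in> points (arrows G) \<and> h \<in> points (arrows G) \<and> src G g = tgt G h}"

definition composable_manifold :: "('g, 'm) groupoid_data \<Rightarrow> ('g \<times> 'g) manifold" where
  "composable_manifold G = submanifold (prod_manifold (arrows G) (arrows G)) (composable G)
     (2 * mdim (arrows G) - mdim (base G))"

definition lie_groupoid :: "('g, 'm) groupoid_data \<Rightarrow> bool" where
  "lie_groupoid G \<longleftrightarrow>
     smooth_atlas (arrows G) \<and> smooth_manifold (base G) \<and>
     submersion (arrows G) (base G) (src G) \<and> submersion (arrows G) (base G) (tgt G) \<and>
     smooth_map (composable_manifold G) (arrows G) (\<lambda>(g, h). cmp G g h) \<and>
     smooth_map (base G) (arrows G) (unit_arr G) \<and>
     smooth_map (arrows G) (arrows G) (inv_arr G) \<and>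
     (\<forall>(g, h)\<in>composable G. src G (cmp G g h) = src G h \<and> tgt G (cmp G g h) = tgt G g) \<and>
     (\<forall>g h k. (g, h) \<in> composable G \<and> (h, k) \<in> composable G \<longrightarrow>
        cmp G (cmp G g h) k = cmp G g (cmp G h k)) \<and>
     (\<forall>x\<in>points (base G). src G (unit_arr G x) = x \<and> tgt G (unit_arr G x) = x) \<and>
     (\<forall>g\<in>points (arrows G).
        cmp G (unit_arr G (tgt G g)) g = g \<and> cmp G g (unit_arr G (src G g)) = g \<and>
        src G (inv_arr G g) = tgt G g \<and> tgt G (inv_arr G g) = src G g \<and>
        cmp G g (inv_arr G g) = unit_arr G (tgt G g) \<and>
        cmp G (inv_arr G g) g = unit_arr G (src G g))"

definition groupoid_morphism ::
    "('g, 'm) groupoid_data \<Rightarrow> ('k, 'n) groupoid_data \<Rightarrow> ('g \<Rightarrow> 'k) \<Rightarrow> ('m \<Rightarrow> 'n) \<Rightarrow> bool" where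
  "groupoid_morphism G K \<Phi> \<phi> \<longleftrightarrow>
     smooth_map (arrows G) (arrows K) \<Phi> \<and> smooth_map (base G) (base K) \<phi> \<and>
     (\<forall>g\<in>points (arrows G). src K (\<Phi> g) = \<phi> (src G g) \<and> tgt K (\<Phi> g) = \<phi> (tgt G g)) \<and>
     (\<forall>(g, h)\<in>composable G. \<Phi> (cmp G g h) = cmp K (\<Phi> g) (\<Phi> h))"

definition action_groupoid ::
    "'h lie_group_data \<Rightarrow> 'm manifold \<Rightarrow> ('h \<Rightarrow> 'm \<Rightarrow> 'm) \<Rightarrow> ('h \<times> 'm, 'm) groupoid_data" where
  "action_groupoid H M act =
     \<lparr>arrows = prod_manifold (gmanifold H) M, base = M,
      src = (\<lambda>(h, x). x), tgt = (\<lambda>(h, x). act h x),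
      cmp = (\<lambda>(h, x) (k, y). (h \<otimes>\<^bsub>H\<^esub> k, y)),
      unit_arr = (\<lambda>x. (\<one>\<^bsub>H\<^esub>, x)), inv_arr = (\<lambda>(h, x). (inv\<^bsub>H\<^esub> h, act h x))\<rparr>"

text \<open>The fibre at \<open>x\<close> of the Lie algebroid \<open>A = ker (ds)|\<^sub>M\<close>.\<close>

definition algebroid :: "('g, 'm) groupoid_data \<Rightarrow> 'm \<Rightarrow> 'g tvec set" where
  "algebroid G x = {a \<in> tangent_space (arrows G) (unit_arr G x).
     tmap (arrows G) (base G) (src G) (unit_arr G x) a = tzero}"

definition anchor :: "('g, 'm) groupoid_data \<Rightarrow> 'm \<Rightarrow> 'g tvec \<Rightarrow> 'm tvec" where
  "anchor G x a = tmap (arrows G) (base G) (tgt G) (unit_arr G x) a"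


section \<open>Pre-symplectic groupoids\<close>

text \<open>\<open>(i\<^sub>a \<omega>)|\<^sub>T\<^sub>M\<close>, where \<open>TM\<close> is embedded by the differential of the unit map.\<close>

definition mu_map :: "('g, 'm) groupoid_data \<Rightarrow> 'g form2 \<Rightarrow> 'm \<Rightarrow> 'g tvec \<Rightarrow> 'm covec" where
  "mu_map G \<omega> x a =
     covec_pullback (base G) (arrows G) (unit_arr G) x (\<lambda>v. \<omega> (unit_arr G x) a v)"

definition delta_map ::
    "('g, 'm) groupoid_data \<Rightarrow> 'g form2 \<Rightarrow> 'm \<Rightarrow> 'g tvec \<Rightarrow> 'm tvec \<times> 'm covec" where
  "delta_map G \<omega> x a = (anchor G x a, mu_map G \<omega> x a)"

definition multiplicative :: "('g, 'm) groupoid_data \<Rightarrow> 'g form2 \<Rightarrow> bool" where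
  "multiplicative G \<omega> \<longleftrightarrow>
     (let C = composable_manifold G; A = arrows G in
      form2_pullback C A (\<lambda>(g, h). cmp G g h) \<omega> =
        (\<lambda>z v w. form2_pullback C A fst \<omega> z v w + form2_pullback C A snd \<omega> z v w))"

definition presymplectic_groupoid :: "('g, 'm) groupoid_data \<Rightarrow> 'g form2 \<Rightarrow> bool" where
  "presymplectic_groupoid G \<omega> \<longleftrightarrow>
     lie_groupoid G \<and> is_form2 (arrows G) \<omega> \<and> closed_form2 (arrows G) \<omega> \<and> multiplicative G \<omega> \<and>
     mdim (arrows G) = 2 * mdim (base G) \<and>
     (\<forall>x\<in>points (base G). inj_on (delta_map G \<omega> x) (algebroid G x))"

definition integrates :: "('g, 'm) groupoid_data \<Rightarrow> 'g form2 \<Rightarrow> 'm family \<Rightarrow> bool" where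
  "integrates G \<omega> E \<longleftrightarrow> presymplectic_groupoid G \<omega> \<and>
     (\<forall>x\<in>points (base G). E x = delta_map G \<omega> x ` algebroid G x)"


section \<open>Admissibility and the quotient groupoid\<close>

definition HH_action :: "('g, 'm) groupoid_data \<Rightarrow> ('h \<times> 'm \<Rightarrow> 'g) \<Rightarrow> 'h \<Rightarrow> 'h \<Rightarrow> 'g \<Rightarrow> 'g" where
  "HH_action G \<Psi> h1 h2 g =
     cmp G (cmp G (\<Psi> (h1, tgt G g)) g) (inv_arr G (\<Psi> (h2, src G g)))"

text \<open>
  The morphism \<open>\<Psi>\<close> integrating \<open>\<psi>\<close> is kept as a parameter, since it need not be
  unique when \<open>H\<close> is disconnected. The Lie algebroid of \<open>H \<ltimes> M\<close> at \<open>x\<close> consists of the vectors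
  \<open>(u, 0\<^sub>x)\<close> tangent to \<open>H \<times> M\<close> at the unit \<open>(1, x)\<close>, i.e. of the images of
  the vectors \<open>u\<close> under the differential of \<open>h \<mapsto> (h, x)\<close>.
\<close>

definition H_admissible ::
    "'h lie_group_data \<Rightarrow> 'm manifold \<Rightarrow> ('h \<Rightarrow> 'm \<Rightarrow> 'm) \<Rightarrow> ('g, 'm) groupoid_data \<Rightarrow> 'g form2 \<Rightarrow>
     ('h \<times> 'm \<Rightarrow> 'g) \<Rightarrow> bool" where
  "H_admissible H M act G \<omega> \<Psi> \<longleftrightarrow>
     groupoid_morphism (action_groupoid H M act) G \<Psi> id \<and>
     (\<forall>x\<in>points M. \<forall>u\<in>lie_algebra H.
        delta_map G \<omega> x
          (tmap (prod_manifold (gmanifold H) M) (arrows G) \<Psi> (\<one>\<^bsub>H\<^esub>, x)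
            (tmap (gmanifold H) (prod_manifold (gmanifold H) M) (\<lambda>h. (h, x)) \<one>\<^bsub>H\<^esub> u))
        = (fundamental_field H M act u x, \<lambda>_. 0)) \<and>
     (\<forall>h1\<in>carrier H. \<forall>h2\<in>carrier H.
        form2_pullback (arrows G) (arrows G) (HH_action G \<Psi> h1 h2) \<omega> = \<omega>)"

definition orbit_map ::
    "'h lie_group_data \<Rightarrow> ('g, 'm) groupoid_data \<Rightarrow> ('h \<times> 'm \<Rightarrow> 'g) \<Rightarrow> 'g \<Rightarrow> 'g set" where
  "orbit_map H G \<Psi> g = {HH_action G \<Psi> h1 h2 g |h1 h2. h1 \<in> carrier H \<and> h2 \<in> carrier H}"

text \<open>
  The Lie groupoid structure over \<open>B = M/H\<close> on the set of orbits. All its data are determined by these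
  conditions (the smooth structure up to the choice of an atlas).
\<close>

definition quotient_groupoid ::
    "'h lie_group_data \<Rightarrow> ('g, 'm) groupoid_data \<Rightarrow> ('h \<times> 'm \<Rightarrow> 'g) \<Rightarrow> 'b manifold \<Rightarrow> ('m \<Rightarrow> 'b) \<Rightarrow>
     ('g set, 'b) groupoid_data \<Rightarrow> bool" where
  "quotient_groupoid H G \<Psi> B q Q \<longleftrightarrow>
     lie_groupoid Q \<and> base Q = B \<and> points (arrows Q) = orbit_map H G \<Psi> ` points (arrows G) \<and>
     submersion (arrows G) (arrows Q) (orbit_map H G \<Psi>) \<and>
     groupoid_morphism G Q (orbit_map H G \<Psi>) q"

end

theory Submission imports Defs
begin

text \<open>
  The quotient map \<open>p\<close> is a surjective submersion whose fibres are the orbits of \<open>H \<times> H\<close>, so \<open>p\<^sup>*\<close> is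
  injective on forms and \<open>\<omega>\<close> descends precisely when it is basic: invariant under \<open>H \<times> H\<close> and zero on vectors
  tangent to the orbits. Invariance is part of admissibility. That the orbit directions lie in the kernel
  of \<open>\<omega>\<close> (\<open>horizontal\<close>) comes from multiplicativity. A vector tangent to an orbit of the first factor
  is the product of \<open>d\<Psi>(u)\<close> with a zero vector, and any tangent vector \<open>w\<close> at \<open>g\<close> is the product
  of a vector tangent to the units with \<open>w\<close> itself. Hence \<open>\<omega>\<close> of the two is
  \<open>\<omega>(d\<Psi>(u), v)\<close> with \<open>v\<close> tangent to the units, that is \<open>\<mu>\<^sub>\<omega>(d\<Psi>(u))(v)\<close>, which is zero since
  \<open>\<delta>\<^sub>\<omega>(d\<Psi>(u)) = (u\<^sub>M, 0)\<close> (\<open>left_orbit\<close>). The second factor is treated with the inversion, which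
  reverses the sign of \<open>\<omega>\<close> (\<open>right_orbit\<close>).

  The value of the descended form at \<open>k\<close> is then computed from arbitrary lifts (\<open>basic\<close>, \<open>descended_eval\<close>).
  Near each point it is also the pullback of \<open>\<omega>\<close> by a local section of \<open>p\<close> (\<open>local_section\<close>), which makes it
  smooth and closed (\<open>local_pullback_form\<close>). It is multiplicative because pairs of composable arrows
  of the quotient lift locally to pairs of composable arrows (\<open>composable_lift\<close>): local sections
  of \<open>p\<close> give lifts whose source and target agree up to a group element, and a local trivialization of
  \<open>q\<close> provides that element smoothly.

  For the dimension and for the description of the orbit directions, the same trivialization
  shows that near a point every arrow is uniquely \<open>(h\<^sub>1, h\<^sub>2) \<cdot> \<theta>(k)\<close> with a local section \<open>\<theta>\<close>.
  Differentiating this decomposition (\<open>slice_split\<close>, \<open>slice_dim\<close>) shows that \<open>ker dp\<close> consists of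
  orbit directions and that \<open>dim G = dim Q + 2 dim H\<close>; likewise \<open>dim M = dim B + dim H\<close>,
  whence \<open>dim Q = 2 dim B\<close>.

  Finally \<open>dp\<close> maps the algebroid of \<open>G\<close> onto that of the quotient and intertwines anchors and \<open>\<mu>\<close>. If two
  elements of the algebroid of \<open>G\<close> project to elements that \<open>\<delta>\<close> of the quotient does not separate, adding some
  \<open>d\<Psi>(u)\<close> to one of them makes their images under \<open>\<delta>\<^sub>\<omega>\<close> equal; so injectivity of \<open>\<delta>\<^sub>\<omega>\<close> descends
  (\<open>quotient_delta_inj\<close>). Comparing \<open>q\<^sup>!F = \<delta>\<^sub>\<omega>(A)\<close> with \<open>F\<close> fibre by fibre then identifies the
  image of \<open>\<delta>\<close> on the quotient with \<open>F\<close> (\<open>quotient_dirac\<close>).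

  The calculus behind these arguments is developed from partial derivatives. Submersions are
  straightened one coordinate at a time (\<open>straighten\<close>), which yields local sections and, for the
  space of composable pairs, the charts of a fibre product (\<open>fibre_product_chart\<close>).
\<close>

section \<open>Open sets of Euclidean space\<close>

abbreviation ES :: "nat \<Rightarrow> (nat \<Rightarrow> real) set" where
  "ES n \<equiv> topspace (Euclidean_space n)"

lemma ES_iff: "x \<in> ES n \<longleftrightarrow> (\<forall>i\<ge>n. x i = 0)"
  by (simp add: topspace_Euclidean_space)

lemma ES_upd: "x \<in> ES n \<Longrightarrow> i < n \<Longrightarrow> x(i := t) \<in> ES n"
  by (auto simp: ES_iff)

lemma ES_eqI: "x \<in> ES n \<Longrightarrow> y \<in> ES n \<Longrightarrow> (\<And>i. i < n \<Longrightarrow> x i = y i) \<Longrightarrow> x = y"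
  by (rule ext) (metis ES_iff not_le)

text \<open>
  Cubes rather than balls: moving one coordinate of a point, as partial derivatives demand, is
  controlled by a condition on that coordinate alone.
\<close>

definition cube :: "nat \<Rightarrow> (nat \<Rightarrow> real) \<Rightarrow> real \<Rightarrow> (nat \<Rightarrow> real) set" where
  "cube n x e = {y \<in> ES n. \<forall>i<n. \<bar>y i - x i\<bar> < e}"

lemma Euclidean_space_eu: "Euclidean_space n = top_of_set (ES n)"
  by (simp add: Euclidean_space_def euclidean_product_topology)

lemma openin_cube: "openin (Euclidean_space n) (cube n x e)"
proof -
  have "open {y::nat\<Rightarrow>real. \<bar>y i - x i\<bar> < e}" for i
    by (intro open_Collect_less continuous_intros continuous_on_product_coordinates)
  then have "open (\<Inter>i\<in>{..<n}. {y::nat\<Rightarrow>real. \<bar>y i - x i\<bar> < e})"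
    by (intro open_INT) auto
  moreover have "cube n x e = ES n \<inter> (\<Inter>i\<in>{..<n}. {y::nat\<Rightarrow>real. \<bar>y i - x i\<bar> < e})"
    by (auto simp: cube_def)
  ultimately show ?thesis
    by (subst Euclidean_space_eu) (simp add: openin_open_Int)
qed

lemma cube_self: "x \<in> ES n \<Longrightarrow> e > 0 \<Longrightarrow> x \<in> cube n x e"
  by (simp add: cube_def)

lemma cube_mono: "d \<le> e \<Longrightarrow> cube n x d \<subseteq> cube n x e"
  by (force simp: cube_def)

text \<open>
  The topology of \<open>Euclidean_space n\<close> is inherited from the product of countably many lines. A basic
  open set constrains finitely many coordinates, and those from \<open>n\<close> on are constantly zero, so a cube fits inside.
\<close>

lemma openin_ES_iff:
  "openin (Euclidean_space n) S \<longleftrightarrow> S \<subseteq> ES n \<and> (\<forall>x\<in>S. \<exists>e>0. cube n x e \<subseteq> S)" (is "?L \<longleftrightarrow> ?R")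
proof
  assume L: ?L
  then have "openin (top_of_set (ES n)) S" by (simp flip: Euclidean_space_eu)
  then obtain T where T: "open T" "S = ES n \<inter> T" by (meson openin_open)
  have "\<exists>e>0. cube n x e \<subseteq> S" if x: "x \<in> S" for x
  proof -
    have "openin (product_topology (\<lambda>i. euclidean) UNIV) T"
      using T(1) by (simp add: euclidean_product_topology)
    then obtain X where X: "x \<in> (\<Pi>\<^sub>E i\<in>UNIV. X i)" "\<And>i. open (X i)"
      "finite {i. X i \<noteq> (UNIV::real set)}" "(\<Pi>\<^sub>E i\<in>UNIV. X i) \<subseteq> T"
      using product_topology_open_contains_basis[of "\<lambda>i. euclidean" UNIV T x] x T(2) by auto
    have "\<exists>e>0. \<forall>y. \<bar>y - x i\<bar> < e \<longrightarrow> y \<in> X i" for i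
    proof -
      have "x i \<in> X i" using X(1) by auto
      then obtain e where "e > 0" "ball (x i) e \<subseteq> X i" using X(2) open_contains_ball by blast
      then show ?thesis by (intro exI[of _ e]) (auto simp: subset_iff dist_real_def abs_minus_commute)
    qed
    then obtain e where e: "\<And>i. e i > 0" "\<And>i y. \<bar>y - x i\<bar> < e i \<Longrightarrow> y \<in> X i" by metis
    define d where "d = Min (insert 1 (e ` {i. X i \<noteq> UNIV}))"
    have d: "d > 0" "\<And>i. X i \<noteq> UNIV \<Longrightarrow> d \<le> e i"
      using X(3) e(1) by (auto simp: d_def)
    have "cube n x d \<subseteq> S"
    proof
      fix y assume y: "y \<in> cube n x d"
      have "y i \<in> X i" for i
      proof (cases "X i = UNIV")
        case False
        have "\<bar>y i - x i\<bar> < d"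
        proof (cases "i < n")
          case False
          then have "y i = 0" "x i = 0" using y x T(2) by (auto simp: cube_def ES_iff)
          then show ?thesis using d by simp
        qed (use y in \<open>auto simp: cube_def\<close>)
        then show ?thesis using d(2)[OF False] e(2) by fastforce
      qed auto
      then show "y \<in> S" using T(2) X(4) y by (auto simp: cube_def)
    qed
    then show ?thesis using d(1) by blast
  qed
  then show ?R using L openin_subset by blast
next
  assume R: ?R
  then obtain e where e: "\<And>x. x \<in> S \<Longrightarrow> e x > 0 \<and> cube n x (e x) \<subseteq> S" by metis
  have "S = (\<Union>x\<in>S. cube n x (e x))"
    using e R cube_self by blast
  then show ?L by (metis (no_types, lifting) imageE openin_Union openin_cube)
qed

lemma openin_ES_subset: "openin (Euclidean_space n) S \<Longrightarrow> S \<subseteq> ES n"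
  by (rule openin_subset)

lemma cont_ES: "S \<subseteq> ES n \<Longrightarrow>
  continuous_map (subtopology (Euclidean_space n) S) euclideanreal f \<longleftrightarrow> continuous_on S f"
  by (subst Euclidean_space_eu) (simp add: subtopology_subtopology inf_absorb2)

lemma cont_cube:
  assumes S: "openin (Euclidean_space n) S" and f: "continuous_on S (f :: _ \<Rightarrow> real)"
    and x: "x \<in> S" and e: "e > 0"
  shows "\<exists>d>0. cube n x d \<subseteq> S \<and> (\<forall>y\<in>cube n x d. \<bar>f y - f x\<bar> < e)"
proof -
  have "openin (top_of_set S) (S \<inter> f -` ball (f x) e)"
    using f by (simp add: continuous_openin_preimage_gen)
  then have "openin (Euclidean_space n) (S \<inter> f -` ball (f x) e)"
    by (metis S Euclidean_space_eu openin_trans)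
  moreover have "x \<in> S \<inter> f -` ball (f x) e" using x e by auto
  ultimately obtain d where "d > 0" "cube n x d \<subseteq> S \<inter> f -` ball (f x) e"
    unfolding openin_ES_iff by blast
  then show ?thesis
    by (intro exI[of _ d]) (auto simp: subset_iff dist_real_def abs_minus_commute)
qed

lemma cont_cubeI:
  assumes S: "openin (Euclidean_space n) S"
    and *: "\<And>x e. x \<in> S \<Longrightarrow> e > 0 \<Longrightarrow> \<exists>d>0. \<forall>y\<in>cube n x d. y \<in> S \<longrightarrow> \<bar>f y - f x\<bar> < (e::real)"
  shows "continuous_on S f"
proof -
  have "openin (top_of_set S) (S \<inter> f -` T)" if T: "open T" for T
  proof -
    have "openin (Euclidean_space n) (S \<inter> f -` T)"
      unfolding openin_ES_iff
    proof (intro conjI ballI)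
      fix x assume x: "x \<in> S \<inter> f -` T"
      then obtain e where e: "e > 0" "ball (f x) e \<subseteq> T"
        using openE[OF T, of "f x"] by auto
      obtain d where d: "d > 0" "\<And>y. y \<in> cube n x d \<Longrightarrow> y \<in> S \<Longrightarrow> \<bar>f y - f x\<bar> < e"
        using *[of x e] x e by auto
      obtain d' where d': "d' > 0" "cube n x d' \<subseteq> S"
        using S x unfolding openin_ES_iff by auto
      have "cube n x (min d d') \<subseteq> S \<inter> f -` T"
      proof
        fix y assume "y \<in> cube n x (min d d')"
        then have "y \<in> cube n x d" "y \<in> cube n x d'" by (auto simp: cube_def)
        then have "y \<in> cube n x d" "y \<in> S" using d' by auto
        then show "y \<in> S \<inter> f -` T" using d(2) e(2)
          by (auto simp: subset_iff dist_real_def abs_minus_commute)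
      qed
      then show "\<exists>e>0. cube n x e \<subseteq> S \<inter> f -` T"
        using d d' by (intro exI[of _ "min d d'"]) auto
    qed (use openin_subset[OF S] in auto)
    then have "openin (subtopology (Euclidean_space n) S) (S \<inter> f -` T)"
      by (simp add: openin_open_subtopology S)
    then show ?thesis using S openin_subset[OF S]
      by (metis Euclidean_space_eu inf_absorb2 subtopology_subtopology)
  qed
  then show ?thesis by (simp add: continuous_openin_preimage_eq)
qed

section \<open>Functions with continuous partial derivatives\<close>

lemma ev_upd:
  assumes "openin (Euclidean_space n) S" "x \<in> S" "i < n"
  shows "eventually (\<lambda>t. x(i := t) \<in> S) (nhds (x i))"
proof -
  obtain e where e: "e > 0" "cube n x e \<subseteq> S" using assms by (auto simp: openin_ES_iff)
  have x: "x \<in> ES n" using assms(1,2) openin_ES_subset by blast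
  have *: "x(i := t) \<in> S" if "t \<in> ball (x i) e" for t
  proof -
    have "x(i := t) \<in> cube n x e"
      using ES_upd[OF x assms(3)] that e(1) by (auto simp: cube_def dist_real_def abs_minus_commute)
    then show ?thesis using e(2) by (rule rev_subsetD)
  qed
  have "eventually (\<lambda>t. t \<in> ball (x i) e) (nhds (x i))"
    using e(1) by (intro eventually_nhds_in_open) auto
  then show ?thesis by (rule eventually_mono) (rule *)
qed

lemma partialI: "((\<lambda>t. f (x(i:=t))) has_real_derivative d) (at (x i)) \<Longrightarrow> partial i f x = d"
  by (simp add: partial_def DERIV_imp_deriv)

lemma Ck_cont: "Ck_on n k S f \<Longrightarrow> S \<subseteq> ES n \<Longrightarrow> continuous_on S f"
  by (cases k) (auto simp: cont_ES)

lemma Ck_Suc_has_partial: "Ck_on n (Suc k) S f \<Longrightarrow> x \<in> S \<Longrightarrow> i < n \<Longrightarrow>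
   ((\<lambda>t. f (x(i:=t))) has_real_derivative partial i f x) (at (x i))"
  by (auto simp: partial_def DERIV_deriv_iff_field_differentiable)

lemma Ck_Suc_partial: "Ck_on n (Suc k) S f \<Longrightarrow> i < n \<Longrightarrow> Ck_on n k S (partial i f)"
  by auto

lemma has_partial_cong:
  assumes "openin (Euclidean_space n) S" "\<And>x. x \<in> S \<Longrightarrow> f x = g x" "x \<in> S" "i < n"
    "((\<lambda>t. f (x(i:=t))) has_real_derivative d) (at (x i))"
  shows "((\<lambda>t. g (x(i:=t))) has_real_derivative d) (at (x i))"
proof -
  have "eventually (\<lambda>t. f (x(i:=t)) = g (x(i:=t))) (nhds (x i))"
    using ev_upd[OF assms(1,3,4)] by eventually_elim (auto simp: assms)
  from DERIV_cong_ev[OF refl this refl] show ?thesis using assms(5) by blast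
qed

lemma partial_cong:
  assumes "openin (Euclidean_space n) S" "\<And>x. x \<in> S \<Longrightarrow> f x = g x" "x \<in> S" "i < n"
  shows "partial i f x = partial i g x"
proof -
  have "eventually (\<lambda>t. f (x(i:=t)) = g (x(i:=t))) (nhds (x i))"
    using ev_upd[OF assms(1,3,4)] by eventually_elim (auto simp: assms)
  then show ?thesis unfolding partial_def by (intro deriv_cong_ev) auto
qed

lemma Ck_cong:
  assumes "openin (Euclidean_space n) S" "\<And>x. x \<in> S \<Longrightarrow> f x = g x" "Ck_on n k S f"
  shows "Ck_on n k S g"
  using assms(2,3)
proof (induction k arbitrary: f g)
  case 0
  then show ?case using assms(1)
    by (auto simp: cont_ES openin_ES_subset cong: continuous_on_cong)
next
  case (Suc k)
  have "Ck_on n k S (partial i g)" if "i < n" for i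
    using Suc.IH[of "partial i f" "partial i g"] partial_cong[OF assms(1) Suc.prems(1)] that Suc.prems(2)
    by auto
  moreover have "(\<lambda>t. g (x(i := t))) field_differentiable at (x i)" if "i < n" "x \<in> S" for i x
    using has_partial_cong[of n S f g x i, OF assms(1) Suc.prems(1) that(2,1) Ck_Suc_has_partial[OF Suc.prems(2) that(2,1)]]
    by (auto simp: field_differentiable_def)
  moreover have "continuous_on S g"
    using Suc.prems openin_ES_subset[OF assms(1)] Ck_cont by (metis continuous_on_cong)
  ultimately show ?case by (simp add: cont_ES openin_ES_subset assms(1))
qed

text \<open>
  The derivative is given as any function \<open>f' i\<close>; membership then passes to \<open>partial i f\<close>, which is only
  known to agree with it on the open set.
\<close>

lemma Ck_SucI:
  assumes "openin (Euclidean_space n) S" "continuous_on S f"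
    "\<And>i x. i < n \<Longrightarrow> x \<in> S \<Longrightarrow> ((\<lambda>t. f (x(i:=t))) has_real_derivative f' i x) (at (x i))"
    "\<And>i. i < n \<Longrightarrow> Ck_on n k S (f' i)"
  shows "Ck_on n (Suc k) S f"
proof -
  have "Ck_on n k S (partial i f)" if "i < n" for i
    using Ck_cong[OF assms(1), of "f' i" "partial i f"] partialI assms(3,4) that by metis
  moreover have "(\<lambda>t. f (x(i := t))) field_differentiable at (x i)" if "i < n" "x \<in> S" for i x
    using assms(3)[OF that] by (auto simp: field_differentiable_def)
  ultimately show ?thesis using assms(1,2)
    by (auto simp: cont_ES openin_ES_subset)
qed

lemma Ck_SucD: "Ck_on n (Suc k) S f \<Longrightarrow> Ck_on n k S f"
  by (induction k arbitrary: f) auto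

lemma Ck_subset: "Ck_on n k S f \<Longrightarrow> T \<subseteq> S \<Longrightarrow> Ck_on n k T f"
  by (induction k arbitrary: f) (auto intro: continuous_map_from_subtopology_mono)

lemma Ck_local:
  assumes "openin (Euclidean_space n) S"
    "\<And>x. x \<in> S \<Longrightarrow> \<exists>T. openin (Euclidean_space n) T \<and> x \<in> T \<and> Ck_on n k T f"
  shows "Ck_on n k S f"
proof -
  have cont: "continuous_on S f" if loc: "\<And>x. x \<in> S \<Longrightarrow> \<exists>T. openin (Euclidean_space n) T \<and> x \<in> T \<and> Ck_on n k T f" for k f
  proof (rule cont_cubeI[OF assms(1)])
    fix x e assume x: "x \<in> S" and e: "e > (0::real)"
    obtain T where T: "openin (Euclidean_space n) T" "x \<in> T" "Ck_on n k T f" using loc[OF x] by auto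
    show "\<exists>d>0. \<forall>y\<in>cube n x d. y \<in> S \<longrightarrow> \<bar>f y - f x\<bar> < e"
      using cont_cube[OF T(1) Ck_cont[OF T(3) openin_ES_subset[OF T(1)]] T(2) e] by auto
  qed
  show ?thesis using assms(2)
  proof (induction k arbitrary: f)
    case 0
    then show ?case using cont[of 0 f] by (auto simp: cont_ES openin_ES_subset assms(1))
  next
    case (Suc k)
    have "Ck_on n k S (partial i f)" if "i < n" for i
      using Suc.prems that by (intro Suc.IH) fastforce
    moreover have "(\<lambda>t. f (x(i := t))) field_differentiable at (x i)" if "i < n" "x \<in> S" for i x
      using Suc.prems[OF that(2)] that(1) by auto
    ultimately show ?case using cont[of "Suc k" f, OF Suc.prems]
      by (simp add: cont_ES openin_ES_subset assms(1))
  qed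
qed

lemma Ck_const: "S \<subseteq> ES n \<Longrightarrow> Ck_on n k S (\<lambda>x. c)"
  by (induction k arbitrary: c) (auto simp: partial_def[abs_def])

lemma Ck_coord:
  assumes "openin (Euclidean_space n) S" shows "Ck_on n k S (\<lambda>x. x j)"
proof (cases k)
  case 0
  then show ?thesis using assms
    by (auto simp: cont_ES openin_ES_subset intro: continuous_on_subset[OF continuous_on_product_coordinates])
next
  case (Suc m)
  show ?thesis unfolding Suc
  proof (rule Ck_SucI[OF assms])
    show "continuous_on S (\<lambda>x. x j)" by (intro continuous_on_subset[OF continuous_on_product_coordinates]) auto
    show "((\<lambda>t. (x(i := t)) j) has_real_derivative (if i = j then 1 else 0)) (at (x i))" for i and x :: "nat \<Rightarrow> real"
      by (auto intro!: derivative_eq_intros)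
  qed (use assms in \<open>auto intro!: Ck_const openin_ES_subset\<close>)
qed

lemma Ck_add:
  assumes "openin (Euclidean_space n) S" "Ck_on n k S f" "Ck_on n k S g"
  shows "Ck_on n k S (\<lambda>x. f x + g x)"
  using assms(2,3)
proof (induction k arbitrary: f g)
  case 0 then show ?case using assms(1) by (auto simp: cont_ES openin_ES_subset intro: continuous_intros)
next
  case (Suc k)
  show ?case
  proof (rule Ck_SucI[OF assms(1)])
    show "continuous_on S (\<lambda>x. f x + g x)"
      using Suc.prems Ck_cont openin_ES_subset[OF assms(1)] by (intro continuous_intros) blast+
    show "((\<lambda>t. f (x(i := t)) + g (x(i := t))) has_real_derivative partial i f x + partial i g x) (at (x i))"
      if "i < n" "x \<in> S" for i x
      by (intro DERIV_add Ck_Suc_has_partial[OF Suc.prems(1) that(2,1)] Ck_Suc_has_partial[OF Suc.prems(2) that(2,1)])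
  qed (use Suc in auto)
qed

lemma Ck_mult:
  assumes "openin (Euclidean_space n) S" "Ck_on n k S f" "Ck_on n k S g"
  shows "Ck_on n k S (\<lambda>x. f x * g x)"
  using assms(2,3)
proof (induction k arbitrary: f g)
  case 0 then show ?case using assms(1) by (auto simp: cont_ES openin_ES_subset intro: continuous_intros)
next
  case (Suc k)
  show ?case
  proof (rule Ck_SucI[OF assms(1)])
    show "continuous_on S (\<lambda>x. f x * g x)"
      using Suc.prems Ck_cont openin_ES_subset[OF assms(1)] by (intro continuous_intros) blast+
    show "((\<lambda>t. f (x(i := t)) * g (x(i := t))) has_real_derivative partial i f x * g x + partial i g x * f x) (at (x i))"
      if "i < n" "x \<in> S" for i x
      using DERIV_mult[OF Ck_Suc_has_partial[OF Suc.prems(1) that(2,1)] Ck_Suc_has_partial[OF Suc.prems(2) that(2,1)]]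
      by (simp only: fun_upd_triv)
    show "Ck_on n k S (\<lambda>x. partial i f x * g x + partial i g x * f x)" if "i < n" for i
      by (intro Ck_add assms Suc.IH Ck_SucD[OF Suc.prems(1)] Ck_SucD[OF Suc.prems(2)]
          Ck_Suc_partial[OF Suc.prems(1) that] Ck_Suc_partial[OF Suc.prems(2) that])
  qed
qed

lemma Ck_sum:
  assumes "openin (Euclidean_space n) S" "\<And>j. j \<in> A \<Longrightarrow> Ck_on n k S (f j)"
  shows "Ck_on n k S (\<lambda>x. \<Sum>j\<in>A. f j x)"
  using assms(2)
  by (induction A rule: infinite_finite_induct)
     (auto intro!: Ck_add Ck_const assms(1) openin_ES_subset)

lemma Ck_inverse:
  assumes "openin (Euclidean_space n) S" "Ck_on n k S f" "\<And>x. x \<in> S \<Longrightarrow> f x \<noteq> 0"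
  shows "Ck_on n k S (\<lambda>x. inverse (f x))"
  using assms(2)
proof (induction k)
  case 0 then show ?case using assms(1,3) by (auto simp: cont_ES openin_ES_subset intro: continuous_intros)
next
  case (Suc k)
  show ?case
  proof (rule Ck_SucI[OF assms(1)])
    show "continuous_on S (\<lambda>x. inverse (f x))"
      using Suc.prems Ck_cont openin_ES_subset[OF assms(1)] assms(3) by (intro continuous_intros) blast+
    show "((\<lambda>t. inverse (f (x(i := t)))) has_real_derivative (-1) * (partial i f x * (inverse (f x) * inverse (f x)))) (at (x i))"
      if "i < n" "x \<in> S" for i x
      using DERIV_inverse'[OF Ck_Suc_has_partial[OF Suc.prems that(2,1)]] assms(3)[OF that(2)]
      by (simp only: fun_upd_triv not_False_eq_True simp_thms) (simp add: algebra_simps del: fun_upd_apply)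
    show "Ck_on n k S (\<lambda>x. (-1) * (partial i f x * (inverse (f x) * inverse (f x))))" if "i < n" for i
      by (intro Ck_mult Ck_const assms(1) Suc.IH Ck_SucD[OF Suc.prems] Ck_Suc_partial[OF Suc.prems that]
           openin_ES_subset)
  qed
qed

lemma MVT_coord:
  assumes "openin (Euclidean_space n) S" "Ck_on n 1 S f" "cube n x d \<subseteq> S" "j < n"
    "y \<in> cube n x d" "\<bar>a - x j\<bar> < d"
  shows "\<exists>w\<in>cube n x d. f (y(j:=a)) - f y = (a - y j) * partial j f w"
proof -
  have incube: "y(j:=t) \<in> cube n x d" if "\<bar>t - x j\<bar> < d" for t
    using assms(4,5) that by (auto simp: cube_def ES_iff)
  have yj: "\<bar>y j - x j\<bar> < d" using assms(4,5) by (auto simp: cube_def)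
  have D: "((\<lambda>t. f (y(j:=t))) has_real_derivative partial j f (y(j:=t))) (at t)" if "\<bar>t - x j\<bar> < d" for t
    using Ck_Suc_has_partial[of n 0 S f "y(j:=t)" j] incube[OF that] assms(2,3,4) by auto
  have seg: "\<bar>t - x j\<bar> < d" if "min a (y j) \<le> t" "t \<le> max a (y j)" for t
    using that assms(6) yj by (auto simp: min_def max_def split: if_splits)
  consider "a = y j" | "a < y j" | "y j < a" by linarith
  then show ?thesis
  proof cases
    case 1 then show ?thesis using assms(5) by auto
  next
    case 2
    then obtain z where "a < z" "z < y j" "f (y(j:=y j)) - f (y(j:=a)) = (y j - a) * partial j f (y(j:=z))"
      using MVT2[of a "y j" "\<lambda>t. f (y(j:=t))" "\<lambda>t. partial j f (y(j:=t))"] D seg by auto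
    then show ?thesis using incube seg 2 by (intro bexI[of _ "y(j:=z)"]) (auto simp: algebra_simps)
  next
    case 3
    then obtain z where "y j < z" "z < a" "f (y(j:=a)) - f (y(j:=y j)) = (a - y j) * partial j f (y(j:=z))"
      using MVT2[of "y j" a "\<lambda>t. f (y(j:=t))" "\<lambda>t. partial j f (y(j:=t))"] D seg by auto
    then show ?thesis using incube seg 3 by (intro bexI[of _ "y(j:=z)"]) (auto simp: algebra_simps)
  qed
qed

lemma partials_near:
  assumes "openin (Euclidean_space n) S" "Ck_on n 1 S f" "x \<in> S" "e > 0"
  shows "\<exists>d>0. cube n x d \<subseteq> S \<and> (\<forall>j<n. \<forall>w\<in>cube n x d. \<bar>partial j f w - partial j f x\<bar> < e)"
proof -
  have "\<exists>d>0. cube n x d \<subseteq> S \<and> (\<forall>w\<in>cube n x d. \<bar>partial j f w - partial j f x\<bar> < e)" if "j < n" for j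
    using that assms Ck_Suc_partial[of n 0 S f j] Ck_cont[of n 0 S "partial j f"] openin_ES_subset[OF assms(1)]
    by (intro cont_cube[OF assms(1)]) (auto simp del: Ck_on.simps)
  then obtain d where d: "\<And>j. j < n \<Longrightarrow> d j > 0 \<and> cube n x (d j) \<subseteq> S \<and> (\<forall>w\<in>cube n x (d j). \<bar>partial j f w - partial j f x\<bar> < e)"
    by metis
  obtain d0 where d0: "d0 > 0" "cube n x d0 \<subseteq> S" using assms by (auto simp: openin_ES_iff)
  define D where "D = Min (insert d0 (d ` {..<n}))"
  have "D > 0" "D \<le> d0" "\<And>j. j < n \<Longrightarrow> D \<le> d j" using d d0 by (auto simp: D_def)
  then show ?thesis using d d0 cube_mono by (intro exI[of _ D]) blast
qed

text \<open>
  Strict differentiability at \<open>x\<close>: both end points vary. One passes from \<open>y\<close> to \<open>y'\<close> by changing one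
  coordinate after the other and applies the mean value theorem to each step.
\<close>

lemma frechet_cube:
  assumes "openin (Euclidean_space n) S" "Ck_on n 1 S f" "x \<in> S" "e > 0"
  shows "\<exists>d>0. cube n x d \<subseteq> S \<and> (\<forall>y\<in>cube n x d. \<forall>y'\<in>cube n x d.
     \<bar>f y' - f y - (\<Sum>j<n. (y' j - y j) * partial j f x)\<bar> \<le> e * (\<Sum>j<n. \<bar>y' j - y j\<bar>))"
proof -
  obtain d where d: "d > 0" "cube n x d \<subseteq> S" "\<And>j w. j < n \<Longrightarrow> w \<in> cube n x d \<Longrightarrow> \<bar>partial j f w - partial j f x\<bar> < e"
    using partials_near[OF assms] by blast
  have "\<bar>f y' - f y - (\<Sum>j<n. (y' j - y j) * partial j f x)\<bar> \<le> e * (\<Sum>j<n. \<bar>y' j - y j\<bar>)"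
    if y: "y \<in> cube n x d" and y': "y' \<in> cube n x d" for y y'
  proof -
    \<comment> \<open>the point after the first \<open>k\<close> coordinates have been changed\<close>
    define z where "z k = (\<lambda>i. if i < k then y' i else y i)" for k
    have zin: "z k \<in> cube n x d" for k using y y' by (auto simp: cube_def z_def ES_iff)
    have zS: "z (Suc k) = (z k)(k := y' k)" for k by (auto simp: z_def)
    have *: "\<bar>f (z k) - f y - (\<Sum>j<k. (y' j - y j) * partial j f x)\<bar> \<le> e * (\<Sum>j<k. \<bar>y' j - y j\<bar>)" if "k \<le> n" for k
      using that
    proof (induction k)
      case 0 then show ?case by (simp add: z_def)
    next
      case (Suc k)
      have zk: "z k k = y k" by (simp add: z_def)
      have "\<bar>y' k - x k\<bar> < d" using y' Suc.prems by (auto simp: cube_def)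
      then obtain w where w: "w \<in> cube n x d" "f (z (Suc k)) - f (z k) = (y' k - y k) * partial k f w"
        using MVT_coord[OF assms(1,2) d(2) _ zin[of k], of k "y' k"] Suc.prems zS zk by (metis Suc_le_lessD)
      have "\<bar>(y' k - y k) * partial k f w - (y' k - y k) * partial k f x\<bar> = \<bar>partial k f w - partial k f x\<bar> * \<bar>y' k - y k\<bar>"
        by (simp add: abs_mult[symmetric] algebra_simps)
      also have "\<dots> \<le> e * \<bar>y' k - y k\<bar>"
        using d(3)[of k w] w(1) Suc.prems by (intro mult_right_mono) auto
      finally have "\<bar>(f (z (Suc k)) - f (z k)) - (y' k - y k) * partial k f x\<bar> \<le> e * \<bar>y' k - y k\<bar>"
        using w(2) by simp
      moreover have "\<bar>f (z k) - f y - (\<Sum>j<k. (y' j - y j) * partial j f x)\<bar> \<le> e * (\<Sum>j<k. \<bar>y' j - y j\<bar>)"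
        using Suc by simp
      ultimately show ?case
        unfolding sum.lessThan_Suc distrib_left by linarith
    qed
    have "z n = y'" using y y' by (intro ES_eqI[of _ n]) (auto simp: z_def cube_def ES_iff)
    with *[of n] show ?thesis by simp
  qed
  then show ?thesis using d by blast
qed

text \<open>
  The chain rule. The curve has no regularity beyond differentiability at \<open>t0\<close>, so the remainder is estimated through
  the difference quotients \<open>q j\<close>, which converge and are therefore bounded by \<open>K\<close>.
\<close>

lemma has_derivative_along_curve:
  assumes S: "openin (Euclidean_space m) S" and g: "Ck_on m 1 S g" and t0: "\<gamma> t0 \<in> S"
    and ES: "eventually (\<lambda>t. \<gamma> t \<in> ES m) (nhds t0)"
    and D: "\<And>j. j < m \<Longrightarrow> ((\<lambda>t. \<gamma> t j) has_real_derivative D j) (at t0)"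
  shows "((\<lambda>t. g (\<gamma> t)) has_real_derivative (\<Sum>j<m. D j * partial j g (\<gamma> t0))) (at t0)"
proof -
  define q where "q j t = (\<gamma> t j - \<gamma> t0 j) / (t - t0)" for j t
  have q: "(q j \<longlongrightarrow> D j) (at t0)" if "j < m" for j
    using D[OF that] by (simp add: has_field_derivative_iff q_def[abs_def])
  have QS: "((\<lambda>t. \<Sum>j<m. \<bar>q j t\<bar>) \<longlongrightarrow> (\<Sum>j<m. \<bar>D j\<bar>)) (at t0)"
    by (intro tendsto_sum tendsto_rabs q) auto
  define K where "K = (\<Sum>j<m. \<bar>D j\<bar>) + 1"
  have K: "K > 0" by (simp add: K_def add_nonneg_pos sum_nonneg)
  have QK: "eventually (\<lambda>t. (\<Sum>j<m. \<bar>q j t\<bar>) < K) (at t0)"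
    using order_tendstoD(2)[OF QS, of K] by (simp add: K_def)
  define r where "r t = (g (\<gamma> t) - g (\<gamma> t0)) / (t - t0) - (\<Sum>j<m. q j t * partial j g (\<gamma> t0))" for t
  have incube: "eventually (\<lambda>t. \<gamma> t \<in> cube m (\<gamma> t0) d) (at t0)" if "d > 0" for d
  proof -
    have "eventually (\<lambda>t. \<bar>\<gamma> t j - \<gamma> t0 j\<bar> < d) (at t0)" if "j < m" for j
    proof -
      have "((\<lambda>t. \<gamma> t j) \<longlongrightarrow> \<gamma> t0 j) (at t0)" using D[OF that] DERIV_isCont isCont_def by blast
      then show ?thesis using \<open>d > 0\<close> by (auto simp: tendsto_iff dist_real_def)
    qed
    then have "eventually (\<lambda>t. \<forall>j\<in>{..<m}. \<bar>\<gamma> t j - \<gamma> t0 j\<bar> < d) (at t0)"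
      by (intro eventually_ball_finite) auto
    moreover have "eventually (\<lambda>t. \<gamma> t \<in> ES m) (at t0)" using ES by (simp add: eventually_nhds_conv_at)
    ultimately show ?thesis by eventually_elim (auto simp: cube_def)
  qed
  have neq: "eventually (\<lambda>t. t \<noteq> t0) (at t0)" by (simp add: eventually_at_filter)
  have "(r \<longlongrightarrow> 0) (at t0)"
  proof (rule tendstoI)
    fix e :: real assume e: "e > 0"
    obtain d where d: "d > 0" and dd: "\<And>y y'. y \<in> cube m (\<gamma> t0) d \<Longrightarrow> y' \<in> cube m (\<gamma> t0) d \<Longrightarrow>
      \<bar>g y' - g y - (\<Sum>j<m. (y' j - y j) * partial j g (\<gamma> t0))\<bar> \<le> e / K * (\<Sum>j<m. \<bar>y' j - y j\<bar>)"
      using frechet_cube[OF S g t0 divide_pos_pos[OF e K]] by auto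
    have in0: "\<gamma> t0 \<in> cube m (\<gamma> t0) d" using cube_self d t0 openin_ES_subset[OF S] by blast
    show "eventually (\<lambda>t. dist (r t) 0 < e) (at t0)"
      using incube[OF d] QK neq
    proof eventually_elim
      case (elim t)
      have "r t = (g (\<gamma> t) - g (\<gamma> t0) - (\<Sum>j<m. (\<gamma> t j - \<gamma> t0 j) * partial j g (\<gamma> t0))) / (t - t0)"
        by (simp add: r_def q_def diff_divide_distrib[of "g (\<gamma> t) - g (\<gamma> t0)"] sum_divide_distrib)
      then have "\<bar>r t\<bar> = \<bar>g (\<gamma> t) - g (\<gamma> t0) - (\<Sum>j<m. (\<gamma> t j - \<gamma> t0 j) * partial j g (\<gamma> t0))\<bar> / \<bar>t - t0\<bar>"
        by simp
      also have "\<dots> \<le> (e / K * (\<Sum>j<m. \<bar>\<gamma> t j - \<gamma> t0 j\<bar>)) / \<bar>t - t0\<bar>"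
        by (intro divide_right_mono dd in0 elim) auto
      also have "\<dots> = e / K * (\<Sum>j<m. \<bar>q j t\<bar>)"
        by (simp add: q_def sum_divide_distrib[symmetric])
      also have "\<dots> < e / K * K" using elim e K by (intro mult_strict_left_mono) auto
      finally show ?case using K by simp
    qed
  qed
  moreover have "((\<lambda>t. \<Sum>j<m. q j t * partial j g (\<gamma> t0)) \<longlongrightarrow> (\<Sum>j<m. D j * partial j g (\<gamma> t0))) (at t0)"
    by (intro tendsto_sum tendsto_mult q) auto
  ultimately have "((\<lambda>t. r t + (\<Sum>j<m. q j t * partial j g (\<gamma> t0))) \<longlongrightarrow> 0 + (\<Sum>j<m. D j * partial j g (\<gamma> t0))) (at t0)"
    by (rule tendsto_add)
  then show ?thesis by (simp add: r_def has_field_derivative_iff)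
qed

lemma Ck_mono: "Ck_on n l S f \<Longrightarrow> k \<le> l \<Longrightarrow> Ck_on n k S f"
  by (induction l) (auto simp del: Ck_on.simps simp: le_Suc_eq dest: Ck_SucD)

text \<open>
  Induction on \<open>k\<close>: the chain rule expresses the partial derivatives by products of functions to which
  the induction hypothesis applies.
\<close>

lemma Ck_compose:
  assumes S: "openin (Euclidean_space n) S" and T: "openin (Euclidean_space m) T"
    and F: "\<And>x. x \<in> S \<Longrightarrow> F x \<in> T"
    and "\<And>j. j < m \<Longrightarrow> Ck_on n k S (\<lambda>x. F x j)" "Ck_on m k T g"
  shows "Ck_on n k S (\<lambda>x. g (F x))"
  using assms(4,5)
proof (induction k arbitrary: g)
  have TE: "T \<subseteq> ES m" and SE: "S \<subseteq> ES n" using openin_ES_subset S T by auto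
  have contF: "continuous_on S F" if "\<And>j. j < m \<Longrightarrow> Ck_on n k S (\<lambda>x. F x j)" for k
  proof (rule continuous_on_coordinatewise_then_product)
    fix j show "continuous_on S (\<lambda>x. F x j)"
    proof (cases "j < m")
      case True then show ?thesis using Ck_cont[OF that SE] by blast
    next
      case False
      then have "F x j = 0" if "x \<in> S" for x using F[OF that] TE by (auto simp: ES_iff)
      then show ?thesis using continuous_on_cong[OF refl, of S "\<lambda>x. F x j" "\<lambda>x. 0"] by simp
    qed
  qed
  have cont: "continuous_on S (\<lambda>x. g (F x))" if "\<And>j. j < m \<Longrightarrow> Ck_on n k S (\<lambda>x. F x j)" "Ck_on m k T g" for k g
    by (rule continuous_on_compose2[OF Ck_cont[OF that(2) TE] contF[OF that(1)]]) (use F in auto)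
  {
    case 0
    then show ?case using cont[of 0 g] SE by (auto simp: cont_ES)
  next
    case (Suc k)
    show ?case
    proof (rule Ck_SucI[OF S cont[OF Suc.prems]])
      fix i x assume i: "i < n" and x: "x \<in> S"
      have "((\<lambda>t. g (F (x(i := t)))) has_real_derivative
          (\<Sum>j<m. partial i (\<lambda>x. F x j) x * partial j g (F (x(i := x i))))) (at (x i))"
      proof (rule has_derivative_along_curve[OF T, where \<gamma> = "\<lambda>t. F (x(i := t))"])
        show "Ck_on m 1 T g" by (rule Ck_mono[OF Suc.prems(2)]) simp
        show "F (x(i := x i)) \<in> T" using F x by simp
        show "\<forall>\<^sub>F t in nhds (x i). F (x(i := t)) \<in> ES m"
          using ev_upd[OF S x i] by eventually_elim (use F TE in blast)
        show "((\<lambda>t. F (x(i := t)) j) has_real_derivative partial i (\<lambda>x. F x j) x) (at (x i))" if "j < m" for j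
          by (rule Ck_Suc_has_partial[OF Suc.prems(1)[OF that] x i])
      qed
      then show "((\<lambda>t. g (F (x(i := t)))) has_real_derivative
          (\<Sum>j<m. partial i (\<lambda>x. F x j) x * partial j g (F x))) (at (x i))" by simp
    next
      fix i assume i: "i < n"
      show "Ck_on n k S (\<lambda>x. \<Sum>j<m. partial i (\<lambda>x. F x j) x * partial j g (F x))"
      proof (intro Ck_sum Ck_mult S)
        fix j assume j: "j \<in> {..<m}"
        show "Ck_on n k S (partial i (\<lambda>x. F x j))" using Ck_Suc_partial[OF Suc.prems(1) i] j by auto
        show "Ck_on n k S (\<lambda>x. partial j g (F x))"
          using Suc.IH[of "partial j g"] Ck_SucD[OF Suc.prems(1)] Ck_Suc_partial[OF Suc.prems(2)] j by blast
      qed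
    qed
  }
qed

section \<open>Germs of smooth functions\<close>

abbreviation nhdsE :: "nat \<Rightarrow> (nat \<Rightarrow> real) \<Rightarrow> (nat \<Rightarrow> real) filter" where
  "nhdsE n y \<equiv> nhdsin (Euclidean_space n) y"

lemma eventually_nhdsE: "y \<in> ES n \<Longrightarrow> eventually P (nhdsE n y) \<longleftrightarrow>
    (\<exists>S. openin (Euclidean_space n) S \<and> y \<in> S \<and> (\<forall>z\<in>S. P z))"
  by (simp add: eventually_nhdsin)

lemma eventually_nhdsin_self: "a \<in> topspace X \<Longrightarrow> eventually P (nhdsin X a) \<Longrightarrow> P a"
  by (auto simp: eventually_nhdsin)

lemma eventually_nhdsin_in: "openin X S \<Longrightarrow> a \<in> S \<Longrightarrow> eventually (\<lambda>x. x \<in> S) (nhdsin X a)"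
  by (auto simp: eventually_nhdsin)

lemma eventually_nhdsin_eventually:
  "eventually P (nhdsin X a) \<Longrightarrow> eventually (\<lambda>x. eventually P (nhdsin X x)) (nhdsin X a)"
  by (auto simp: eventually_nhdsin)

text \<open>
  Smoothness near a point. Statements about maps of manifolds are made pointwise in this form, so that locally
  defined maps (charts, local sections) can be composed without tracking their domains.
\<close>

definition smooth_germ :: "nat \<Rightarrow> (nat \<Rightarrow> real) \<Rightarrow> ((nat \<Rightarrow> real) \<Rightarrow> real) \<Rightarrow> bool" where
  "smooth_germ n y f \<longleftrightarrow> (\<exists>S. y \<in> S \<and> smooth_on n S f)"

lemma smooth_on_open: "smooth_on n S f \<Longrightarrow> openin (Euclidean_space n) S"
  by (simp add: smooth_on_def)

lemma smooth_germ_ES: "smooth_germ n y f \<Longrightarrow> y \<in> ES n"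
  by (meson smooth_germ_def smooth_on_open openin_ES_subset subsetD)

lemma smooth_onI_germ:
  assumes "openin (Euclidean_space n) S" "\<And>y. y \<in> S \<Longrightarrow> smooth_germ n y f"
  shows "smooth_on n S f"
  unfolding smooth_on_def
proof (intro conjI allI Ck_local assms(1))
  fix k x assume "x \<in> S"
  then obtain T where "x \<in> T" "smooth_on n T f" using assms(2)[of x] by (auto simp: smooth_germ_def)
  then show "\<exists>T. openin (Euclidean_space n) T \<and> x \<in> T \<and> Ck_on n k T f"
    by (auto simp: smooth_on_def)
qed

lemma smooth_on_germ: "smooth_on n S f \<Longrightarrow> y \<in> S \<Longrightarrow> smooth_germ n y f"
  by (auto simp: smooth_germ_def)

lemma smooth_germ_eventually: "smooth_germ n y f \<Longrightarrow> eventually (\<lambda>z. smooth_germ n z f) (nhdsE n y)"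
  unfolding smooth_germ_def eventually_nhdsin using smooth_on_open by blast

lemma smooth_germ_cong:
  assumes "eventually (\<lambda>z. f z = g z) (nhdsE n y)" "smooth_germ n y f"
  shows "smooth_germ n y g"
proof -
  obtain S where S: "y \<in> S" "smooth_on n S f" using assms(2) by (auto simp: smooth_germ_def)
  obtain U where U: "openin (Euclidean_space n) U" "y \<in> U" "\<And>z. z \<in> U \<Longrightarrow> f z = g z"
    using assms(1) smooth_germ_ES[OF assms(2)] by (auto simp: eventually_nhdsE)
  have o: "openin (Euclidean_space n) (S \<inter> U)" using U(1) smooth_on_open[OF S(2)] by blast
  have "Ck_on n k (S \<inter> U) g" for k
    by (rule Ck_cong[OF o, of f]) (use U(3) S(2) in \<open>auto simp: smooth_on_def intro: Ck_subset\<close>)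
  then show ?thesis unfolding smooth_germ_def smooth_on_def using o S(1) U(2) by blast
qed

lemma partial_cong_germ:
  assumes "eventually (\<lambda>z. f z = g z) (nhdsE n y)" "y \<in> ES n" "i < n"
  shows "partial i f y = partial i g y"
proof -
  obtain U where "openin (Euclidean_space n) U" "y \<in> U" "\<And>z. z \<in> U \<Longrightarrow> f z = g z"
    using assms by (auto simp: eventually_nhdsE)
  then show ?thesis using partial_cong assms(3) by blast
qed

text \<open>
  Reduces closure properties of germs to those of functions on a common domain.
\<close>

lemma smooth_germ_binary:
  assumes "smooth_germ n y f" "smooth_germ n y g"
    "\<And>S k. openin (Euclidean_space n) S \<Longrightarrow> Ck_on n k S f \<Longrightarrow> Ck_on n k S g \<Longrightarrow> Ck_on n k S h"
  shows "smooth_germ n y h"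
proof -
  obtain S T where *: "y \<in> S" "smooth_on n S f" "y \<in> T" "smooth_on n T g"
    using assms by (auto simp: smooth_germ_def)
  then have "openin (Euclidean_space n) (S \<inter> T)" using smooth_on_open by blast
  then have "smooth_on n (S \<inter> T) h"
    using assms(3)[of "S \<inter> T"] * Ck_subset[of n _ S f "S \<inter> T"] Ck_subset[of n _ T g "S \<inter> T"]
    by (simp add: smooth_on_def)
  then show ?thesis using * by (auto simp: smooth_germ_def)
qed

lemma smooth_germ_add: "smooth_germ n y f \<Longrightarrow> smooth_germ n y g \<Longrightarrow> smooth_germ n y (\<lambda>x. f x + g x)"
  by (rule smooth_germ_binary[of n y f g]) (auto intro: Ck_add)

lemma smooth_germ_mult: "smooth_germ n y f \<Longrightarrow> smooth_germ n y g \<Longrightarrow> smooth_germ n y (\<lambda>x. f x * g x)"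
  by (rule smooth_germ_binary[of n y f g]) (auto intro: Ck_mult)

lemma smooth_germ_const: "y \<in> ES n \<Longrightarrow> smooth_germ n y (\<lambda>x. c)"
  unfolding smooth_germ_def smooth_on_def by (intro exI[of _ "ES n"]) (auto intro: Ck_const)

lemma smooth_germ_coord: "y \<in> ES n \<Longrightarrow> smooth_germ n y (\<lambda>x. x j)"
  unfolding smooth_germ_def smooth_on_def by (intro exI[of _ "ES n"]) (auto intro: Ck_coord)

lemma smooth_germ_sum:
  "y \<in> ES n \<Longrightarrow> (\<And>j. j \<in> A \<Longrightarrow> smooth_germ n y (f j)) \<Longrightarrow> smooth_germ n y (\<lambda>x. \<Sum>j\<in>A. f j x)"
  by (induction A rule: infinite_finite_induct) (auto intro!: smooth_germ_add smooth_germ_const)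

lemma smooth_on_partial: "smooth_on n S f \<Longrightarrow> i < n \<Longrightarrow> smooth_on n S (partial i f)"
  unfolding smooth_on_def using Ck_Suc_partial by blast

lemma smooth_germ_partial: "smooth_germ n y f \<Longrightarrow> i < n \<Longrightarrow> smooth_germ n y (partial i f)"
  unfolding smooth_germ_def using smooth_on_partial by blast

lemma smooth_on_has_partial: "smooth_on n S f \<Longrightarrow> x \<in> S \<Longrightarrow> i < n \<Longrightarrow>
   ((\<lambda>t. f (x(i:=t))) has_real_derivative partial i f x) (at (x i))"
  unfolding smooth_on_def using Ck_Suc_has_partial by blast

lemma smooth_germ_has_partial: "smooth_germ n y f \<Longrightarrow> i < n \<Longrightarrow>
   ((\<lambda>t. f (y(i:=t))) has_real_derivative partial i f y) (at (y i))"
  unfolding smooth_germ_def using smooth_on_has_partial by blast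

lemma germ_common_domain:
  assumes "y \<in> ES n" "\<And>j. j < m \<Longrightarrow> smooth_germ n y (f j)" "eventually P (nhdsE n y)"
  obtains S where "openin (Euclidean_space n) S" "y \<in> S" "\<And>j. j < (m::nat) \<Longrightarrow> smooth_on n S (f j)"
    "\<And>z. z \<in> S \<Longrightarrow> P z"
proof -
  have "eventually (\<lambda>z. \<forall>j\<in>{..<m}. smooth_germ n z (f j)) (nhdsE n y)"
    by (rule eventually_ball_finite) (use assms smooth_germ_eventually in auto)
  with assms(3) have "eventually (\<lambda>z. P z \<and> (\<forall>j\<in>{..<m}. smooth_germ n z (f j))) (nhdsE n y)"
    by (rule eventually_conj)
  then obtain S where "openin (Euclidean_space n) S" "y \<in> S" "\<forall>z\<in>S. P z \<and> (\<forall>j\<in>{..<m}. smooth_germ n z (f j))"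
    using assms(1) by (auto simp: eventually_nhdsE)
  then show thesis by (intro that[of S]) (auto intro: smooth_onI_germ)
qed

definition vgerm :: "nat \<Rightarrow> nat \<Rightarrow> (nat \<Rightarrow> real) \<Rightarrow> ((nat \<Rightarrow> real) \<Rightarrow> nat \<Rightarrow> real) \<Rightarrow> bool" where
  "vgerm n m y F \<longleftrightarrow> y \<in> ES n \<and> eventually (\<lambda>z. F z \<in> ES m) (nhdsE n y) \<and>
     (\<forall>j<m. smooth_germ n y (\<lambda>z. F z j))"

lemma vgerm_ES: "vgerm n m y F \<Longrightarrow> y \<in> ES n" "vgerm n m y F \<Longrightarrow> F y \<in> ES m"
  by (auto simp: vgerm_def dest: eventually_nhdsin_self[rotated])

lemma vgerm_cong:
  assumes "eventually (\<lambda>z. F z = G z) (nhdsE n y)" "vgerm n m y F"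
  shows "vgerm n m y G"
  unfolding vgerm_def
proof (intro conjI allI impI)
  show "y \<in> ES n" using assms vgerm_ES by blast
  show "\<forall>\<^sub>F z in nhdsE n y. G z \<in> ES m"
    using assms(1) assms(2)[unfolded vgerm_def, THEN conjunct2, THEN conjunct1] by eventually_elim simp
  fix j assume "j < m"
  then have "smooth_germ n y (\<lambda>z. F z j)" using assms(2) by (simp add: vgerm_def)
  then show "smooth_germ n y (\<lambda>z. G z j)"
    by (rule smooth_germ_cong[rotated]) (use assms(1) in eventually_elim, simp)
qed

lemma vgerm_tendsto:
  assumes F: "vgerm n m y F" and P: "eventually P (nhdsE m (F y))"
  shows "eventually (\<lambda>z. P (F z)) (nhdsE n y)"
proof -
  have y: "y \<in> ES n" "F y \<in> ES m" using F vgerm_ES by auto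
  obtain T where T: "openin (Euclidean_space m) T" "F y \<in> T" "\<And>z. z \<in> T \<Longrightarrow> P z"
    using P y by (auto simp: eventually_nhdsE)
  obtain e where e: "e > 0" "cube m (F y) e \<subseteq> T" using T by (auto simp: openin_ES_iff)
  have "eventually (\<lambda>z. \<bar>F z j - F y j\<bar> < e) (nhdsE n y)" if j: "j < m" for j
  proof -
    obtain S where S: "y \<in> S" "smooth_on n S (\<lambda>z. F z j)" using F j by (auto simp: vgerm_def smooth_germ_def)
    have o: "openin (Euclidean_space n) S" using S(2) smooth_on_open by blast
    have "continuous_on S (\<lambda>z. F z j)"
      using S(2) Ck_cont[of n 0 S, OF _ openin_ES_subset[OF o]] unfolding smooth_on_def by blast
    from cont_cube[OF o this S(1) e(1)] obtain d where "d > 0" "\<forall>z\<in>cube n y d. \<bar>F z j - F y j\<bar> < e"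
      by auto
    then show ?thesis unfolding eventually_nhdsE[OF y(1)]
      by (intro exI[of _ "cube n y d"]) (simp add: openin_cube cube_self y(1))
  qed
  then have "eventually (\<lambda>z. \<forall>j\<in>{..<m}. \<bar>F z j - F y j\<bar> < e) (nhdsE n y)"
    by (intro eventually_ball_finite) auto
  moreover have "eventually (\<lambda>z. F z \<in> ES m) (nhdsE n y)" using F by (simp add: vgerm_def)
  ultimately show ?thesis
    by eventually_elim (use e(2) T(3) in \<open>auto simp: cube_def\<close>)
qed

lemma vgerm_eventually: assumes "vgerm n m y F" shows "eventually (\<lambda>z. vgerm n m z F) (nhdsE n y)"
proof -
  have "eventually (\<lambda>z. \<forall>j\<in>{..<m}. smooth_germ n z (\<lambda>z. F z j)) (nhdsE n y)"
    by (rule eventually_ball_finite) (use assms smooth_germ_eventually in \<open>auto simp: vgerm_def\<close>)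
  moreover have "eventually (\<lambda>z. eventually (\<lambda>z. F z \<in> ES m) (nhdsE n z)) (nhdsE n y)"
    using assms by (intro eventually_nhdsin_eventually) (simp add: vgerm_def)
  moreover have "eventually (\<lambda>z. z \<in> ES n) (nhdsE n y)"
    using vgerm_ES[OF assms] by (intro eventually_nhdsin_in) auto
  ultimately show ?thesis by eventually_elim (auto simp: vgerm_def)
qed

lemma germ_compose_domain:
  assumes F: "vgerm n m y F" and g: "smooth_germ m (F y) g"
  obtains S T where "openin (Euclidean_space n) S" "y \<in> S" "openin (Euclidean_space m) T"
    "\<And>z. z \<in> S \<Longrightarrow> F z \<in> T" "\<And>j. j < m \<Longrightarrow> smooth_on n S (\<lambda>z. F z j)" "smooth_on m T g"
proof -
  obtain T where T: "F y \<in> T" "smooth_on m T g" using g by (auto simp: smooth_germ_def)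
  have oT: "openin (Euclidean_space m) T" using T(2) smooth_on_open by blast
  have "eventually (\<lambda>z. F z \<in> T) (nhdsE n y)"
    by (rule vgerm_tendsto[OF F]) (use T oT in \<open>auto intro: eventually_nhdsin_in\<close>)
  then show thesis
    using germ_common_domain[of y n m "\<lambda>j z. F z j" "\<lambda>z. F z \<in> T" thesis] F oT T that
    unfolding vgerm_def by blast
qed

lemma smooth_germ_compose:
  assumes F: "vgerm n m y F" and g: "smooth_germ m (F y) g"
  shows "smooth_germ n y (\<lambda>z. g (F z))"
proof -
  obtain S T where *: "openin (Euclidean_space n) S" "y \<in> S" "openin (Euclidean_space m) T"
    "\<And>z. z \<in> S \<Longrightarrow> F z \<in> T" "\<And>j. j < m \<Longrightarrow> smooth_on n S (\<lambda>z. F z j)" "smooth_on m T g"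
    using germ_compose_domain[OF F g] by blast
  have "Ck_on n k S (\<lambda>z. g (F z))" for k
    by (rule Ck_compose[OF *(1,3,4)]) (use *(5,6) in \<open>auto simp: smooth_on_def\<close>)
  then show ?thesis using * unfolding smooth_germ_def smooth_on_def by blast
qed

lemma partial_compose:
  assumes F: "vgerm n m y F" and g: "smooth_germ m (F y) g" and i: "i < n"
  shows "partial i (\<lambda>z. g (F z)) y = (\<Sum>j<m. partial i (\<lambda>z. F z j) y * partial j g (F y))"
proof -
  obtain S T where *: "openin (Euclidean_space n) S" "y \<in> S" "openin (Euclidean_space m) T"
    "\<And>z. z \<in> S \<Longrightarrow> F z \<in> T" "\<And>j. j < m \<Longrightarrow> smooth_on n S (\<lambda>z. F z j)" "smooth_on m T g"
    using germ_compose_domain[OF F g] by blast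
  have "((\<lambda>t. g (F (y(i := t)))) has_real_derivative
          (\<Sum>j<m. partial i (\<lambda>x. F x j) y * partial j g (F (y(i := y i))))) (at (y i))"
  proof (rule has_derivative_along_curve[OF *(3), where \<gamma> = "\<lambda>t. F (y(i := t))"])
    show "Ck_on m 1 T g" using *(6) unfolding smooth_on_def by blast
    show "F (y(i := y i)) \<in> T" using * by simp
    show "\<forall>\<^sub>F t in nhds (y i). F (y(i := t)) \<in> ES m"
      using ev_upd[OF *(1,2) i] by eventually_elim (use *(4) openin_ES_subset[OF *(3)] in blast)
    show "((\<lambda>t. F (y(i := t)) j) has_real_derivative partial i (\<lambda>x. F x j) y) (at (y i))" if "j < m" for j
      by (rule smooth_on_has_partial[OF *(5)[OF that] *(2) i])
  qed
  then show ?thesis using partialI by simp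
qed

lemma vgerm_compose:
  assumes F: "vgerm n m y F" and G: "vgerm m k (F y) G"
  shows "vgerm n k y (\<lambda>z. G (F z))"
  unfolding vgerm_def
proof (intro conjI allI impI)
  show "y \<in> ES n" using F vgerm_ES by blast
  show "\<forall>\<^sub>F z in nhdsE n y. G (F z) \<in> ES k"
    by (rule vgerm_tendsto[OF F]) (use G in \<open>simp add: vgerm_def\<close>)
  show "smooth_germ n y (\<lambda>z. G (F z) j)" if "j < k" for j
    by (rule smooth_germ_compose[OF F, of "\<lambda>w. G w j"]) (use G that in \<open>simp add: vgerm_def\<close>)
qed

lemma vgerm_id: "y \<in> ES n \<Longrightarrow> vgerm n n y (\<lambda>z. z)"
  using eventually_nhdsin_in[of "Euclidean_space n" "ES n" y] by (simp add: vgerm_def smooth_germ_coord)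

lemma jacobian_compose:
  assumes F: "vgerm n m y F" and G: "vgerm m k (F y) G"
  shows "jacobian n (\<lambda>z. G (F z)) y v = jacobian m G (F y) (jacobian n F y v)"
proof
  fix j
  show "jacobian n (\<lambda>z. G (F z)) y v j = jacobian m G (F y) (jacobian n F y v) j"
  proof (cases "j < k")
    case True
    then have g: "smooth_germ m (F y) (\<lambda>w. G w j)" using G by (simp add: vgerm_def)
    have "jacobian n (\<lambda>z. G (F z)) y v j = (\<Sum>i<n. \<Sum>l<m. v i * (partial i (\<lambda>z. F z l) y * partial l (\<lambda>w. G w j) (F y)))"
      unfolding jacobian_def by (intro sum.cong refl) (simp add: partial_compose[OF F g] sum_distrib_left)
    also have "\<dots> = (\<Sum>l<m. (\<Sum>i<n. v i * partial i (\<lambda>z. F z l) y) * partial l (\<lambda>w. G w j) (F y))"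
      by (subst sum.swap) (simp add: sum_distrib_right mult.assoc)
    finally show ?thesis by (simp add: jacobian_def)
  next
    case False
    have 0: "\<forall>\<^sub>F z in nhdsE m (F y). G z j = 0"
      using G False unfolding vgerm_def by (auto simp: ES_iff elim: eventually_mono)
    have p0: "partial i (\<lambda>x. 0) z = 0" for i z by (simp add: partial_def)
    have "partial l (\<lambda>w. G w j) (F y) = 0" if "l < m" for l
      using partial_cong_germ[OF 0 vgerm_ES(2)[OF F] that] p0 by simp
    moreover have "partial l (\<lambda>z. G (F z) j) y = 0" if "l < n" for l
      using partial_cong_germ[OF vgerm_tendsto[OF F 0] vgerm_ES(1)[OF F] that] p0 by simp
    ultimately show ?thesis by (simp add: jacobian_def)
  qed
qed

lemma jacobian_cong:
  assumes "eventually (\<lambda>z. F z = G z) (nhdsE n y)" "y \<in> ES n"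
  shows "jacobian n F y = jacobian n G y"
proof (intro ext)
  fix v j
  have "eventually (\<lambda>z. F z j = G z j) (nhdsE n y)" using assms(1) by eventually_elim simp
  then show "jacobian n F y v j = jacobian n G y v j"
    unfolding jacobian_def by (intro sum.cong refl) (use partial_cong_germ assms(2) in auto)
qed

lemma jacobian_id: "y \<in> ES n \<Longrightarrow> v \<in> ES n \<Longrightarrow> jacobian n (\<lambda>z. z) y v = v"
proof (rule ES_eqI[of _ n])
  assume y: "y \<in> ES n" and v: "v \<in> ES n"
  have *: "partial i (\<lambda>z. z j) y = (if i = j then 1 else 0)" for i j
    by (rule partialI) (auto intro!: derivative_eq_intros)
  show "jacobian n (\<lambda>z. z) y v \<in> ES n" by (auto simp: ES_iff jacobian_def * intro!: sum.neutral)
  show "jacobian n (\<lambda>z. z) y v i = v i" if "i < n" for i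
    using that by (simp add: jacobian_def * if_distrib[of "\<lambda>x. _ * x"] sum.delta' cong: if_cong)
qed

lemma jacobian_ES:
  assumes "vgerm n m y F" shows "jacobian n F y v \<in> ES m"
proof -
  have "partial l (\<lambda>w. F w j) y = 0" if "l < n" "j \<ge> m" for l j
  proof -
    have 0: "\<forall>\<^sub>F z in nhdsE n y. F z j = 0"
      using assms that unfolding vgerm_def by (auto simp: ES_iff elim: eventually_mono)
    show ?thesis using partial_cong_germ[OF 0 vgerm_ES(1)[OF assms] that(1)] by (simp add: partial_def)
  qed
  then show ?thesis by (auto simp: ES_iff jacobian_def)
qed

section \<open>Implicit functions and local diffeomorphisms\<close>

text \<open>
  Implicit differentiation. The hypothesis is the linearization of \<open>f u = const\<close> with an error that still involves the
  unknown increment \<open>\<Delta> t\<close>. As \<open>C \<noteq> 0\<close>, a small multiple of \<open>\<bar>\<Delta> t\<bar>\<close> can be absorbed, which bounds \<open>\<Delta> t\<close> by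
  \<open>K \<bar>t - t0\<bar>\<close> and then gives the limit.
\<close>

lemma implicit_slope_limit:
  fixes \<Delta> :: "real \<Rightarrow> real"
  assumes C: "C \<noteq> 0"
    and *: "\<And>e. e > 0 \<Longrightarrow> eventually (\<lambda>t. \<bar>\<Delta> t * C - (t - t0) * G\<bar> \<le> e * (\<bar>t - t0\<bar> + \<bar>\<Delta> t\<bar>)) (at t0)"
  shows "((\<lambda>t. \<Delta> t / (t - t0)) \<longlongrightarrow> G / C) (at t0)"
proof (rule tendstoI)
  fix \<epsilon> :: real assume \<epsilon>: "\<epsilon> > 0"
  define K where "K = 2 * (\<bar>G\<bar> + \<bar>C\<bar>) / \<bar>C\<bar>"
  have K: "K > 0" using C by (simp add: K_def field_simps add_nonneg_pos)
  define e where "e = min (\<bar>C\<bar> / 2) (\<epsilon> * \<bar>C\<bar> / (2 * (1 + K)))"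
  have e: "e > 0" "e \<le> \<bar>C\<bar> / 2" "e \<le> \<epsilon> * \<bar>C\<bar> / (2 * (1 + K))"
    unfolding e_def using C \<epsilon> K by (simp_all only: min.cobounded1 min.cobounded2 min_less_iff_conj) auto
  have neq: "eventually (\<lambda>t. t \<noteq> t0) (at t0)" by (simp add: eventually_at_filter)
  show "eventually (\<lambda>t. dist (\<Delta> t / (t - t0)) (G / C) < \<epsilon>) (at t0)"
    using *[OF e(1)] neq
  proof eventually_elim
    case (elim t)
    define h where "h = t - t0"
    have h: "h \<noteq> 0" using elim by (simp add: h_def)
    have 1: "\<bar>\<Delta> t * C - h * G\<bar> \<le> e * (\<bar>h\<bar> + \<bar>\<Delta> t\<bar>)" using elim by (simp add: h_def)
    have "\<bar>\<Delta> t\<bar> * \<bar>C\<bar> \<le> \<bar>h\<bar> * \<bar>G\<bar> + e * (\<bar>h\<bar> + \<bar>\<Delta> t\<bar>)"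
      using 1 abs_triangle_ineq2[of "\<Delta> t * C" "h * G"] by (simp add: abs_mult)
    also have "\<dots> \<le> \<bar>h\<bar> * \<bar>G\<bar> + \<bar>C\<bar> / 2 * (\<bar>h\<bar> + \<bar>\<Delta> t\<bar>)"
      using mult_right_mono[OF e(2), of "\<bar>h\<bar> + \<bar>\<Delta> t\<bar>"] by simp
    finally have "\<bar>\<Delta> t\<bar> * \<bar>C\<bar> \<le> \<bar>h\<bar> * \<bar>G\<bar> + \<bar>C\<bar> / 2 * (\<bar>h\<bar> + \<bar>\<Delta> t\<bar>)" .
    then have "\<bar>\<Delta> t\<bar> * \<bar>C\<bar> \<le> 2 * (\<bar>G\<bar> + \<bar>C\<bar>) * \<bar>h\<bar>"
    proof -
      have gen: "a \<le> b + x \<Longrightarrow> x = (r + a) / 2 \<Longrightarrow> s = 2 * b + 2 * r \<Longrightarrow> 0 \<le> r \<Longrightarrow> 0 \<le> b \<Longrightarrow> a \<le> s"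
        for a b x r s :: real by (simp add: field_simps)
      have "0 \<le> \<bar>h\<bar> * \<bar>C\<bar>" "0 \<le> \<bar>h\<bar> * \<bar>G\<bar>" by simp_all
      moreover have "\<bar>C\<bar> / 2 * (\<bar>h\<bar> + \<bar>\<Delta> t\<bar>) = (\<bar>h\<bar> * \<bar>C\<bar> + \<bar>\<Delta> t\<bar> * \<bar>C\<bar>) / 2" by (simp add: algebra_simps)
      moreover have "2 * (\<bar>G\<bar> + \<bar>C\<bar>) * \<bar>h\<bar> = 2 * (\<bar>h\<bar> * \<bar>G\<bar>) + 2 * (\<bar>h\<bar> * \<bar>C\<bar>)" by (simp add: algebra_simps)
      ultimately show ?thesis
        using gen \<open>\<bar>\<Delta> t\<bar> * \<bar>C\<bar> \<le> \<bar>h\<bar> * \<bar>G\<bar> + \<bar>C\<bar> / 2 * (\<bar>h\<bar> + \<bar>\<Delta> t\<bar>)\<close> by blast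
    qed
    then have 2: "\<bar>\<Delta> t\<bar> \<le> K * \<bar>h\<bar>" using C by (simp add: K_def field_simps)
    have "\<bar>\<Delta> t * C - h * G\<bar> \<le> e * ((1 + K) * \<bar>h\<bar>)"
    proof -
      have "e * (\<bar>h\<bar> + \<bar>\<Delta> t\<bar>) \<le> e * ((1 + K) * \<bar>h\<bar>)"
        using 2 e(1) by (intro mult_left_mono) (auto simp: distrib_right)
      then show ?thesis using 1 by linarith
    qed
    then have "\<bar>\<Delta> t * C - h * G\<bar> / (\<bar>h\<bar> * \<bar>C\<bar>) \<le> e * ((1 + K) * \<bar>h\<bar>) / (\<bar>h\<bar> * \<bar>C\<bar>)"
      by (rule divide_right_mono) simp
    moreover have "\<Delta> t / h - G / C = (\<Delta> t * C - h * G) / (h * C)" using h C by (simp add: field_simps)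
    ultimately have "\<bar>\<Delta> t / h - G / C\<bar> \<le> e * (1 + K) / \<bar>C\<bar>"
      using h by (simp add: abs_divide abs_mult)
    also have "\<dots> \<le> \<epsilon> / 2" using e(3) C K by (simp add: field_simps)
    also have "\<dots> < \<epsilon>" using \<epsilon> by simp
    finally show ?case by (simp add: h_def dist_real_def)
  qed
qed

text \<open>
  The implicit function theorem for one equation in one coordinate: where \<open>partial i f\<close> keeps the sign of a constant \<open>c\<close>,
  the map that replaces coordinate \<open>i\<close> by the value of \<open>f\<close> is injective and open with smooth inverse \<open>\<psi>\<close>. Along
  coordinate \<open>i\<close> this needs only the mean and intermediate value theorems; general submersions are straightened
  by composing such maps.
\<close>

context
  fixes n i :: nat and f :: "(nat \<Rightarrow> real) \<Rightarrow> real" and S y d c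
  assumes S: "smooth_on n S f" and i: "i < n" and BS: "cube n y d \<subseteq> S"
    and c: "\<And>w. w \<in> cube n y d \<Longrightarrow> partial i f w * c > 0"
begin

private abbreviation "\<phi> \<equiv> \<lambda>z. z(i := f z)"

private lemma mvt: "z \<in> cube n y d \<Longrightarrow> \<bar>a - y i\<bar> < d \<Longrightarrow>
    \<exists>w\<in>cube n y d. f (z(i := a)) - f z = (a - z i) * partial i f w"
  using MVT_coord[of n S f y d i z a] S i BS unfolding smooth_on_def by blast

private lemma phi_inj: "inj_on \<phi> (cube n y d)"
proof (rule inj_onI)
  fix z z' assume z: "z \<in> cube n y d" and z': "z' \<in> cube n y d" and eq: "\<phi> z = \<phi> z'"
  have j: "z j = z' j" if "j \<noteq> i" for j using fun_cong[OF eq, of j] that by simp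
  then have z'eq: "z' = z(i := z' i)" by auto
  have feq: "f z = f z'" using fun_cong[OF eq, of i] by simp
  have "\<bar>z' i - y i\<bar> < d" using z' i by (auto simp: cube_def)
  then obtain w where w: "w \<in> cube n y d" "f (z(i := z' i)) - f z = (z' i - z i) * partial i f w"
    using mvt[OF z] by blast
  then have "z' i = z i" using z'eq feq c[OF w(1)] by auto
  then show "z = z'" using z'eq by auto
qed

text \<open>
  On the segment from \<open>p\<close> to \<open>q\<close> in direction \<open>i\<close> through \<open>z\<close> the function is strictly monotone, so the value of
  \<open>f\<close> at \<open>z\<close> lies strictly between the values at the ends. This persists with margin \<open>A\<close> on parallel nearby
  segments, on each of which the prescribed value is attained.
\<close>

private lemma phi_open:
  assumes z: "z \<in> cube n y d" and r: "r > 0"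
  shows "\<exists>s>0. \<forall>w\<in>cube n (\<phi> z) s. \<exists>z'\<in>cube n y d \<inter> cube n z r. \<phi> z' = w"
proof -
  have zE: "z \<in> ES n" using z by (simp add: cube_def)
  have cont: "continuous_on (cube n y d) f"
  proof -
    have "Ck_on n 0 S f" using S unfolding smooth_on_def by blast
    then show ?thesis by (rule Ck_cont[OF Ck_subset[OF _ BS] openin_ES_subset[OF openin_cube]])
  qed
  obtain r0 where r0: "r0 > 0" "cube n z r0 \<subseteq> cube n y d"
    using openin_cube[of n y d] z by (auto simp: openin_ES_iff)
  define r1 where "r1 = min r r0 / 2"
  have r1: "r1 > 0" "r1 < r" "r1 < r0" using r r0 by (auto simp: r1_def)
  define p q where "p = z(i := z i - r1)" and "q = z(i := z i + r1)"
  have "p \<in> cube n z r0" "q \<in> cube n z r0"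
    using r1 r0(1) ES_upd[OF zE i] by (auto simp: cube_def p_def q_def)
  then have pq: "p \<in> cube n y d" "q \<in> cube n y d" using r0(2) by auto
  have pqi: "\<bar>z i - r1 - y i\<bar> < d" "\<bar>z i + r1 - y i\<bar> < d"
    using pq i by (auto simp: cube_def p_def q_def)
  obtain w1 where w1: "w1 \<in> cube n y d" "f p - f z = - r1 * partial i f w1"
    using mvt[OF z pqi(1)] by (auto simp: p_def)
  obtain w2 where w2: "w2 \<in> cube n y d" "f q - f z = r1 * partial i f w2"
    using mvt[OF z pqi(2)] by (auto simp: q_def)
  define A where "A = min \<bar>f p - f z\<bar> \<bar>f q - f z\<bar> / 2"
  have signs: "(f p < f z \<and> f z < f q) \<or> (f q < f z \<and> f z < f p)"
  proof (cases "c > 0")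
    case True
    then have "partial i f w1 > 0" "partial i f w2 > 0" using c[OF w1(1)] c[OF w2(1)]
      by (auto simp: zero_less_mult_iff)
    then have "r1 * partial i f w1 > 0" "r1 * partial i f w2 > 0" using r1 by auto
    then show ?thesis using w1 w2 by auto
  next
    case False
    then have "partial i f w1 < 0" "partial i f w2 < 0" using c[OF w1(1)] c[OF w2(1)]
      by (auto simp: zero_less_mult_iff)
    then have "r1 * partial i f w1 < 0" "r1 * partial i f w2 < 0" using r1 by (auto simp: mult_pos_neg)
    then show ?thesis using w1 w2 by auto
  qed
  then have A: "A > 0" by (auto simp: A_def)
  obtain s1 where s1: "s1 > 0" "\<And>w. w \<in> cube n p s1 \<Longrightarrow> \<bar>f w - f p\<bar> < A"
    using cont_cube[OF openin_cube cont pq(1) A] by auto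
  obtain s2 where s2: "s2 > 0" "\<And>w. w \<in> cube n q s2 \<Longrightarrow> \<bar>f w - f q\<bar> < A"
    using cont_cube[OF openin_cube cont pq(2) A] by auto
  define s where "s = min (min s1 s2) (min r1 A)"
  have s: "s > 0" "s \<le> s1" "s \<le> s2" "s \<le> r1" "s \<le> A" using s1 s2 r1 A by (auto simp: s_def)
  have "\<exists>z'\<in>cube n y d \<inter> cube n z r. \<phi> z' = w" if w: "w \<in> cube n (\<phi> z) s" for w
  proof -
    have wE: "w \<in> ES n" using w by (simp add: cube_def)
    have wj: "\<bar>w j - z j\<bar> < s" if "j < n" "j \<noteq> i" for j using w that by (auto simp: cube_def)
    have wi: "\<bar>w i - f z\<bar> < s" using w i by (auto simp: cube_def)
    have in0: "w(i := t) \<in> cube n z r0 \<inter> cube n z r" if "z i - r1 \<le> t" "t \<le> z i + r1" for t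
    proof -
      have "\<bar>(w(i := t)) j - z j\<bar> < min r0 r" if "j < n" for j
        using wj[OF that] \<open>z i - r1 \<le> t\<close> \<open>t \<le> z i + r1\<close> s r1 by (cases "j = i") auto
      then show ?thesis using ES_upd[OF wE i] by (auto simp: cube_def)
    qed
    have "w(i := z i - r1) \<in> cube n p s1"
      using ES_upd[OF wE i] wj s s1(1) by (force simp: cube_def p_def)
    then have fp: "\<bar>f (w(i := z i - r1)) - f p\<bar> < A" using s1 by blast
    have "w(i := z i + r1) \<in> cube n q s2"
      using ES_upd[OF wE i] wj s s2(1) by (force simp: cube_def q_def)
    then have fq: "\<bar>f (w(i := z i + r1)) - f q\<bar> < A" using s2 by blast
    have cw: "continuous_on {z i - r1..z i + r1} (\<lambda>t. f (w(i := t)))"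
    proof (rule continuous_on_compose2[OF cont])
      show "continuous_on {z i - r1..z i + r1} (\<lambda>t. w(i := t))"
      proof (rule continuous_on_coordinatewise_then_product)
        fix j show "continuous_on {z i - r1..z i + r1} (\<lambda>t. (w(i := t)) j)" by (cases "j = i") auto
      qed
      show "(\<lambda>t. w(i := t)) ` {z i - r1..z i + r1} \<subseteq> cube n y d" using in0 r0 by auto
    qed
    have wi': "\<bar>w i - f z\<bar> < A" using wi s by linarith
    have A': "2 * A \<le> \<bar>f p - f z\<bar>" "2 * A \<le> \<bar>f q - f z\<bar>" unfolding A_def by auto
    have "\<exists>t. z i - r1 \<le> t \<and> t \<le> z i + r1 \<and> f (w(i := t)) = w i"
      using signs
    proof
      assume "f p < f z \<and> f z < f q"
      then have "f (w(i := z i - r1)) \<le> w i" "w i \<le> f (w(i := z i + r1))"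
        using fp fq wi' A' by linarith+
      then show ?thesis using IVT'[OF _ _ _ cw] r1 by auto
    next
      assume "f q < f z \<and> f z < f p"
      then have "f (w(i := z i + r1)) \<le> w i" "w i \<le> f (w(i := z i - r1))"
        using fp fq wi' A' by linarith+
      then show ?thesis using IVT2'[OF _ _ _ cw] r1 by auto
    qed
    then obtain t where t: "z i - r1 \<le> t" "t \<le> z i + r1" "f (w(i := t)) = w i" by blast
    then show ?thesis using in0[OF t(1,2)] r0(2)
      by (intro bexI[of _ "w(i := t)"]) auto
  qed
  then show ?thesis using s(1) by blast
qed

private abbreviation "V \<equiv> \<phi> ` cube n y d"
private abbreviation "\<psi> \<equiv> inv_into (cube n y d) \<phi>"

private lemma psi1: "w \<in> V \<Longrightarrow> \<psi> w \<in> cube n y d"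
  by (rule inv_into_into)
private lemma psi2: "w \<in> V \<Longrightarrow> \<phi> (\<psi> w) = w"
  by (rule f_inv_into_f[of w "\<lambda>z. z(i := f z)" "cube n y d"])
private lemma psi3: "z \<in> cube n y d \<Longrightarrow> \<psi> (\<phi> z) = z"
  by (rule inv_into_f_f[OF phi_inj])
private lemmas psi = psi1 psi2 psi3

private lemma psi_coord: assumes w: "w \<in> V" shows "j \<noteq> i \<Longrightarrow> \<psi> w j = w j" "f (\<psi> w) = w i"
proof -
  have *: "\<phi> (\<psi> w) = w" using psi(2)[OF w] .
  show "\<psi> w j = w j" if "j \<noteq> i" using fun_cong[OF *, of j] that by (simp only: fun_upd_other not_False_eq_True)
  show "f (\<psi> w) = w i" using fun_cong[OF *, of i] by (simp only: fun_upd_same)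
qed

private lemma V_open: "openin (Euclidean_space n) V"
  unfolding openin_ES_iff
proof (intro conjI subsetI ballI)
  fix w assume "w \<in> V"
  then obtain z where z: "z \<in> cube n y d" "w = \<phi> z" by blast
  then show "w \<in> ES n" using ES_upd[of z n i "f z"] i by (auto simp: cube_def)
  show "\<exists>e>0. cube n w e \<subseteq> V" using phi_open[OF z(1), of 1] z(2) by fastforce
qed

private lemma psi_cont:
  assumes w: "w \<in> V" and r: "r > 0"
  shows "\<exists>s>0. \<forall>w'\<in>cube n w s. w' \<in> V \<and> \<psi> w' \<in> cube n (\<psi> w) r"
proof -
  from phi_open[OF psi(1)[OF w] r]
  obtain s where s: "s > 0" "\<forall>w'\<in>cube n (\<phi> (\<psi> w)) s. \<exists>z'\<in>cube n y d \<inter> cube n (\<psi> w) r. \<phi> z' = w'"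
    by (elim exE conjE)
  have "w' \<in> V \<and> \<psi> w' \<in> cube n (\<psi> w) r" if "w' \<in> cube n w s" for w'
  proof -
    have "w' \<in> cube n (\<phi> (\<psi> w)) s" unfolding psi(2)[OF w] by (rule that)
    from bspec[OF s(2) this] obtain z' where z': "z' \<in> cube n y d" "z' \<in> cube n (\<psi> w) r" "\<phi> z' = w'"
      by (elim bexE IntE)
    show ?thesis using psi(3)[OF z'(1)] z'(1,2) unfolding z'(3)[symmetric] by simp
  qed
  then show ?thesis using s(1) by blast
qed

private lemma psi_deriv:
  assumes w: "w \<in> V" and l: "l < n"
  shows "((\<lambda>t. \<psi> (w(l := t)) i) has_real_derivative
     (if l = i then 1 else - partial l f (\<psi> w)) * inverse (partial i f (\<psi> w))) (at (w l))"
proof -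
  define z where "z = \<psi> w"
  have z: "z \<in> cube n y d" "\<phi> z = w" using psi w by (auto simp: z_def)
  define C G where "C = partial i f z" and "G = (if l = i then 1 else - partial l f z)"
  have C: "C \<noteq> 0" using c[OF z(1)] by (auto simp: C_def)
  define \<Delta> where "\<Delta> t = \<psi> (w(l := t)) i - z i" for t
  have wE: "w \<in> ES n" using w V_open openin_ES_subset by blast
  have ev: "eventually (\<lambda>t. w(l := t) \<in> V \<and> \<psi> (w(l := t)) \<in> cube n z r) (at (w l))" if rpos: "r > 0" for r
  proof -
    obtain s where s: "s > 0" "\<And>w'. w' \<in> cube n w s \<Longrightarrow> w' \<in> V \<and> \<psi> w' \<in> cube n z r"
      using psi_cont[OF w rpos] unfolding z_def by blast
    have "eventually (\<lambda>t. w(l := t) \<in> cube n w s) (at (w l))"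
      using ev_upd[OF openin_cube cube_self[OF wE s(1)] l]
      by (simp add: eventually_nhds_conv_at)
    then show ?thesis by eventually_elim (rule s(2))
  qed
  have "((\<lambda>t. \<Delta> t / (t - w l)) \<longlongrightarrow> G / C) (at (w l))"
  proof (rule implicit_slope_limit[OF C])
    fix e :: real assume e: "e > 0"
    have "Ck_on n 1 S f" "openin (Euclidean_space n) S" using S unfolding smooth_on_def by blast+
    then obtain r where r: "r > 0" "\<And>y y'. y \<in> cube n z r \<Longrightarrow> y' \<in> cube n z r \<Longrightarrow>
       \<bar>f y' - f y - (\<Sum>j<n. (y' j - y j) * partial j f z)\<bar> \<le> e * (\<Sum>j<n. \<bar>y' j - y j\<bar>)"
      using frechet_cube[of n S f z e] e subsetD[OF BS z(1)] by auto
    have zr: "z \<in> cube n z r" using z(1) r(1) by (simp add: cube_self cube_def)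
    show "eventually (\<lambda>t. \<bar>\<Delta> t * C - (t - w l) * G\<bar> \<le> e * (\<bar>t - w l\<bar> + \<bar>\<Delta> t\<bar>)) (at (w l))"
      using ev[OF r(1)]
    proof eventually_elim
      case (elim t)
      define u where "u = \<psi> (w(l := t))"
      have u: "u \<in> cube n z r" "w(l := t) \<in> V" using elim by (auto simp: u_def)
      have uj: "u j - z j = (if j = i then \<Delta> t else 0) + (if j = l then (if l = i then 0 else t - w l) else 0)" for j
        using psi_coord(1)[OF u(2), of j] psi_coord(1)[OF w, of j]
        by (auto simp: u_def \<Delta>_def z_def)
      have fu: "f u - f z = (if l = i then t - w l else 0)"
        using psi_coord(2)[OF u(2)] psi_coord(2)[OF w] by (auto simp: u_def z_def)
      have s1: "(\<Sum>j<n. (u j - z j) * partial j f z) = \<Delta> t * C + (if l = i then 0 else (t - w l) * partial l f z)"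
        unfolding uj distrib_right sum.distrib using i l
        by (simp add: if_distrib[of "\<lambda>x. x * _"] C_def cong: if_cong)
      have s2: "(\<Sum>j<n. \<bar>u j - z j\<bar>) \<le> \<bar>t - w l\<bar> + \<bar>\<Delta> t\<bar>"
      proof -
        have "(\<Sum>j<n. \<bar>u j - z j\<bar>) \<le> (\<Sum>j<n. (if j = i then \<bar>\<Delta> t\<bar> else 0) + (if j = l then \<bar>t - w l\<bar> else 0))"
          unfolding uj by (intro sum_mono) auto
        also have "\<dots> = \<bar>t - w l\<bar> + \<bar>\<Delta> t\<bar>" unfolding sum.distrib using i l by simp
        finally show ?thesis .
      qed
      have "\<bar>f u - f z - (\<Sum>j<n. (u j - z j) * partial j f z)\<bar> = \<bar>\<Delta> t * C - (t - w l) * G\<bar>"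
        unfolding fu s1 G_def by (auto simp: abs_if algebra_simps)
      then show ?case using r(2)[OF zr u(1)] mult_left_mono[OF s2, of e] e by linarith
    qed
  qed
  then show ?thesis unfolding has_field_derivative_iff \<Delta>_def C_def G_def z_def
    by (simp only: fun_upd_triv divide_inverse)
qed

text \<open>
  The formula for the derivative contains \<open>\<psi>\<close> itself, so each order of differentiability yields the next.
\<close>

private lemma psi_Ck: "Ck_on n k V (\<lambda>w. \<psi> w i)"
proof (induction k)
  case 0
  have "continuous_on V (\<lambda>w. \<psi> w i)"
  proof (rule cont_cubeI[OF V_open])
    fix w e assume w: "w \<in> V" and e: "e > (0::real)"
    then obtain s where "s > 0" "\<forall>w'\<in>cube n w s. w' \<in> V \<and> \<psi> w' \<in> cube n (\<psi> w) e" using psi_cont by blast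
    then show "\<exists>s>0. \<forall>w'\<in>cube n w s. w' \<in> V \<longrightarrow> \<bar>\<psi> w' i - \<psi> w i\<bar> < e"
      using i by (intro exI[of _ s]) (auto simp: cube_def)
  qed
  then show ?case unfolding Ck_on.simps using cont_ES[OF openin_ES_subset[OF V_open]] by blast
next
  case (Suc k)
  show ?case
  proof (rule Ck_SucI[OF V_open])
    show "continuous_on V (\<lambda>w. \<psi> w i)" by (rule Ck_cont[OF Suc openin_ES_subset[OF V_open]])
    show "((\<lambda>t. \<psi> (w(l := t)) i) has_real_derivative
     (\<lambda>w. (if l = i then 1 else - 1 * partial l f (\<psi> w)) * inverse (partial i f (\<psi> w))) w) (at (w l))"
      if "l < n" "w \<in> V" for l w using psi_deriv[OF that(2,1)] by (simp only: mult_minus1)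
    fix l assume l: "l < n"
    have comp: "Ck_on n k V (\<lambda>w. \<psi> w j)" if "j < n" for j
    proof (cases "j = i")
      case False
      show ?thesis by (rule Ck_cong[OF V_open _ Ck_coord[OF V_open, of k j]]) (simp add: psi_coord(1) False)
    next
      case True
      show ?thesis unfolding True by (rule Suc)
    qed
    have sp: "Ck_on n k V (\<lambda>w. partial j f (\<psi> w))" if "j < n" for j
    proof (rule Ck_compose[OF V_open openin_cube psi(1) comp])
      show "Ck_on n k (cube n y d) (partial j f)"
        using smooth_on_partial[OF S that] Ck_subset[OF _ BS] unfolding smooth_on_def by blast
    qed auto
    have nz: "partial i f (\<psi> w) \<noteq> 0" if "w \<in> V" for w using c[OF psi(1)[OF that]] by auto
    have VE: "V \<subseteq> ES n" by (rule openin_ES_subset[OF V_open])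
    show "Ck_on n k V (\<lambda>w. (if l = i then 1 else - 1 * partial l f (\<psi> w)) * inverse (partial i f (\<psi> w)))"
    proof (cases "l = i")
      case True
      then show ?thesis using Ck_inverse[OF V_open sp[OF i] nz] by simp
    next
      case False
      show ?thesis unfolding if_not_P[OF False]
        by (intro Ck_mult[OF V_open] Ck_const[OF VE] sp l Ck_inverse[OF V_open sp[OF i] nz])
    qed
  qed
qed

lemma implicit_function_set:
  assumes d: "d > 0" and y: "y \<in> ES n"
  shows "\<exists>V \<psi>. openin (Euclidean_space n) V \<and> (\<forall>j<n. smooth_on n V (\<lambda>w. \<psi> w j)) \<and>
    (\<forall>w\<in>V. \<psi> w \<in> ES n \<and> (\<psi> w)(i := f (\<psi> w)) = w) \<and>
    (\<forall>z\<in>cube n y d. z(i := f z) \<in> V \<and> \<psi> (z(i := f z)) = z)"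
proof (intro exI[of _ V] exI[of _ \<psi>] conjI allI impI ballI)
  show "openin (Euclidean_space n) V" by (rule V_open)
  show "smooth_on n V (\<lambda>w. \<psi> w j)" if "j < n" for j
  proof (cases "j = i")
    case True
    then show ?thesis using psi_Ck V_open by (simp add: smooth_on_def)
  next
    case False
    have "Ck_on n k V (\<lambda>w. \<psi> w j)" for k
      by (rule Ck_cong[OF V_open _ Ck_coord[OF V_open, of k j]]) (simp add: psi_coord(1) False)
    then show ?thesis using V_open by (simp add: smooth_on_def)
  qed
  show "\<psi> w \<in> ES n" if "w \<in> V" for w using psi(1)[OF that] by (simp add: cube_def)
qed (use psi in auto)

end

definition local_diffeo ::
    "nat \<Rightarrow> (nat \<Rightarrow> real) \<Rightarrow> ((nat \<Rightarrow> real) \<Rightarrow> nat \<Rightarrow> real) \<Rightarrow> ((nat \<Rightarrow> real) \<Rightarrow> nat \<Rightarrow> real) \<Rightarrow> bool" where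
  "local_diffeo n y \<phi> \<psi> \<longleftrightarrow> vgerm n n y \<phi> \<and> vgerm n n (\<phi> y) \<psi> \<and>
     eventually (\<lambda>z. \<psi> (\<phi> z) = z) (nhdsE n y) \<and> eventually (\<lambda>w. \<phi> (\<psi> w) = w) (nhdsE n (\<phi> y))"

lemma local_diffeo_inv: "local_diffeo n y \<phi> \<psi> \<Longrightarrow> \<psi> (\<phi> y) = y"
  unfolding local_diffeo_def by (rule eventually_nhdsin_self[of y "Euclidean_space n"]) (auto dest: vgerm_ES)

lemma local_diffeo_compose:
  assumes "local_diffeo n y \<phi> \<psi>" "local_diffeo n (\<phi> y) \<phi>1 \<psi>1"
  shows "local_diffeo n y (\<lambda>z. \<phi>1 (\<phi> z)) (\<lambda>w. \<psi> (\<psi>1 w))"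
proof -
  note 1 = assms(1)[unfolded local_diffeo_def] and 2 = assms(2)[unfolded local_diffeo_def]
  have p: "\<psi>1 (\<phi>1 (\<phi> y)) = \<phi> y" by (rule local_diffeo_inv[OF assms(2)])
  have "eventually (\<lambda>z. \<psi>1 (\<phi>1 (\<phi> z)) = \<phi> z) (nhdsE n y)"
    by (rule vgerm_tendsto[of n n]) (use 1 2 in auto)
  then have A: "eventually (\<lambda>z. \<psi> (\<psi>1 (\<phi>1 (\<phi> z))) = z) (nhdsE n y)"
    using 1[THEN conjunct2, THEN conjunct2, THEN conjunct1] by eventually_elim simp
  have "eventually (\<lambda>w. \<phi> (\<psi> (\<psi>1 w)) = \<psi>1 w) (nhdsE n (\<phi>1 (\<phi> y)))"
    by (rule vgerm_tendsto[of n n _ \<psi>1]) (use 1 2 p in auto)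
  then have B: "eventually (\<lambda>w. \<phi>1 (\<phi> (\<psi> (\<psi>1 w))) = w) (nhdsE n (\<phi>1 (\<phi> y)))"
    using 2[THEN conjunct2, THEN conjunct2, THEN conjunct2] by eventually_elim simp
  show ?thesis
    unfolding local_diffeo_def using A B vgerm_compose[of n n y \<phi> n \<phi>1] vgerm_compose[of n n "\<phi>1 (\<phi> y)" \<psi>1 n \<psi>] 1 2 p by simp
qed

lemma local_diffeo_id: "y \<in> ES n \<Longrightarrow> local_diffeo n y (\<lambda>z. z) (\<lambda>z. z)"
  by (simp add: local_diffeo_def vgerm_id)

lemma vgerm_swap:
  assumes "i < n" "k < n" "y \<in> ES n"
  shows "vgerm n n y (\<lambda>z j. z (Transposition.transpose i k j))"
proof -
  have "(\<lambda>j. z (Transposition.transpose i k j)) \<in> ES n" if "z \<in> ES n" for z :: "nat \<Rightarrow> real"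
    using that assms by (auto simp: ES_iff transpose_def)
  then have "eventually (\<lambda>z. (\<lambda>j. z (Transposition.transpose i k j)) \<in> ES n) (nhdsE n y)"
    using eventually_nhdsin_in[of "Euclidean_space n" "ES n" y] assms(3) by (auto elim: eventually_mono)
  then show ?thesis using assms by (simp add: vgerm_def smooth_germ_coord)
qed

lemma local_diffeo_swap:
  assumes "i < n" "k < n" "y \<in> ES n"
  shows "local_diffeo n y (\<lambda>z j. z (Transposition.transpose i k j)) (\<lambda>z j. z (Transposition.transpose i k j))"
  unfolding local_diffeo_def
  using vgerm_swap[OF assms] vgerm_swap[OF assms(1,2) vgerm_ES(2)[OF vgerm_swap[OF assms]]] by simp

lemma local_diffeo_implicit:
  assumes f: "smooth_germ n y f" and i: "i < n" and nz: "partial i f y \<noteq> 0"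
  shows "\<exists>\<psi>. local_diffeo n y (\<lambda>z. z(i := f z)) \<psi>"
proof -
  obtain S where S: "y \<in> S" "smooth_on n S f" using f by (auto simp: smooth_germ_def)
  have y: "y \<in> ES n" using f smooth_germ_ES by blast
  define c where "c = partial i f y"
  have "Ck_on n 1 S f" "openin (Euclidean_space n) S" using S unfolding smooth_on_def by blast+
  then obtain d where d: "d > 0" "cube n y d \<subseteq> S" "\<And>w. w \<in> cube n y d \<Longrightarrow> \<bar>partial i f w - c\<bar> < \<bar>c\<bar> / 2"
    using partials_near[of n S f y "\<bar>c\<bar> / 2"] S(1) nz i unfolding c_def by auto
  have pos: "partial i f w * c > 0" if "w \<in> cube n y d" for w
    using d(3)[OF that] by (auto simp: zero_less_mult_iff abs_if split: if_splits)
  obtain V \<psi> where V: "openin (Euclidean_space n) V" "\<And>j. j < n \<Longrightarrow> smooth_on n V (\<lambda>w. \<psi> w j)"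
    "\<And>w. w \<in> V \<Longrightarrow> \<psi> w \<in> ES n \<and> (\<psi> w)(i := f (\<psi> w)) = w"
    "\<And>z. z \<in> cube n y d \<Longrightarrow> z(i := f z) \<in> V \<and> \<psi> (z(i := f z)) = z"
    using implicit_function_set[OF S(2) i d(2) pos d(1) y] by blast
  have yV: "y(i := f y) \<in> V" using V(4) cube_self[OF y d(1)] by blast
  have evV: "eventually (\<lambda>w. w \<in> V) (nhdsE n (y(i := f y)))" using V(1) yV by (rule eventually_nhdsin_in)
  have evB: "eventually (\<lambda>z. z \<in> cube n y d) (nhdsE n y)"
    by (rule eventually_nhdsin_in[OF openin_cube cube_self[OF y d(1)]])
  have "vgerm n n y (\<lambda>z. z(i := f z))"
    unfolding vgerm_def
  proof (intro conjI allI impI y)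
    show "\<forall>\<^sub>F z in nhdsE n y. z(i := f z) \<in> ES n"
      using evB by eventually_elim (use V(4) openin_ES_subset[OF V(1)] in blast)
    show "smooth_germ n y (\<lambda>z. (z(i := f z)) j)" if "j < n" for j
      by (cases "j = i") (simp_all add: f smooth_germ_coord y)
  qed
  moreover have "vgerm n n (y(i := f y)) \<psi>"
    unfolding vgerm_def
  proof (intro conjI allI impI)
    show "y(i := f y) \<in> ES n" using y i ES_upd by blast
    show "\<forall>\<^sub>F w in nhdsE n (y(i := f y)). \<psi> w \<in> ES n" using evV by eventually_elim (use V(3) in blast)
    show "smooth_germ n (y(i := f y)) (\<lambda>w. \<psi> w j)" if "j < n" for j
      using V(2)[OF that] yV by (auto simp: smooth_germ_def)
  qed
  moreover have "eventually (\<lambda>z. \<psi> (z(i := f z)) = z) (nhdsE n y)"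
    using evB by eventually_elim (use V(4) in blast)
  moreover have "eventually (\<lambda>w. (\<psi> w)(i := f (\<psi> w)) = w) (nhdsE n (y(i := f y)))"
    using evV by eventually_elim (use V(3) in blast)
  ultimately show ?thesis unfolding local_diffeo_def by (intro exI[of _ \<psi>]) simp
qed

text \<open>
  If the functions \<open>s j\<close> have independent differentials at \<open>y\<close>, they can be made the first coordinates. They are
  installed one after the other: in the coordinates \<open>\<phi>\<close> found so far some
  further coordinate \<open>i \<ge> k\<close> is replaced by the value of \<open>s k\<close> and then exchanged with coordinate \<open>k\<close>.
\<close>

lemma straighten:
  assumes y: "y \<in> ES n" and s: "\<And>j. j < m \<Longrightarrow> smooth_germ n y (s j)"
    and surj: "\<And>j. j < m \<Longrightarrow> \<exists>v. \<forall>k<m. (\<Sum>i<n. v i * partial i (s k) y) = (if k = j then 1 else 0)"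
  shows "m \<le> n \<and> (\<exists>\<phi> \<psi>. local_diffeo n y \<phi> \<psi> \<and> (\<forall>j<m. eventually (\<lambda>z. \<phi> z j = s j z) (nhdsE n y)))"
proof -
  have "k \<le> n \<and> (\<exists>\<phi> \<psi>. local_diffeo n y \<phi> \<psi> \<and> (\<forall>j<k. eventually (\<lambda>z. \<phi> z j = s j z) (nhdsE n y)))"
    if "k \<le> m" for k using that
  proof (induction k)
    case 0
    then show ?case using local_diffeo_id[OF y] by auto
  next
    case (Suc k)
    then obtain \<phi> \<psi> where \<phi>: "local_diffeo n y \<phi> \<psi>" "\<And>j. j < k \<Longrightarrow> eventually (\<lambda>z. \<phi> z j = s j z) (nhdsE n y)"
      and kn: "k \<le> n" by auto
    note d = \<phi>(1)[unfolded local_diffeo_def]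
    have inv: "\<psi> (\<phi> y) = y" using local_diffeo_inv[OF \<phi>(1)] .
    have km: "k < m" using Suc by simp
    define h where "h = (\<lambda>w. s k (\<psi> w))"
    have h: "smooth_germ n (\<phi> y) h" unfolding h_def
      by (rule smooth_germ_compose[of n n]) (use d s[OF km] inv in auto)
    obtain v where v: "\<And>l. l < m \<Longrightarrow> (\<Sum>i<n. v i * partial i (s l) y) = (if l = k then 1 else 0)"
      using surj[OF km] by blast
    \<comment> \<open>\<open>v\<close> moves \<open>s k\<close> but none of the functions already installed, so in new coordinates it has no component below \<open>k\<close>\<close>
    define w where "w = jacobian n \<phi> y v"
    have w0: "w j = 0" if "j < k" for j
    proof -
      have "w j = (\<Sum>i<n. v i * partial i (s j) y)"
        unfolding w_def jacobian_def
        by (intro sum.cong refl) (use partial_cong_germ[OF \<phi>(2)[OF that] y] in auto)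
      then show ?thesis using v[of j] that km by simp
    qed
    have sk: "eventually (\<lambda>z. s k z = h (\<phi> z)) (nhdsE n y)"
      using d[THEN conjunct2, THEN conjunct2, THEN conjunct1] by eventually_elim (simp add: h_def)
    have "1 = (\<Sum>i<n. v i * partial i (s k) y)" using v[OF km] by simp
    also have "\<dots> = (\<Sum>i<n. v i * (\<Sum>j<n. partial i (\<lambda>z. \<phi> z j) y * partial j h (\<phi> y)))"
      by (intro sum.cong refl) (use partial_cong_germ[OF sk y] partial_compose[of n n y \<phi> h] d h in auto)
    also have "\<dots> = (\<Sum>j<n. w j * partial j h (\<phi> y))"
      unfolding sum_distrib_left w_def jacobian_def sum_distrib_right mult.assoc by (rule sum.swap)
    finally have "\<exists>i<n. w i * partial i h (\<phi> y) \<noteq> 0"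
      by (metis (mono_tags, lifting) lessThan_iff sum.neutral zero_neq_one)
    then obtain i where i: "i < n" "w i \<noteq> 0" "partial i h (\<phi> y) \<noteq> 0" by auto
    then have ki: "k \<le> i" using w0 not_le by blast
    obtain \<psi>1 where 1: "local_diffeo n (\<phi> y) (\<lambda>z. z(i := h z)) \<psi>1"
      using local_diffeo_implicit[OF h i(1,3)] by blast
    have kn': "k < n" using ki i by simp
    let ?t = "\<lambda>z j. z (Transposition.transpose i k j)"
    have yE: "(\<phi> y)(i := h (\<phi> y)) \<in> ES n" using 1 vgerm_ES unfolding local_diffeo_def by blast
    have 2: "local_diffeo n y (\<lambda>z. (\<phi> z)(i := h (\<phi> z))) (\<lambda>w. \<psi> (\<psi>1 w))"
      by (rule local_diffeo_compose[OF \<phi>(1) 1])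
    have 3: "local_diffeo n y (\<lambda>z. ?t ((\<phi> z)(i := h (\<phi> z)))) (\<lambda>w. \<psi> (\<psi>1 (?t w)))"
      by (rule local_diffeo_compose[OF 2 local_diffeo_swap[OF i(1) kn' yE]])
    have "eventually (\<lambda>z. ?t ((\<phi> z)(i := h (\<phi> z))) j = s j z) (nhdsE n y)" if "j < Suc k" for j
    proof (cases "j = k")
      case True
      then show ?thesis using sk by (auto elim: eventually_mono simp: transpose_def)
    next
      case False
      then have "j < k" using that by simp
      then show ?thesis using \<phi>(2)[of j] ki by (auto simp: transpose_def elim: eventually_mono)
    qed
    then show ?case using 3 kn' by (intro conjI exI) auto
  qed
  then show ?thesis by blast
qed

section \<open>Symmetry of second derivatives\<close>

text \<open>
  The second difference quotient over a square is a mixed derivative at some point, by the mean value theorem in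
  direction \<open>i\<close> followed by direction \<open>j\<close>. The quotient itself is symmetric in \<open>i\<close> and \<open>j\<close>.
\<close>

lemma double_difference:
  assumes S: "smooth_on n S f" and B: "cube n y d \<subseteq> S" and d: "d > 0" and ij: "i < n" "j < n" "i \<noteq> j"
    and y: "y \<in> ES n"
  shows "\<exists>w\<in>cube n y d. f (y(i := y i + d/2, j := y j + d/2)) - f (y(i := y i + d/2)) - f (y(j := y j + d/2)) + f y
     = (d/2) * (d/2) * partial j (partial i f) w"
proof -
  define k where "k = d/2"
  have k: "0 < k" "k < d" using d by (auto simp: k_def)
  have inB: "y(i := s, j := t) \<in> cube n y d" if "y i \<le> s" "s \<le> y i + k" "y j \<le> t" "t \<le> y j + k" for s t
    using that k y ij ES_upd[OF ES_upd[OF y ij(1)] ij(2)] by (auto simp: cube_def)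
  have D1: "((\<lambda>s. f (y(i := s, j := t))) has_real_derivative partial i f (y(i := s, j := t))) (at s)"
    if "y i \<le> s" "s \<le> y i + k" "y j \<le> t" "t \<le> y j + k" for s t
    using smooth_on_has_partial[OF S, of "y(i := s, j := t)" i] inB[OF that] B ij
    by (auto simp: fun_upd_twist[of i j])
  have D2: "((\<lambda>t. partial i f (y(i := s, j := t))) has_real_derivative partial j (partial i f) (y(i := s, j := t))) (at t)"
    if "y i \<le> s" "s \<le> y i + k" "y j \<le> t" "t \<le> y j + k" for s t
    using smooth_on_has_partial[OF smooth_on_partial[OF S ij(1)], of "y(i := s, j := t)" j] inB[OF that] B ij
    by auto
  define u where "u s = f (y(i := s, j := y j + k)) - f (y(i := s, j := y j))" for s
  have "\<exists>s>y i. s < y i + k \<and> u (y i + k) - u (y i) = (y i + k - y i) *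
     (partial i f (y(i := s, j := y j + k)) - partial i f (y(i := s, j := y j)))"
    unfolding u_def by (rule MVT2) (use k in \<open>auto intro!: DERIV_diff D1 simp del: fun_upd_apply\<close>)
  then obtain s where s: "y i < s" "s < y i + k" "u (y i + k) - u (y i) = k *
     (partial i f (y(i := s, j := y j + k)) - partial i f (y(i := s, j := y j)))" by auto
  have "\<exists>t>y j. t < y j + k \<and> partial i f (y(i := s, j := y j + k)) - partial i f (y(i := s, j := y j))
      = (y j + k - y j) * partial j (partial i f) (y(i := s, j := t))"
    by (rule MVT2) (use k s in \<open>auto intro!: D2 simp del: fun_upd_apply\<close>)
  then obtain t where t: "y j < t" "t < y j + k" "partial i f (y(i := s, j := y j + k)) - partial i f (y(i := s, j := y j))
      = k * partial j (partial i f) (y(i := s, j := t))" by auto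
  have "u (y i + k) - u (y i) = k * k * partial j (partial i f) (y(i := s, j := t))" using s t by simp
  moreover have "u (y i + k) - u (y i) = f (y(i := y i + k, j := y j + k)) - f (y(i := y i + k)) - f (y(j := y j + k)) + f y"
    using ij by (simp add: u_def fun_upd_twist[of i j] )
  ultimately show ?thesis using inB[of s t] s t unfolding k_def[symmetric] by auto
qed

lemma partial_commute:
  assumes f: "smooth_germ n y f" and ij: "i < n" "j < n"
  shows "partial i (partial j f) y = partial j (partial i f) y"
proof (cases "i = j")
  case False
  obtain S where S: "y \<in> S" "smooth_on n S f" using f by (auto simp: smooth_germ_def)
  have o: "openin (Euclidean_space n) S" using S smooth_on_open by blast
  have y: "y \<in> ES n" using f smooth_germ_ES by blast
  show ?thesis
  proof (rule ccontr)
    assume neq: "\<not> ?thesis"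
    define e where "e = \<bar>partial i (partial j f) y - partial j (partial i f) y\<bar> / 2"
    have e: "e > 0" using neq by (simp add: e_def)
    have c: "continuous_on S (partial a (partial b f))" if "a < n" "b < n" for a b
      using smooth_on_partial[OF smooth_on_partial[OF S(2) that(2)] that(1)]
        Ck_cont[of n 0 S "partial a (partial b f)", OF _ openin_ES_subset[OF o]] unfolding smooth_on_def by blast
    obtain d1 where d1: "d1 > 0" "cube n y d1 \<subseteq> S" "\<And>w. w \<in> cube n y d1 \<Longrightarrow> \<bar>partial i (partial j f) w - partial i (partial j f) y\<bar> < e"
      using cont_cube[OF o c[OF ij] S(1) e] by auto
    obtain d2 where d2: "d2 > 0" "cube n y d2 \<subseteq> S" "\<And>w. w \<in> cube n y d2 \<Longrightarrow> \<bar>partial j (partial i f) w - partial j (partial i f) y\<bar> < e"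
      using cont_cube[OF o c[OF ij(2,1)] S(1) e] by auto
    define d where "d = min d1 d2"
    have d: "d > 0" "cube n y d \<subseteq> S" "cube n y d \<subseteq> cube n y d1" "cube n y d \<subseteq> cube n y d2"
      using d1 d2 by (auto simp: d_def cube_def)
    obtain w1 where w1: "w1 \<in> cube n y d" "f (y(i := y i + d/2, j := y j + d/2)) - f (y(i := y i + d/2)) - f (y(j := y j + d/2)) + f y
     = (d/2) * (d/2) * partial j (partial i f) w1"
      using double_difference[OF S(2) d(2,1) ij False y] by blast
    obtain w2 where w2: "w2 \<in> cube n y d" "f (y(j := y j + d/2, i := y i + d/2)) - f (y(j := y j + d/2)) - f (y(i := y i + d/2)) + f y
     = (d/2) * (d/2) * partial i (partial j f) w2"
      using double_difference[OF S(2) d(2,1) ij(2,1) _ y] False by blast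
    have "(d/2) * (d/2) * partial j (partial i f) w1 = (d/2) * (d/2) * partial i (partial j f) w2"
      using w1(2) w2(2) unfolding fun_upd_twist[OF False, of y "y i + d/2" "y j + d/2"] by linarith
    then have "partial j (partial i f) w1 = partial i (partial j f) w2" using d(1) by simp
    moreover have "\<bar>partial i (partial j f) w2 - partial i (partial j f) y\<bar> < e" using d1(3) d(3) w2(1) by blast
    moreover have "\<bar>partial j (partial i f) w1 - partial j (partial i f) y\<bar> < e" using d2(3) d(4) w1(1) by blast
    moreover have "\<not> (\<bar>x - a\<bar> < \<bar>a - b\<bar> / 2 \<and> \<bar>x - b\<bar> < \<bar>a - b\<bar> / 2)" for x a b :: real
      by (auto simp: abs_if)
    ultimately show False unfolding e_def by metis
  qed
qed simp

\<comment> \<open>charts are pairs: quantifiers over charts are kept as quantifiers over one variable\<close>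
declare split_paired_All [simp del] split_paired_Ex [simp del]

section \<open>Topology through neighbourhood filters\<close>

lemma openin_eventuallyI:
  assumes "\<And>x. x \<in> S \<Longrightarrow> x \<in> topspace X" "\<And>x. x \<in> S \<Longrightarrow> eventually (\<lambda>y. y \<in> S) (nhdsin X x)"
  shows "openin X S"
proof (subst openin_subopen, intro ballI)
  fix x assume x: "x \<in> S"
  have "\<exists>T. openin X T \<and> x \<in> T \<and> (\<forall>y\<in>T. y \<in> S)"
    using assms(2)[OF x] assms(1)[OF x] by (simp add: eventually_nhdsin)
  then show "\<exists>T. openin X T \<and> x \<in> T \<and> T \<subseteq> S" by (simp only: subset_eq)
qed

lemma continuous_map_eventually:
  assumes "continuous_map X Y f" "x \<in> topspace X" "eventually P (nhdsin Y (f x))"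
  shows "eventually (\<lambda>x. P (f x)) (nhdsin X x)"
proof -
  have "f x \<in> topspace Y" using funcset_mem[OF continuous_map_funspace[OF assms(1)] assms(2)] .
  then obtain T where T: "openin Y T" "f x \<in> T" "\<forall>y\<in>T. P y" using assms(3) by (auto simp: eventually_nhdsin)
  have "openin X {x \<in> topspace X. f x \<in> T}" using assms(1) T(1) by (rule openin_continuous_map_preimage)
  then show ?thesis using assms(2) T unfolding eventually_nhdsin by blast
qed

lemma eventually_nhdsin_subtopology:
  assumes "eventually P (nhdsin X x)" "x \<in> topspace X"
  shows "eventually P (nhdsin (subtopology X S) x)"
proof (cases "x \<in> S")
  case True
  obtain T where T: "openin X T" "x \<in> T" "\<forall>y\<in>T. P y" using assms unfolding eventually_nhdsin by blast
  then have "openin (subtopology X S) (T \<inter> S)" by (simp add: openin_subtopology_Int)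
  then show ?thesis unfolding eventually_nhdsin using T True by blast
qed (simp add: eventually_nhdsin)

text \<open>
  Continuity is expressed by neighbourhood filters. A map that is continuous at each point of \<open>U\<close>, whose image
  contains a neighbourhood of each of its points, and that has a left inverse \<open>k\<close> continuous along \<open>h ` U\<close>, is an open embedding. Charts arise below
  from germs of smooth maps, which provide exactly this information.
\<close>

lemma chart_onI:
  assumes U: "openin X U"
    and hE: "\<And>x. x \<in> U \<Longrightarrow> h x \<in> ES n" and kh: "\<And>x. x \<in> U \<Longrightarrow> k (h x) = x"
    and ch: "\<And>x P. x \<in> U \<Longrightarrow> eventually P (nhdsE n (h x)) \<Longrightarrow> eventually (\<lambda>x. P (h x)) (nhdsin X x)"
    and V: "\<And>x. x \<in> U \<Longrightarrow> eventually (\<lambda>z. z \<in> h ` U) (nhdsE n (h x))"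
    and ck: "\<And>x P. x \<in> U \<Longrightarrow> eventually P (nhdsin X x) \<Longrightarrow> eventually (\<lambda>z. P (k z)) (nhdsE n (h x))"
  shows "chart_on X n (U, h)"
proof -
  have UX: "U \<subseteq> topspace X" using U openin_subset by blast
  have oI: "openin (Euclidean_space n) (h ` W)" if "openin X W" "W \<subseteq> U" for W
  proof (rule openin_eventuallyI)
    fix y assume "y \<in> h ` W"
    then obtain x where x: "x \<in> W" "y = h x" by blast
    then have xU: "x \<in> U" using that by blast
    show "y \<in> ES n" using hE xU x by simp
    have "eventually (\<lambda>z. k z \<in> W) (nhdsE n (h x))"
      by (rule ck[OF xU]) (rule eventually_nhdsin_in[OF that(1) x(1)])
    then show "eventually (\<lambda>z. z \<in> h ` W) (nhdsE n y)"
      using V[OF xU] unfolding x(2) by eventually_elim (use kh in force)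
  qed
  have oV: "openin (Euclidean_space n) (h ` U)" using oI U by blast
  have "homeomorphic_map (subtopology X U) (subtopology (Euclidean_space n) (h ` U)) h"
  proof (rule bijective_open_imp_homeomorphic_map)
    show "continuous_map (subtopology X U) (subtopology (Euclidean_space n) (h ` U)) h"
      unfolding continuous_map_in_subtopology
    proof (intro conjI)
      show "continuous_map (subtopology X U) (Euclidean_space n) h"
        unfolding continuous_map_def
      proof (intro conjI allI impI)
        show "h \<in> topspace (subtopology X U) \<rightarrow> ES n" using hE by auto
        fix T assume T: "openin (Euclidean_space n) T"
        have "openin X {x \<in> U. h x \<in> T}"
        proof (rule openin_eventuallyI)
          fix x assume x: "x \<in> {x \<in> U. h x \<in> T}"
          then show "x \<in> topspace X" using UX by blast
          have "eventually (\<lambda>x. h x \<in> T) (nhdsin X x)"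
            by (rule ch) (use x T in \<open>auto intro: eventually_nhdsin_in\<close>)
          moreover have "eventually (\<lambda>x. x \<in> U) (nhdsin X x)" using U x by (auto intro: eventually_nhdsin_in)
          ultimately show "eventually (\<lambda>y. y \<in> {x \<in> U. h x \<in> T}) (nhdsin X x)" by eventually_elim auto
        qed
        moreover have "{x \<in> topspace (subtopology X U). h x \<in> T} = {x \<in> U. h x \<in> T}" using UX by auto
        ultimately show "openin (subtopology X U) {x \<in> topspace (subtopology X U). h x \<in> T}"
          using U by (simp add: openin_open_subtopology)
      qed
    qed (use UX in auto)
    show "open_map (subtopology X U) (subtopology (Euclidean_space n) (h ` U)) h"
      unfolding open_map_def using U oV oI by (auto simp: openin_open_subtopology)
    show "h ` topspace (subtopology X U) = topspace (subtopology (Euclidean_space n) (h ` U))"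
      using UX hE by auto
    show "inj_on h (topspace (subtopology X U))" using kh by (auto intro: inj_on_inverseI)
  qed
  then show ?thesis using U oV by (simp add: chart_on_def)
qed

section \<open>Charts and their inverses\<close>

lemma chart_props:
  assumes "chart_on X n c"
  shows chart_inj: "inj_on (snd c) (fst c)" and chart_dom_open: "openin X (fst c)"
    and chart_im_open: "openin (Euclidean_space n) (snd c ` fst c)"
    and chart_dom_sub: "fst c \<subseteq> topspace X"
    and chart_ES: "x \<in> fst c \<Longrightarrow> snd c x \<in> ES n"
    and chart_inv_left: "x \<in> fst c \<Longrightarrow> chart_inv c (snd c x) = x"
proof -
  note * = assms[unfolded chart_on_def]
  show 1: "openin X (fst c)" and 2: "openin (Euclidean_space n) (snd c ` fst c)" using * by auto
  show 3: "fst c \<subseteq> topspace X" using openin_subset[OF 1] .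
  show 4: "inj_on (snd c) (fst c)" using * 3 by (auto simp: homeomorphic_map_def inf_absorb2)
  show "x \<in> fst c \<Longrightarrow> snd c x \<in> ES n" using openin_ES_subset[OF 2] by blast
  show "x \<in> fst c \<Longrightarrow> chart_inv c (snd c x) = x" unfolding chart_inv_def using inv_into_f_f[OF 4] .
qed

lemma chart_eventually1:
  assumes c: "chart_on X n c" and x: "x \<in> fst c" and P: "eventually P (nhdsE n (snd c x))"
  shows "eventually (\<lambda>x'. P (snd c x')) (nhdsin X x)"
proof -
  note * = c[unfolded chart_on_def]
  obtain T where T: "openin (Euclidean_space n) T" "snd c x \<in> T" "\<forall>y\<in>T. P y"
    using P chart_ES[OF c x] by (auto simp: eventually_nhdsin)
  have cm: "continuous_map (subtopology X (fst c)) (subtopology (Euclidean_space n) (snd c ` fst c)) (snd c)"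
    using * homeomorphic_imp_continuous_map by blast
  have "openin (subtopology X (fst c)) {x \<in> topspace (subtopology X (fst c)). snd c x \<in> T \<inter> snd c ` fst c}"
    by (rule openin_continuous_map_preimage[OF cm]) (use T(1) in \<open>simp add: openin_subtopology_Int\<close>)
  then have "openin X {x \<in> topspace (subtopology X (fst c)). snd c x \<in> T \<inter> snd c ` fst c}"
    using * by (simp add: openin_open_subtopology)
  moreover have "x \<in> {x \<in> topspace (subtopology X (fst c)). snd c x \<in> T \<inter> snd c ` fst c}"
    using x T chart_dom_sub[OF c] by auto
  ultimately show ?thesis using T(3) unfolding eventually_nhdsin by blast
qed

lemma chart_eventually2:
  assumes c: "chart_on X n c" and x: "x \<in> fst c" and P: "eventually P (nhdsin X x)"
  shows "eventually (\<lambda>y. P (chart_inv c y)) (nhdsE n (snd c x))"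
proof -
  note * = c[unfolded chart_on_def]
  obtain T where T: "openin X T" "x \<in> T" "\<forall>y\<in>T. P y"
    using P x chart_dom_sub[OF c] by (auto simp: eventually_nhdsin)
  have om: "open_map (subtopology X (fst c)) (subtopology (Euclidean_space n) (snd c ` fst c)) (snd c)"
    using * homeomorphic_imp_open_map by blast
  have "openin (subtopology X (fst c)) (T \<inter> fst c)" using T(1) by (simp add: openin_subtopology_Int)
  then have "openin (subtopology (Euclidean_space n) (snd c ` fst c)) (snd c ` (T \<inter> fst c))"
    using om unfolding open_map_def by blast
  then have "openin (Euclidean_space n) (snd c ` (T \<inter> fst c))" using * by (simp add: openin_open_subtopology)
  moreover have "snd c x \<in> snd c ` (T \<inter> fst c)" using T x by blast
  moreover have "P (chart_inv c y)" if "y \<in> snd c ` (T \<inter> fst c)" for y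
    using that T(3) chart_inv_left[OF c] by auto
  ultimately show ?thesis unfolding eventually_nhdsin by blast
qed

lemma chart_eventually_dom:
  assumes c: "chart_on X n c" and x: "x \<in> fst c"
  shows "eventually (\<lambda>y. y \<in> snd c ` fst c \<and> chart_inv c y \<in> fst c \<and> snd c (chart_inv c y) = y) (nhdsE n (snd c x))"
proof -
  have "eventually (\<lambda>y. y \<in> snd c ` fst c) (nhdsE n (snd c x))"
    by (rule eventually_nhdsin_in[OF chart_im_open[OF c]]) (use x in simp)
  then show ?thesis by eventually_elim (auto simp: chart_inv_left[OF c])
qed

section \<open>Manifolds and smooth germs of maps\<close>

text \<open>
  An atlas of compatible charts, possibly of the empty set, so that it passes to any open or embedded subset.
\<close>

definition mfd :: "'a manifold \<Rightarrow> bool" where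
  "mfd M \<longleftrightarrow> (\<forall>c\<in>atlas M. chart_on (mtop M) (mdim M) c) \<and> (\<Union>c\<in>atlas M. fst c) = points M \<and>
     (\<forall>c\<in>atlas M. \<forall>d\<in>atlas M. \<forall>j<mdim M.
        smooth_on (mdim M) (snd c ` (fst c \<inter> fst d)) (\<lambda>y. chart_rep c d id y j))"

lemma smooth_atlas_mfd: "smooth_atlas M \<Longrightarrow> mfd M"
  by (simp add: smooth_atlas_def mfd_def)

abbreviation near :: "'a manifold \<Rightarrow> 'a \<Rightarrow> 'a filter" where
  "near M x \<equiv> nhdsin (mtop M) x"

lemma mfd_chart: "mfd M \<Longrightarrow> c \<in> charts_at M x \<Longrightarrow> chart_on (mtop M) (mdim M) c"
  by (simp add: mfd_def charts_at_def)

lemma mfd_chart_exists: "mfd M \<Longrightarrow> x \<in> points M \<Longrightarrow> \<exists>c. c \<in> charts_at M x"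
  unfolding mfd_def charts_at_def by blast

lemma charts_at_points: "mfd M \<Longrightarrow> c \<in> charts_at M x \<Longrightarrow> x \<in> points M"
  unfolding mfd_def charts_at_def by blast

lemma some_chart_in: "mfd M \<Longrightarrow> x \<in> points M \<Longrightarrow> some_chart M x \<in> charts_at M x"
  unfolding some_chart_def by (rule someI_ex) (rule mfd_chart_exists)

lemma charts_at_in: "c \<in> charts_at M x \<Longrightarrow> x \<in> fst c" "c \<in> charts_at M x \<Longrightarrow> c \<in> atlas M"
  by (auto simp: charts_at_def)

lemma near_self: "x \<in> points M \<Longrightarrow> eventually P (near M x) \<Longrightarrow> P x"
  unfolding points_def by (rule eventually_nhdsin_self)

text \<open>
  The representative of \<open>f\<close> in one pair of charts is smooth near \<open>x\<close>. By compatibility of the charts the pair is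
  immaterial (\<open>smooth_at_rep\<close>). Continuity at \<open>x\<close> appears as the condition that \<open>f\<close> maps a neighbourhood
  into the domain of the second chart.
\<close>

definition smooth_rep :: "'a manifold \<Rightarrow> 'b manifold \<Rightarrow> ('a \<Rightarrow> 'b) \<Rightarrow> 'a \<Rightarrow> 'a chart \<Rightarrow> 'b chart \<Rightarrow> bool" where
  "smooth_rep M N f x c d \<longleftrightarrow> c \<in> charts_at M x \<and> d \<in> charts_at N (f x) \<and>
     eventually (\<lambda>x'. f x' \<in> fst d) (near M x) \<and>
     vgerm (mdim M) (mdim N) (snd c x) (chart_rep c d f)"

lemma smooth_rep_charts:
  assumes "mfd M" "smooth_rep M N f x c d"
  shows "chart_on (mtop M) (mdim M) c" "x \<in> fst c"
    "mfd N \<Longrightarrow> chart_on (mtop N) (mdim N) d" "f x \<in> fst d" "d \<in> charts_at N (f x)"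
  using assms mfd_chart[of M c x] mfd_chart[of N d "f x"] unfolding smooth_rep_def charts_at_def by blast+

definition smooth_at :: "'a manifold \<Rightarrow> 'b manifold \<Rightarrow> ('a \<Rightarrow> 'b) \<Rightarrow> 'a \<Rightarrow> bool" where
  "smooth_at M N f x \<longleftrightarrow> (\<exists>c d. smooth_rep M N f x c d)"

lemma smooth_atI: "smooth_rep M N f x c d \<Longrightarrow> smooth_at M N f x"
  unfolding smooth_at_def by (intro exI)

lemma smooth_atE: assumes "smooth_at M N f x" obtains c d where "smooth_rep M N f x c d"
  using assms unfolding smooth_at_def by (elim exE)

lemma smooth_rep_tendsto:
  assumes M: "mfd M" and N: "mfd N" and f: "smooth_rep M N f x c d" and P: "eventually P (near N (f x))"
  shows "eventually (\<lambda>x'. P (f x')) (near M x)"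
proof -
  note c = smooth_rep_charts(1,2)[OF M f] and d = smooth_rep_charts(3)[OF M f N] smooth_rep_charts(4)[OF M f]
  have v: "vgerm (mdim M) (mdim N) (snd c x) (chart_rep c d f)" and fd: "eventually (\<lambda>x'. f x' \<in> fst d) (near M x)"
    using f by (auto simp: smooth_rep_def)
  have r: "chart_rep c d f (snd c x) = snd d (f x)" by (simp add: chart_rep_def chart_inv_left[OF c])
  have "eventually (\<lambda>y. P (chart_inv d y)) (nhdsE (mdim N) (chart_rep c d f (snd c x)))"
    unfolding r by (rule chart_eventually2[OF d P])
  then have "eventually (\<lambda>y. P (chart_inv d (chart_rep c d f y))) (nhdsE (mdim M) (snd c x))"
    by (rule vgerm_tendsto[OF v])
  then have "eventually (\<lambda>x'. P (chart_inv d (chart_rep c d f (snd c x')))) (near M x)"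
    by (rule chart_eventually1[OF c])
  moreover have "eventually (\<lambda>x'. x' \<in> fst c) (near M x)"
    using chart_dom_open[OF c(1)] c(2) by (rule eventually_nhdsin_in)
  ultimately show ?thesis using fd
    by eventually_elim (simp add: chart_rep_def chart_inv_left[OF c(1)] chart_inv_left[OF d(1)])
qed

lemma smooth_rep_compose_eq:
  assumes M: "mfd M" and N: "mfd N"
    and f: "smooth_rep M N f x c d" and g: "smooth_rep N K g (f x) d e"
  shows "chart_rep c d f (snd c x) = snd d (f x)"
    "eventually (\<lambda>y. chart_rep d e g (chart_rep c d f y) = chart_rep c e (\<lambda>x. g (f x)) y) (nhdsE (mdim M) (snd c x))"
proof -
  note c = smooth_rep_charts(1,2)[OF M f] and d = smooth_rep_charts(3)[OF M f N] smooth_rep_charts(4)[OF M f]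
  show "chart_rep c d f (snd c x) = snd d (f x)" by (simp add: chart_rep_def chart_inv_left[OF c])
  have "eventually (\<lambda>y. f (chart_inv c y) \<in> fst d) (nhdsE (mdim M) (snd c x))"
    by (rule chart_eventually2[OF c]) (use f in \<open>simp add: smooth_rep_def\<close>)
  then show "eventually (\<lambda>y. chart_rep d e g (chart_rep c d f y) = chart_rep c e (\<lambda>x. g (f x)) y) (nhdsE (mdim M) (snd c x))"
    by eventually_elim (simp add: chart_rep_def chart_inv_left[OF d(1)])
qed

lemma smooth_rep_compose:
  assumes M: "mfd M" and N: "mfd N"
    and f: "smooth_rep M N f x c d" and g: "smooth_rep N K g (f x) d e"
  shows "smooth_rep M K (\<lambda>x. g (f x)) x c e"
proof -
  note r = smooth_rep_compose_eq[OF assms]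
  have "vgerm (mdim M) (mdim K) (snd c x) (\<lambda>y. chart_rep d e g (chart_rep c d f y))"
    by (rule vgerm_compose[of _ "mdim N"]) (use f g r(1) in \<open>auto simp: smooth_rep_def\<close>)
  then have "vgerm (mdim M) (mdim K) (snd c x) (chart_rep c e (\<lambda>x. g (f x)))"
    by (rule vgerm_cong[OF r(2)])
  moreover have "eventually (\<lambda>x. g (f x) \<in> fst e) (near M x)"
    by (rule smooth_rep_tendsto[OF M N f]) (use g in \<open>simp add: smooth_rep_def\<close>)
  ultimately show ?thesis using f g by (simp add: smooth_rep_def)
qed

lemma jacobian_rep_compose:
  assumes M: "mfd M" and N: "mfd N"
    and f: "smooth_rep M N f x c d" and g: "smooth_rep N K g (f x) d e"
  shows "jacobian (mdim M) (chart_rep c e (\<lambda>x. g (f x))) (snd c x) v =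
     jacobian (mdim N) (chart_rep d e g) (snd d (f x)) (jacobian (mdim M) (chart_rep c d f) (snd c x) v)"
proof -
  note r = smooth_rep_compose_eq[OF assms]
  have F: "vgerm (mdim M) (mdim N) (snd c x) (chart_rep c d f)"
    and G: "vgerm (mdim N) (mdim K) (chart_rep c d f (snd c x)) (chart_rep d e g)"
    using f g r(1) by (auto simp: smooth_rep_def)
  show ?thesis using jacobian_compose[OF F G, of v] jacobian_cong[OF r(2) vgerm_ES(1)[OF F]] r(1) by simp
qed

lemma smooth_rep_id:
  assumes M: "mfd M" and "c \<in> charts_at M x" "d \<in> charts_at M x"
  shows "smooth_rep M M (\<lambda>x. x) x c d"
  unfolding smooth_rep_def
proof (intro conjI assms(2,3))
  have c: "chart_on (mtop M) (mdim M) c" "x \<in> fst c" and d: "chart_on (mtop M) (mdim M) d" "x \<in> fst d"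
    using mfd_chart[OF M assms(2)] mfd_chart[OF M assms(3)] charts_at_in(1)[OF assms(2)] charts_at_in(1)[OF assms(3)] by simp_all
  show evd: "\<forall>\<^sub>F x' in near M x. x' \<in> fst d" using chart_dom_open[OF d(1)] d(2) by (rule eventually_nhdsin_in)
  show "vgerm (mdim M) (mdim M) (snd c x) (chart_rep c d (\<lambda>x. x))"
    unfolding vgerm_def
  proof (intro conjI allI impI)
    show "snd c x \<in> ES (mdim M)" by (rule chart_ES[OF c])
    show "\<forall>\<^sub>F z in nhdsE (mdim M) (snd c x). chart_rep c d (\<lambda>x. x) z \<in> ES (mdim M)"
      using chart_eventually2[OF c evd] by eventually_elim (simp add: chart_rep_def chart_ES[OF d(1)])
    fix j assume "j < mdim M"
    then have "smooth_on (mdim M) (snd c ` (fst c \<inter> fst d)) (\<lambda>y. chart_rep c d id y j)"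
      using assms by (auto simp: mfd_def charts_at_def)
    then have "smooth_germ (mdim M) (snd c x) (\<lambda>y. chart_rep c d id y j)"
      by (rule smooth_on_germ) (use c(2) d(2) in blast)
    then show "smooth_germ (mdim M) (snd c x) (\<lambda>z. chart_rep c d (\<lambda>x. x) z j)" by (simp add: id_def)
  qed
qed

lemma smooth_at_rep:
  assumes M: "mfd M" and N: "mfd N" and f: "smooth_at M N f x"
    and c: "c \<in> charts_at M x" and d: "d \<in> charts_at N (f x)"
  shows "smooth_rep M N f x c d"
proof -
  obtain c0 d0 where 0: "smooth_rep M N f x c0 d0" using f by (rule smooth_atE)
  then have c0: "c0 \<in> charts_at M x" "d0 \<in> charts_at N (f x)" by (auto simp: smooth_rep_def)
  show ?thesis
    using smooth_rep_compose[OF M N smooth_rep_compose[OF M M smooth_rep_id[OF M c c0(1)] 0] smooth_rep_id[OF N c0(2) d]] .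
qed

lemma smooth_at_points:
  assumes "mfd M" "mfd N" "smooth_at M N f x" shows "x \<in> points M" "f x \<in> points N"
proof -
  obtain c d where "smooth_rep M N f x c d" using assms(3) by (rule smooth_atE)
  then show "x \<in> points M" "f x \<in> points N"
    using charts_at_points[OF assms(1), of c x] charts_at_points[OF assms(2), of d "f x"] by (simp_all add: smooth_rep_def)
qed

lemma smooth_at_tendsto:
  "mfd M \<Longrightarrow> mfd N \<Longrightarrow> smooth_at M N f x \<Longrightarrow> eventually P (near N (f x)) \<Longrightarrow> eventually (\<lambda>x'. P (f x')) (near M x)"
  by (erule smooth_atE) (rule smooth_rep_tendsto)

lemma smooth_at_compose:
  assumes "mfd M" "mfd N" "mfd K" "smooth_at M N f x" "smooth_at N K g (f x)"
  shows "smooth_at M K (\<lambda>x. g (f x)) x"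
proof -
  obtain c d where f: "smooth_rep M N f x c d" using assms(4) by (rule smooth_atE)
  obtain d' e where g: "smooth_rep N K g (f x) d' e" using assms(5) by (rule smooth_atE)
  have "smooth_rep N K g (f x) d e"
    using smooth_at_rep[OF assms(2,3,5) smooth_rep_charts(5)[OF assms(1) f] smooth_rep_charts(5)[OF assms(2) g]] .
  from smooth_atI[OF smooth_rep_compose[OF assms(1,2) f this]] show ?thesis .
qed

lemma jacobian_rep_cong:
  assumes M: "mfd M" and f: "smooth_rep M N f x c d" and eq: "eventually (\<lambda>x. f x = g x) (near M x)"
  shows "jacobian (mdim M) (chart_rep c d f) (snd c x) = jacobian (mdim M) (chart_rep c d g) (snd c x)"
proof -
  note c = smooth_rep_charts(1,2)[OF M f]
  have ev: "eventually (\<lambda>y. chart_rep c d f y = chart_rep c d g y) (nhdsE (mdim M) (snd c x))"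
    using chart_eventually2[OF c eq] by eventually_elim (simp add: chart_rep_def)
  show "jacobian (mdim M) (chart_rep c d f) (snd c x) = jacobian (mdim M) (chart_rep c d g) (snd c x)"
    by (rule jacobian_cong[OF ev chart_ES[OF c]])
qed

lemma smooth_at_id: "mfd M \<Longrightarrow> x \<in> points M \<Longrightarrow> smooth_at M M (\<lambda>x. x) x"
  using mfd_chart_exists smooth_rep_id smooth_atI by metis

lemma smooth_at_const:
  assumes M: "mfd M" and N: "mfd N" and "x \<in> points M" "y \<in> points N"
  shows "smooth_at M N (\<lambda>_. y) x"
proof -
  obtain c where c: "c \<in> charts_at M x" using mfd_chart_exists[OF M assms(3)] by (elim exE)
  obtain d where d: "d \<in> charts_at N y" using mfd_chart_exists[OF N assms(4)] by (elim exE)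
  have cE: "snd c x \<in> ES (mdim M)" using chart_ES[OF mfd_chart[OF M c]] charts_at_in[OF c] by blast
  have dE: "snd d y \<in> ES (mdim N)" using chart_ES[OF mfd_chart[OF N d]] charts_at_in[OF d] by blast
  have "smooth_rep M N (\<lambda>_. y) x c d"
    using c d charts_at_in(1)[OF d] cE dE by (simp add: smooth_rep_def vgerm_def chart_rep_def smooth_germ_const)
  then show ?thesis by (rule smooth_atI)
qed

lemma smooth_at_eventually:
  assumes M: "mfd M" and N: "mfd N" and f: "smooth_at M N f x"
  shows "eventually (\<lambda>x. smooth_at M N f x) (near M x)"
proof -
  obtain c d where r: "smooth_rep M N f x c d" using f by (rule smooth_atE)
  note c = smooth_rep_charts(1,2)[OF M r]
  have cx: "c \<in> atlas M"
    and v: "vgerm (mdim M) (mdim N) (snd c x) (chart_rep c d f)"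
    and e: "eventually (\<lambda>x'. f x' \<in> fst d) (near M x)" and d: "d \<in> atlas N"
    using r by (simp_all add: smooth_rep_def charts_at_def)
  have "eventually (\<lambda>x'. vgerm (mdim M) (mdim N) (snd c x') (chart_rep c d f)) (near M x)"
    by (rule chart_eventually1[OF c vgerm_eventually[OF v]])
  moreover have "eventually (\<lambda>x'. x' \<in> fst c) (near M x)"
    using chart_dom_open[OF c(1)] c(2) by (rule eventually_nhdsin_in)
  moreover have "eventually (\<lambda>x. eventually (\<lambda>x'. f x' \<in> fst d) (near M x)) (near M x)"
    by (rule eventually_nhdsin_eventually[OF e])
  ultimately show ?thesis using e
    by eventually_elim (rule smooth_atI[of _ _ _ _ c d], simp add: cx d smooth_rep_def charts_at_def)
qed

text \<open>
  Continuity keeps the values near \<open>x\<close> in the domain of a chart around \<open>f x\<close>.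
\<close>

lemma smooth_map_at:
  assumes M: "mfd M" and N: "mfd N" and f: "smooth_map M N f" and x: "x \<in> points M"
  shows "smooth_at M N f x"
proof -
  have cont: "continuous_map (mtop M) (mtop N) f" using f by (simp add: smooth_map_def)
  have fx: "f x \<in> points N" using funcset_mem[OF continuous_map_funspace[OF cont]] x by (simp add: points_def)
  obtain c where cx: "c \<in> charts_at M x" using mfd_chart_exists[OF M x] by (elim exE)
  obtain d where dx: "d \<in> charts_at N (f x)" using mfd_chart_exists[OF N fx] by (elim exE)
  have c: "chart_on (mtop M) (mdim M) c" "x \<in> fst c" using mfd_chart[OF M cx] charts_at_in[OF cx] by auto
  have d: "chart_on (mtop N) (mdim N) d" "f x \<in> fst d" using mfd_chart[OF N dx] charts_at_in[OF dx] by auto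
  have e: "eventually (\<lambda>x'. f x' \<in> fst d) (near M x)"
    by (rule continuous_map_eventually[OF cont]) (use x d chart_dom_open[OF d(1)] in \<open>auto simp: points_def intro: eventually_nhdsin_in\<close>)
  have "vgerm (mdim M) (mdim N) (snd c x) (chart_rep c d f)"
    unfolding vgerm_def
  proof (intro conjI allI impI)
    show "snd c x \<in> ES (mdim M)" by (rule chart_ES[OF c])
    show "\<forall>\<^sub>F z in nhdsE (mdim M) (snd c x). chart_rep c d f z \<in> ES (mdim N)"
      using chart_eventually2[OF c e] by eventually_elim (simp add: chart_rep_def chart_ES[OF d(1)])
    fix j assume "j < mdim N"
    then have "smooth_on (mdim M) (snd c ` (fst c \<inter> f -` fst d)) (\<lambda>y. chart_rep c d f y j)"
      using f cx dx by (auto simp: smooth_map_def charts_at_def)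
    then show "smooth_germ (mdim M) (snd c x) (\<lambda>z. chart_rep c d f z j)"
      by (rule smooth_on_germ) (use c(2) d(2) in blast)
  qed
  then show ?thesis using cx dx e by (intro smooth_atI[of _ _ _ _ c d]) (simp add: smooth_rep_def)
qed

section \<open>Tangent vectors\<close>

lemma jacobian_add: "jacobian n F y (\<lambda>i. v i + w i) = (\<lambda>j. jacobian n F y v j + jacobian n F y w j)"
  by (simp add: jacobian_def distrib_right sum.distrib)

lemma jacobian_scale: "jacobian n F y (\<lambda>i. a * v i) = (\<lambda>j. a * jacobian n F y v j)"
  by (simp add: jacobian_def sum_distrib_left mult.assoc)

lemma jacobian_zero: "jacobian n F y (\<lambda>i. 0) = (\<lambda>j. 0)"
  by (simp add: jacobian_def)

lemma tangent_spaceI: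
  assumes "\<And>c. c \<notin> charts_at M x \<Longrightarrow> v c = (\<lambda>_. 0)" "\<And>c. c \<in> charts_at M x \<Longrightarrow> v c \<in> ES (mdim M)"
    "\<And>c d. c \<in> charts_at M x \<Longrightarrow> d \<in> charts_at M x \<Longrightarrow>
       v d = jacobian (mdim M) (chart_rep c d (\<lambda>x. x)) (snd c x) (v c)"
  shows "v \<in> tangent_space M x"
  unfolding tangent_space_def id_def using assms by blast

lemma tangent_spaceD:
  assumes "v \<in> tangent_space M x"
  shows tangent_off: "c \<notin> charts_at M x \<Longrightarrow> v c = (\<lambda>_. 0)" and tangent_ES: "c \<in> charts_at M x \<Longrightarrow> v c \<in> ES (mdim M)"
    and tangent_change: "c \<in> charts_at M x \<Longrightarrow> d \<in> charts_at M x \<Longrightarrow>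
       v d = jacobian (mdim M) (chart_rep c d (\<lambda>x. x)) (snd c x) (v c)"
  using assms unfolding tangent_space_def id_def by blast+

lemma tangent_zero: "tzero \<in> tangent_space M x"
  by (rule tangent_spaceI) (simp_all add: tzero_def jacobian_zero ES_iff)

lemma tangent_add:
  assumes "v \<in> tangent_space M x" "w \<in> tangent_space M x" shows "tadd v w \<in> tangent_space M x"
proof (rule tangent_spaceI)
  show "tadd v w c = (\<lambda>_. 0)" if "c \<notin> charts_at M x" for c
    using tangent_off[OF assms(1) that] tangent_off[OF assms(2) that] by (simp add: tadd_def)
  show "tadd v w c \<in> ES (mdim M)" if "c \<in> charts_at M x" for c
    using tangent_ES[OF assms(1) that] tangent_ES[OF assms(2) that] by (simp add: tadd_def ES_iff)
  show "tadd v w d = jacobian (mdim M) (chart_rep c d (\<lambda>x. x)) (snd c x) (tadd v w c)"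
    if "c \<in> charts_at M x" "d \<in> charts_at M x" for c d
    unfolding tadd_def jacobian_add using tangent_change[OF assms(1) that] tangent_change[OF assms(2) that] by simp
qed

lemma tangent_scale:
  assumes "v \<in> tangent_space M x" shows "tscale a v \<in> tangent_space M x"
proof (rule tangent_spaceI)
  show "tscale a v c = (\<lambda>_. 0)" if "c \<notin> charts_at M x" for c
    using tangent_off[OF assms(1) that] by (simp add: tscale_def)
  show "tscale a v c \<in> ES (mdim M)" if "c \<in> charts_at M x" for c
    using tangent_ES[OF assms(1) that] by (simp add: tscale_def ES_iff)
  show "tscale a v d = jacobian (mdim M) (chart_rep c d (\<lambda>x. x)) (snd c x) (tscale a v c)"
    if "c \<in> charts_at M x" "d \<in> charts_at M x" for c d
    unfolding tscale_def jacobian_scale using tangent_change[OF assms(1) that] by simp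
qed

lemma tangent_eqI:
  assumes "v \<in> tangent_space M x" "w \<in> tangent_space M x" "c \<in> charts_at M x" "v c = w c"
  shows "v = w"
proof
  fix d show "v d = w d"
  proof (cases "d \<in> charts_at M x")
    case True
    show ?thesis using tangent_change[OF assms(1,3) True] tangent_change[OF assms(2,3) True] assms(4) by simp
  next
    case False
    show ?thesis using tangent_off[OF assms(1) False] tangent_off[OF assms(2) False] by simp
  qed
qed

definition lift_vec :: "'a manifold \<Rightarrow> 'a chart \<Rightarrow> 'a \<Rightarrow> (nat \<Rightarrow> real) \<Rightarrow> 'a tvec" where
  "lift_vec M c x u = (\<lambda>d. if d \<in> charts_at M x
     then jacobian (mdim M) (chart_rep c d id) (snd c x) u else (\<lambda>_. 0))"

lemma lift_vec:
  assumes M: "mfd M" and c: "c \<in> charts_at M x" and u: "u \<in> ES (mdim M)"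
  shows "lift_vec M c x u \<in> tangent_space M x" "lift_vec M c x u c = u"
proof -
  have rep: "smooth_rep M M (\<lambda>x. x) x d e" if "d \<in> charts_at M x" "e \<in> charts_at M x" for d e
    by (rule smooth_rep_id[OF M that])
  have c1: "chart_on (mtop M) (mdim M) c" "x \<in> fst c" using mfd_chart[OF M c] charts_at_in[OF c] by auto
  show "lift_vec M c x u \<in> tangent_space M x"
  proof (rule tangent_spaceI)
    show "lift_vec M c x u d = (\<lambda>_. 0)" if "d \<notin> charts_at M x" for d using that by (simp add: lift_vec_def)
    show "lift_vec M c x u d \<in> ES (mdim M)" if "d \<in> charts_at M x" for d
      using that jacobian_ES[of "mdim M" "mdim M"] rep[OF c that] by (simp add: lift_vec_def smooth_rep_def id_def)
    show "lift_vec M c x u e = jacobian (mdim M) (chart_rep d e (\<lambda>x. x)) (snd d x) (lift_vec M c x u d)"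
      if "d \<in> charts_at M x" "e \<in> charts_at M x" for d e
      using jacobian_rep_compose[OF M M rep[OF c that(1)] rep[OF that]] that by (simp add: lift_vec_def id_def)
  qed
  have "eventually (\<lambda>y. chart_rep c c id y = y) (nhdsE (mdim M) (snd c x))"
    using chart_eventually_dom[OF c1] by eventually_elim (simp add: chart_rep_def)
  then show "lift_vec M c x u c = u"
    using jacobian_cong[of "chart_rep c c id" "\<lambda>y. y"] chart_ES[OF c1] jacobian_id u c by (simp add: lift_vec_def)
qed

lemma coord_vec_lift: "coord_vec M c i x = lift_vec M c x (\<lambda>j. if j = i then 1 else 0)"
  by (simp add: coord_vec_def lift_vec_def)

lemma coord_vec:
  assumes "mfd M" "c \<in> charts_at M x" "i < mdim M"
  shows "coord_vec M c i x \<in> tangent_space M x" "coord_vec M c i x c = (\<lambda>j. if j = i then 1 else 0)"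
  using lift_vec[OF assms(1,2), of "\<lambda>j. if j = i then 1 else 0"] assms(3) by (auto simp: coord_vec_lift ES_iff)

text \<open>
  The chain rule removes the choice of \<open>some_chart\<close> from the definition of the differential.
\<close>

lemma tmap_chart:
  assumes M: "mfd M" and N: "mfd N" and f: "smooth_at M N f x" and v: "v \<in> tangent_space M x"
    and c: "c \<in> charts_at M x" and d: "d \<in> charts_at N (f x)"
  shows "tmap M N f x v d = jacobian (mdim M) (chart_rep c d f) (snd c x) (v c)"
proof -
  define c0 where "c0 = some_chart M x"
  have c0: "c0 \<in> charts_at M x" using some_chart_in[OF M charts_at_points[OF M c]] by (simp add: c0_def)
  have "v c = jacobian (mdim M) (chart_rep c0 c (\<lambda>x. x)) (snd c0 x) (v c0)"
    by (rule tangent_change[OF v c0 c])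
  then have "jacobian (mdim M) (chart_rep c d f) (snd c x) (v c) =
     jacobian (mdim M) (chart_rep c0 d f) (snd c0 x) (v c0)"
    using jacobian_rep_compose[OF M M smooth_rep_id[OF M c0 c] smooth_at_rep[OF M N f c d]] by simp
  then show ?thesis using d by (simp add: tmap_def c0_def Let_def)
qed

lemma tmap_in:
  assumes M: "mfd M" and N: "mfd N" and f: "smooth_at M N f x" and v: "v \<in> tangent_space M x"
  shows "tmap M N f x v \<in> tangent_space N (f x)"
proof (rule tangent_spaceI)
  obtain c where c: "c \<in> charts_at M x" using mfd_chart_exists[OF M] smooth_at_points[OF M N f] by blast
  show "tmap M N f x v d = (\<lambda>_. 0)" if "d \<notin> charts_at N (f x)" for d using that by (simp add: tmap_def)
  show "tmap M N f x v d \<in> ES (mdim N)" if "d \<in> charts_at N (f x)" for d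
    unfolding tmap_chart[OF M N f v c that]
    by (rule jacobian_ES) (use smooth_at_rep[OF M N f c that] in \<open>simp add: smooth_rep_def\<close>)
  fix d e assume d: "d \<in> charts_at N (f x)" and e: "e \<in> charts_at N (f x)"
  show "tmap M N f x v e = jacobian (mdim N) (chart_rep d e (\<lambda>x. x)) (snd d (f x)) (tmap M N f x v d)"
    using jacobian_rep_compose[OF M N smooth_at_rep[OF M N f c d] smooth_rep_id[OF N d e], of "v c"]
      tmap_chart[OF M N f v c] d e by simp
qed

lemma tmap_compose:
  assumes M: "mfd M" and N: "mfd N" and K: "mfd K" and f: "smooth_at M N f x" and g: "smooth_at N K g (f x)"
    and v: "v \<in> tangent_space M x"
  shows "tmap M K (\<lambda>x. g (f x)) x v = tmap N K g (f x) (tmap M N f x v)"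
proof -
  obtain c where c: "c \<in> charts_at M x" using mfd_chart_exists[OF M] smooth_at_points[OF M N f] by blast
  obtain d where d: "d \<in> charts_at N (f x)" using mfd_chart_exists[OF N] smooth_at_points[OF M N f] by blast
  obtain e where e: "e \<in> charts_at K (g (f x))" using mfd_chart_exists[OF K] smooth_at_points[OF N K g] by blast
  have gf: "smooth_at M K (\<lambda>x. g (f x)) x" by (rule smooth_at_compose[OF M N K f g])
  have fv: "tmap M N f x v \<in> tangent_space N (f x)" by (rule tmap_in[OF M N f v])
  show ?thesis
  proof (rule tangent_eqI[OF _ _ e])
    show "tmap M K (\<lambda>x. g (f x)) x v \<in> tangent_space K (g (f x))" using tmap_in[OF M K gf v] .
    show "tmap N K g (f x) (tmap M N f x v) \<in> tangent_space K (g (f x))" by (rule tmap_in[OF N K g fv])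
    show "tmap M K (\<lambda>x. g (f x)) x v e = tmap N K g (f x) (tmap M N f x v) e"
      using tmap_chart[OF M K gf v c e] tmap_chart[OF N K g fv d e] tmap_chart[OF M N f v c d]
        jacobian_rep_compose[OF M N smooth_at_rep[OF M N f c d] smooth_at_rep[OF N K g d e]] by simp
  qed
qed

lemma tmap_cong:
  assumes M: "mfd M" and f: "smooth_at M N f x" and N: "mfd N" and eq: "eventually (\<lambda>x. f x = g x) (near M x)"
  shows "tmap M N f x = tmap M N g x"
proof -
  have x: "x \<in> points M" using smooth_at_points[OF M N f] by blast
  have fg: "f x = g x" by (rule near_self[OF x eq])
  have s: "some_chart M x \<in> charts_at M x" by (rule some_chart_in[OF M x])
  have "jacobian (mdim M) (chart_rep (some_chart M x) d f) (snd (some_chart M x) x) =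
     jacobian (mdim M) (chart_rep (some_chart M x) d g) (snd (some_chart M x) x)" if "d \<in> charts_at N (f x)" for d
    by (rule jacobian_rep_cong[OF M smooth_at_rep[OF M N f s that] eq])
  then show ?thesis using fg by (intro ext) (simp add: tmap_def Let_def)
qed

lemma tmap_id:
  assumes M: "mfd M" and x: "x \<in> points M" and v: "v \<in> tangent_space M x"
  shows "tmap M M (\<lambda>x. x) x v = v"
proof -
  have id: "smooth_at M M (\<lambda>x. x) x" by (rule smooth_at_id[OF M x])
  have s: "some_chart M x \<in> charts_at M x" by (rule some_chart_in[OF M x])
  show ?thesis
  proof
    fix d show "tmap M M (\<lambda>x. x) x v d = v d"
      using tangent_change[OF v s, of d] tangent_off[OF v, of d]
      by (cases "d \<in> charts_at M x") (simp_all add: tmap_def Let_def)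
  qed
qed

lemma tmap_id_near:
  assumes M: "mfd M" and x: "x \<in> points M" and v: "v \<in> tangent_space M x"
    and eq: "eventually (\<lambda>x. f x = x) (near M x)"
  shows "tmap M M f x v = v"
proof -
  have "tmap M M (\<lambda>x. x) x = tmap M M f x"
    by (rule tmap_cong[OF M smooth_at_id[OF M x] M]) (use eq in \<open>auto elim: eventually_mono\<close>)
  then show ?thesis using tmap_id[OF M x v] by simp
qed

lemma tmap_const: "tmap M N (\<lambda>_. y) x v = tzero"
  by (intro ext) (simp add: tmap_def tzero_def chart_rep_def jacobian_def partial_def Let_def)

lemma tmap_add: "tmap M N f x (tadd v w) = tadd (tmap M N f x v) (tmap M N f x w)"
  by (intro ext) (simp add: tmap_def tadd_def jacobian_add Let_def)

lemma tmap_scale: "tmap M N f x (tscale a v) = tscale a (tmap M N f x v)"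
  by (intro ext) (simp add: tmap_def tscale_def jacobian_scale Let_def)

lemma tmap_zero: "tmap M N f x tzero = tzero"
  by (intro ext) (simp add: tmap_def tzero_def jacobian_zero Let_def)

lemma tadd_simps: "tadd v tzero = v" "tadd tzero v = v" "tadd (tadd u v) w = tadd u (tadd v w)"
  "tadd v (tscale (-1) v) = tzero"
  by (intro ext, simp add: tadd_def tzero_def tscale_def add.assoc)+

lemma cotangent_add: "\<alpha> \<in> cotangent_space M x \<Longrightarrow> v \<in> tangent_space M x \<Longrightarrow> w \<in> tangent_space M x \<Longrightarrow>
    \<alpha> (tadd v w) = \<alpha> v + \<alpha> w"
  unfolding cotangent_space_def by blast

lemma cotangent_scale: "\<alpha> \<in> cotangent_space M x \<Longrightarrow> v \<in> tangent_space M x \<Longrightarrow> \<alpha> (tscale a v) = a * \<alpha> v"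
  unfolding cotangent_space_def by blast

lemma cotangent_zero: "\<alpha> \<in> cotangent_space M x \<Longrightarrow> \<alpha> tzero = 0"
proof -
  assume a: "\<alpha> \<in> cotangent_space M x"
  have "tscale 0 tzero = (tzero :: 'a tvec)" by (simp add: tscale_def tzero_def)
  then show ?thesis using cotangent_scale[OF a tangent_zero, of 0] by simp
qed

text \<open>
  A vector is the sum of its components times the coordinate vectors; the sum is formed term by term inside the
  tangent space, where the covector is additive.
\<close>

lemma cotangent_expand:
  assumes M: "mfd M" and c: "c \<in> charts_at M x" and v: "v \<in> tangent_space M x" and \<alpha>: "\<alpha> \<in> cotangent_space M x"
  shows "\<alpha> v = (\<Sum>i<mdim M. v c i * \<alpha> (coord_vec M c i x))"
proof -
  define t where "t k = (\<lambda>d j. \<Sum>i<k. v c i * coord_vec M c i x d j)" for k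
  have tS: "t (Suc k) = tadd (t k) (tscale (v c k) (coord_vec M c k x))" for k
    by (simp add: t_def tadd_def tscale_def)
  have "t k \<in> tangent_space M x \<and> \<alpha> (t k) = (\<Sum>i<k. v c i * \<alpha> (coord_vec M c i x))" if "k \<le> mdim M" for k
    using that
  proof (induction k)
    case 0
    have "t 0 = tzero" by (simp add: t_def tzero_def)
    then show ?case using tangent_zero cotangent_zero[OF \<alpha>] by simp
  next
    case (Suc k)
    have cv: "coord_vec M c k x \<in> tangent_space M x" using coord_vec[OF M c] Suc.prems by simp
    have tk: "t k \<in> tangent_space M x" "\<alpha> (t k) = (\<Sum>i<k. v c i * \<alpha> (coord_vec M c i x))" using Suc by auto
    show ?case unfolding tS
      using tangent_add[OF tk(1) tangent_scale[OF cv]] cotangent_add[OF \<alpha> tk(1) tangent_scale[OF cv]]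
        cotangent_scale[OF \<alpha> cv] tk(2) by simp
  qed
  from this[of "mdim M"] have t: "t (mdim M) \<in> tangent_space M x"
    "\<alpha> (t (mdim M)) = (\<Sum>i<mdim M. v c i * \<alpha> (coord_vec M c i x))" by auto
  have "t (mdim M) c = v c"
  proof (rule ES_eqI[of _ "mdim M"])
    show "t (mdim M) c \<in> ES (mdim M)" "v c \<in> ES (mdim M)" using tangent_ES[OF t(1) c] tangent_ES[OF v c] by simp_all
    show "t (mdim M) c j = v c j" if "j < mdim M" for j
      using that coord_vec(2)[OF M c] by (simp add: t_def if_distrib[of "\<lambda>x. _ * x"] cong: if_cong)
  qed
  then have "t (mdim M) = v" by (rule tangent_eqI[OF t(1) v c])
  then show ?thesis using t(2) by simp
qed

text \<open>
  The differentials of \<open>f\<close> and \<open>g\<close> in charts are mutually inverse matrices \<open>A\<close> and \<open>B\<close>, and the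
  traces of \<open>A B\<close> and \<open>B A\<close> are the two dimensions. Equality of traces needs no rank theory.
\<close>

lemma local_inverse_dim:
  assumes M: "mfd M" and N: "mfd N" and f: "smooth_at M N f x" and g: "smooth_at N M g (f x)"
    and gf: "eventually (\<lambda>x. g (f x) = x) (near M x)" and fg: "eventually (\<lambda>y. f (g y) = y) (near N (f x))"
  shows "mdim M = mdim N"
proof -
  have px: "x \<in> points M" "f x \<in> points N" using smooth_at_points[OF M N f] by auto
  have gfx: "g (f x) = x" by (rule near_self[OF px(1) gf])
  obtain c where c: "c \<in> charts_at M x" using mfd_chart_exists[OF M px(1)] by (elim exE)
  obtain d where d: "d \<in> charts_at N (f x)" using mfd_chart_exists[OF N px(2)] by (elim exE)
  have f': "smooth_at M N f (g (f x))" using f gfx by simp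
  define A where "A i l = partial i (\<lambda>z. chart_rep c d f z l) (snd c x)" for i l
  define B where "B l i = partial l (\<lambda>z. chart_rep d c g z i) (snd d (f x))" for i l
  have 1: "(\<Sum>l<mdim N. A k l * B l k) = 1" if k: "k < mdim M" for k
  proof -
    define v where "v = coord_vec M c k x"
    have v: "v \<in> tangent_space M x" "v c = (\<lambda>j. if j = k then 1 else 0)" using coord_vec[OF M c k] by (auto simp: v_def)
    have fv: "tmap M N f x v \<in> tangent_space N (f x)" by (rule tmap_in[OF M N f v(1)])
    have "tmap N M g (f x) (tmap M N f x v) = v"
      using tmap_compose[OF M N M f g v(1)] tmap_id_near[OF M px(1) v(1) gf] by simp
    then have "jacobian (mdim N) (chart_rep d c g) (snd d (f x)) (jacobian (mdim M) (chart_rep c d f) (snd c x) (v c)) k = v c k"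
      using tmap_chart[OF N M g fv d, of c] tmap_chart[OF M N f v(1) c d] c gfx by simp
    then show ?thesis unfolding jacobian_def v(2) A_def B_def using k
      by (simp add: if_distrib[of "\<lambda>x. x * _"] cong: if_cong)
  qed
  have 2: "(\<Sum>k<mdim M. B l k * A k l) = 1" if l: "l < mdim N" for l
  proof -
    define v where "v = coord_vec N d l (f x)"
    have v: "v \<in> tangent_space N (f x)" "v d = (\<lambda>j. if j = l then 1 else 0)" using coord_vec[OF N d l] by (auto simp: v_def)
    have gv: "tmap N M g (f x) v \<in> tangent_space M (g (f x))" by (rule tmap_in[OF N M g v(1)])
    have "tmap M N f (g (f x)) (tmap N M g (f x) v) = v"
      using tmap_compose[OF N M N g f' v(1)] tmap_id_near[OF N px(2) v(1) fg] by simp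
    then have "jacobian (mdim M) (chart_rep c d f) (snd c x) (jacobian (mdim N) (chart_rep d c g) (snd d (f x)) (v d)) l = v d l"
      using tmap_chart[OF M N f' gv, of c d] tmap_chart[OF N M g v(1) d, of c] c d gfx by simp
    then show ?thesis unfolding jacobian_def v(2) A_def B_def using l
      by (simp add: if_distrib[of "\<lambda>x. x * _"] cong: if_cong)
  qed
  have "real (mdim M) = (\<Sum>k<mdim M. \<Sum>l<mdim N. A k l * B l k)" using 1 by simp
  also have "\<dots> = (\<Sum>l<mdim N. \<Sum>k<mdim M. B l k * A k l)" by (subst sum.swap) (simp add: mult.commute)
  also have "\<dots> = real (mdim N)" using 2 by simp
  finally show ?thesis by simp
qed

lemma points_near: "x \<in> points N \<Longrightarrow> eventually (\<lambda>y. y \<in> points N) (near N x)"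
  by (intro eventually_nhdsin_in) (auto simp: points_def)

section \<open>Products\<close>

text \<open>
  The inverse of \<open>join n\<close>, used for coordinates on products.
\<close>

definition take_c :: "nat \<Rightarrow> (nat \<Rightarrow> real) \<Rightarrow> nat \<Rightarrow> real" where "take_c n z = (\<lambda>i. if i < n then z i else 0)"
definition drop_c :: "nat \<Rightarrow> (nat \<Rightarrow> real) \<Rightarrow> nat \<Rightarrow> real" where "drop_c n z = (\<lambda>i. z (n + i))"

lemma join_ES: "x \<in> ES n \<Longrightarrow> y \<in> ES m \<Longrightarrow> join n x y \<in> ES (n + m)"
  by (auto simp: ES_iff join_def)
lemma take_ES: "take_c n z \<in> ES n" by (auto simp: ES_iff take_c_def)
lemma drop_ES: "z \<in> ES (n + m) \<Longrightarrow> drop_c n z \<in> ES m" by (auto simp: ES_iff drop_c_def)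
lemma join_take_drop: "join n (take_c n z) (drop_c n z) = z" by (auto simp: join_def take_c_def drop_c_def)
lemma take_join: "x \<in> ES n \<Longrightarrow> take_c n (join n x y) = x" by (rule ext) (auto simp: ES_iff join_def take_c_def)
lemma drop_join: "drop_c n (join n x y) = y" by (auto simp: join_def drop_c_def)

lemma vgerm_take: assumes "y \<in> ES (n + m)" shows "vgerm (n + m) n y (take_c n)"
  unfolding vgerm_def
proof (intro conjI allI impI assms)
  show "\<forall>\<^sub>F z in nhdsE (n + m) y. take_c n z \<in> ES n" by (simp add: take_ES)
  show "smooth_germ (n + m) y (\<lambda>z. take_c n z j)" if "j < n" for j
    using that smooth_germ_coord[OF assms, of j] by (simp add: take_c_def)
qed

lemma eventually_ES: "y \<in> ES n \<Longrightarrow> eventually (\<lambda>z. z \<in> ES n) (nhdsE n y)"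
  by (rule eventually_nhdsin_in) auto

lemma vgerm_drop: assumes "y \<in> ES (n + m)" shows "vgerm (n + m) m y (drop_c n)"
proof -
  have "eventually (\<lambda>z. drop_c n z \<in> ES m) (nhdsE (n + m) y)"
    using eventually_ES[OF assms] by eventually_elim (rule drop_ES)
  then show ?thesis unfolding vgerm_def using assms by (simp add: smooth_germ_coord drop_c_def[of n])
qed

lemma vgerm_join:
  assumes "vgerm k n y F" "vgerm k m y G"
  shows "vgerm k (n + m) y (\<lambda>z. join n (F z) (G z))"
  unfolding vgerm_def
proof (intro conjI allI impI)
  note F = assms(1)[unfolded vgerm_def] and G = assms(2)[unfolded vgerm_def]
  show "y \<in> ES k" using F by simp
  show "\<forall>\<^sub>F z in nhdsE k y. join n (F z) (G z) \<in> ES (n + m)"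
    using F[THEN conjunct2, THEN conjunct1] G[THEN conjunct2, THEN conjunct1] by eventually_elim (rule join_ES)
  show "smooth_germ k y (\<lambda>z. join n (F z) (G z) j)" if "j < n + m" for j
    using that F G by (cases "j < n") (auto simp: join_def)
qed

lemma join_eventually:
  assumes a: "a \<in> ES n" and b: "b \<in> ES m" and P: "eventually P (nhdsE (n + m) (join n a b))"
  obtains P1 P2 where "eventually P1 (nhdsE n a)" "eventually P2 (nhdsE m b)" "\<And>u v. P1 u \<Longrightarrow> P2 v \<Longrightarrow> P (join n u v)"
proof -
  have j: "join n a b \<in> ES (n + m)" by (rule join_ES[OF a b])
  obtain T where T: "openin (Euclidean_space (n + m)) T" "join n a b \<in> T" "\<forall>y\<in>T. P y"
    using P j unfolding eventually_nhdsin by blast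
  obtain e where e: "e > 0" "cube (n + m) (join n a b) e \<subseteq> T" using T(1,2) unfolding openin_ES_iff by blast
  show thesis
  proof (rule that[of "\<lambda>u. u \<in> cube n a e" "\<lambda>v. v \<in> cube m b e"])
    show "eventually (\<lambda>u. u \<in> cube n a e) (nhdsE n a)"
      by (rule eventually_nhdsin_in[OF openin_cube cube_self[OF a e(1)]])
    show "eventually (\<lambda>u. u \<in> cube m b e) (nhdsE m b)"
      by (rule eventually_nhdsin_in[OF openin_cube cube_self[OF b e(1)]])
    fix u v assume u: "u \<in> cube n a e" and v: "v \<in> cube m b e"
    have "join n u v \<in> cube (n + m) (join n a b) e"
      using u v join_ES[of u n v m] by (auto simp: cube_def join_def)
    then show "P (join n u v)" using e(2) T(3) by blast
  qed
qed

lemma eventually_nhdsinE: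
  assumes "eventually P (nhdsin X x)" "x \<in> topspace X"
  obtains S where "openin X S" "x \<in> S" "\<And>y. y \<in> S \<Longrightarrow> P y"
  using assms by (auto simp: eventually_nhdsin)

lemma eventually_prod:
  assumes P: "eventually P (nhdsin X x)" and Q: "eventually Q (nhdsin Y y)"
  shows "eventually (\<lambda>z. P (fst z) \<and> Q (snd z)) (nhdsin (prod_topology X Y) (x, y))"
proof (cases "x \<in> topspace X \<and> y \<in> topspace Y")
  case True
  obtain S where S: "openin X S" "x \<in> S" "\<And>x. x \<in> S \<Longrightarrow> P x" using eventually_nhdsinE[OF P] True by blast
  obtain T where T: "openin Y T" "y \<in> T" "\<And>x. x \<in> T \<Longrightarrow> Q x" using eventually_nhdsinE[OF Q] True by blast
  have "openin (prod_topology X Y) (S \<times> T)" using S T by (simp add: openin_prod_Times_iff)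
  then have "eventually (\<lambda>z. z \<in> S \<times> T) (nhdsin (prod_topology X Y) (x, y))"
    by (rule eventually_nhdsin_in) (simp add: S T)
  then show ?thesis by eventually_elim (use S(3) T(3) in auto)
qed (auto simp: eventually_nhdsin)

lemma eventually_prodE:
  assumes "eventually P (nhdsin (prod_topology X Y) (x, y))" "x \<in> topspace X" "y \<in> topspace Y"
  obtains P1 P2 where "eventually P1 (nhdsin X x)" "eventually P2 (nhdsin Y y)" "\<And>a b. P1 a \<Longrightarrow> P2 b \<Longrightarrow> P (a, b)"
proof -
  have "(x, y) \<in> topspace (prod_topology X Y)" using assms(2,3) by simp
  then obtain W where W: "openin (prod_topology X Y) W" "(x, y) \<in> W" "\<And>z. z \<in> W \<Longrightarrow> P z"
    using eventually_nhdsinE[OF assms(1)] by blast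
  then have "\<exists>S T. openin X S \<and> openin Y T \<and> x \<in> S \<and> y \<in> T \<and> S \<times> T \<subseteq> W"
    by (simp add: openin_prod_topology_alt)
  then obtain S T where ST: "openin X S" "openin Y T" "x \<in> S" "y \<in> T" "S \<times> T \<subseteq> W" by (elim exE conjE)
  show thesis
  proof (rule that)
    show "eventually (\<lambda>a. a \<in> S) (nhdsin X x)" by (rule eventually_nhdsin_in[OF ST(1,3)])
    show "eventually (\<lambda>b. b \<in> T) (nhdsin Y y)" by (rule eventually_nhdsin_in[OF ST(2,4)])
    show "P (a, b)" if "a \<in> S" "b \<in> T" for a b using W(3) ST(5) that by blast
  qed
qed

definition prod_chart :: "nat \<Rightarrow> 'a chart \<Rightarrow> 'b chart \<Rightarrow> ('a \<times> 'b) chart" where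
  "prod_chart n c d = (fst c \<times> fst d, \<lambda>(x, y). join n (snd c x) (snd d y))"

lemma prod_chart_simps: "fst (prod_chart n c d) = fst c \<times> fst d"
  "snd (prod_chart n c d) (x, y) = join n (snd c x) (snd d y)"
  by (simp_all add: prod_chart_def)

lemma prod_manifold_simps: "mtop (prod_manifold M N) = prod_topology (mtop M) (mtop N)"
  "mdim (prod_manifold M N) = mdim M + mdim N"
  "points (prod_manifold M N) = points M \<times> points N"
  "atlas (prod_manifold M N) = {prod_chart (mdim M) c d |c d. c \<in> atlas M \<and> d \<in> atlas N}"
  by (simp_all add: prod_manifold_def points_def prod_chart_def)

lemma chart_on_prod:
  assumes c: "chart_on X n c" and d: "chart_on Y m d"
  shows "chart_on (prod_topology X Y) (n + m) (prod_chart n c d)"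
    "x \<in> fst c \<Longrightarrow> y \<in> fst d \<Longrightarrow> eventually (\<lambda>z. chart_inv (prod_chart n c d) z = (chart_inv c (take_c n z), chart_inv d (drop_c n z)))
       (nhdsE (n + m) (join n (snd c x) (snd d y)))"
proof -
  let ?h = "\<lambda>(x, y). join n (snd c x) (snd d y)"
  let ?k = "\<lambda>z. (chart_inv c (take_c n z), chart_inv d (drop_c n z))"
  have jE: "join n (snd c x) (snd d y) \<in> ES (n + m)" if "x \<in> fst c" "y \<in> fst d" for x y
    using that chart_ES[OF c] chart_ES[OF d] join_ES by blast
  have tj: "take_c n (join n (snd c x) (snd d y)) = snd c x" if "x \<in> fst c" for x y
    using take_join chart_ES[OF c that] by blast
  have t: "eventually (\<lambda>z. P (take_c n z)) (nhdsE (n + m) (join n (snd c x) (snd d y)))"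
    if "x \<in> fst c" "y \<in> fst d" "eventually P (nhdsE n (snd c x))" for P x y
    by (rule vgerm_tendsto[OF vgerm_take[OF jE[OF that(1,2)]]]) (simp add: tj that)
  have dr: "eventually (\<lambda>z. P (drop_c n z)) (nhdsE (n + m) (join n (snd c x) (snd d y)))"
    if "x \<in> fst c" "y \<in> fst d" "eventually P (nhdsE m (snd d y))" for P x y
    by (rule vgerm_tendsto[OF vgerm_drop[OF jE[OF that(1,2)]]]) (simp add: drop_join that)
  have evV: "eventually (\<lambda>z. z \<in> ?h ` (fst c \<times> fst d)) (nhdsE (n + m) (join n (snd c x) (snd d y)))"
    if "x \<in> fst c" "y \<in> fst d" for x y
    using t[OF that chart_eventually_dom[OF c that(1)]] dr[OF that chart_eventually_dom[OF d that(2)]]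
  proof eventually_elim
    case (elim z)
    then have "z = ?h (chart_inv c (take_c n z), chart_inv d (drop_c n z))" by (simp add: join_take_drop)
    then show ?case using elim by blast
  qed
  show 1: "chart_on (prod_topology X Y) (n + m) (prod_chart n c d)"
    unfolding prod_chart_def
  proof (rule chart_onI[where k = ?k])
    show "openin (prod_topology X Y) (fst c \<times> fst d)"
      using chart_dom_open[OF c] chart_dom_open[OF d] by (simp add: openin_prod_Times_iff)
    show "?h z \<in> ES (n + m)" if "z \<in> fst c \<times> fst d" for z using that jE by auto
    show "(chart_inv c (take_c n (?h z)), chart_inv d (drop_c n (?h z))) = z" if "z \<in> fst c \<times> fst d" for z
      using that by (auto simp: tj drop_join chart_inv_left[OF c] chart_inv_left[OF d])
    show "eventually (\<lambda>z. z \<in> ?h ` (fst c \<times> fst d)) (nhdsE (n + m) (?h z))" if "z \<in> fst c \<times> fst d" for z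
      using that evV by auto
    fix z P assume z: "z \<in> fst c \<times> fst d"
    obtain x y where xy: "z = (x, y)" "x \<in> fst c" "y \<in> fst d" using z by auto
    have xyt: "x \<in> topspace X" "y \<in> topspace Y" using xy chart_dom_sub[OF c] chart_dom_sub[OF d] by auto
    {
      assume P: "eventually P (nhdsE (n + m) (?h z))"
      have "eventually P (nhdsE (n + m) (join n (snd c x) (snd d y)))" using P xy by simp
      then obtain P1 P2 where P12: "eventually P1 (nhdsE n (snd c x))" "eventually P2 (nhdsE m (snd d y))"
        "\<And>u v. P1 u \<Longrightarrow> P2 v \<Longrightarrow> P (join n u v)"
        using join_eventually[OF chart_ES[OF c xy(2)] chart_ES[OF d xy(3)]] by blast
      show "eventually (\<lambda>x. P (?h x)) (nhdsin (prod_topology X Y) z)"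
        using eventually_prod[OF chart_eventually1[OF c xy(2) P12(1)] chart_eventually1[OF d xy(3) P12(2)]]
        unfolding xy(1) by eventually_elim (auto intro: P12(3))
    next
      assume P: "eventually P (nhdsin (prod_topology X Y) z)"
      obtain P1 P2 where P12: "eventually P1 (nhdsin X x)" "eventually P2 (nhdsin Y y)"
        "\<And>a b. P1 a \<Longrightarrow> P2 b \<Longrightarrow> P (a, b)"
        using eventually_prodE[OF P[unfolded xy(1)] xyt] by blast
      have "eventually (\<lambda>z. P (?k z)) (nhdsE (n + m) (join n (snd c x) (snd d y)))"
        using t[OF xy(2,3) chart_eventually2[OF c xy(2) P12(1)]] dr[OF xy(2,3) chart_eventually2[OF d xy(3) P12(2)]]
        by eventually_elim (rule P12(3))
      then show "eventually (\<lambda>z. P (?k z)) (nhdsE (n + m) (?h z))" using xy by simp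
    }
  qed
  have 2: "chart_inv (prod_chart n c d) (join n (snd c x) (snd d y)) = (x, y)" if "x \<in> fst c" "y \<in> fst d" for x y
    using chart_inv_left[OF 1, of "(x, y)"] that by (simp add: prod_chart_simps)
  show "eventually (\<lambda>z. chart_inv (prod_chart n c d) z = ?k z) (nhdsE (n + m) (join n (snd c x) (snd d y)))"
    if "x \<in> fst c" "y \<in> fst d"
    using t[OF that chart_eventually_dom[OF c that(1)]] dr[OF that chart_eventually_dom[OF d that(2)]]
  proof eventually_elim
    case (elim z)
    then show ?case using 2[of "chart_inv c (take_c n z)" "chart_inv d (drop_c n z)"] by (simp add: join_take_drop)
  qed
qed

lemma chart_image_open:
  assumes c: "chart_on X n c" and W: "openin X W"
  shows "openin (Euclidean_space n) (snd c ` (fst c \<inter> W))"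
proof (rule openin_eventuallyI)
  fix y assume "y \<in> snd c ` (fst c \<inter> W)"
  then obtain x where x: "x \<in> fst c" "x \<in> W" "y = snd c x" by blast
  show "y \<in> ES n" using chart_ES[OF c x(1)] x(3) by simp
  show "eventually (\<lambda>z. z \<in> snd c ` (fst c \<inter> W)) (nhdsE n y)"
    using chart_eventually2[OF c x(1) eventually_nhdsin_in[OF W x(2)]] chart_eventually_dom[OF c x(1)]
    unfolding x(3) by eventually_elim (metis IntI imageI)
qed

lemma mfdI:
  assumes "\<And>c. c \<in> atlas M \<Longrightarrow> chart_on (mtop M) (mdim M) c"
    "\<And>x. x \<in> points M \<Longrightarrow> \<exists>c\<in>atlas M. x \<in> fst c"
    "\<And>c d x. c \<in> atlas M \<Longrightarrow> d \<in> atlas M \<Longrightarrow> x \<in> fst c \<Longrightarrow> x \<in> fst d \<Longrightarrow>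
       vgerm (mdim M) (mdim M) (snd c x) (chart_rep c d (\<lambda>x. x))"
  shows "mfd M"
  unfolding mfd_def
proof (intro conjI ballI allI impI)
  show "chart_on (mtop M) (mdim M) c" if "c \<in> atlas M" for c by (rule assms(1)[OF that])
  show "(\<Union>c\<in>atlas M. fst c) = points M"
    using assms(2) chart_dom_sub[OF assms(1)] unfolding points_def by blast
  fix c d j assume c: "c \<in> atlas M" and d: "d \<in> atlas M" and j: "j < mdim M"
  show "smooth_on (mdim M) (snd c ` (fst c \<inter> fst d)) (\<lambda>y. chart_rep c d id y j)"
  proof (rule smooth_onI_germ)
    show "openin (Euclidean_space (mdim M)) (snd c ` (fst c \<inter> fst d))"
      by (rule chart_image_open[OF assms(1)[OF c] chart_dom_open[OF assms(1)[OF d]]])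
    fix y assume "y \<in> snd c ` (fst c \<inter> fst d)"
    then obtain x where x: "x \<in> fst c" "x \<in> fst d" "y = snd c x" by blast
    then show "smooth_germ (mdim M) y (\<lambda>y. chart_rep c d id y j)"
      using assms(3)[OF c d x(1,2)] j by (simp add: vgerm_def id_def)
  qed
qed

lemma charts_at_prodI: "c \<in> charts_at M x \<Longrightarrow> d \<in> charts_at N y \<Longrightarrow>
   prod_chart (mdim M) c d \<in> charts_at (prod_manifold M N) (x, y)"
  by (auto simp: charts_at_def prod_manifold_simps prod_chart_simps)

lemma mfd_prod: assumes M: "mfd M" and N: "mfd N" shows "mfd (prod_manifold M N)"
proof (rule mfdI)
  let ?P = "prod_manifold M N"
  have cM: "chart_on (mtop M) (mdim M) c" if "c \<in> atlas M" for c using M that by (simp add: mfd_def)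
  have cN: "chart_on (mtop N) (mdim N) c" if "c \<in> atlas N" for c using N that by (simp add: mfd_def)
  show "chart_on (mtop ?P) (mdim ?P) c" if "c \<in> atlas ?P" for c
    using that chart_on_prod(1)[OF cM cN] by (auto simp: prod_manifold_simps)
  show "\<exists>c\<in>atlas ?P. z \<in> fst c" if z: "z \<in> points ?P" for z
  proof -
    obtain x y where xy: "z = (x, y)" "x \<in> points M" "y \<in> points N" using z by (auto simp: prod_manifold_simps)
    obtain c where c: "c \<in> charts_at M x" using mfd_chart_exists[OF M xy(2)] by (elim exE)
    obtain d where d: "d \<in> charts_at N y" using mfd_chart_exists[OF N xy(3)] by (elim exE)
    show ?thesis using charts_at_prodI[OF c d] unfolding xy(1) charts_at_def by blast
  qed
  fix e f z assume e: "e \<in> atlas ?P" and f: "f \<in> atlas ?P" and z: "z \<in> fst e" "z \<in> fst f"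
  obtain x y where xy: "z = (x, y)" by fastforce
  obtain c d where cd: "e = prod_chart (mdim M) c d" "c \<in> atlas M" "d \<in> atlas N" using e by (auto simp: prod_manifold_simps)
  obtain c' d' where cd': "f = prod_chart (mdim M) c' d'" "c' \<in> atlas M" "d' \<in> atlas N" using f by (auto simp: prod_manifold_simps)
  have in1: "x \<in> fst c" "y \<in> fst d" "x \<in> fst c'" "y \<in> fst d'"
    using z xy cd cd' by (auto simp: prod_chart_simps)
  let ?n = "mdim M" and ?m = "mdim N"
  let ?w = "join ?n (snd c x) (snd d y)"
  have wE: "?w \<in> ES (?n + ?m)" using chart_ES[OF cM[OF cd(2)] in1(1)] chart_ES[OF cN[OF cd(3)] in1(2)] join_ES by blast
  have tw: "take_c ?n ?w = snd c x" "drop_c ?n ?w = snd d y"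
    using take_join chart_ES[OF cM[OF cd(2)] in1(1)] drop_join by blast+
  have 1: "vgerm ?n ?n (snd c x) (chart_rep c c' (\<lambda>x. x))" "vgerm ?m ?m (snd d y) (chart_rep d d' (\<lambda>x. x))"
    using smooth_rep_id[OF M, of c x c'] smooth_rep_id[OF N, of d y d'] cd cd' in1
    by (auto simp: smooth_rep_def charts_at_def)
  have "vgerm (?n + ?m) (?n + ?m) ?w (\<lambda>w. join ?n (chart_rep c c' (\<lambda>x. x) (take_c ?n w)) (chart_rep d d' (\<lambda>x. x) (drop_c ?n w)))"
    by (intro vgerm_join vgerm_compose[OF vgerm_take[OF wE]] vgerm_compose[OF vgerm_drop[OF wE]]) (simp_all add: tw 1)
  moreover have "eventually (\<lambda>w. join ?n (chart_rep c c' (\<lambda>x. x) (take_c ?n w)) (chart_rep d d' (\<lambda>x. x) (drop_c ?n w)) = chart_rep e f (\<lambda>x. x) w) (nhdsE (?n + ?m) ?w)"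
    using chart_on_prod(2)[OF cM[OF cd(2)] cN[OF cd(3)] in1(1,2)]
    by eventually_elim (simp add: chart_rep_def cd(1) cd'(1) prod_chart_simps)
  ultimately have "vgerm (?n + ?m) (?n + ?m) ?w (chart_rep e f (\<lambda>x. x))" by (rule vgerm_cong[rotated])
  then show "vgerm (mdim ?P) (mdim ?P) (snd e z) (chart_rep e f (\<lambda>x. x))"
    by (simp add: prod_manifold_simps xy cd(1) prod_chart_simps)
qed

lemma near_prod: "eventually P (near M x) \<Longrightarrow> eventually Q (near N y) \<Longrightarrow>
   eventually (\<lambda>z. P (fst z) \<and> Q (snd z)) (near (prod_manifold M N) (x, y))"
  by (simp add: prod_manifold_simps eventually_prod)

lemma points_chart: "mfd M \<Longrightarrow> x \<in> points M \<Longrightarrow> (\<And>c. c \<in> charts_at M x \<Longrightarrow> thesis) \<Longrightarrow> thesis"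
  using mfd_chart_exists by metis

lemma smooth_at_fst_snd:
  assumes M: "mfd M" and N: "mfd N" and x: "x \<in> points M" and y: "y \<in> points N"
  shows smooth_at_fst: "smooth_at (prod_manifold M N) M fst (x, y)"
    and smooth_at_snd: "smooth_at (prod_manifold M N) N snd (x, y)"
proof -
  let ?P = "prod_manifold M N" and ?n = "mdim M" and ?m = "mdim N"
  obtain c where c: "c \<in> charts_at M x" using points_chart[OF M x] .
  obtain d where d: "d \<in> charts_at N y" using points_chart[OF N y] .
  note cc = mfd_chart[OF M c] charts_at_in(1)[OF c] and dd = mfd_chart[OF N d] charts_at_in(1)[OF d]
  let ?w = "join ?n (snd c x) (snd d y)"
  have wE: "?w \<in> ES (?n + ?m)" using chart_ES[OF cc] chart_ES[OF dd] join_ES by blast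
  have tw: "take_c ?n ?w = snd c x" "drop_c ?n ?w = snd d y" using take_join chart_ES[OF cc] drop_join by blast+
  have ev: "eventually (\<lambda>z. fst z \<in> fst c \<and> snd z \<in> fst d) (near ?P (x, y))"
    by (rule near_prod) (rule eventually_nhdsin_in[OF chart_dom_open[OF cc(1)] cc(2)], rule eventually_nhdsin_in[OF chart_dom_open[OF dd(1)] dd(2)])
  note inv = chart_on_prod(2)[OF cc(1) dd(1) cc(2) dd(2)]
  have "eventually (\<lambda>z. chart_inv c (take_c ?n z) \<in> fst c \<and> snd c (chart_inv c (take_c ?n z)) = take_c ?n z) (nhdsE (?n + ?m) ?w)"
    by (rule vgerm_tendsto[OF vgerm_take[OF wE], of "\<lambda>z. chart_inv c z \<in> fst c \<and> snd c (chart_inv c z) = z"])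
       (use chart_eventually_dom[OF cc] in \<open>auto simp: tw elim: eventually_mono\<close>)
  then have "eventually (\<lambda>z. take_c ?n z = chart_rep (prod_chart ?n c d) c fst z) (nhdsE (?n + ?m) ?w)"
    using inv by eventually_elim (simp add: chart_rep_def)
  from vgerm_cong[OF this vgerm_take[OF wE]]
  have "smooth_rep ?P M fst (x, y) (prod_chart ?n c d) c"
    unfolding smooth_rep_def using c charts_at_prodI[OF c d] ev
    by (auto simp: prod_manifold_simps prod_chart_simps elim: eventually_mono)
  then show "smooth_at ?P M fst (x, y)" by (rule smooth_atI)
  have "eventually (\<lambda>z. chart_inv d (drop_c ?n z) \<in> fst d \<and> snd d (chart_inv d (drop_c ?n z)) = drop_c ?n z) (nhdsE (?n + ?m) ?w)"
    by (rule vgerm_tendsto[OF vgerm_drop[OF wE], of "\<lambda>z. chart_inv d z \<in> fst d \<and> snd d (chart_inv d z) = z"])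
       (use chart_eventually_dom[OF dd] in \<open>auto simp: tw elim: eventually_mono\<close>)
  then have "eventually (\<lambda>z. drop_c ?n z = chart_rep (prod_chart ?n c d) d snd z) (nhdsE (?n + ?m) ?w)"
    using inv by eventually_elim (simp add: chart_rep_def)
  from vgerm_cong[OF this vgerm_drop[OF wE]]
  have "smooth_rep ?P N snd (x, y) (prod_chart ?n c d) d"
    unfolding smooth_rep_def using d charts_at_prodI[OF c d] ev
    by (auto simp: prod_manifold_simps prod_chart_simps elim: eventually_mono)
  then show "smooth_at ?P N snd (x, y)" by (rule smooth_atI)
qed

lemma smooth_rep_Pair:
  assumes W: "mfd W" and M: "mfd M" and N: "mfd N"
    and f: "smooth_rep W M f w a c" and g: "smooth_rep W N g w a d"
  shows "smooth_rep W (prod_manifold M N) (\<lambda>w. (f w, g w)) w a (prod_chart (mdim M) c d)"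
    "chart_rep a (prod_chart (mdim M) c d) (\<lambda>w. (f w, g w)) = (\<lambda>z. join (mdim M) (chart_rep a c f z) (chart_rep a d g z))"
proof -
  show 1: "chart_rep a (prod_chart (mdim M) c d) (\<lambda>w. (f w, g w)) = (\<lambda>z. join (mdim M) (chart_rep a c f z) (chart_rep a d g z))"
    by (simp add: chart_rep_def prod_chart_simps)
  have "eventually (\<lambda>w. f w \<in> fst c) (near W w)" "eventually (\<lambda>w. g w \<in> fst d) (near W w)"
    using f g by (simp_all add: smooth_rep_def)
  then have "eventually (\<lambda>w. (f w, g w) \<in> fst (prod_chart (mdim M) c d)) (near W w)"
    by eventually_elim (simp add: prod_chart_simps)
  then show "smooth_rep W (prod_manifold M N) (\<lambda>w. (f w, g w)) w a (prod_chart (mdim M) c d)"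
    using f g charts_at_prodI[of c M "f w" d N "g w"]
      vgerm_join[of "mdim W" "mdim M" "snd a w" "chart_rep a c f" "mdim N" "chart_rep a d g"]
    unfolding smooth_rep_def 1 by (simp add: prod_manifold_simps)
qed

lemma smooth_at_Pair:
  assumes W: "mfd W" and M: "mfd M" and N: "mfd N"
    and f: "smooth_at W M f w" and g: "smooth_at W N g w"
  shows "smooth_at W (prod_manifold M N) (\<lambda>w. (f w, g w)) w"
proof -
  obtain a where a: "a \<in> charts_at W w" using points_chart[OF W smooth_at_points(1)[OF W M f]] .
  obtain c where c: "c \<in> charts_at M (f w)" using points_chart[OF M smooth_at_points(2)[OF W M f]] .
  obtain d where d: "d \<in> charts_at N (g w)" using points_chart[OF N smooth_at_points(2)[OF W N g]] .
  show ?thesis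
    by (rule smooth_atI[OF smooth_rep_Pair(1)[OF W M N smooth_at_rep[OF W M f a c] smooth_at_rep[OF W N g a d]]])
qed

text \<open>
  Product rule: a pair of maps is differentiated by varying one component at a time. The tangent space of the product is not
  identified with a product of tangent spaces; the two summands are differentials of maps into the product.
\<close>

lemma tmap_Pair_split:
  assumes W: "mfd W" and M: "mfd M" and N: "mfd N"
    and f: "smooth_at W M f w" and g: "smooth_at W N g w" and v: "v \<in> tangent_space W w"
  shows "tmap W (prod_manifold M N) (\<lambda>w. (f w, g w)) w v =
    tadd (tmap W (prod_manifold M N) (\<lambda>x. (f x, g w)) w v) (tmap W (prod_manifold M N) (\<lambda>x. (f w, g x)) w v)"
proof -
  let ?P = "prod_manifold M N"
  note pf = smooth_at_points[OF W M f] and pg = smooth_at_points[OF W N g]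
  obtain a where a: "a \<in> charts_at W w" using points_chart[OF W pf(1)] .
  obtain c where c: "c \<in> charts_at M (f w)" using points_chart[OF M pf(2)] .
  obtain d where d: "d \<in> charts_at N (g w)" using points_chart[OF N pg(2)] .
  have P: "mfd ?P" by (rule mfd_prod[OF M N])
  have cf: "smooth_at W M (\<lambda>_. f w) w" and cg: "smooth_at W N (\<lambda>_. g w) w"
    using smooth_at_const[OF W M pf] smooth_at_const[OF W N pg] by auto
  have 1: "smooth_at W ?P (\<lambda>w. (f w, g w)) w" by (rule smooth_at_Pair[OF W M N f g])
  have 2: "smooth_at W ?P (\<lambda>x. (f x, g w)) w" by (rule smooth_at_Pair[OF W M N f cg])
  have 3: "smooth_at W ?P (\<lambda>x. (f w, g x)) w" by (rule smooth_at_Pair[OF W M N cf g])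
  let ?e = "prod_chart (mdim M) c d"
  have e: "?e \<in> charts_at ?P (f w, g w)" by (rule charts_at_prodI[OF c d])
  note R = smooth_at_rep[OF W M f a c] smooth_at_rep[OF W N g a d] smooth_at_rep[OF W M cf a c] smooth_at_rep[OF W N cg a d]
  have p0: "partial i (\<lambda>z. k) y = 0" for i k y by (simp add: partial_def)
  show ?thesis
  proof (rule tangent_eqI[OF _ _ e])
    show "tmap W ?P (\<lambda>w. (f w, g w)) w v \<in> tangent_space ?P (f w, g w)" by (rule tmap_in[OF W P 1 v])
    show "tadd (tmap W ?P (\<lambda>x. (f x, g w)) w v) (tmap W ?P (\<lambda>x. (f w, g x)) w v) \<in> tangent_space ?P (f w, g w)"
      by (rule tangent_add) (rule tmap_in[OF W P 2 v], rule tmap_in[OF W P 3 v])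
    show "tmap W ?P (\<lambda>w. (f w, g w)) w v ?e = tadd (tmap W ?P (\<lambda>x. (f x, g w)) w v) (tmap W ?P (\<lambda>x. (f w, g x)) w v) ?e"
      unfolding tadd_def tmap_chart[OF W P 1 v a e] tmap_chart[OF W P 2 v a e] tmap_chart[OF W P 3 v a e]
        smooth_rep_Pair(2)[OF W M N R(1) R(2)] smooth_rep_Pair(2)[OF W M N R(1) R(4)] smooth_rep_Pair(2)[OF W M N R(3) R(2)]
    proof (rule ext)
      fix i
      show "jacobian (mdim W) (\<lambda>z. join (mdim M) (chart_rep a c f z) (chart_rep a d g z)) (snd a w) (v a) i =
        jacobian (mdim W) (\<lambda>z. join (mdim M) (chart_rep a c f z) (chart_rep a d (\<lambda>_. g w) z)) (snd a w) (v a) i +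
        jacobian (mdim W) (\<lambda>z. join (mdim M) (chart_rep a c (\<lambda>_. f w) z) (chart_rep a d g z)) (snd a w) (v a) i"
        by (cases "i < mdim M") (simp_all add: jacobian_def join_def chart_rep_def p0)
    qed
  qed
qed

lemma tmap_two:
  assumes W: "mfd W" and M: "mfd M" and N: "mfd N" and K: "mfd K"
    and F: "smooth_at (prod_manifold M N) K (\<lambda>(x, y). F x y) (f w, g w)"
    and f: "smooth_at W M f w" and g: "smooth_at W N g w" and v: "v \<in> tangent_space W w"
  shows "tmap W K (\<lambda>w. F (f w) (g w)) w v =
    tadd (tmap W K (\<lambda>x. F (f x) (g w)) w v) (tmap W K (\<lambda>x. F (f w) (g x)) w v)"
proof -
  let ?P = "prod_manifold M N"
  note pf = smooth_at_points[OF W M f] and pg = smooth_at_points[OF W N g]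
  have P: "mfd ?P" by (rule mfd_prod[OF M N])
  have cf: "smooth_at W M (\<lambda>_. f w) w" and cg: "smooth_at W N (\<lambda>_. g w) w"
    using smooth_at_const[OF W M pf] smooth_at_const[OF W N pg] by auto
  have 1: "smooth_at W ?P (\<lambda>w. (f w, g w)) w" by (rule smooth_at_Pair[OF W M N f g])
  have 2: "smooth_at W ?P (\<lambda>x. (f x, g w)) w" by (rule smooth_at_Pair[OF W M N f cg])
  have 3: "smooth_at W ?P (\<lambda>x. (f w, g x)) w" by (rule smooth_at_Pair[OF W M N cf g])
  show ?thesis
    using tmap_compose[OF W P K 1 F v] tmap_compose[OF W P K 2 F v] tmap_compose[OF W P K 3 F v]
      tmap_Pair_split[OF W M N f g v] by (simp add: tmap_add)
qed

lemma smooth_at_two: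
  assumes W: "mfd W" and M: "mfd M" and N: "mfd N" and K: "mfd K"
    and F: "smooth_at (prod_manifold M N) K (\<lambda>(x, y). F x y) (f w, g w)"
    and f: "smooth_at W M f w" and g: "smooth_at W N g w"
  shows "smooth_at W K (\<lambda>w. F (f w) (g w)) w"
  using smooth_at_compose[OF W mfd_prod[OF M N] K smooth_at_Pair[OF W M N f g] F] by simp

section \<open>Euclidean space as a manifold\<close>

text \<open>
  As a manifold with one global chart, so that coordinate maps are smooth maps and compose with the others.
\<close>

definition euc :: "nat \<Rightarrow> (nat \<Rightarrow> real) manifold" where
  "euc n = \<lparr>mtop = Euclidean_space n, mdim = n, atlas = {(ES n, \<lambda>x. x)}\<rparr>"

lemma euc_simps: "mtop (euc n) = Euclidean_space n" "mdim (euc n) = n" "atlas (euc n) = {(ES n, \<lambda>x. x)}"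
  "points (euc n) = ES n" by (simp_all add: euc_def points_def)

lemma euc_chart_inv: "y \<in> ES n \<Longrightarrow> chart_inv (ES n, \<lambda>x. x) y = y"
  by (simp add: chart_inv_def inv_into_f_f[where f = "\<lambda>x. x", simplified])

lemma mfd_euc: "mfd (euc n)"
proof (rule mfdI)
  show "chart_on (mtop (euc n)) (mdim (euc n)) c" if "c \<in> atlas (euc n)" for c
  proof -
    have "chart_on (Euclidean_space n) n (ES n, \<lambda>x. x)"
      by (rule chart_onI[where k = "\<lambda>x. x"]) (auto simp: eventually_ES)
    then show ?thesis using that by (simp add: euc_simps)
  qed
  show "\<exists>c\<in>atlas (euc n). x \<in> fst c" if "x \<in> points (euc n)" for x using that by (simp add: euc_simps)
  fix c d x assume c: "c \<in> atlas (euc n)" "d \<in> atlas (euc n)" "x \<in> fst c"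
  then have x: "x \<in> ES n" by (simp add: euc_simps)
  have "eventually (\<lambda>z. z = chart_rep (ES n, \<lambda>x. x) (ES n, \<lambda>x. x) (\<lambda>x. x) z) (nhdsE n x)"
    using eventually_ES[OF x] by eventually_elim (simp add: chart_rep_def euc_chart_inv)
  from vgerm_cong[OF this vgerm_id[OF x]]
  show "vgerm (mdim (euc n)) (mdim (euc n)) (snd c x) (chart_rep c d (\<lambda>x. x))" using c by (simp add: euc_simps)
qed

lemma charts_at_euc: "x \<in> ES n \<Longrightarrow> charts_at (euc n) x = {(ES n, \<lambda>x. x)}"
  by (auto simp: charts_at_def euc_simps)

lemma smooth_at_to_euc:
  assumes M: "mfd M" and c: "c \<in> charts_at M x"
  shows "smooth_at M (euc m) f x \<longleftrightarrow> vgerm (mdim M) m (snd c x) (\<lambda>y. f (chart_inv c y))"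
proof
  note cc = mfd_chart[OF M c] charts_at_in(1)[OF c]
  assume s: "smooth_at M (euc m) f x"
  have fx: "f x \<in> ES m" using smooth_at_points[OF M mfd_euc s] by (simp add: euc_simps)
  have "smooth_rep M (euc m) f x c (ES m, \<lambda>x. x)" by (rule smooth_at_rep[OF M mfd_euc s c]) (simp add: charts_at_euc fx)
  then show "vgerm (mdim M) m (snd c x) (\<lambda>y. f (chart_inv c y))"
    by (simp add: smooth_rep_def euc_simps chart_rep_def)
next
  note cc = mfd_chart[OF M c] charts_at_in(1)[OF c]
  assume v: "vgerm (mdim M) m (snd c x) (\<lambda>y. f (chart_inv c y))"
  have fx: "f x \<in> ES m" using vgerm_ES(2)[OF v] by (simp add: chart_inv_left[OF cc])
  have "eventually (\<lambda>y. f (chart_inv c y) \<in> ES m) (nhdsE (mdim M) (snd c x))" using v by (simp add: vgerm_def)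
  from chart_eventually1[OF cc this] eventually_nhdsin_in[OF chart_dom_open[OF cc(1)] cc(2)]
  have "eventually (\<lambda>x. f x \<in> ES m) (near M x)"
    by eventually_elim (simp add: chart_inv_left[OF cc(1)])
  then have "smooth_rep M (euc m) f x c (ES m, \<lambda>x. x)"
    unfolding smooth_rep_def using c v by (simp add: charts_at_euc fx euc_simps chart_rep_def)
  then show "smooth_at M (euc m) f x" by (rule smooth_atI)
qed

lemma smooth_at_chart:
  assumes M: "mfd M" and c: "c \<in> charts_at M x"
  shows "smooth_at M (euc (mdim M)) (snd c) x"
  using smooth_rep_id[OF M c c] unfolding smooth_at_to_euc[OF M c] by (simp add: smooth_rep_def chart_rep_def)

lemma smooth_at_euc: "smooth_at (euc n) (euc m) F y \<longleftrightarrow> vgerm n m y F"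
proof (cases "y \<in> ES n")
  case True
  have 1: "eventually (\<lambda>z. F (chart_inv (ES n, \<lambda>x. x) z) = F z) (nhdsE n y)"
    using eventually_ES[OF True] by eventually_elim (simp add: euc_chart_inv)
  then have 2: "eventually (\<lambda>z. F z = F (chart_inv (ES n, \<lambda>x. x) z)) (nhdsE n y)"
    by eventually_elim simp
  have "(ES n, \<lambda>x. x) \<in> charts_at (euc n) y" by (simp add: charts_at_euc True)
  from smooth_at_to_euc[OF mfd_euc this, of m F]
  show ?thesis using vgerm_cong[OF 1] vgerm_cong[OF 2] by (auto simp only: euc_simps snd_conv)
next
  case False
  then show ?thesis using smooth_at_points(1)[OF mfd_euc mfd_euc, of n m F y] vgerm_ES(1)[of n m y F]
    by (auto simp only: euc_simps)
qed

lemma smooth_at_chart_inv: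
  assumes M: "mfd M" and c: "c \<in> charts_at M x"
  shows "smooth_at (euc (mdim M)) M (chart_inv c) (snd c x)"
proof -
  note cc = mfd_chart[OF M c] charts_at_in(1)[OF c]
  have yE: "snd c x \<in> ES (mdim M)" by (rule chart_ES[OF cc])
  have d: "eventually (\<lambda>z. z = chart_rep (ES (mdim M), \<lambda>x. x) c (chart_inv c) z \<and> chart_inv c z \<in> fst c) (nhdsE (mdim M) (snd c x))"
    using chart_eventually_dom[OF cc] eventually_ES[OF yE] by eventually_elim (simp add: chart_rep_def euc_chart_inv)
  have "vgerm (mdim M) (mdim M) (snd c x) (chart_rep (ES (mdim M), \<lambda>x. x) c (chart_inv c))"
    by (rule vgerm_cong[OF _ vgerm_id[OF yE]]) (use d in eventually_elim, simp)
  moreover have "eventually (\<lambda>z. chart_inv c z \<in> fst c) (nhdsE (mdim M) (snd c x))"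
    using d by eventually_elim simp
  ultimately have "smooth_rep (euc (mdim M)) M (chart_inv c) (snd c x) (ES (mdim M), \<lambda>x. x) c"
    unfolding smooth_rep_def by (simp add: charts_at_euc[OF yE] euc_simps chart_inv_left[OF cc] c)
  then show ?thesis by (rule smooth_atI)
qed

lemma smooth_at_join:
  assumes M: "mfd M" and f: "smooth_at M (euc a) f x" and g: "smooth_at M (euc b) g x"
  shows "smooth_at M (euc (a + b)) (\<lambda>w. join a (f w) (g w)) x"
proof -
  obtain c where c: "c \<in> charts_at M x" using points_chart[OF M smooth_at_points(1)[OF M mfd_euc f]] .
  show ?thesis using f g unfolding smooth_at_to_euc[OF M c] by (rule vgerm_join)
qed

lemma smooth_at_take: "y \<in> ES (n + m) \<Longrightarrow> smooth_at (euc (n + m)) (euc n) (take_c n) y"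
  by (simp add: smooth_at_euc vgerm_take)

lemma smooth_at_drop: "y \<in> ES (n + m) \<Longrightarrow> smooth_at (euc (n + m)) (euc m) (drop_c n) y"
  by (simp add: smooth_at_euc vgerm_drop)

section \<open>Submersions\<close>

text \<open>
  Vectors mapped to the coordinate vectors of the target witness the independence that \<open>straighten\<close> demands.
\<close>

lemma submersion_adapted_coordinates:
  assumes M: "mfd M" and N: "mfd N" and f: "smooth_at M N f x"
    and surj: "tangent_space N (f x) \<subseteq> tmap M N f x ` tangent_space M x"
    and c: "c \<in> charts_at M x" and d: "d \<in> charts_at N (f x)"
  shows "mdim N \<le> mdim M \<and> (\<exists>\<phi> \<psi>. local_diffeo (mdim M) (snd c x) \<phi> \<psi> \<and>
     (\<forall>j<mdim N. eventually (\<lambda>y. \<phi> y j = chart_rep c d f y j) (nhdsE (mdim M) (snd c x))))"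
proof (rule straighten)
  have r: "smooth_rep M N f x c d" by (rule smooth_at_rep[OF M N f c d])
  show "snd c x \<in> ES (mdim M)" by (rule chart_ES[OF mfd_chart[OF M c] charts_at_in(1)[OF c]])
  show "smooth_germ (mdim M) (snd c x) (\<lambda>y. chart_rep c d f y j)" if "j < mdim N" for j
    using r that by (simp add: smooth_rep_def vgerm_def)
  fix j assume j: "j < mdim N"
  obtain v where v: "v \<in> tangent_space M x" "coord_vec N d j (f x) = tmap M N f x v"
    using surj coord_vec(1)[OF N d j] by blast
  have "jacobian (mdim M) (chart_rep c d f) (snd c x) (v c) = (\<lambda>k. if k = j then 1 else 0)"
    using tmap_chart[OF M N f v(1) c d] coord_vec(2)[OF N d j] v(2) by simp
  then show "\<exists>v. \<forall>k<mdim N. (\<Sum>i<mdim M. v i * partial i (\<lambda>y. chart_rep c d f y k) (snd c x)) = (if k = j then 1 else 0)"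
    unfolding jacobian_def by (intro exI[of _ "v c"]) (simp add: fun_eq_iff)
qed

text \<open>
  In coordinates where \<open>f\<close> is the projection to the first \<open>m\<close> coordinates, a section through \<open>x\<close> is obtained by
  giving the remaining coordinates the constant values they have at \<open>x\<close>.
\<close>

lemma local_section:
  assumes M: "mfd M" and N: "mfd N" and f: "smooth_at M N f x"
    and surj: "tangent_space N (f x) \<subseteq> tmap M N f x ` tangent_space M x"
  obtains \<theta> where "smooth_at N M \<theta> (f x)" "\<theta> (f x) = x" "eventually (\<lambda>y. f (\<theta> y) = y) (near N (f x))"
proof -
  note pts = smooth_at_points[OF M N f]
  obtain c where c: "c \<in> charts_at M x" using points_chart[OF M pts(1)] .
  obtain d where d: "d \<in> charts_at N (f x)" using points_chart[OF N pts(2)] .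
  note cc = mfd_chart[OF M c] charts_at_in(1)[OF c] and dd = mfd_chart[OF N d] charts_at_in(1)[OF d]
  let ?n = "mdim M" and ?m = "mdim N"
  obtain \<phi> \<psi> where mn: "?m \<le> ?n" and ld: "local_diffeo ?n (snd c x) \<phi> \<psi>"
    and \<phi>: "\<And>j. j < ?m \<Longrightarrow> eventually (\<lambda>y. \<phi> y j = chart_rep c d f y j) (nhdsE ?n (snd c x))"
    using submersion_adapted_coordinates[OF assms c d] by blast
  define w0 where "w0 = \<phi> (snd c x)"
  note ldd = ld[unfolded local_diffeo_def]
  have w0: "w0 \<in> ES ?n" "vgerm ?n ?n w0 \<psi>" "\<psi> w0 = snd c x"
    using ldd vgerm_ES local_diffeo_inv[OF ld] by (auto simp: w0_def)
  have nm: "?n = ?m + (?n - ?m)" using mn by simp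
  have uE: "drop_c ?m w0 \<in> ES (?n - ?m)" by (rule drop_ES) (use w0(1) nm in simp)
  \<comment> \<open>the section in the straightened coordinates\<close>
  define \<eta> where "\<eta> y = join ?m (snd d y) (drop_c ?m w0)" for y
  have \<eta>0: "\<eta> (f x) = w0"
  proof (rule ES_eqI[of _ ?n])
    show "\<eta> (f x) \<in> ES ?n" using join_ES[OF chart_ES[OF dd] uE] nm by (simp add: \<eta>_def)
    fix j assume "j < ?n"
    show "\<eta> (f x) j = w0 j"
    proof (cases "j < ?m")
      case True
      have "\<phi> (snd c x) j = chart_rep c d f (snd c x) j"
        by (rule eventually_nhdsin_self[OF _ \<phi>[OF True]]) (rule chart_ES[OF cc])
      then show ?thesis using True by (simp add: \<eta>_def w0_def join_def chart_rep_def chart_inv_left[OF cc])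
    qed (simp add: \<eta>_def join_def drop_c_def)
  qed (rule w0)
  have s1: "smooth_at N (euc ?n) \<eta> (f x)"
  proof -
    have "smooth_at N (euc (?m + (?n - ?m))) \<eta> (f x)" unfolding \<eta>_def
      by (rule smooth_at_join[OF N smooth_at_chart[OF N d]])
         (rule smooth_at_const[OF N mfd_euc pts(2)], simp add: euc_simps uE)
    then show ?thesis using nm by simp
  qed
  have s2: "smooth_at (euc ?n) (euc ?n) \<psi> (\<eta> (f x))" using w0 \<eta>0 by (simp add: smooth_at_euc)
  have s12: "smooth_at N (euc ?n) (\<lambda>y. \<psi> (\<eta> y)) (f x)" by (rule smooth_at_compose[OF N mfd_euc mfd_euc s1 s2])
  have s3: "smooth_at (euc ?n) M (chart_inv c) (\<psi> (\<eta> (f x)))"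
    using smooth_at_chart_inv[OF M c] w0 \<eta>0 by simp
  define \<theta> where "\<theta> y = chart_inv c (\<psi> (\<eta> y))" for y
  have s: "smooth_at N M \<theta> (f x)" unfolding \<theta>_def by (rule smooth_at_compose[OF N mfd_euc M s12 s3])
  have \<theta>0: "\<theta> (f x) = x" using \<eta>0 w0 by (simp add: \<theta>_def chart_inv_left[OF cc])
  have ev1: "eventually (\<lambda>y. \<phi> (\<psi> (\<eta> y)) = \<eta> y) (near N (f x))"
    by (rule smooth_at_tendsto[OF N mfd_euc s1]) (use ldd \<eta>0 w0_def in \<open>simp add: euc_simps\<close>)
  have "eventually (\<lambda>z. \<forall>j\<in>{..<?m}. \<phi> z j = chart_rep c d f z j) (nhdsE ?n (snd c x))"
    by (rule eventually_ball_finite) (use \<phi> in auto)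
  then have ev2: "eventually (\<lambda>y. \<forall>j\<in>{..<?m}. \<phi> (\<psi> (\<eta> y)) j = chart_rep c d f (\<psi> (\<eta> y)) j) (near N (f x))"
    by (intro smooth_at_tendsto[OF N mfd_euc s12]) (use \<eta>0 w0 in \<open>simp add: euc_simps\<close>)
  have ev3: "eventually (\<lambda>y. f (\<theta> y) \<in> fst d) (near N (f x))"
    by (rule smooth_at_tendsto[OF N M s])
       (use smooth_at_rep[OF M N f c d] \<theta>0 in \<open>simp add: smooth_rep_def\<close>)
  have ev4: "eventually (\<lambda>y. y \<in> fst d) (near N (f x))"
    by (rule eventually_nhdsin_in[OF chart_dom_open[OF dd(1)] dd(2)])
  have "eventually (\<lambda>y. f (\<theta> y) = y) (near N (f x))"
    using ev1 ev2 ev3 ev4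
  proof eventually_elim
    case (elim y)
    have "snd d (f (\<theta> y)) = snd d y"
    proof (rule ES_eqI[of _ ?m])
      show "snd d (f (\<theta> y)) \<in> ES ?m" "snd d y \<in> ES ?m" using elim chart_ES[OF dd(1)] by auto
      show "snd d (f (\<theta> y)) j = snd d y j" if "j < ?m" for j
        using elim that by (auto simp: chart_rep_def \<theta>_def \<eta>_def join_def)
    qed
    then show ?case using chart_inj[OF dd(1)] elim by (simp add: inj_on_eq_iff)
  qed
  then show thesis using that s \<theta>0 by blast
qed

section \<open>Embedded submanifolds\<close>

lemma submanifold_simps: "mtop (submanifold N S k) = subtopology (mtop N) S" "mdim (submanifold N S k) = k"
  "points (submanifold N S k) = points N \<inter> S"
  by (simp_all add: submanifold_def points_def)

lemma submanifold_atlas: "c \<in> atlas (submanifold N S k) \<longleftrightarrow>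
   chart_on (subtopology (mtop N) S) k c \<and>
        (\<forall>x\<in>fst c. \<exists>W f. openin (mtop N) W \<and> x \<in> W \<and>
            (\<forall>j<k. smooth_fun_on N W (\<lambda>y. f y j)) \<and> (\<forall>y\<in>W \<inter> fst c. f y = snd c y)) \<and>
        (\<forall>d\<in>atlas N. \<forall>j<mdim N.
            smooth_on k (snd c ` (fst c \<inter> fst d)) (\<lambda>y. snd d (chart_inv c y) j))"
  by (simp add: submanifold_def)

text \<open>
  The inclusion of a submanifold is smooth in charts: this is the clause on inverse charts in the definition.
\<close>

lemma sub_chart_incl:
  assumes N: "mfd N" and c: "c \<in> atlas (submanifold N S k)" and x: "x \<in> fst c" and e: "e \<in> charts_at N x"
  shows "eventually (\<lambda>x'. x' \<in> fst e) (near (submanifold N S k) x)"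
    "vgerm k (mdim N) (snd c x) (chart_rep c e (\<lambda>x. x))"
proof -
  note cc = c[unfolded submanifold_atlas]
  have ch: "chart_on (subtopology (mtop N) S) k c" using cc by blast
  note ee = mfd_chart[OF N e] charts_at_in[OF e]
  have xN: "x \<in> topspace (mtop N)" using chart_dom_sub[OF ch] x by auto
  show 1: "eventually (\<lambda>x'. x' \<in> fst e) (near (submanifold N S k) x)"
    unfolding submanifold_simps
    by (rule eventually_nhdsin_subtopology[OF eventually_nhdsin_in[OF chart_dom_open[OF ee(1)] ee(2)] xN])
  show "vgerm k (mdim N) (snd c x) (chart_rep c e (\<lambda>x. x))"
    unfolding vgerm_def
  proof (intro conjI allI impI)
    show "snd c x \<in> ES k" by (rule chart_ES[OF ch x])
    show "\<forall>\<^sub>F z in nhdsE k (snd c x). chart_rep c e (\<lambda>x. x) z \<in> ES (mdim N)"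
      using chart_eventually2[OF ch x 1[unfolded submanifold_simps]]
      by eventually_elim (simp add: chart_rep_def chart_ES[OF ee(1)])
    fix j assume "j < mdim N"
    then have "smooth_on k (snd c ` (fst c \<inter> fst e)) (\<lambda>y. snd e (chart_inv c y) j)" using cc ee(3) by blast
    then have "smooth_germ k (snd c x) (\<lambda>y. snd e (chart_inv c y) j)"
      by (rule smooth_on_germ) (use x ee(2) in blast)
    then show "smooth_germ k (snd c x) (\<lambda>z. chart_rep c e (\<lambda>x. x) z j)" by (simp add: chart_rep_def)
  qed
qed

text \<open>
  A chart of a submanifold is the restriction of a smooth germ \<open>F\<close> of the ambient manifold. Smoothness of maps into a
  submanifold and compatibility of its charts both come from composing with such an \<open>F\<close>.
\<close>

lemma sub_chart_ext:
  assumes N: "mfd N" and c: "c \<in> atlas (submanifold N S k)" and x: "x \<in> fst c" and e: "e \<in> charts_at N x"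
  obtains F where "eventually (\<lambda>x'. x' \<in> fst c \<longrightarrow> F x' = snd c x') (near N x)"
    "\<And>j. j < k \<Longrightarrow> smooth_germ (mdim N) (snd e x) (\<lambda>y. F (chart_inv e y) j)"
proof -
  note cc = c[unfolded submanifold_atlas]
  note ee = mfd_chart[OF N e] charts_at_in[OF e]
  from cc[THEN conjunct2, THEN conjunct1, rule_format, OF x]
  obtain W f where W: "openin (mtop N) W" "x \<in> W" "\<forall>j<k. smooth_fun_on N W (\<lambda>y. f y j)"
    "\<forall>y\<in>W \<inter> fst c. f y = snd c y" by (elim exE conjE)
  show thesis
  proof (rule that[of f])
    show "eventually (\<lambda>x'. x' \<in> fst c \<longrightarrow> f x' = snd c x') (near N x)"
      using eventually_nhdsin_in[OF W(1,2)] by eventually_elim (use W(4) in blast)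
    fix j assume "j < k"
    then have "smooth_on (mdim N) (snd e ` (fst e \<inter> W)) (\<lambda>y. f (chart_inv e y) j)"
      using W(3) ee(3) unfolding smooth_fun_on_def by blast
    then show "smooth_germ (mdim N) (snd e x) (\<lambda>y. f (chart_inv e y) j)"
      by (rule smooth_on_germ) (use W(2) ee(2) in blast)
  qed
qed

lemma mfd_submanifold:
  assumes N: "mfd N" and cov: "\<And>x. x \<in> points N \<Longrightarrow> x \<in> S \<Longrightarrow> \<exists>c\<in>atlas (submanifold N S k). x \<in> fst c"
  shows "mfd (submanifold N S k)"
proof (rule mfdI)
  let ?C = "submanifold N S k"
  show "chart_on (mtop ?C) (mdim ?C) c" if "c \<in> atlas ?C" for c
    using that by (simp add: submanifold_atlas submanifold_simps)
  show "\<exists>c\<in>atlas ?C. x \<in> fst c" if "x \<in> points ?C" for x using cov that by (simp add: submanifold_simps)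
  fix c d x assume c: "c \<in> atlas ?C" and d: "d \<in> atlas ?C" and x: "x \<in> fst c" "x \<in> fst d"
  have cch: "chart_on (mtop ?C) k c" and dch: "chart_on (mtop ?C) k d"
    using c d by (auto simp: submanifold_atlas submanifold_simps)
  have xN: "x \<in> points N" using chart_dom_sub[OF cch] x(1) by (auto simp: submanifold_simps points_def)
  obtain e where e: "e \<in> charts_at N x" using points_chart[OF N xN] .
  note ee = mfd_chart[OF N e] charts_at_in[OF e]
  obtain F where F: "eventually (\<lambda>x'. x' \<in> fst d \<longrightarrow> F x' = snd d x') (near N x)"
    "\<And>j. j < k \<Longrightarrow> smooth_germ (mdim N) (snd e x) (\<lambda>y. F (chart_inv e y) j)"
    using sub_chart_ext[OF N d x(2) e] by blast
  note inc = sub_chart_incl[OF N c x(1) e]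
  have cx: "chart_rep c e (\<lambda>x. x) (snd c x) = snd e x" by (simp add: chart_rep_def chart_inv_left[OF cch x(1)])
  have e1: "eventually (\<lambda>x'. x' \<in> fst d \<longrightarrow> F x' = snd d x') (near ?C x)"
    unfolding submanifold_simps by (rule eventually_nhdsin_subtopology[OF F(1)]) (use xN in \<open>simp add: points_def\<close>)
  have e2: "eventually (\<lambda>x'. x' \<in> fst d) (near ?C x)" by (rule eventually_nhdsin_in[OF chart_dom_open[OF dch] x(2)])
  have ev: "eventually (\<lambda>y. chart_inv c y \<in> fst d \<and> chart_inv c y \<in> fst e \<and> F (chart_inv c y) = snd d (chart_inv c y)) (nhdsE k (snd c x))"
    using chart_eventually2[OF cch x(1) e1] chart_eventually2[OF cch x(1) e2] chart_eventually2[OF cch x(1) inc(1)]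
    by eventually_elim simp
  show "vgerm (mdim ?C) (mdim ?C) (snd c x) (chart_rep c d (\<lambda>x. x))"
    unfolding submanifold_simps vgerm_def
  proof (intro conjI allI impI)
    show "snd c x \<in> ES k" by (rule chart_ES[OF cch x(1)])
    show "\<forall>\<^sub>F z in nhdsE k (snd c x). chart_rep c d (\<lambda>x. x) z \<in> ES k"
      using ev by eventually_elim (simp add: chart_rep_def chart_ES[OF dch])
    fix j assume j: "j < k"
    have "smooth_germ k (snd c x) (\<lambda>y. F (chart_inv e (chart_rep c e (\<lambda>x. x) y)) j)"
      by (rule smooth_germ_compose[OF inc(2)]) (simp add: cx F(2)[OF j])
    then show "smooth_germ k (snd c x) (\<lambda>z. chart_rep c d (\<lambda>x. x) z j)"
      by (rule smooth_germ_cong[rotated])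
         (use ev in eventually_elim, simp add: chart_rep_def chart_inv_left[OF ee(1)])
  qed
qed

lemma smooth_at_incl:
  assumes N: "mfd N" and C: "mfd (submanifold N S k)" and x: "x \<in> points N" "x \<in> S"
  shows "smooth_at (submanifold N S k) N (\<lambda>x. x) x"
proof -
  have "x \<in> points (submanifold N S k)" using x by (simp add: submanifold_simps)
  then obtain c where c: "c \<in> charts_at (submanifold N S k) x" using points_chart[OF C] by blast
  obtain e where e: "e \<in> charts_at N x" using points_chart[OF N x(1)] .
  note i = sub_chart_incl[OF N charts_at_in(2)[OF c] charts_at_in(1)[OF c] e]
  show ?thesis by (rule smooth_atI[of _ _ _ _ c e]) (use c e i in \<open>simp add: smooth_rep_def submanifold_simps\<close>)
qed

lemma smooth_at_into_submanifold:
  assumes W: "mfd W" and N: "mfd N" and C: "mfd (submanifold N S k)" and f: "smooth_at W N f w"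
    and S: "eventually (\<lambda>w. f w \<in> S) (near W w)"
  shows "smooth_at W (submanifold N S k) f w"
proof -
  let ?C = "submanifold N S k"
  note pts = smooth_at_points[OF W N f]
  have fw: "f w \<in> points ?C" using pts near_self[OF pts(1) S] by (simp add: submanifold_simps)
  obtain a where a: "a \<in> charts_at W w" using points_chart[OF W pts(1)] .
  obtain c where c: "c \<in> charts_at ?C (f w)" using points_chart[OF C fw] .
  obtain e where e: "e \<in> charts_at N (f w)" using points_chart[OF N pts(2)] .
  note aa = mfd_chart[OF W a] charts_at_in[OF a] and cc = mfd_chart[OF C c] charts_at_in[OF c] and ee = mfd_chart[OF N e] charts_at_in[OF e]
  obtain O' where O: "openin (mtop N) O'" "fst c = O' \<inter> S"
    using chart_dom_open[OF cc(1)] by (auto simp: submanifold_simps openin_subtopology)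
  have "eventually (\<lambda>w. f w \<in> O') (near W w)"
    by (rule smooth_at_tendsto[OF W N f eventually_nhdsin_in[OF O(1)]]) (use cc(2) O(2) in blast)
  then have inc: "eventually (\<lambda>w. f w \<in> fst c) (near W w)" using S by eventually_elim (simp add: O(2))
  have ine: "eventually (\<lambda>w. f w \<in> fst e) (near W w)"
    using smooth_at_rep[OF W N f a e] by (simp add: smooth_rep_def)
  obtain F where F: "eventually (\<lambda>x'. x' \<in> fst c \<longrightarrow> F x' = snd c x') (near N (f w))"
    "\<And>j. j < k \<Longrightarrow> smooth_germ (mdim N) (snd e (f w)) (\<lambda>y. F (chart_inv e y) j)"
    using sub_chart_ext[OF N cc(3,2) e] by blast
  have Fe: "eventually (\<lambda>w. f w \<in> fst c \<longrightarrow> F (f w) = snd c (f w)) (near W w)"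
    by (rule smooth_at_tendsto[OF W N f F(1)])
  have ev: "eventually (\<lambda>y. f (chart_inv a y) \<in> fst c \<and> f (chart_inv a y) \<in> fst e \<and> F (f (chart_inv a y)) = snd c (f (chart_inv a y)))
     (nhdsE (mdim W) (snd a w))"
    using chart_eventually2[OF aa(1,2) inc] chart_eventually2[OF aa(1,2) ine] chart_eventually2[OF aa(1,2) Fe]
    by eventually_elim simp
  have v: "vgerm (mdim W) (mdim N) (snd a w) (chart_rep a e f)"
    using smooth_at_rep[OF W N f a e] by (simp add: smooth_rep_def)
  have ax: "chart_rep a e f (snd a w) = snd e (f w)" by (simp add: chart_rep_def chart_inv_left[OF aa(1,2)])
  have "vgerm (mdim W) k (snd a w) (chart_rep a c f)"
    unfolding vgerm_def
  proof (intro conjI allI impI)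
    show "snd a w \<in> ES (mdim W)" by (rule chart_ES[OF aa(1,2)])
    show "\<forall>\<^sub>F z in nhdsE (mdim W) (snd a w). chart_rep a c f z \<in> ES k"
      using ev by eventually_elim (use chart_ES[OF cc(1)] in \<open>simp add: chart_rep_def submanifold_simps\<close>)
    fix j assume j: "j < k"
    have "smooth_germ (mdim W) (snd a w) (\<lambda>y. F (chart_inv e (chart_rep a e f y)) j)"
      by (rule smooth_germ_compose[OF v]) (simp add: ax F(2)[OF j])
    then show "smooth_germ (mdim W) (snd a w) (\<lambda>z. chart_rep a c f z j)"
      by (rule smooth_germ_cong[rotated])
         (use ev in eventually_elim, simp add: chart_rep_def chart_inv_left[OF ee(1)])
  qed
  then show ?thesis
    by (intro smooth_atI[of _ _ _ _ a c]) (use a c inc in \<open>simp add: smooth_rep_def submanifold_simps\<close>)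
qed

text \<open>
  To exhibit a chart it suffices to have germs at one point: a smooth \<open>\<xi>\<close> on the ambient manifold and a smooth
  parametrization \<open>\<kappa>\<close> of \<open>S\<close> that are inverse to each other on \<open>S\<close>. All conditions are open, so they hold on a common
  neighbourhood.
\<close>

lemma submanifold_chart:
  assumes N: "mfd N" and x0: "x0 \<in> S" and \<xi>: "smooth_at N (euc k) \<xi> x0" and \<kappa>: "smooth_at (euc k) N \<kappa> (\<xi> x0)"
    and 1: "eventually (\<lambda>x. x \<in> S \<longrightarrow> \<kappa> (\<xi> x) = x) (near N x0)"
    and 2: "eventually (\<lambda>w. \<kappa> w \<in> S \<and> \<xi> (\<kappa> w) = w) (nhdsE k (\<xi> x0))"
  shows "\<exists>c\<in>atlas (submanifold N S k). x0 \<in> fst c"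
proof -
  have x0N: "x0 \<in> points N" "\<xi> x0 \<in> ES k" using smooth_at_points[OF N mfd_euc \<xi>] by (auto simp: euc_simps)
  have ev1: "eventually (\<lambda>x. (x \<in> S \<longrightarrow> \<kappa> (\<xi> x) = x) \<and> smooth_at N (euc k) \<xi> x) (near N x0)"
    using 1 smooth_at_eventually[OF N mfd_euc \<xi>] by eventually_elim simp
  obtain O' where O': "openin (mtop N) O'" "x0 \<in> O'"
    "\<And>x. x \<in> O' \<Longrightarrow> (x \<in> S \<longrightarrow> \<kappa> (\<xi> x) = x) \<and> smooth_at N (euc k) \<xi> x"
    using eventually_nhdsinE[OF ev1 x0N(1)[unfolded points_def]] by blast
  then have O: "openin (mtop N) O'" "x0 \<in> O'" "\<And>x. x \<in> O' \<Longrightarrow> x \<in> S \<Longrightarrow> \<kappa> (\<xi> x) = x"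
    "\<And>x. x \<in> O' \<Longrightarrow> smooth_at N (euc k) \<xi> x" by blast+
  have ev2: "eventually (\<lambda>w. (\<kappa> w \<in> S \<and> \<xi> (\<kappa> w) = w) \<and> smooth_at (euc k) N \<kappa> w) (nhdsE k (\<xi> x0))"
    using 2 smooth_at_eventually[OF mfd_euc N \<kappa>] unfolding euc_simps by eventually_elim simp
  obtain Y where "openin (Euclidean_space k) Y" "\<xi> x0 \<in> Y"
    "\<And>w. w \<in> Y \<Longrightarrow> (\<kappa> w \<in> S \<and> \<xi> (\<kappa> w) = w) \<and> smooth_at (euc k) N \<kappa> w"
    using eventually_nhdsinE[OF ev2 x0N(2)] by blast
  then have Y: "openin (Euclidean_space k) Y" "\<xi> x0 \<in> Y" "\<And>w. w \<in> Y \<Longrightarrow> \<kappa> w \<in> S"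
    "\<And>w. w \<in> Y \<Longrightarrow> \<xi> (\<kappa> w) = w" "\<And>w. w \<in> Y \<Longrightarrow> smooth_at (euc k) N \<kappa> w" by blast+
  have YE: "Y \<subseteq> ES k" by (rule openin_ES_subset[OF Y(1)])
  \<comment> \<open>\<open>Z\<close> is the ambient domain of \<open>\<xi>\<close> and \<open>U\<close> that of the chart of \<open>S\<close>\<close>
  define Z where "Z = {x \<in> O'. \<xi> x \<in> Y}"
  define U where "U = Z \<inter> S"
  have OU: "x \<in> O'" "x \<in> S" "\<xi> x \<in> Y" "\<kappa> (\<xi> x) = x" "x \<in> topspace (mtop N)" if "x \<in> U" for x
    using that O(1,3) openin_subset by (auto simp: U_def Z_def)
  have tend: "eventually (\<lambda>x. P (\<xi> x)) (near N x)" if "x \<in> O'" "eventually P (nhdsE k (\<xi> x))" for x P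
    using smooth_at_tendsto[OF N mfd_euc O(4)[OF that(1)], of P] that(2) by (simp add: euc_simps)
  have tendk: "eventually (\<lambda>w. P (\<kappa> w)) (nhdsE k (\<xi> x))" if "x \<in> U" "eventually P (near N x)" for x P
    using smooth_at_tendsto[OF mfd_euc N Y(5)[OF OU(3)[OF that(1)]], of P] that(2) OU(4)[OF that(1)] by (simp add: euc_simps)
  have Zo: "openin (mtop N) Z"
  proof (rule openin_eventuallyI)
    fix x assume x: "x \<in> Z"
    then show "x \<in> topspace (mtop N)" using O(1) openin_subset by (auto simp: Z_def)
    have "eventually (\<lambda>x. x \<in> O') (near N x)" using x by (intro eventually_nhdsin_in[OF O(1)]) (simp add: Z_def)
    moreover have "eventually (\<lambda>x. \<xi> x \<in> Y) (near N x)"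
      by (rule tend) (use x Y(1) in \<open>auto simp: Z_def intro: eventually_nhdsin_in\<close>)
    ultimately show "eventually (\<lambda>y. y \<in> Z) (near N x)" by eventually_elim (simp add: Z_def)
  qed
  have Uo: "openin (subtopology (mtop N) S) U" unfolding U_def by (rule openin_subtopology_Int[OF Zo])
  have V: "eventually (\<lambda>w. w \<in> \<xi> ` U) (nhdsE k (\<xi> x))" if x: "x \<in> U" for x
  proof -
    have "eventually (\<lambda>w. w \<in> Y) (nhdsE k (\<xi> x))" by (rule eventually_nhdsin_in[OF Y(1) OU(3)[OF x]])
    moreover have "eventually (\<lambda>w. \<kappa> w \<in> O') (nhdsE k (\<xi> x))"
      by (rule tendk[OF x eventually_nhdsin_in[OF O(1) OU(1)[OF x]]])
    ultimately show ?thesis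
    proof eventually_elim
      case (elim w)
      then have "\<kappa> w \<in> U" "w = \<xi> (\<kappa> w)" using Y(3,4) by (auto simp: U_def Z_def)
      then show ?case by blast
    qed
  qed
  have ch: "chart_on (subtopology (mtop N) S) k (U, \<xi>)"
  proof (rule chart_onI[where k = \<kappa>])
    show "openin (subtopology (mtop N) S) U" by (rule Uo)
    fix x assume x: "x \<in> U"
    show "\<xi> x \<in> ES k" using OU[OF x] YE by blast
    show "\<kappa> (\<xi> x) = x" by (rule OU(4)[OF x])
    show "eventually (\<lambda>w. w \<in> \<xi> ` U) (nhdsE k (\<xi> x))" by (rule V[OF x])
    fix P
    {
      assume "eventually P (nhdsE k (\<xi> x))"
      then show "eventually (\<lambda>x. P (\<xi> x)) (nhdsin (subtopology (mtop N) S) x)"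
        by (intro eventually_nhdsin_subtopology tend OU(1,5)[OF x])
    next
      assume Pev: "eventually P (nhdsin (subtopology (mtop N) S) x)"
      have xS: "x \<in> topspace (subtopology (mtop N) S)" using OU[OF x] by simp
      obtain T where T: "openin (subtopology (mtop N) S) T" "x \<in> T" "\<And>y. y \<in> T \<Longrightarrow> P y"
        using eventually_nhdsinE[OF Pev xS] by metis
      obtain T' where T': "openin (mtop N) T'" "T = T' \<inter> S" using T(1) by (auto simp: openin_subtopology)
      have "eventually (\<lambda>w. \<kappa> w \<in> T') (nhdsE k (\<xi> x))"
        by (rule tendk[OF x eventually_nhdsin_in[OF T'(1)]]) (use T(2) T'(2) in simp)
      moreover have "eventually (\<lambda>w. w \<in> Y) (nhdsE k (\<xi> x))" by (rule eventually_nhdsin_in[OF Y(1) OU(3)[OF x]])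
      ultimately show "eventually (\<lambda>w. P (\<kappa> w)) (nhdsE k (\<xi> x))"
        by eventually_elim (rule T(3), simp add: T'(2) Y(3))
    }
  qed
  have "(U, \<xi>) \<in> atlas (submanifold N S k)"
    unfolding submanifold_atlas fst_conv snd_conv
  proof (intro conjI ballI allI impI ch)
    fix x assume x: "x \<in> U"
    show "\<exists>W f. openin (mtop N) W \<and> x \<in> W \<and> (\<forall>j<k. smooth_fun_on N W (\<lambda>y. f y j)) \<and> (\<forall>y\<in>W \<inter> U. f y = \<xi> y)"
    proof (intro exI[of _ Z] exI[of _ \<xi>] conjI allI impI ballI)
      show "openin (mtop N) Z" by (rule Zo)
      show "x \<in> Z" using x by (simp add: U_def)
      fix j assume j: "j < k"
      show "smooth_fun_on N Z (\<lambda>y. \<xi> y j)"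
        unfolding smooth_fun_on_def
      proof (intro ballI smooth_onI_germ)
        fix c assume c: "c \<in> atlas N"
        have cch: "chart_on (mtop N) (mdim N) c" using N c by (simp add: mfd_def)
        show "openin (Euclidean_space (mdim N)) (snd c ` (fst c \<inter> Z))" by (rule chart_image_open[OF cch Zo])
        fix y assume "y \<in> snd c ` (fst c \<inter> Z)"
        then obtain z where z: "z \<in> fst c" "z \<in> Z" "y = snd c z" by blast
        have "smooth_at N (euc k) \<xi> z" using z(2) O(4) by (simp add: Z_def)
        then have "vgerm (mdim N) k (snd c z) (\<lambda>y. \<xi> (chart_inv c y))"
          using smooth_at_to_euc[OF N, of c z k \<xi>] c z(1) by (simp add: charts_at_def)
        then show "smooth_germ (mdim N) y (\<lambda>y. \<xi> (chart_inv c y) j)" using j z(3) by (simp add: vgerm_def)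
      qed
    qed auto
  next
    fix d j assume d: "d \<in> atlas N" and j: "j < mdim N"
    have dch: "chart_on (mtop N) (mdim N) d" using N d by (simp add: mfd_def)
    show "smooth_on k (\<xi> ` (U \<inter> fst d)) (\<lambda>y. snd d (chart_inv (U, \<xi>) y) j)"
    proof (rule smooth_onI_germ)
      have "openin (Euclidean_space k) (snd (U, \<xi>) ` (fst (U, \<xi>) \<inter> (fst d \<inter> S)))"
        by (rule chart_image_open[OF ch openin_subtopology_Int[OF chart_dom_open[OF dch]]])
      moreover have "U \<inter> (fst d \<inter> S) = U \<inter> fst d" by (auto simp: U_def)
      ultimately show "openin (Euclidean_space k) (\<xi> ` (U \<inter> fst d))" by simp
      fix y assume "y \<in> \<xi> ` (U \<inter> fst d)"
      then obtain x where x: "x \<in> U" "x \<in> fst d" "y = \<xi> x" by blast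
      have dx: "d \<in> charts_at N x" using d x(2) by (simp add: charts_at_def)
      have "smooth_at (euc k) (euc (mdim N)) (\<lambda>w. snd d (\<kappa> w)) (\<xi> x)"
        by (rule smooth_at_compose[OF mfd_euc N mfd_euc Y(5)[OF OU(3)[OF x(1)]]])
           (simp add: OU(4)[OF x(1)] smooth_at_chart[OF N dx])
      then have g: "smooth_germ k (\<xi> x) (\<lambda>w. snd d (\<kappa> w) j)" using j by (simp add: smooth_at_euc vgerm_def)
      have "eventually (\<lambda>w. snd d (\<kappa> w) j = snd d (chart_inv (U, \<xi>) w) j) (nhdsE k (\<xi> x))"
        using V[OF x(1)]
      proof eventually_elim
        case (elim w)
        then obtain x' where "x' \<in> U" "w = \<xi> x'" by blast
        then show ?case using chart_inv_left[OF ch, of x'] OU(4)[of x'] by simp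
      qed
      from smooth_germ_cong[OF this g] show "smooth_germ k y (\<lambda>y. snd d (chart_inv (U, \<xi>) y) j)" using x(3) by simp
    qed
  qed
  moreover have "x0 \<in> U" using O(2) Y(2) x0 by (simp add: U_def Z_def)
  ultimately show ?thesis by force
qed

text \<open>
  Coordinates on a fibre product along a submersion \<open>f\<close>: straighten \<open>f\<close> around \<open>a0\<close>. In a pair \<open>(a, b)\<close> with \<open>f a = g b\<close>
  the first coordinates of \<open>a\<close> are those of \<open>g b\<close>, so the remaining ones together with the coordinates of
  \<open>b\<close> parametrize the fibre product. The map \<open>\<xi>\<close> reads off these coordinates and \<open>\<kappa>\<close> rebuilds the pair.
\<close>

lemma fibre_product_chart:
  assumes A: "mfd A" and B: "mfd B" and M: "mfd M" and f: "smooth_at A M f a0" and g: "smooth_at B M g b0"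
    and surj: "tangent_space M (f a0) \<subseteq> tmap A M f a0 ` tangent_space A a0" and fg: "f a0 = g b0"
    and S: "S = {(a, b). a \<in> points A \<and> b \<in> points B \<and> f a = g b}"
  shows "mdim M \<le> mdim A" "\<exists>c\<in>atlas (submanifold (prod_manifold A B) S (mdim A - mdim M + mdim B)). (a0, b0) \<in> fst c"
proof -
  let ?P = "prod_manifold A B" and ?n = "mdim A" and ?m = "mdim M" and ?l = "mdim B"
  have P: "mfd ?P" by (rule mfd_prod[OF A B])
  note pf = smooth_at_points[OF A M f] and pg = smooth_at_points[OF B M g]
  obtain ca where ca: "ca \<in> charts_at A a0" using points_chart[OF A pf(1)] .
  obtain cb where cb: "cb \<in> charts_at B b0" using points_chart[OF B pg(1)] .
  obtain e where e: "e \<in> charts_at M (f a0)" using points_chart[OF M pf(2)] .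
  note caa = mfd_chart[OF A ca] charts_at_in(1)[OF ca] and cbb = mfd_chart[OF B cb] charts_at_in(1)[OF cb]
    and ee = mfd_chart[OF M e] charts_at_in(1)[OF e]
  obtain \<phi> \<psi> where mn: "?m \<le> ?n" and ld: "local_diffeo ?n (snd ca a0) \<phi> \<psi>"
    and \<phi>: "\<And>j. j < ?m \<Longrightarrow> eventually (\<lambda>y. \<phi> y j = chart_rep ca e f y j) (nhdsE ?n (snd ca a0))"
    using submersion_adapted_coordinates[OF A M f surj ca e] by blast
  show "?m \<le> ?n" by (rule mn)
  define r where "r = ?n - ?m"
  have nm: "?m + r = ?n" using mn by (simp add: r_def)
  note ldd = ld[unfolded local_diffeo_def]
  define v0 where "v0 = \<phi> (snd ca a0)"
  have v0: "v0 \<in> ES ?n" "\<psi> v0 = snd ca a0" using ldd vgerm_ES local_diffeo_inv[OF ld] by (auto simp: v0_def)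
  have s\<phi>: "smooth_at (euc ?n) (euc ?n) \<phi> (snd ca a0)" and s\<psi>: "smooth_at (euc ?n) (euc ?n) \<psi> v0"
    using ldd by (auto simp: smooth_at_euc v0_def)
  have dE: "drop_c ?m v0 \<in> ES r" using drop_ES[of v0 ?m r] v0(1) nm by simp
  have dropjoin: "join ?m x (drop_c ?m y) = y" if "\<And>j. j < ?m \<Longrightarrow> x j = y j" for x y :: "nat \<Rightarrow> real"
    using that by (auto simp: join_def drop_c_def)
  have "eventually (\<lambda>z. \<forall>j\<in>{..<?m}. \<phi> z j = chart_rep ca e f z j) (nhdsE ?n (snd ca a0))"
    by (rule eventually_ball_finite) (use \<phi> in auto)
  then have \<phi>all: "eventually (\<lambda>z. \<forall>j<?m. \<phi> z j = chart_rep ca e f z j) (nhdsE ?n (snd ca a0))"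
    by eventually_elim simp
  have \<phi>0: "v0 j = snd e (f a0) j" if "j < ?m" for j
  proof -
    have "\<phi> (snd ca a0) j = chart_rep ca e f (snd ca a0) j"
      using eventually_nhdsin_self[OF chart_ES[OF caa] \<phi>all] that by blast
    then show ?thesis by (simp add: v0_def chart_rep_def chart_inv_left[OF caa])
  qed
  define \<xi> where "\<xi> z = join r (drop_c ?m (\<phi> (snd ca (fst z)))) (snd cb (snd z))" for z
  define \<beta> where "\<beta> w = chart_inv cb (drop_c r w)" for w
  define v where "v w = join ?m (snd e (g (\<beta> w))) (take_c r w)" for w
  define \<alpha> where "\<alpha> w = chart_inv ca (\<psi> (v w))" for w
  define \<kappa> where "\<kappa> w = (\<alpha> w, \<beta> w)" for w
  define w0 where "w0 = \<xi> (a0, b0)"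
  have w0: "take_c r w0 = drop_c ?m v0" "drop_c r w0 = snd cb b0" "w0 \<in> ES (r + ?l)"
    using take_join[OF dE] drop_join join_ES[OF dE chart_ES[OF cbb]] by (auto simp: w0_def \<xi>_def v0_def)
  have sfst: "smooth_at ?P A fst (a0, b0)" by (rule smooth_at_fst[OF A B pf(1) pg(1)])
  have ssnd: "smooth_at ?P B snd (a0, b0)" by (rule smooth_at_snd[OF A B pf(1) pg(1)])
  have s1: "smooth_at ?P (euc ?n) (\<lambda>z. snd ca (fst z)) (a0, b0)"
    by (rule smooth_at_compose[OF P A mfd_euc sfst]) (simp add: smooth_at_chart[OF A ca])
  have s2: "smooth_at ?P (euc ?n) (\<lambda>z. \<phi> (snd ca (fst z))) (a0, b0)"
    by (rule smooth_at_compose[OF P mfd_euc mfd_euc s1]) (simp add: s\<phi>)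
  have s3: "smooth_at ?P (euc r) (\<lambda>z. drop_c ?m (\<phi> (snd ca (fst z)))) (a0, b0)"
    by (rule smooth_at_compose[OF P mfd_euc mfd_euc s2])
       (use smooth_at_drop[of v0 ?m r] v0(1) nm in \<open>simp add: v0_def\<close>)
  have s4: "smooth_at ?P (euc ?l) (\<lambda>z. snd cb (snd z)) (a0, b0)"
    by (rule smooth_at_compose[OF P B mfd_euc ssnd]) (simp add: smooth_at_chart[OF B cb])
  have s\<xi>: "smooth_at ?P (euc (r + ?l)) \<xi> (a0, b0)" unfolding \<xi>_def by (rule smooth_at_join[OF P s3 s4])
  let ?E = "euc (r + ?l)"
  have \<beta>0: "\<beta> w0 = b0" using w0(2) by (simp add: \<beta>_def chart_inv_left[OF cbb])
  have s\<beta>: "smooth_at ?E B \<beta> w0" unfolding \<beta>_def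
    by (rule smooth_at_compose[OF mfd_euc mfd_euc B smooth_at_drop[OF w0(3)]]) (simp add: w0(2) smooth_at_chart_inv[OF B cb])
  have sg: "smooth_at ?E M (\<lambda>w. g (\<beta> w)) w0"
    by (rule smooth_at_compose[OF mfd_euc B M s\<beta>]) (simp add: \<beta>0 g)
  have seg: "smooth_at ?E (euc ?m) (\<lambda>w. snd e (g (\<beta> w))) w0"
    by (rule smooth_at_compose[OF mfd_euc M mfd_euc sg]) (simp add: \<beta>0 fg[symmetric] smooth_at_chart[OF M e])
  have sv: "smooth_at ?E (euc ?n) v w0"
    unfolding v_def using smooth_at_join[OF mfd_euc seg smooth_at_take[OF w0(3)]] nm by simp
  have v0': "v w0 = v0" unfolding v_def w0(1) \<beta>0 by (rule dropjoin) (use \<phi>0 fg in simp)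
  have s\<psi>v: "smooth_at ?E (euc ?n) (\<lambda>w. \<psi> (v w)) w0"
    by (rule smooth_at_compose[OF mfd_euc mfd_euc mfd_euc sv]) (simp add: v0' s\<psi>)
  have s\<alpha>: "smooth_at ?E A \<alpha> w0" unfolding \<alpha>_def
    by (rule smooth_at_compose[OF mfd_euc mfd_euc A s\<psi>v]) (simp add: v0' v0(2) smooth_at_chart_inv[OF A ca])
  have \<alpha>0: "\<alpha> w0 = a0" by (simp add: \<alpha>_def v0' v0(2) chart_inv_left[OF caa])
  have s\<kappa>: "smooth_at ?E ?P \<kappa> w0" unfolding \<kappa>_def by (rule smooth_at_Pair[OF mfd_euc A B s\<alpha> s\<beta>])
  have evA: "eventually (\<lambda>a. a \<in> fst ca) (near A a0)" by (rule eventually_nhdsin_in[OF chart_dom_open[OF caa(1)] caa(2)])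
  have evB: "eventually (\<lambda>b. b \<in> fst cb) (near B b0)" by (rule eventually_nhdsin_in[OF chart_dom_open[OF cbb(1)] cbb(2)])
  have evM: "eventually (\<lambda>b. b \<in> fst e) (near M (f a0))" by (rule eventually_nhdsin_in[OF chart_dom_open[OF ee(1)] ee(2)])
  have evE: "eventually (\<lambda>w. w \<in> ES ?n) (nhdsE ?n v0)" by (rule eventually_ES[OF v0(1)])
  have A1: "eventually (\<lambda>z. \<psi> (\<phi> (snd ca (fst z))) = snd ca (fst z)) (near ?P (a0, b0))"
    by (rule smooth_at_tendsto[OF P mfd_euc s1]) (use ldd in \<open>simp add: euc_simps\<close>)
  have A2: "eventually (\<lambda>z. \<forall>j<?m. \<phi> (snd ca (fst z)) j = chart_rep ca e f (snd ca (fst z)) j) (near ?P (a0, b0))"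
    by (rule smooth_at_tendsto[OF P mfd_euc s1]) (use \<phi>all in \<open>simp add: euc_simps\<close>)
  have A3: "eventually (\<lambda>z. fst z \<in> fst ca) (near ?P (a0, b0))" by (rule smooth_at_tendsto[OF P A sfst]) (simp add: evA)
  have A4: "eventually (\<lambda>z. snd z \<in> fst cb) (near ?P (a0, b0))" by (rule smooth_at_tendsto[OF P B ssnd]) (simp add: evB)
  have A5: "eventually (\<lambda>z. \<phi> (snd ca (fst z)) \<in> ES ?n) (near ?P (a0, b0))"
    by (rule smooth_at_tendsto[OF P mfd_euc s2]) (use evE in \<open>simp add: euc_simps v0_def\<close>)
  have 1: "eventually (\<lambda>z. z \<in> S \<longrightarrow> \<kappa> (\<xi> z) = z) (near ?P (a0, b0))"
    using A1 A2 A3 A4 A5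
  proof eventually_elim
    case (elim z)
    obtain a b where z: "z = (a, b)" by fastforce
    show ?case
    proof
      assume "z \<in> S"
      then have ab: "f a = g b" unfolding S z by simp
      have b: "\<beta> (\<xi> z) = b" using elim(4) by (simp add: \<beta>_def \<xi>_def drop_join z chart_inv_left[OF cbb(1)])
      have "drop_c ?m (\<phi> (snd ca a)) \<in> ES r" using drop_ES[of "\<phi> (snd ca a)" ?m r] elim(5) nm z by simp
      then have "take_c r (\<xi> z) = drop_c ?m (\<phi> (snd ca a))" by (simp add: \<xi>_def z take_join)
      then have "v (\<xi> z) = join ?m (snd e (f a)) (drop_c ?m (\<phi> (snd ca a)))" by (simp add: v_def b ab)
      also have "\<dots> = \<phi> (snd ca a)"
        by (rule dropjoin) (use elim(2,3) z in \<open>simp add: chart_rep_def chart_inv_left[OF caa(1)]\<close>)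
      finally have "\<alpha> (\<xi> z) = a" using elim(1,3) z by (simp add: \<alpha>_def chart_inv_left[OF caa(1)])
      then show "\<kappa> (\<xi> z) = z" using b by (simp add: \<kappa>_def z)
    qed
  qed
  have tE: "eventually (\<lambda>w. Q (h w)) (nhdsE (r + ?l) w0)"
    if "smooth_at ?E (euc k) h w0" "eventually Q (nhdsE k (h w0))" for h k Q
    using smooth_at_tendsto[OF mfd_euc mfd_euc that(1), of Q] that(2) by (simp add: euc_simps)
  have tN: "eventually (\<lambda>w. Q (h w)) (nhdsE (r + ?l) w0)"
    if "mfd K" "smooth_at ?E K h w0" "eventually Q (near K (h w0))" for h Q and K :: "'x manifold"
    using smooth_at_tendsto[OF mfd_euc that(1,2), of Q] that(3) by (simp add: euc_simps)
  have B1: "eventually (\<lambda>w. \<phi> (\<psi> (v w)) = v w) (nhdsE (r + ?l) w0)"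
    by (rule tE[OF sv]) (use ldd v0' v0_def in simp)
  have B2: "eventually (\<lambda>w. \<forall>j<?m. \<phi> (\<psi> (v w)) j = chart_rep ca e f (\<psi> (v w)) j) (nhdsE (r + ?l) w0)"
    by (rule tE[OF s\<psi>v, of "\<lambda>z. \<forall>j<?m. \<phi> z j = chart_rep ca e f z j"]) (use \<phi>all v0' v0(2) in simp)
  have B3: "eventually (\<lambda>w. chart_inv ca (\<psi> (v w)) \<in> fst ca \<and> snd ca (chart_inv ca (\<psi> (v w))) = \<psi> (v w)) (nhdsE (r + ?l) w0)"
    by (rule tE[OF s\<psi>v, of "\<lambda>z. chart_inv ca z \<in> fst ca \<and> snd ca (chart_inv ca z) = z"])
       (use chart_eventually_dom[OF caa] v0' v0(2) in \<open>auto elim: eventually_mono\<close>)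
  have B4: "eventually (\<lambda>w. chart_inv cb (drop_c r w) \<in> fst cb \<and> snd cb (chart_inv cb (drop_c r w)) = drop_c r w) (nhdsE (r + ?l) w0)"
    by (rule tE[OF smooth_at_drop[OF w0(3)], of "\<lambda>z. chart_inv cb z \<in> fst cb \<and> snd cb (chart_inv cb z) = z"])
       (use chart_eventually_dom[OF cbb] w0(2) in \<open>auto elim: eventually_mono\<close>)
  have B5: "eventually (\<lambda>w. g (\<beta> w) \<in> fst e) (nhdsE (r + ?l) w0)"
    using smooth_at_tendsto[OF mfd_euc M sg, of "\<lambda>b. b \<in> fst e"] evM \<beta>0 fg by (simp add: euc_simps)
  have sf: "smooth_at ?E M (\<lambda>w. f (\<alpha> w)) w0" by (rule smooth_at_compose[OF mfd_euc A M s\<alpha>]) (simp add: \<alpha>0 f)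
  have B6: "eventually (\<lambda>w. f (\<alpha> w) \<in> fst e) (nhdsE (r + ?l) w0)"
    using smooth_at_tendsto[OF mfd_euc M sf, of "\<lambda>b. b \<in> fst e"] evM \<alpha>0 by (simp add: euc_simps)
  have 2: "eventually (\<lambda>w. \<kappa> w \<in> S \<and> \<xi> (\<kappa> w) = w) (nhdsE (r + ?l) w0)"
    using B1 B2 B3 B4 B5 B6
  proof eventually_elim
    case (elim w)
    have "snd e (f (\<alpha> w)) = snd e (g (\<beta> w))"
    proof (rule ES_eqI[of _ ?m])
      show "snd e (f (\<alpha> w)) \<in> ES ?m" "snd e (g (\<beta> w)) \<in> ES ?m" using elim chart_ES[OF ee(1)] by auto
      fix j assume j: "j < ?m"
      have "snd e (f (\<alpha> w)) j = \<phi> (\<psi> (v w)) j" using elim(2) j by (simp add: chart_rep_def \<alpha>_def)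
      also have "\<dots> = v w j" using elim(1) by simp
      finally show "snd e (f (\<alpha> w)) j = snd e (g (\<beta> w)) j" using j by (simp add: v_def join_def)
    qed
    then have "f (\<alpha> w) = g (\<beta> w)" using chart_inj[OF ee(1)] elim(5,6) by (simp add: inj_on_eq_iff)
    moreover have "\<alpha> w \<in> points A" "\<beta> w \<in> points B"
      using elim(3,4) chart_dom_sub[OF caa(1)] chart_dom_sub[OF cbb(1)] by (auto simp: \<alpha>_def \<beta>_def points_def)
    ultimately have "\<kappa> w \<in> S" unfolding S \<kappa>_def by simp
    moreover have "\<xi> (\<kappa> w) = w"
    proof -
      have "\<phi> (snd ca (\<alpha> w)) = v w" using elim(1,3) by (simp add: \<alpha>_def)
      moreover have "snd cb (\<beta> w) = drop_c r w" using elim(4) by (simp add: \<beta>_def)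
      ultimately show ?thesis by (simp add: \<xi>_def \<kappa>_def v_def drop_join join_take_drop)
    qed
    ultimately show ?case by simp
  qed
  show "\<exists>c\<in>atlas (submanifold ?P S (mdim A - mdim M + mdim B)). (a0, b0) \<in> fst c"
    unfolding r_def[symmetric]
  proof (rule submanifold_chart[OF P _ s\<xi> _ 1])
    show "(a0, b0) \<in> S" unfolding S using pf pg fg by simp
    show "smooth_at ?E ?P \<kappa> (\<xi> (a0, b0))" using s\<kappa> by (simp add: w0_def)
    show "\<forall>\<^sub>F w in nhdsE (r + ?l) (\<xi> (a0, b0)). \<kappa> w \<in> S \<and> \<xi> (\<kappa> w) = w" using 2 by (simp add: w0_def)
  qed
qed

section \<open>Lie groupoids\<close>

locale lie_gpd =
  fixes G :: "('g, 'm) groupoid_data"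
  assumes lie_groupoid: "lie_groupoid G"
begin

abbreviation "Arr \<equiv> arrows G"
abbreviation "Bas \<equiv> base G"
abbreviation "Cmp \<equiv> composable_manifold G"

lemma mfd_Arr: "mfd Arr" using lie_groupoid by (simp add: lie_groupoid_def smooth_atlas_mfd)
lemma mfd_Bas: "mfd Bas" using lie_groupoid by (simp add: lie_groupoid_def smooth_manifold_def smooth_atlas_mfd)

lemma src_at: "g \<in> points Arr \<Longrightarrow> smooth_at Arr Bas (src G) g"
  and tgt_at: "g \<in> points Arr \<Longrightarrow> smooth_at Arr Bas (tgt G) g"
  and inv_at: "g \<in> points Arr \<Longrightarrow> smooth_at Arr Arr (inv_arr G) g"
  and unit_at: "x \<in> points Bas \<Longrightarrow> smooth_at Bas Arr (unit_arr G) x"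
  using lie_groupoid smooth_map_at mfd_Arr mfd_Bas by (auto simp: lie_groupoid_def submersion_def)

lemma src_surj: "g \<in> points Arr \<Longrightarrow> tmap Arr Bas (src G) g ` tangent_space Arr g = tangent_space Bas (src G g)"
  and tgt_surj: "g \<in> points Arr \<Longrightarrow> tmap Arr Bas (tgt G) g ` tangent_space Arr g = tangent_space Bas (tgt G g)"
  using lie_groupoid by (auto simp: lie_groupoid_def submersion_def)

lemma src_in: "g \<in> points Arr \<Longrightarrow> src G g \<in> points Bas"
  and tgt_in: "g \<in> points Arr \<Longrightarrow> tgt G g \<in> points Bas"
  and inv_in: "g \<in> points Arr \<Longrightarrow> inv_arr G g \<in> points Arr"
  and unit_in: "x \<in> points Bas \<Longrightarrow> unit_arr G x \<in> points Arr"
  using smooth_at_points(2)[OF mfd_Arr mfd_Bas src_at] smooth_at_points(2)[OF mfd_Arr mfd_Bas tgt_at]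
    smooth_at_points(2)[OF mfd_Arr mfd_Arr inv_at] smooth_at_points(2)[OF mfd_Bas mfd_Arr unit_at] by blast+

lemma composableI: "g \<in> points Arr \<Longrightarrow> h \<in> points Arr \<Longrightarrow> src G g = tgt G h \<Longrightarrow> (g, h) \<in> composable G"
  by (simp add: composable_def)

text \<open>
  Since the source map is a submersion, the space of composable pairs is a fibre product.
\<close>

lemma mfd_Cmp: "mfd Cmp" and points_Cmp: "points Cmp = composable G"
proof -
  have P: "mfd (prod_manifold Arr Arr)" by (rule mfd_prod[OF mfd_Arr mfd_Arr])
  have S: "composable G = {(a, b). a \<in> points Arr \<and> b \<in> points Arr \<and> src G a = tgt G b}"
    by (simp add: composable_def)
  show "mfd Cmp"
    unfolding composable_manifold_def
  proof (rule mfd_submanifold[OF P])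
    fix z assume "z \<in> composable G"
    then obtain g h where z: "z = (g, h)" "g \<in> points Arr" "h \<in> points Arr" "src G g = tgt G h"
      by (auto simp: composable_def)
    have sj: "tangent_space Bas (src G g) \<subseteq> tmap Arr Bas (src G) g ` tangent_space Arr g"
      using src_surj[OF z(2)] by simp
    note * = fibre_product_chart[OF mfd_Arr mfd_Arr mfd_Bas src_at[OF z(2)] tgt_at[OF z(3)] sj z(4) S]
    have "mdim Arr - mdim Bas + mdim Arr = 2 * mdim Arr - mdim Bas" using *(1) by simp
    then show "\<exists>c\<in>atlas (submanifold (prod_manifold Arr Arr) (composable G) (2 * mdim Arr - mdim Bas)). z \<in> fst c"
      using *(2) z(1) by simp
  qed
  show "points Cmp = composable G"
    by (auto simp: composable_manifold_def submanifold_simps prod_manifold_simps composable_def)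
qed

lemma mult_at: "(g, h) \<in> composable G \<Longrightarrow> smooth_at Cmp Arr (\<lambda>(g, h). cmp G g h) (g, h)"
  using lie_groupoid smooth_map_at[OF mfd_Cmp mfd_Arr] by (auto simp: lie_groupoid_def points_Cmp)

lemma cmp_in: "g \<in> points Arr \<Longrightarrow> h \<in> points Arr \<Longrightarrow> src G g = tgt G h \<Longrightarrow> cmp G g h \<in> points Arr"
  using smooth_at_points(2)[OF mfd_Cmp mfd_Arr mult_at] composableI by fastforce

text \<open>
  Together with smoothness of the multiplication this is how products of families of arrows are differentiated.
\<close>

lemma pair_at:
  assumes W: "mfd W" and f: "smooth_at W Arr f w" and g: "smooth_at W Arr g w"
    and c: "eventually (\<lambda>w. src G (f w) = tgt G (g w)) (near W w)"
  shows "smooth_at W Cmp (\<lambda>w. (f w, g w)) w"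
  unfolding composable_manifold_def
proof (rule smooth_at_into_submanifold[OF W mfd_prod[OF mfd_Arr mfd_Arr] _ smooth_at_Pair[OF W mfd_Arr mfd_Arr f g]])
  show "mfd (submanifold (prod_manifold Arr Arr) (composable G) (2 * mdim Arr - mdim Bas))"
    using mfd_Cmp by (simp add: composable_manifold_def)
  have "eventually (\<lambda>w. smooth_at W Arr f w) (near W w)" "eventually (\<lambda>w. smooth_at W Arr g w) (near W w)"
    using smooth_at_eventually[OF W mfd_Arr] f g by auto
  then show "eventually (\<lambda>w. (f w, g w) \<in> composable G) (near W w)"
    using c by eventually_elim (auto intro!: composableI smooth_at_points(2)[OF W mfd_Arr])
qed

lemma cmp_at:
  assumes W: "mfd W" and f: "smooth_at W Arr f w" and g: "smooth_at W Arr g w"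
    and c: "eventually (\<lambda>w. src G (f w) = tgt G (g w)) (near W w)"
  shows "smooth_at W Arr (\<lambda>w. cmp G (f w) (g w)) w"
proof -
  note p = pair_at[OF assms]
  have "(f w, g w) \<in> composable G" using smooth_at_points(2)[OF W mfd_Cmp p] points_Cmp by simp
  then show ?thesis using smooth_at_compose[OF W mfd_Cmp mfd_Arr p mult_at] by simp
qed

lemma src_cmp: "g \<in> points Arr \<Longrightarrow> h \<in> points Arr \<Longrightarrow> src G g = tgt G h \<Longrightarrow> src G (cmp G g h) = src G h"
  and tgt_cmp: "g \<in> points Arr \<Longrightarrow> h \<in> points Arr \<Longrightarrow> src G g = tgt G h \<Longrightarrow> tgt G (cmp G g h) = tgt G g"
  using lie_groupoid composableI[of g h] unfolding lie_groupoid_def by fastforce+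

lemma assoc: "g \<in> points Arr \<Longrightarrow> h \<in> points Arr \<Longrightarrow> k \<in> points Arr \<Longrightarrow> src G g = tgt G h \<Longrightarrow> src G h = tgt G k \<Longrightarrow>
   cmp G (cmp G g h) k = cmp G g (cmp G h k)"
  using lie_groupoid composableI unfolding lie_groupoid_def by blast

lemma unit_simps: "x \<in> points Bas \<Longrightarrow> src G (unit_arr G x) = x" "x \<in> points Bas \<Longrightarrow> tgt G (unit_arr G x) = x"
  using lie_groupoid unfolding lie_groupoid_def by blast+

lemma inv_simps: assumes "g \<in> points Arr"
  shows "cmp G (unit_arr G (tgt G g)) g = g" "cmp G g (unit_arr G (src G g)) = g"
    "src G (inv_arr G g) = tgt G g" "tgt G (inv_arr G g) = src G g"
    "cmp G g (inv_arr G g) = unit_arr G (tgt G g)" "cmp G (inv_arr G g) g = unit_arr G (src G g)"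
  using lie_groupoid assms unfolding lie_groupoid_def by blast+

lemma idem_unit: assumes "g \<in> points Arr" "src G g = tgt G g" "cmp G g g = g" shows "g = unit_arr G (src G g)"
proof -
  have "unit_arr G (src G g) = cmp G (inv_arr G g) (cmp G g g)" using inv_simps[OF assms(1)] assms(3) by simp
  also have "\<dots> = cmp G (cmp G (inv_arr G g) g) g" using assoc[of "inv_arr G g" g g] assms inv_in inv_simps by simp
  also have "\<dots> = g" using inv_simps[OF assms(1)] assms(2) by simp
  finally show ?thesis by simp
qed

lemma left_inverse_unique:
  assumes "g \<in> points Arr" "h \<in> points Arr" "src G h = tgt G g" "cmp G h g = unit_arr G (src G g)"
  shows "h = inv_arr G g"
proof -
  have "h = cmp G h (cmp G g (inv_arr G g))" using inv_simps[OF assms(1)] inv_simps(2)[OF assms(2)] assms(3) by simp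
  also have "\<dots> = cmp G (cmp G h g) (inv_arr G g)" using assoc[of h g "inv_arr G g"] assms inv_in inv_simps by simp
  also have "\<dots> = inv_arr G g" using inv_simps(1)[OF inv_in[OF assms(1)]] inv_simps[OF assms(1)] assms(4) by simp
  finally show ?thesis .
qed

lemma inv_unit: "x \<in> points Bas \<Longrightarrow> inv_arr G (unit_arr G x) = unit_arr G x"
  using left_inverse_unique[of "unit_arr G x" "unit_arr G x"] unit_in unit_simps inv_simps(1)[of "unit_arr G x"] by simp

lemma inv_cmp:
  assumes "g \<in> points Arr" "h \<in> points Arr" "src G g = tgt G h"
  shows "inv_arr G (cmp G g h) = cmp G (inv_arr G h) (inv_arr G g)"
proof (rule left_inverse_unique[symmetric])
  note i = inv_in[OF assms(1)] inv_in[OF assms(2)] inv_simps[OF assms(1)] inv_simps[OF assms(2)]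
  show "cmp G g h \<in> points Arr" using cmp_in assms by blast
  show "cmp G (inv_arr G h) (inv_arr G g) \<in> points Arr" using cmp_in i assms by simp
  show "src G (cmp G (inv_arr G h) (inv_arr G g)) = tgt G (cmp G g h)" using src_cmp tgt_cmp i assms by simp
  have "cmp G (cmp G (inv_arr G h) (inv_arr G g)) (cmp G g h) = cmp G (inv_arr G h) (cmp G (inv_arr G g) (cmp G g h))"
    using assoc[of "inv_arr G h" "inv_arr G g" "cmp G g h"] i assms cmp_in tgt_cmp by simp
  also have "cmp G (inv_arr G g) (cmp G g h) = cmp G (cmp G (inv_arr G g) g) h"
    using assoc[of "inv_arr G g" g h] i assms by simp
  also have "\<dots> = h" using i assms by simp
  finally show "cmp G (cmp G (inv_arr G h) (inv_arr G g)) (cmp G g h) = unit_arr G (src G (cmp G g h))"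
    using i src_cmp assms by simp
qed

end

section \<open>Open submanifolds\<close>

lemma open_submanifold_simps: "mtop (open_submanifold M U) = subtopology (mtop M) U"
  "mdim (open_submanifold M U) = mdim M" "points (open_submanifold M U) = points M \<inter> U"
  "c \<in> atlas M \<Longrightarrow> (fst c \<inter> U, snd c) \<in> atlas (open_submanifold M U)"
  by (auto simp: open_submanifold_def points_def)

lemma restrict_chart:
  assumes c: "chart_on X n c" and U: "openin X U"
  shows "chart_on (subtopology X U) n (fst c \<inter> U, snd c)"
    "x \<in> fst c \<inter> U \<Longrightarrow> eventually (\<lambda>z. chart_inv (fst c \<inter> U, snd c) z = chart_inv c z \<and> chart_inv c z \<in> U) (nhdsE n (snd c x))"
proof -
  have V: "eventually (\<lambda>z. z \<in> snd c ` (fst c \<inter> U)) (nhdsE n (snd c x))" if "x \<in> fst c \<inter> U" for x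
    by (rule eventually_nhdsin_in[OF chart_image_open[OF c U]]) (use that in blast)
  have sub: "fst c \<subseteq> topspace X" by (rule chart_dom_sub[OF c])
  show 1: "chart_on (subtopology X U) n (fst c \<inter> U, snd c)"
  proof (rule chart_onI[where k = "chart_inv c"])
    show "openin (subtopology X U) (fst c \<inter> U)" by (rule openin_subtopology_Int[OF chart_dom_open[OF c]])
    fix x assume x: "x \<in> fst c \<inter> U"
    then have xc: "x \<in> fst c" "x \<in> topspace X" using sub by auto
    show "snd c x \<in> ES n" by (rule chart_ES[OF c xc(1)])
    show "chart_inv c (snd c x) = x" by (rule chart_inv_left[OF c xc(1)])
    show "eventually (\<lambda>z. z \<in> snd c ` (fst c \<inter> U)) (nhdsE n (snd c x))" by (rule V[OF x])
    fix P
    {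
      assume "eventually P (nhdsE n (snd c x))"
      then show "eventually (\<lambda>x. P (snd c x)) (nhdsin (subtopology X U) x)"
        by (intro eventually_nhdsin_subtopology chart_eventually1[OF c xc(1)] xc(2))
    next
      assume P: "eventually P (nhdsin (subtopology X U) x)"
      have "x \<in> topspace (subtopology X U)" using x xc by simp
      from eventually_nhdsinE[OF P this] obtain T where T: "openin (subtopology X U) T" "x \<in> T" "\<And>y. y \<in> T \<Longrightarrow> P y" by metis
      have "openin X T" using T(1) U by (simp add: openin_open_subtopology)
      from chart_eventually2[OF c xc(1) eventually_nhdsin_in[OF this T(2)]]
      show "eventually (\<lambda>z. P (chart_inv c z)) (nhdsE n (snd c x))" by eventually_elim (rule T(3))
    }
  qed
  show "eventually (\<lambda>z. chart_inv (fst c \<inter> U, snd c) z = chart_inv c z \<and> chart_inv c z \<in> U) (nhdsE n (snd c x))"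
    if "x \<in> fst c \<inter> U" using V[OF that]
  proof eventually_elim
    case (elim z)
    then obtain y where y: "y \<in> fst c" "y \<in> U" "z = snd c y" by blast
    have "chart_inv (fst c \<inter> U, snd c) z = y" using chart_inv_left[OF 1, of y] y by simp
    moreover have "chart_inv c z = y" using chart_inv_left[OF c y(1)] y(3) by simp
    ultimately show ?case using y(2) by simp
  qed
qed

lemma mfd_open_submanifold:
  assumes M: "mfd M" and U: "openin (mtop M) U"
  shows "mfd (open_submanifold M U)"
proof (rule mfdI)
  let ?M = "open_submanifold M U"
  have at: "\<exists>c0\<in>atlas M. c = (fst c0 \<inter> U, snd c0)" if "c \<in> atlas ?M" for c
    using that by (auto simp: open_submanifold_def)
  have ch: "chart_on (mtop M) (mdim M) c" if "c \<in> atlas M" for c using M that by (simp add: mfd_def)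
  show "chart_on (mtop ?M) (mdim ?M) c" if c: "c \<in> atlas ?M" for c
    using at[OF c] restrict_chart(1)[OF ch U] by (auto simp: open_submanifold_simps)
  show "\<exists>c\<in>atlas ?M. x \<in> fst c" if x: "x \<in> points ?M" for x
  proof -
    have "x \<in> points M" using x by (simp add: open_submanifold_simps)
    then obtain c where c: "c \<in> charts_at M x" by (rule points_chart[OF M])
    then show ?thesis using x open_submanifold_simps(4)[of c M U]
      by (intro bexI[of _ "(fst c \<inter> U, snd c)"]) (auto simp: charts_at_def open_submanifold_simps(3))
  qed
  fix c d x assume c: "c \<in> atlas ?M" and d: "d \<in> atlas ?M" and x: "x \<in> fst c" "x \<in> fst d"
  obtain c0 where c0: "c0 \<in> atlas M" "c = (fst c0 \<inter> U, snd c0)" using at[OF c] by blast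
  obtain d0 where d0: "d0 \<in> atlas M" "d = (fst d0 \<inter> U, snd d0)" using at[OF d] by blast
  have v: "vgerm (mdim M) (mdim M) (snd c0 x) (chart_rep c0 d0 (\<lambda>x. x))"
    using smooth_rep_id[OF M, of c0 x d0] c0 d0 x by (simp add: smooth_rep_def charts_at_def)
  have "eventually (\<lambda>z. chart_rep c0 d0 (\<lambda>x. x) z = chart_rep c d (\<lambda>x. x) z) (nhdsE (mdim M) (snd c0 x))"
    using restrict_chart(2)[OF ch[OF c0(1)] U, of x] x(1) c0(2) d0(2) by (auto simp: chart_rep_def elim: eventually_mono)
  from vgerm_cong[OF this v] show "vgerm (mdim ?M) (mdim ?M) (snd c x) (chart_rep c d (\<lambda>x. x))"
    by (simp add: open_submanifold_simps c0(2))
qed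

lemma smooth_at_open_submanifold:
  assumes M: "mfd M" and U: "openin (mtop M) U" and x: "x \<in> points M" "x \<in> U" and N: "mfd N"
    and f: "smooth_at (open_submanifold M U) N f x"
  shows "smooth_at M N f x"
proof -
  let ?M = "open_submanifold M U"
  obtain c where c: "c \<in> charts_at M x" by (rule points_chart[OF M x(1)])
  note cc = mfd_chart[OF M c] charts_at_in[OF c]
  let ?d = "(fst c \<inter> U, snd c)"
  have d: "?d \<in> charts_at ?M x" using cc x open_submanifold_simps(4)[of c M U] by (simp add: charts_at_def)
  have "eventually (\<lambda>y. y \<in> fst c) (near M x)" by (rule eventually_nhdsin_in[OF chart_dom_open[OF cc(1)] cc(2)])
  then have "eventually (\<lambda>y. y \<in> fst ?d) (near M x)"
    using eventually_nhdsin_in[OF U x(2)] by eventually_elim simp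
  moreover have "chart_rep c ?d (\<lambda>x. x) = chart_rep c c (\<lambda>x. x)" by (simp add: chart_rep_def)
  ultimately have "smooth_rep M ?M (\<lambda>x. x) x c ?d"
    using smooth_rep_id[OF M c c] c d by (simp add: smooth_rep_def open_submanifold_simps)
  from smooth_at_compose[OF M mfd_open_submanifold[OF M U] N smooth_atI[OF this] f] show ?thesis .
qed

section \<open>Splitting along the orbits of an action\<close>

text \<open>
  Near \<open>x\<close> every point is recovered from its image under \<open>p\<close>, through the section \<open>\<theta>\<close>, and a parameter \<open>k y\<close> that
  acts on \<open>\<theta> (p y)\<close>. Differentiating \<open>y = a (k y) (\<theta> (p y))\<close> along a vector in the kernel of \<open>dp\<close>, the part through
  \<open>\<theta> (p y)\<close> vanishes and only the direction of the action remains.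
\<close>

lemma slice_split:
  assumes X: "mfd X" and Y: "mfd Y" and L: "mfd L"
    and p: "smooth_at X Y p x" and \<theta>: "smooth_at Y X \<theta> (p x)" and \<theta>x: "\<theta> (p x) = x"
    and k: "smooth_at X L k x" and a: "smooth_at (prod_manifold L X) X (\<lambda>(l, y). a l y) (k x, x)"
    and split: "eventually (\<lambda>y. a (k y) (\<theta> (p y)) = y) (near X x)"
    and v: "v \<in> tangent_space X x" and pv: "tmap X Y p x v = tzero"
  shows "v = tmap X X (\<lambda>y. a (k y) x) x v"
proof -
  have x: "x \<in> points X" using smooth_at_points[OF X Y p] by blast
  have r: "smooth_at X X (\<lambda>y. \<theta> (p y)) x" by (rule smooth_at_compose[OF X Y X p \<theta>])
  have a': "smooth_at (prod_manifold L X) X (\<lambda>(l, y). a l y) (k x, \<theta> (p x))" using a \<theta>x by simp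
  have ar: "smooth_at X X (\<lambda>y. a (k x) y) x"
  proof -
    have "smooth_at X L (\<lambda>_. k x) x" using smooth_at_const[OF X L x] smooth_at_points[OF X L k] by blast
    from smooth_at_two[OF X L X X a this smooth_at_id[OF X x]] show ?thesis by simp
  qed
  have "v = tmap X X (\<lambda>y. a (k y) (\<theta> (p y))) x v"
    using tmap_id_near[OF X x v split] by simp
  also have "\<dots> = tadd (tmap X X (\<lambda>y. a (k y) (\<theta> (p x))) x v) (tmap X X (\<lambda>y. a (k x) (\<theta> (p y))) x v)"
    by (rule tmap_two[OF X L X X a' k r v])
  also have "tmap X X (\<lambda>y. a (k x) (\<theta> (p y))) x v = tmap X X (a (k x)) x (tmap X X (\<lambda>y. \<theta> (p y)) x v)"
    using tmap_compose[OF X X X r _ v, of "a (k x)"] ar \<theta>x by simp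
  also have "tmap X X (\<lambda>y. \<theta> (p y)) x v = tzero"
    using tmap_compose[OF X Y X p \<theta> v] pv by (simp add: tmap_zero)
  finally show ?thesis unfolding tmap_zero tadd_simps \<theta>x .
qed

text \<open>
  The decomposition of \<open>slice_split\<close> is a local diffeomorphism onto the product of the base with the parameters.
\<close>

lemma slice_dim:
  assumes X: "mfd X" and Y: "mfd Y" and L: "mfd L"
    and p: "smooth_at X Y p x" and \<theta>: "smooth_at Y X \<theta> (p x)" and \<theta>x: "\<theta> (p x) = x"
    and k: "smooth_at X L k x" and a: "smooth_at (prod_manifold L X) X (\<lambda>(l, y). a l y) (k x, x)"
    and split: "eventually (\<lambda>y. a (k y) (\<theta> (p y)) = y) (near X x)"
    and sec: "eventually (\<lambda>y. \<forall>l\<in>points L. k (a l (\<theta> y)) = l \<and> p (a l (\<theta> y)) = y) (near Y (p x))"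
  shows "mdim X = mdim Y + mdim L"
proof -
  let ?P = "prod_manifold Y L"
  have P: "mfd ?P" by (rule mfd_prod[OF Y L])
  note px = smooth_at_points[OF X Y p] and kx = smooth_at_points(2)[OF X L k]
  let ?f = "\<lambda>y. (p y, k y)" and ?g = "\<lambda>z. a (snd z) (\<theta> (fst z))"
  have f: "smooth_at X ?P ?f x" by (rule smooth_at_Pair[OF X Y L p k])
  have sf: "smooth_at ?P Y fst (?f x)" and ss: "smooth_at ?P L snd (?f x)"
    using smooth_at_fst[OF Y L px(2) kx] smooth_at_snd[OF Y L px(2) kx] by auto
  have st: "smooth_at ?P X (\<lambda>z. \<theta> (fst z)) (?f x)" by (rule smooth_at_compose[OF P Y X sf]) (simp add: \<theta>)
  have g: "smooth_at ?P X ?g (?f x)"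
    by (rule smooth_at_two[OF P L X X _ ss st]) (simp add: a \<theta>x)
  have "eventually (\<lambda>z. z \<in> points L) (near L (k x))"
    using kx by (intro eventually_nhdsin_in) (auto simp: points_def)
  from near_prod[OF sec this]
  have fg: "eventually (\<lambda>z. ?f (?g z) = z) (near ?P (?f x))"
  proof eventually_elim
    case (elim z)
    obtain y l where "z = (y, l)" by fastforce
    then show ?case using elim by simp
  qed
  have "mdim X = mdim ?P" by (rule local_inverse_dim[OF X P f g _ fg]) (use split in simp)
  then show ?thesis by (simp add: prod_manifold_simps)
qed

section \<open>The quotient groupoid\<close>

locale groupoid_quotient = G: lie_gpd G + Q: lie_gpd Q
  for G :: "('g, 'm) groupoid_data" and Q :: "('g set, 'b) groupoid_data" +
  fixes H :: "'h lie_group_data" and M :: "'m manifold" and act :: "'h \<Rightarrow> 'm \<Rightarrow> 'm" and B :: "'b manifold"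
    and q :: "'m \<Rightarrow> 'b" and \<Psi> :: "'h \<times> 'm \<Rightarrow> 'g"
  assumes H: "lie_group H" and PB: "principal_bundle H M act B q" and bG: "base G = M"
    and mor: "groupoid_morphism (action_groupoid H M act) G \<Psi> id"
    and QG: "quotient_groupoid H G \<Psi> B q Q"
begin

abbreviation "K \<equiv> gmanifold H"
abbreviation "p \<equiv> orbit_map H G \<Psi>"
abbreviation "HH \<equiv> HH_action G \<Psi>"
abbreviation "mul x y \<equiv> x \<otimes>\<^bsub>H\<^esub> y"
abbreviation "eH \<equiv> \<one>\<^bsub>H\<^esub>"

lemma bQ: "base Q = B" using QG by (simp add: quotient_groupoid_def)
lemma mfd_M: "mfd M" using G.mfd_Bas bG by simp
lemma mfd_B: "mfd B" using Q.mfd_Bas bQ by simp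
lemma mfd_K: "mfd K" using H by (simp add: lie_group_def smooth_manifold_def smooth_atlas_mfd)
lemma grp: "group H" and carr: "carrier H = points K" using H by (auto simp: lie_group_def)
lemma one_in: "eH \<in> points K" using group.is_monoid[OF grp] monoid.one_closed carr by blast
lemma mul_in: "h \<in> points K \<Longrightarrow> k \<in> points K \<Longrightarrow> mul h k \<in> points K"
  using group.is_monoid[OF grp] monoid.m_closed[of H h k] carr by blast
lemma ginv_in: "h \<in> points K \<Longrightarrow> inv\<^bsub>H\<^esub> h \<in> points K"
  using group.inv_closed[OF grp] carr by blast

lemma mul_at: "smooth_at W K f w \<Longrightarrow> smooth_at W K g w \<Longrightarrow> mfd W \<Longrightarrow> smooth_at W K (\<lambda>w. mul (f w) (g w)) w"
proof -
  assume f: "smooth_at W K f w" and g: "smooth_at W K g w" and W: "mfd W"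
  have "smooth_at (prod_manifold K K) K (\<lambda>(h, k). mul h k) (f w, g w)"
    by (rule smooth_map_at[OF mfd_prod[OF mfd_K mfd_K] mfd_K])
       (use H smooth_at_points(2)[OF W mfd_K f] smooth_at_points(2)[OF W mfd_K g] in \<open>simp_all add: lie_group_def prod_manifold_simps\<close>)
  from smooth_at_two[OF W mfd_K mfd_K mfd_K this f g] show ?thesis .
qed

lemma ginv_at:
  assumes f: "smooth_at W K f w" and W: "mfd W" shows "smooth_at W K (\<lambda>w. inv\<^bsub>H\<^esub> (f w)) w"
proof -
  have "smooth_map K K (\<lambda>h. inv\<^bsub>H\<^esub> h)" using H by (simp add: lie_group_def)
  from smooth_map_at[OF mfd_K mfd_K this smooth_at_points(2)[OF W mfd_K f]]
  show ?thesis by (rule smooth_at_compose[OF W mfd_K mfd_K f])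
qed

lemma act_pt: "h \<in> points K \<Longrightarrow> x \<in> points M \<Longrightarrow> smooth_at (prod_manifold K M) M (\<lambda>(h, x). act h x) (h, x)"
  using PB smooth_map_at[OF mfd_prod[OF mfd_K mfd_M] mfd_M] by (auto simp: principal_bundle_def lie_action_def prod_manifold_simps)

lemma act_in: "h \<in> points K \<Longrightarrow> x \<in> points M \<Longrightarrow> act h x \<in> points M"
  using smooth_at_points(2)[OF mfd_prod[OF mfd_K mfd_M] mfd_M act_pt] by simp

lemma act_one: "x \<in> points M \<Longrightarrow> act eH x = x"
  using PB by (simp add: principal_bundle_def lie_action_def)
lemma q_at: "x \<in> points M \<Longrightarrow> smooth_at M B q x"
  using PB smooth_map_at[OF mfd_M mfd_B] by (simp add: principal_bundle_def)
lemma q_in: "x \<in> points M \<Longrightarrow> q x \<in> points B" using smooth_at_points(2)[OF mfd_M mfd_B q_at] .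

text \<open>
  A local trivialization seen through its group component \<open>\<kappa>\<close>: the set \<open>P\<close> is a union of fibres of \<open>q\<close>, and \<open>\<kappa>\<close> is
  equivariant and separates the points of each fibre.
\<close>

definition group_coordinate :: "'m set \<Rightarrow> ('m \<Rightarrow> 'h) \<Rightarrow> bool" where
  "group_coordinate P \<kappa> \<longleftrightarrow> openin (mtop M) P \<and> (\<forall>y\<in>P. y \<in> points M \<and> smooth_at M K \<kappa> y \<and> \<kappa> y \<in> points K) \<and>
    (\<forall>h\<in>points K. \<forall>y\<in>P. act h y \<in> P \<and> q (act h y) = q y \<and> \<kappa> (act h y) = mul h (\<kappa> y)) \<and>
    (\<forall>y\<in>P. \<forall>y'\<in>points M. q y' = q y \<longrightarrow> y' \<in> P \<and> (\<kappa> y' = \<kappa> y \<longrightarrow> y' = y))"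

lemma group_coordinateD:
  assumes "group_coordinate P \<kappa>"
  shows "openin (mtop M) P" "y \<in> P \<Longrightarrow> y \<in> points M" "y \<in> P \<Longrightarrow> smooth_at M K \<kappa> y" "y \<in> P \<Longrightarrow> \<kappa> y \<in> points K"
    "h \<in> points K \<Longrightarrow> y \<in> P \<Longrightarrow> act h y \<in> P" "h \<in> points K \<Longrightarrow> y \<in> P \<Longrightarrow> q (act h y) = q y"
    "h \<in> points K \<Longrightarrow> y \<in> P \<Longrightarrow> \<kappa> (act h y) = mul h (\<kappa> y)"
    "y \<in> P \<Longrightarrow> y' \<in> points M \<Longrightarrow> q y' = q y \<Longrightarrow> y' \<in> P"
    "y \<in> P \<Longrightarrow> y' \<in> points M \<Longrightarrow> q y' = q y \<Longrightarrow> \<kappa> y' = \<kappa> y \<Longrightarrow> y' = y"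
  using assms unfolding group_coordinate_def by blast+

lemma local_trivialization:
  assumes x: "x \<in> points M"
  shows "\<exists>P \<kappa>. group_coordinate P \<kappa> \<and> x \<in> P"
proof -
  from PB[unfolded principal_bundle_def, THEN conjunct2, THEN conjunct2, THEN conjunct2, THEN conjunct2, THEN bspec, OF q_in[OF x]]
  obtain U \<kappa> where U: "openin (mtop B) U" "q x \<in> U" and *:
      "bij_betw (\<lambda>x. (q x, \<kappa> x)) (points M \<inter> q -` U) (U \<times> carrier H)"
      "smooth_map (open_submanifold M (points M \<inter> q -` U)) (prod_manifold (open_submanifold B U) K) (\<lambda>x. (q x, \<kappa> x))"
      "\<forall>h\<in>carrier H. \<forall>x\<in>points M \<inter> q -` U. q (act h x) = q x \<and> \<kappa> (act h x) = mul h (\<kappa> x)"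
    unfolding Let_def by (elim exE conjE)
  define P where "P = points M \<inter> q -` U"
  have P: "bij_betw (\<lambda>x. (q x, \<kappa> x)) P (U \<times> carrier H)"
    "smooth_map (open_submanifold M P) (prod_manifold (open_submanifold B U) K) (\<lambda>x. (q x, \<kappa> x))"
    "\<And>h x. h \<in> points K \<Longrightarrow> x \<in> P \<Longrightarrow> q (act h x) = q x \<and> \<kappa> (act h x) = mul h (\<kappa> x)"
    using *(1,2) bspec[OF bspec[OF *(3)]] by (simp_all add: P_def carr)
  have "openin (mtop M) {x \<in> topspace (mtop M). q x \<in> U}"
    by (rule openin_continuous_map_preimage[OF _ U(1)]) (use PB in \<open>simp add: principal_bundle_def smooth_map_def\<close>)
  moreover have "{x \<in> topspace (mtop M). q x \<in> U} = P" by (auto simp: P_def points_def)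
  ultimately have Po: "openin (mtop M) P" by simp
  note mP = mfd_open_submanifold[OF mfd_M Po] and mU = mfd_open_submanifold[OF mfd_B U(1)]
  have sm: "smooth_at M K \<kappa> y" if y: "y \<in> P" for y
  proof -
    have yM: "y \<in> points M" and yP: "y \<in> points (open_submanifold M P)" using y by (auto simp: P_def open_submanifold_simps)
    have s: "smooth_at (open_submanifold M P) (prod_manifold (open_submanifold B U) K) (\<lambda>x. (q x, \<kappa> x)) y"
      by (rule smooth_map_at[OF mP mfd_prod[OF mU mfd_K] P(2) yP])
    have "(q y, \<kappa> y) \<in> points (prod_manifold (open_submanifold B U) K)"
      using smooth_at_points(2)[OF mP mfd_prod[OF mU mfd_K] s] .
    then have s2: "smooth_at (prod_manifold (open_submanifold B U) K) K snd (q y, \<kappa> y)"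
      by (intro smooth_at_snd[OF mU mfd_K]) (simp_all add: prod_manifold_simps)
    have "smooth_at (open_submanifold M P) K \<kappa> y"
      using smooth_at_compose[OF mP mfd_prod[OF mU mfd_K] mfd_K s s2] by simp
    then show ?thesis by (rule smooth_at_open_submanifold[OF mfd_M Po yM y mfd_K])
  qed
  have sat: "y' \<in> P" if "y \<in> P" "y' \<in> points M" "q y' = q y" for y y' using that by (simp add: P_def)
  have inj: "y' = y" if "y \<in> P" "y' \<in> P" "q y' = q y" "\<kappa> y' = \<kappa> y" for y y'
    using inj_onD[OF bij_betw_imp_inj_on[OF P(1)], of y' y] that by simp
  have eq: "act h y \<in> P \<and> q (act h y) = q y \<and> \<kappa> (act h y) = mul h (\<kappa> y)" if "h \<in> points K" "y \<in> P" for h y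
    using P(3)[OF that] act_in[OF that(1), of y] that(2) by (simp add: P_def)
  have PM: "y \<in> points M" if "y \<in> P" for y using that by (simp add: P_def)
  have "group_coordinate P \<kappa>"
    unfolding group_coordinate_def
  proof (intro conjI ballI impI Po)
    fix y assume y: "y \<in> P"
    show "y \<in> points M" by (rule PM[OF y])
    show "smooth_at M K \<kappa> y" by (rule sm[OF y])
    then show "\<kappa> y \<in> points K" by (rule smooth_at_points(2)[OF mfd_M mfd_K])
    {
      fix h assume "h \<in> points K"
      from eq[OF this y] show "act h y \<in> P" "q (act h y) = q y" "\<kappa> (act h y) = mul h (\<kappa> y)" by simp_all
    next
      fix y' assume y': "y' \<in> points M" "q y' = q y"
      show 1: "y' \<in> P" by (rule sat[OF y y'])
      show "y' = y" if "\<kappa> y' = \<kappa> y" by (rule inj[OF y 1 y'(2) that])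
    }
  qed
  moreover have "x \<in> P" using x U by (simp add: P_def)
  ultimately show ?thesis by blast
qed

lemma mul_cancel: assumes "h \<in> points K" "k \<in> points K"
  shows "mul (mul h k) (inv\<^bsub>H\<^esub> k) = h" "mul (mul h (inv\<^bsub>H\<^esub> k)) k = h" "mul k (inv\<^bsub>H\<^esub> k) = eH" "mul eH eH = eH"
proof -
  interpret group H by (rule grp)
  show "mul (mul h k) (inv\<^bsub>H\<^esub> k) = h" "mul (mul h (inv\<^bsub>H\<^esub> k)) k = h" "mul k (inv\<^bsub>H\<^esub> k) = eH" "mul eH eH = eH"
    using assms by (simp_all add: m_assoc carr[symmetric])
qed

text \<open>
  The quotient of the group coordinates of two points of a fibre is the element that moves one to the other.
\<close>

lemma fibre_orbit:
  assumes "x \<in> points M" "y \<in> points M" "q x = q y"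
  obtains h where "h \<in> points K" "y = act h x"
proof -
  obtain P \<kappa> where gc: "group_coordinate P \<kappa>" and xP: "x \<in> P" using local_trivialization[OF assms(1)] by blast
  note P = group_coordinateD[OF gc]
  have yP: "y \<in> P" using P(8)[OF xP assms(2)] assms(3) by simp
  define h where "h = mul (\<kappa> y) (inv\<^bsub>H\<^esub> (\<kappa> x))"
  have h: "h \<in> points K" using P(4)[OF xP] P(4)[OF yP] mul_in ginv_in by (simp add: h_def)
  have e: "mul h (\<kappa> x) = \<kappa> y" using mul_cancel(2)[OF P(4)[OF yP] P(4)[OF xP]] by (simp add: h_def)
  have "y = act h x"
    by (rule P(9)[OF P(5)[OF h xP] assms(2)]) (simp_all only: P(6,7)[OF h xP] e assms(3))
  then show thesis using that h by blast
qed

lemma psi_at: "h \<in> points K \<Longrightarrow> x \<in> points M \<Longrightarrow> smooth_at (prod_manifold K M) G.Arr \<Psi> (h, x)"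
  using mor smooth_map_at[OF mfd_prod[OF mfd_K mfd_M] G.mfd_Arr]
  by (auto simp: groupoid_morphism_def action_groupoid_def prod_manifold_simps)

lemma psi_in: "h \<in> points K \<Longrightarrow> x \<in> points M \<Longrightarrow> \<Psi> (h, x) \<in> points G.Arr"
  using smooth_at_points(2)[OF mfd_prod[OF mfd_K mfd_M] G.mfd_Arr psi_at] .

lemma psi_src: "h \<in> points K \<Longrightarrow> x \<in> points M \<Longrightarrow> src G (\<Psi> (h, x)) = x"
  and psi_tgt: "h \<in> points K \<Longrightarrow> x \<in> points M \<Longrightarrow> tgt G (\<Psi> (h, x)) = act h x"
  using mor by (auto simp: groupoid_morphism_def action_groupoid_def prod_manifold_simps)

lemma psi_mul: assumes "h \<in> points K" "k \<in> points K" "x \<in> points M"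
  shows "\<Psi> (mul h k, x) = cmp G (\<Psi> (h, act k x)) (\<Psi> (k, x))"
proof -
  have "((h, act k x), (k, x)) \<in> composable (action_groupoid H M act)"
    using assms act_in by (simp add: composable_def action_groupoid_def prod_manifold_simps)
  then have "\<Psi> (cmp (action_groupoid H M act) (h, act k x) (k, x)) = cmp G (\<Psi> (h, act k x)) (\<Psi> (k, x))"
    using mor unfolding groupoid_morphism_def by blast
  then show ?thesis by (simp add: action_groupoid_def)
qed

text \<open>
  A groupoid morphism preserves units: \<open>\<Psi> (eH, x)\<close> is idempotent.
\<close>

lemma psi_one: assumes "x \<in> points M" shows "\<Psi> (eH, x) = unit_arr G x"
proof -
  have "cmp G (\<Psi> (eH, x)) (\<Psi> (eH, x)) = \<Psi> (eH, x)"
    using psi_mul[OF one_in one_in assms] act_one[OF assms] mul_cancel(4)[OF one_in one_in] by simp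
  then show ?thesis using G.idem_unit[OF psi_in[OF one_in assms]] psi_src psi_tgt one_in assms act_one by simp
qed

lemma psi_comp_at:
  assumes W: "mfd W" and h: "smooth_at W K h w" and x: "smooth_at W M x w"
  shows "smooth_at W G.Arr (\<lambda>w. \<Psi> (h w, x w)) w"
  using smooth_at_compose[OF W mfd_prod[OF mfd_K mfd_M] G.mfd_Arr smooth_at_Pair[OF W mfd_K mfd_M h x]]
    psi_at smooth_at_points(2)[OF W mfd_K h] smooth_at_points(2)[OF W mfd_M x] by blast

lemma act_comp_at:
  assumes W: "mfd W" and h: "smooth_at W K h w" and x: "smooth_at W M x w"
  shows "smooth_at W M (\<lambda>w. act (h w) (x w)) w"
  using smooth_at_two[OF W mfd_K mfd_M mfd_M act_pt h x] smooth_at_points(2)[OF W mfd_K h] smooth_at_points(2)[OF W mfd_M x]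
  by blast

lemma tgtM: "g \<in> points G.Arr \<Longrightarrow> tgt G g \<in> points M" and srcM: "g \<in> points G.Arr \<Longrightarrow> src G g \<in> points M"
  using G.tgt_in G.src_in bG by auto

lemma HH_facts:
  assumes "h1 \<in> points K" "h2 \<in> points K" "g \<in> points G.Arr"
  shows HH_left_in: "cmp G (\<Psi> (h1, tgt G g)) g \<in> points G.Arr"
    and HH_in: "HH h1 h2 g \<in> points G.Arr"
    and HH_src: "src G (HH h1 h2 g) = act h2 (src G g)" and HH_tgt: "tgt G (HH h1 h2 g) = act h1 (tgt G g)"
proof -
  note a = psi_in[OF assms(1) tgtM[OF assms(3)]] psi_src[OF assms(1) tgtM[OF assms(3)]] psi_tgt[OF assms(1) tgtM[OF assms(3)]]
  note b = psi_in[OF assms(2) srcM[OF assms(3)]] psi_src[OF assms(2) srcM[OF assms(3)]] psi_tgt[OF assms(2) srcM[OF assms(3)]]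
  note c = G.inv_in[OF b(1)] G.inv_simps[OF b(1)]
  show 1: "cmp G (\<Psi> (h1, tgt G g)) g \<in> points G.Arr" using G.cmp_in a assms by simp
  have 2: "src G (cmp G (\<Psi> (h1, tgt G g)) g) = src G g" "tgt G (cmp G (\<Psi> (h1, tgt G g)) g) = act h1 (tgt G g)"
    using G.src_cmp G.tgt_cmp a assms by auto
  show "HH h1 h2 g \<in> points G.Arr" "src G (HH h1 h2 g) = act h2 (src G g)" "tgt G (HH h1 h2 g) = act h1 (tgt G g)"
    unfolding HH_action_def using G.cmp_in[OF 1 c(1)] G.src_cmp[OF 1 c(1)] G.tgt_cmp[OF 1 c(1)] 2 b c by auto
qed

lemma HH_one1: assumes "h \<in> points K" "g \<in> points G.Arr" shows "HH h eH g = cmp G (\<Psi> (h, tgt G g)) g"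
  and HH_one2: "HH eH h g = cmp G g (inv_arr G (\<Psi> (h, src G g)))"
proof -
  note l = HH_left_in[OF assms(1) one_in assms(2)]
  have "src G (cmp G (\<Psi> (h, tgt G g)) g) = src G g"
    using G.src_cmp psi_in psi_src tgtM assms by simp
  then show "HH h eH g = cmp G (\<Psi> (h, tgt G g)) g"
    unfolding HH_action_def using psi_one[OF srcM[OF assms(2)]] G.inv_unit srcM[OF assms(2)] bG G.inv_simps(2)[OF l] by simp
  show "HH eH h g = cmp G g (inv_arr G (\<Psi> (h, src G g)))"
    unfolding HH_action_def using psi_one[OF tgtM[OF assms(2)]] G.inv_simps(1)[OF assms(2)] by simp
qed

lemma HH_one: assumes "g \<in> points G.Arr" shows "HH eH eH g = g"
  using HH_one1[OF one_in assms] psi_one[OF tgtM[OF assms]] G.inv_simps(1)[OF assms] by simp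

text \<open>
  This is an action because \<open>\<Psi>\<close> turns multiplication in the group into composition of arrows.
\<close>

lemma HH_mul:
  assumes "k1 \<in> points K" "k2 \<in> points K" "h1 \<in> points K" "h2 \<in> points K" "g \<in> points G.Arr"
  shows "HH k1 k2 (HH h1 h2 g) = HH (mul k1 h1) (mul k2 h2) g"
proof -
  note t = tgtM[OF assms(5)] and s = srcM[OF assms(5)]
  define a where "a = \<Psi> (h1, tgt G g)"
  define b0 where "b0 = \<Psi> (h2, src G g)"
  define c where "c = \<Psi> (k1, act h1 (tgt G g))"
  define d0 where "d0 = \<Psi> (k2, act h2 (src G g))"
  define b d where "b = inv_arr G b0" and "d = inv_arr G d0"
  have A: "a \<in> points G.Arr" "src G a = tgt G g" "tgt G a = act h1 (tgt G g)"
    unfolding a_def using psi_in psi_src psi_tgt assms t by auto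
  have C: "c \<in> points G.Arr" "src G c = act h1 (tgt G g)"
    unfolding c_def using psi_in psi_src act_in assms t by auto
  have B0: "b0 \<in> points G.Arr" "src G b0 = src G g" "tgt G b0 = act h2 (src G g)"
    unfolding b0_def using psi_in psi_src psi_tgt assms s by auto
  have D0: "d0 \<in> points G.Arr" "src G d0 = act h2 (src G g)"
    unfolding d0_def using psi_in psi_src act_in assms s by auto
  have Bb: "b \<in> points G.Arr" "tgt G b = src G g" "src G b = act h2 (src G g)"
    using G.inv_in[OF B0(1)] G.inv_simps[OF B0(1)] B0 by (auto simp: b_def)
  have Dd: "d \<in> points G.Arr" "tgt G d = act h2 (src G g)"
    using G.inv_in[OF D0(1)] G.inv_simps[OF D0(1)] D0 by (auto simp: d_def)
  have ag: "cmp G a g \<in> points G.Arr" "src G (cmp G a g) = src G g" "tgt G (cmp G a g) = act h1 (tgt G g)"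
    using G.cmp_in[OF A(1) assms(5) A(2)] G.src_cmp[OF A(1) assms(5) A(2)] G.tgt_cmp[OF A(1) assms(5) A(2)] A by auto
  have cag: "cmp G c (cmp G a g) \<in> points G.Arr" "src G (cmp G c (cmp G a g)) = src G g"
    using G.cmp_in[OF C(1) ag(1)] G.src_cmp[OF C(1) ag(1)] C ag by auto
  have "HH k1 k2 (HH h1 h2 g) = cmp G (cmp G c (cmp G (cmp G a g) b)) d"
    unfolding HH_action_def[of G \<Psi> k1] using HH_src[OF assms(3-5)] HH_tgt[OF assms(3-5)]
    by (simp add: c_def d_def d0_def HH_action_def a_def b_def b0_def)
  also have "cmp G c (cmp G (cmp G a g) b) = cmp G (cmp G c (cmp G a g)) b"
    using G.assoc[OF C(1) ag(1) Bb(1)] C ag Bb by simp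
  also have "cmp G (cmp G (cmp G c (cmp G a g)) b) d = cmp G (cmp G c (cmp G a g)) (cmp G b d)"
    using G.assoc[OF cag(1) Bb(1) Dd(1)] cag Bb Dd by simp
  also have "cmp G c (cmp G a g) = cmp G (cmp G c a) g"
    using G.assoc[OF C(1) A(1) assms(5)] C A by simp
  also have "cmp G c a = \<Psi> (mul k1 h1, tgt G g)" using psi_mul assms t by (simp add: c_def a_def)
  also have "cmp G b d = inv_arr G (\<Psi> (mul k2 h2, src G g))"
    using psi_mul[OF assms(2,4) s] G.inv_cmp[OF D0(1) B0(1)] D0 B0 by (simp add: b_def d_def b0_def d0_def)
  finally show ?thesis unfolding HH_action_def .
qed

lemma HH_at:
  assumes W: "mfd W" and h1: "smooth_at W K h1 w" and h2: "smooth_at W K h2 w" and g: "smooth_at W G.Arr g w"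
  shows "smooth_at W G.Arr (\<lambda>w. HH (h1 w) (h2 w) (g w)) w"
proof -
  have gw: "g w \<in> points G.Arr" using smooth_at_points(2)[OF W G.mfd_Arr g] .
  have t: "smooth_at W M (\<lambda>w. tgt G (g w)) w" and s: "smooth_at W M (\<lambda>w. src G (g w)) w"
    using smooth_at_compose[OF W G.mfd_Arr mfd_M g] G.tgt_at[OF gw] G.src_at[OF gw] bG by auto
  have 1: "smooth_at W G.Arr (\<lambda>w. \<Psi> (h1 w, tgt G (g w))) w" by (rule psi_comp_at[OF W h1 t])
  have 2: "smooth_at W G.Arr (\<lambda>w. \<Psi> (h2 w, src G (g w))) w" by (rule psi_comp_at[OF W h2 s])
  have e: "eventually (\<lambda>w. h1 w \<in> points K \<and> h2 w \<in> points K \<and> g w \<in> points G.Arr) (near W w)"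
    using smooth_at_eventually[OF W mfd_K h1] smooth_at_eventually[OF W mfd_K h2] smooth_at_eventually[OF W G.mfd_Arr g]
    by eventually_elim (use smooth_at_points(2)[OF W mfd_K] smooth_at_points(2)[OF W G.mfd_Arr] in blast)
  have 3: "smooth_at W G.Arr (\<lambda>w. cmp G (\<Psi> (h1 w, tgt G (g w))) (g w)) w"
    by (rule G.cmp_at[OF W 1 g]) (use e in eventually_elim, simp add: psi_src tgtM)
  have i: "smooth_at G.Arr G.Arr (inv_arr G) (\<Psi> (h2 w, src G (g w)))"
    by (rule G.inv_at) (rule smooth_at_points(2)[OF W G.mfd_Arr 2])
  have 4: "smooth_at W G.Arr (\<lambda>w. inv_arr G (\<Psi> (h2 w, src G (g w)))) w"
    by (rule smooth_at_compose[OF W G.mfd_Arr G.mfd_Arr 2 i])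
  show ?thesis unfolding HH_action_def
    by (rule G.cmp_at[OF W 3 4]) (use e in eventually_elim, simp add: psi_src psi_in tgtM srcM G.src_cmp G.inv_simps)
qed

lemma p_HH: assumes "h1 \<in> points K" "h2 \<in> points K" "g \<in> points G.Arr" shows "p (HH h1 h2 g) = p g"
proof
  show "p (HH h1 h2 g) \<subseteq> p g"
    unfolding orbit_map_def carr using HH_mul[OF _ _ assms] mul_in assms(1,2) by blast
  show "p g \<subseteq> p (HH h1 h2 g)"
  proof
    fix x assume "x \<in> p g"
    then obtain k1 k2 where k: "x = HH k1 k2 g" "k1 \<in> points K" "k2 \<in> points K" unfolding orbit_map_def carr by blast
    note m = mul_cancel(2)
    have "HH (mul k1 (inv\<^bsub>H\<^esub> h1)) (mul k2 (inv\<^bsub>H\<^esub> h2)) (HH h1 h2 g) = x"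
      using HH_mul[OF mul_in[OF k(2) ginv_in[OF assms(1)]] mul_in[OF k(3) ginv_in[OF assms(2)]] assms] m k assms by simp
    then show "x \<in> p (HH h1 h2 g)" unfolding orbit_map_def carr
      using mul_in ginv_in k assms by blast
  qed
qed

lemma p_eq: assumes "g' \<in> points G.Arr" "p g = p g'"
  obtains h1 h2 where "h1 \<in> points K" "h2 \<in> points K" "g' = HH h1 h2 g"
proof -
  have "g' \<in> p g'" unfolding orbit_map_def carr using HH_one[OF assms(1)] one_in by force
  then show thesis using that assms(2) unfolding orbit_map_def carr by blast
qed

lemma p_at: "g \<in> points G.Arr \<Longrightarrow> smooth_at G.Arr Q.Arr p g"
  using QG smooth_map_at[OF G.mfd_Arr Q.mfd_Arr] by (simp add: quotient_groupoid_def submersion_def)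
lemma p_surj: "g \<in> points G.Arr \<Longrightarrow> tmap G.Arr Q.Arr p g ` tangent_space G.Arr g = tangent_space Q.Arr (p g)"
  using QG by (simp add: quotient_groupoid_def submersion_def)
lemma p_in: "g \<in> points G.Arr \<Longrightarrow> p g \<in> points Q.Arr"
  and p_onto: "k \<in> points Q.Arr \<Longrightarrow> \<exists>g\<in>points G.Arr. k = p g"
  using QG by (auto simp: quotient_groupoid_def)
lemma p_src: "g \<in> points G.Arr \<Longrightarrow> src Q (p g) = q (src G g)"
  and p_tgt: "g \<in> points G.Arr \<Longrightarrow> tgt Q (p g) = q (tgt G g)"
  using QG by (auto simp: quotient_groupoid_def groupoid_morphism_def)
lemma p_cmp: "g \<in> points G.Arr \<Longrightarrow> h \<in> points G.Arr \<Longrightarrow> src G g = tgt G h \<Longrightarrow> p (cmp G g h) = cmp Q (p g) (p h)"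
  using QG G.composableI[of g h] by (auto simp: quotient_groupoid_def groupoid_morphism_def)

text \<open>
  The image of a unit is idempotent.
\<close>

lemma p_unit: assumes "x \<in> points M" shows "p (unit_arr G x) = unit_arr Q (q x)"
proof -
  let ?u = "unit_arr G x"
  have u: "?u \<in> points G.Arr" "src G ?u = x" "tgt G ?u = x" using G.unit_in G.unit_simps assms bG by auto
  have "cmp Q (p ?u) (p ?u) = p ?u" using p_cmp[OF u(1) u(1)] u G.inv_simps(1)[OF u(1)] by simp
  then show ?thesis using Q.idem_unit[OF p_in[OF u(1)]] p_src[OF u(1)] p_tgt[OF u(1)] u by simp
qed

lemma p_section:
  assumes "g \<in> points G.Arr"
  obtains \<theta> where "smooth_at Q.Arr G.Arr \<theta> (p g)" "\<theta> (p g) = g" "eventually (\<lambda>y. p (\<theta> y) = y) (near Q.Arr (p g))"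
  using local_section[OF G.mfd_Arr Q.mfd_Arr p_at[OF assms]] p_surj[OF assms] by blast

text \<open>
  From \<open>q \<circ> t = t \<circ> p\<close>: the maps \<open>p\<close> and \<open>t\<close> on the quotient groupoid are submersions.
\<close>

lemma q_surj: assumes x: "x \<in> points M" shows "tangent_space B (q x) \<subseteq> tmap M B q x ` tangent_space M x"
proof
  fix b assume b: "b \<in> tangent_space B (q x)"
  let ?u = "unit_arr G x"
  have u: "?u \<in> points G.Arr" "tgt G ?u = x" using G.unit_in G.unit_simps x bG by auto
  have "tangent_space B (q x) = tmap Q.Arr B (tgt Q) (p ?u) ` tangent_space Q.Arr (p ?u)"
    using Q.tgt_surj[OF p_in[OF u(1)]] p_tgt[OF u(1)] u(2) bQ by simp
  then obtain k where k: "k \<in> tangent_space Q.Arr (p ?u)" "b = tmap Q.Arr B (tgt Q) (p ?u) k" using b by blast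
  obtain v where v: "v \<in> tangent_space G.Arr ?u" "k = tmap G.Arr Q.Arr p ?u v" using p_surj[OF u(1)] k(1) by blast
  have tg: "smooth_at G.Arr M (tgt G) ?u" using G.tgt_at[OF u(1)] bG by simp
  have tq: "smooth_at Q.Arr B (tgt Q) (p ?u)" using Q.tgt_at[OF p_in[OF u(1)]] bQ by simp
  have "b = tmap G.Arr B (\<lambda>g. tgt Q (p g)) ?u v"
    using tmap_compose[OF G.mfd_Arr Q.mfd_Arr mfd_B p_at[OF u(1)] tq v(1)] k v by simp
  also have "\<dots> = tmap G.Arr B (\<lambda>g. q (tgt G g)) ?u v"
  proof -
    have "eventually (\<lambda>g. g \<in> points G.Arr) (near G.Arr ?u)" using u(1) by (intro eventually_nhdsin_in) (auto simp: points_def)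
    then have "eventually (\<lambda>g. tgt Q (p g) = q (tgt G g)) (near G.Arr ?u)" by eventually_elim (rule p_tgt)
    from tmap_cong[OF G.mfd_Arr smooth_at_compose[OF G.mfd_Arr Q.mfd_Arr mfd_B p_at[OF u(1)] tq] mfd_B this]
    show ?thesis by simp
  qed
  also have "\<dots> = tmap M B q x (tmap G.Arr M (tgt G) ?u v)"
    using tmap_compose[OF G.mfd_Arr mfd_M mfd_B tg _ v(1), of q] q_at x u(2) by simp
  finally show "b \<in> tmap M B q x ` tangent_space M x"
    using tmap_in[OF G.mfd_Arr mfd_M tg v(1)] u(2) by auto
qed

text \<open>
  The parameter of the splitting compares the group coordinate of a point with that of the section over the
  same fibre.
\<close>

lemma bundle_slice:
  assumes x: "x \<in> points M"
  shows q_vertical: "\<And>v. v \<in> tangent_space M x \<Longrightarrow> tmap M B q x v = tzero \<Longrightarrow>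
      \<exists>u\<in>tangent_space K eH. v = tmap K M (\<lambda>h. act h x) eH u"
    and q_dim: "mdim M = mdim B + mdim K"
proof -
  obtain \<sigma> where \<sigma>: "smooth_at B M \<sigma> (q x)" "\<sigma> (q x) = x" "eventually (\<lambda>y. q (\<sigma> y) = y) (near B (q x))"
    using local_section[OF mfd_M mfd_B q_at[OF x] q_surj[OF x]] by blast
  obtain P \<kappa> where gc: "group_coordinate P \<kappa>" and xP: "x \<in> P" using local_trivialization[OF x] by blast
  note P = group_coordinateD[OF gc]
  define k where "k y = mul (\<kappa> y) (inv\<^bsub>H\<^esub> (\<kappa> (\<sigma> (q y))))" for y
  have s1: "smooth_at M M (\<lambda>y. \<sigma> (q y)) x" by (rule smooth_at_compose[OF mfd_M mfd_B mfd_M q_at[OF x] \<sigma>(1)])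
  have s2: "smooth_at M K (\<lambda>y. \<kappa> (\<sigma> (q y))) x"
    by (rule smooth_at_compose[OF mfd_M mfd_M mfd_K s1]) (simp add: \<sigma>(2) P(3)[OF xP])
  have k: "smooth_at M K k x" unfolding k_def by (intro mul_at ginv_at P(3)[OF xP] s2 mfd_M)
  have kx: "k x = eH" using mul_cancel(3)[OF P(4)[OF xP] P(4)[OF xP]] by (simp add: k_def \<sigma>(2))
  have key: "k (act h y) = h" if "h \<in> points K" "y \<in> P" "\<sigma> (q y) = y" for h y
    using P(6,7)[OF that(1,2)] that(3) mul_cancel(1)[OF that(1) P(4)[OF that(2)]] by (simp add: k_def)
  have evP: "eventually (\<lambda>y. y \<in> P) (near M x)" by (rule eventually_nhdsin_in[OF P(1) xP])
  have ev\<sigma>: "eventually (\<lambda>y. \<sigma> y \<in> P) (near B (q x))"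
    by (rule smooth_at_tendsto[OF mfd_B mfd_M \<sigma>(1)]) (simp add: \<sigma>(2) evP)
  have evq: "eventually (\<lambda>y. q (\<sigma> (q y)) = q y \<and> \<sigma> (q y) \<in> P) (near M x)"
    by (rule smooth_at_tendsto[OF mfd_M mfd_B q_at[OF x], of "\<lambda>b. q (\<sigma> b) = b \<and> \<sigma> b \<in> P"])
       (use \<sigma>(3) ev\<sigma> in eventually_elim, simp)
  have split: "eventually (\<lambda>y. act (k y) (\<sigma> (q y)) = y) (near M x)"
    using evP evq
  proof eventually_elim
    case (elim y)
    then obtain h where h: "h \<in> points K" "y = act h (\<sigma> (q y))"
      using fibre_orbit[of "\<sigma> (q y)" y] P(2) by metis
    have "k (act h (\<sigma> (q y))) = h" by (rule key[OF h(1)]) (use elim in auto)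
    then have "k y = h" using h(2) by simp
    then show ?case using h(2) by simp
  qed
  have a: "smooth_at (prod_manifold K M) M (\<lambda>(l, y). act l y) (k x, x)" using act_pt[OF one_in x] kx by simp
  show "\<exists>u\<in>tangent_space K eH. v = tmap K M (\<lambda>h. act h x) eH u"
    if v: "v \<in> tangent_space M x" and qv: "tmap M B q x v = tzero" for v
  proof
    have "smooth_at K M (\<lambda>h. act h x) (k x)"
      unfolding kx by (rule act_comp_at[OF mfd_K smooth_at_id[OF mfd_K one_in] smooth_at_const[OF mfd_K mfd_M one_in x]])
    from tmap_compose[OF mfd_M mfd_K mfd_M k this v]
      slice_split[OF mfd_M mfd_B mfd_K q_at[OF x] \<sigma>(1,2) k a split v qv]
    show "v = tmap K M (\<lambda>h. act h x) eH (tmap M K k x v)" using kx by simp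
    show "tmap M K k x v \<in> tangent_space K eH" using tmap_in[OF mfd_M mfd_K k v] kx by simp
  qed
  show "mdim M = mdim B + mdim K"
  proof (rule slice_dim[OF mfd_M mfd_B mfd_K q_at[OF x] \<sigma>(1,2) k a split])
    show "\<forall>\<^sub>F y in near B (q x). \<forall>l\<in>points K. k (act l (\<sigma> y)) = l \<and> q (act l (\<sigma> y)) = y"
      using \<sigma>(3) ev\<sigma>
    proof eventually_elim
      case (elim y)
      have "\<sigma> (q (\<sigma> y)) = \<sigma> y" using elim by simp
      then show ?case using key P(6) elim by simp
    qed
  qed
qed

text \<open>
  The first factor of \<open>H \<times> H\<close> moves the target and the second moves the source. Comparing the group coordinates of target and
  source of an arrow with those of the section therefore recovers the pair \<open>(h1, h2)\<close>.
\<close>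

lemma arrow_slice:
  assumes g: "g \<in> points G.Arr"
  shows p_vertical: "\<And>v. v \<in> tangent_space G.Arr g \<Longrightarrow> tmap G.Arr Q.Arr p g v = tzero \<Longrightarrow>
      \<exists>u1\<in>tangent_space K eH. \<exists>u2\<in>tangent_space K eH.
        v = tadd (tmap K G.Arr (\<lambda>h. HH h eH g) eH u1) (tmap K G.Arr (\<lambda>h. HH eH h g) eH u2)"
    and p_dim: "mdim G.Arr = mdim Q.Arr + 2 * mdim K"
proof -
  obtain \<theta> where \<theta>: "smooth_at Q.Arr G.Arr \<theta> (p g)" "\<theta> (p g) = g" "eventually (\<lambda>y. p (\<theta> y) = y) (near Q.Arr (p g))"
    using p_section[OF g] by blast
  note A = G.mfd_Arr and AQ = Q.mfd_Arr
  have sp: "smooth_at G.Arr G.Arr (\<lambda>y. \<theta> (p y)) g" by (rule smooth_at_compose[OF A AQ A p_at[OF g] \<theta>(1)])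
  have st: "smooth_at G.Arr M (tgt G) g" and ss: "smooth_at G.Arr M (src G) g" using G.tgt_at[OF g] G.src_at[OF g] bG by auto
  \<comment> \<open>for \<open>e\<close> the target or the source map: a smooth group element by which \<open>e\<close> has moved away from the section\<close>
  have splitmap: "\<exists>k. smooth_at G.Arr K k g \<and> k g = eH \<and>
      eventually (\<lambda>y. \<forall>h\<in>points K. \<forall>g'\<in>points G.Arr. p g' = y \<longrightarrow> e g' = act h (e (\<theta> y)) \<longrightarrow> k g' = h) (near Q.Arr (p g))"
    if e: "smooth_at G.Arr M e g" for e
  proof -
    have eg: "e g \<in> points M" using smooth_at_points(2)[OF A mfd_M e] .
    obtain P \<kappa> where gc: "group_coordinate P \<kappa>" and xP: "e g \<in> P" using local_trivialization[OF eg] by blast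
    note P = group_coordinateD[OF gc]
    define k where "k y = mul (\<kappa> (e y)) (inv\<^bsub>H\<^esub> (\<kappa> (e (\<theta> (p y)))))" for y
    have 1: "smooth_at G.Arr K (\<lambda>y. \<kappa> (e y)) g" by (rule smooth_at_compose[OF A mfd_M mfd_K e P(3)[OF xP]])
    have 2: "smooth_at G.Arr K (\<lambda>y. \<kappa> (e (\<theta> (p y)))) g"
      by (rule smooth_at_compose[OF A A mfd_K sp]) (simp add: \<theta>(2) 1)
    have k: "smooth_at G.Arr K k g" unfolding k_def by (intro mul_at ginv_at 1 2 A)
    have kg: "k g = eH" using mul_cancel(3)[OF P(4)[OF xP] P(4)[OF xP]] by (simp add: k_def \<theta>(2))
    have s\<theta>: "smooth_at Q.Arr M (\<lambda>y. e (\<theta> y)) (p g)" by (rule smooth_at_compose[OF AQ A mfd_M \<theta>(1)]) (simp add: \<theta>(2) e)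
    have "eventually (\<lambda>y. e (\<theta> y) \<in> P) (near Q.Arr (p g))"
      by (rule smooth_at_tendsto[OF AQ mfd_M s\<theta>]) (use P(1) xP \<theta>(2) in \<open>simp add: eventually_nhdsin_in\<close>)
    then have "eventually (\<lambda>y. \<forall>h\<in>points K. \<forall>g'\<in>points G.Arr. p g' = y \<longrightarrow> e g' = act h (e (\<theta> y)) \<longrightarrow> k g' = h) (near Q.Arr (p g))"
    proof eventually_elim
      case (elim y)
      show ?case
      proof (intro ballI impI)
        fix h g' assume "h \<in> points K" "g' \<in> points G.Arr" "p g' = y" "e g' = act h (e (\<theta> y))"
        then show "k g' = h" using P(7)[OF _ elim] mul_cancel(1)[OF _ P(4)[OF elim]] by (simp add: k_def)
      qed
    qed
    then show ?thesis using k kg by blast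
  qed
  obtain k1 where k1: "smooth_at G.Arr K k1 g" "k1 g = eH"
    "eventually (\<lambda>y. \<forall>h\<in>points K. \<forall>g'\<in>points G.Arr. p g' = y \<longrightarrow> tgt G g' = act h (tgt G (\<theta> y)) \<longrightarrow> k1 g' = h) (near Q.Arr (p g))"
    using splitmap[OF st] by blast
  obtain k2 where k2: "smooth_at G.Arr K k2 g" "k2 g = eH"
    "eventually (\<lambda>y. \<forall>h\<in>points K. \<forall>g'\<in>points G.Arr. p g' = y \<longrightarrow> src G g' = act h (src G (\<theta> y)) \<longrightarrow> k2 g' = h) (near Q.Arr (p g))"
    using splitmap[OF ss] by blast
  have ev\<theta>: "eventually (\<lambda>y. \<theta> y \<in> points G.Arr) (near Q.Arr (p g))"
    by (rule smooth_at_tendsto[OF AQ A \<theta>(1)]) (simp add: \<theta>(2) points_near g)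
  have evQ: "eventually (\<lambda>y. p (\<theta> y) = y \<and> \<theta> y \<in> points G.Arr \<and> (\<forall>h1\<in>points K. \<forall>h2\<in>points K.
      k1 (HH h1 h2 (\<theta> y)) = h1 \<and> k2 (HH h1 h2 (\<theta> y)) = h2)) (near Q.Arr (p g))"
    using \<theta>(3) ev\<theta> k1(3) k2(3)
  proof eventually_elim
    case (elim y)
    have "k1 (HH h1 h2 (\<theta> y)) = h1 \<and> k2 (HH h1 h2 (\<theta> y)) = h2" if h: "h1 \<in> points K" "h2 \<in> points K" for h1 h2
    proof -
      note f = HH_facts[OF h elim(2)] p_HH[OF h elim(2)]
      show ?thesis using elim(3)[rule_format, OF h(1) f(2)] elim(4)[rule_format, OF h(2) f(2)] f elim(1) by simp
    qed
    then show ?case using elim by blast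
  qed
  have evG: "eventually (\<lambda>y. p (\<theta> (p y)) = p y \<and> \<theta> (p y) \<in> points G.Arr \<and> (\<forall>h1\<in>points K. \<forall>h2\<in>points K.
      k1 (HH h1 h2 (\<theta> (p y))) = h1 \<and> k2 (HH h1 h2 (\<theta> (p y))) = h2)) (near G.Arr g)"
    by (rule smooth_at_tendsto[OF A AQ p_at[OF g] evQ])
  define L where "L = prod_manifold K K"
  have mL: "mfd L" unfolding L_def by (rule mfd_prod[OF mfd_K mfd_K])
  define k where "k y = (k1 y, k2 y)" for y
  define a where "a l y = HH (fst l) (snd l) y" for l y
  have k: "smooth_at G.Arr L k g" unfolding k_def L_def by (rule smooth_at_Pair[OF A mfd_K mfd_K k1(1) k2(1)])
  have kg: "k g = (eH, eH)" using k1 k2 by (simp add: k_def)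
  have ooL: "(eH, eH) \<in> points L" using one_in by (simp add: L_def prod_manifold_simps)
  have LX: "mfd (prod_manifold L G.Arr)" by (rule mfd_prod[OF mL A])
  have a: "smooth_at (prod_manifold L G.Arr) G.Arr (\<lambda>(l, y). a l y) (k g, g)"
  proof -
    have f: "smooth_at (prod_manifold L G.Arr) L fst (k g, g)" using smooth_at_fst[OF mL A _ g] ooL kg by simp
    have s: "smooth_at (prod_manifold L G.Arr) G.Arr snd (k g, g)" using smooth_at_snd[OF mL A _ g] ooL kg by simp
    have "smooth_at (prod_manifold L G.Arr) K (\<lambda>z. fst (fst z)) (k g, g)"
      by (rule smooth_at_compose[OF LX mL mfd_K f]) (use smooth_at_fst[OF mfd_K mfd_K one_in one_in] kg in \<open>simp add: L_def\<close>)
    moreover have "smooth_at (prod_manifold L G.Arr) K (\<lambda>z. snd (fst z)) (k g, g)"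
      by (rule smooth_at_compose[OF LX mL mfd_K f]) (use smooth_at_snd[OF mfd_K mfd_K one_in one_in] kg in \<open>simp add: L_def\<close>)
    ultimately have "smooth_at (prod_manifold L G.Arr) G.Arr (\<lambda>z. HH (fst (fst z)) (snd (fst z)) (snd z)) (k g, g)"
      by (rule HH_at[OF LX _ _ s])
    then show ?thesis by (simp add: a_def case_prod_unfold)
  qed
  have split: "eventually (\<lambda>y. a (k y) (\<theta> (p y)) = y) (near G.Arr g)"
    using evG points_near[OF g]
  proof eventually_elim
    case (elim y)
    obtain h1 h2 where h: "h1 \<in> points K" "h2 \<in> points K" "y = HH h1 h2 (\<theta> (p y))"
      using p_eq[OF elim(2), of "\<theta> (p y)"] elim(1) by metis
    have "k1 (HH h1 h2 (\<theta> (p y))) = h1" "k2 (HH h1 h2 (\<theta> (p y))) = h2" using elim(1) h(1,2) by blast+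
    then have "k1 y = h1" "k2 y = h2" using h(3) by simp_all
    then show ?case using h(3) by (simp add: a_def k_def)
  qed
  have cg: "smooth_at K G.Arr (\<lambda>_. g) eH" and c1: "smooth_at K K (\<lambda>_. eH) eH"
    using smooth_at_const[OF mfd_K A one_in g] smooth_at_const[OF mfd_K mfd_K one_in one_in] by auto
  show "\<exists>u1\<in>tangent_space K eH. \<exists>u2\<in>tangent_space K eH.
        v = tadd (tmap K G.Arr (\<lambda>h. HH h eH g) eH u1) (tmap K G.Arr (\<lambda>h. HH eH h g) eH u2)"
    if v: "v \<in> tangent_space G.Arr g" and pv: "tmap G.Arr Q.Arr p g v = tzero" for v
  proof (intro bexI)
    have 1: "v = tmap G.Arr G.Arr (\<lambda>y. HH (k1 y) (k2 y) g) g v"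
      using slice_split[OF A AQ mL p_at[OF g] \<theta>(1,2) k a split v pv] by (simp add: a_def k_def)
    have KK: "smooth_at (prod_manifold K K) G.Arr (\<lambda>(h1, h2). HH h1 h2 g) (k1 g, k2 g)"
    proof -
      have "smooth_at (prod_manifold K K) G.Arr (\<lambda>z. HH (fst z) (snd z) g) (eH, eH)"
        by (rule HH_at[OF mfd_prod[OF mfd_K mfd_K] smooth_at_fst[OF mfd_K mfd_K one_in one_in] smooth_at_snd[OF mfd_K mfd_K one_in one_in]])
           (rule smooth_at_const[OF mfd_prod[OF mfd_K mfd_K] A], simp_all add: prod_manifold_simps one_in g)
      then show ?thesis using k1 k2 by (simp add: case_prod_unfold)
    qed
    have 2: "tmap G.Arr G.Arr (\<lambda>y. HH (k1 y) (k2 y) g) g v =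
      tadd (tmap G.Arr G.Arr (\<lambda>y. HH (k1 y) eH g) g v) (tmap G.Arr G.Arr (\<lambda>y. HH eH (k2 y) g) g v)"
      using tmap_two[OF A mfd_K mfd_K A KK k1(1) k2(1) v] k1(2) k2(2) by simp
    have h1: "smooth_at K G.Arr (\<lambda>h. HH h eH g) (k1 g)" unfolding k1(2) by (rule HH_at[OF mfd_K smooth_at_id[OF mfd_K one_in] c1 cg])
    have h2: "smooth_at K G.Arr (\<lambda>h. HH eH h g) (k2 g)" unfolding k2(2) by (rule HH_at[OF mfd_K c1 smooth_at_id[OF mfd_K one_in] cg])
    show "v = tadd (tmap K G.Arr (\<lambda>h. HH h eH g) eH (tmap G.Arr K k1 g v)) (tmap K G.Arr (\<lambda>h. HH eH h g) eH (tmap G.Arr K k2 g v))"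
      using 1 2 tmap_compose[OF A mfd_K A k1(1) h1 v] tmap_compose[OF A mfd_K A k2(1) h2 v] k1(2) k2(2) by simp
    show "tmap G.Arr K k1 g v \<in> tangent_space K eH" "tmap G.Arr K k2 g v \<in> tangent_space K eH"
      using tmap_in[OF A mfd_K k1(1) v] tmap_in[OF A mfd_K k2(1) v] k1(2) k2(2) by auto
  qed
  have "mdim G.Arr = mdim Q.Arr + mdim L"
  proof (rule slice_dim[OF A AQ mL p_at[OF g] \<theta>(1,2) k a split])
    show "\<forall>\<^sub>F y in near Q.Arr (p g). \<forall>l\<in>points L. k (a l (\<theta> y)) = l \<and> p (a l (\<theta> y)) = y"
      using evQ
    proof eventually_elim
      case (elim y)
      show ?case
      proof
        fix l assume "l \<in> points L"
        then obtain h1 h2 where l: "l = (h1, h2)" "h1 \<in> points K" "h2 \<in> points K" by (auto simp: L_def prod_manifold_simps)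
        show "k (a l (\<theta> y)) = l \<and> p (a l (\<theta> y)) = y" using elim l p_HH[OF l(2,3)] by (simp add: k_def a_def)
      qed
    qed
  qed
  then show "mdim G.Arr = mdim Q.Arr + 2 * mdim K" by (simp add: L_def prod_manifold_simps)
qed

end

section \<open>Two-forms in coordinates\<close>

lemma form2D:
  assumes "is_form2 N \<omega>"
  shows form2_off: "x \<notin> points N \<or> v \<notin> tangent_space N x \<or> w \<notin> tangent_space N x \<Longrightarrow> \<omega> x v w = 0"
    and form2_cot: "x \<in> points N \<Longrightarrow> v \<in> tangent_space N x \<Longrightarrow> \<omega> x v \<in> cotangent_space N x"
    and form2_anti: "x \<in> points N \<Longrightarrow> v \<in> tangent_space N x \<Longrightarrow> w \<in> tangent_space N x \<Longrightarrow> \<omega> x w v = - \<omega> x v w"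
    and form2_comp: "c \<in> atlas N \<Longrightarrow> i < mdim N \<Longrightarrow> j < mdim N \<Longrightarrow> smooth_on (mdim N) (snd c ` fst c) (comp2 N c \<omega> i j)"
  using assms unfolding is_form2_def by blast+

lemma form2_linear:
  assumes \<omega>: "is_form2 N \<omega>" and x: "x \<in> points N" and v: "v \<in> tangent_space N x" and w: "w \<in> tangent_space N x"
    and u: "u \<in> tangent_space N x"
  shows form2_add2: "\<omega> x v (tadd w u) = \<omega> x v w + \<omega> x v u" and form2_add1: "\<omega> x (tadd w u) v = \<omega> x w v + \<omega> x u v"
    and form2_scale2: "\<omega> x v (tscale a w) = a * \<omega> x v w"
    and form2_zero1: "\<omega> x tzero v = 0"
proof -
  note c = form2_cot[OF \<omega> x v]
  show 1: "\<omega> x v (tadd w u) = \<omega> x v w + \<omega> x v u" by (rule cotangent_add[OF c w u])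
  show "\<omega> x v (tscale a w) = a * \<omega> x v w" by (rule cotangent_scale[OF c w])
  have 3: "\<omega> x v tzero = 0" by (rule cotangent_zero[OF c])
  note anti = form2_anti[OF \<omega> x v]
  show "\<omega> x (tadd w u) v = \<omega> x w v + \<omega> x u v" using 1 anti[OF tangent_add[OF w u]] anti[OF w] anti[OF u] by simp
  show "\<omega> x tzero v = 0" using 3 anti[OF tangent_zero] by simp
qed

lemma form2_expand:
  assumes N: "mfd N" and \<omega>: "is_form2 N \<omega>" and c: "c \<in> charts_at N x"
    and v: "v \<in> tangent_space N x" and w: "w \<in> tangent_space N x"
  shows "\<omega> x v w = (\<Sum>a<mdim N. \<Sum>b<mdim N. v c a * w c b * comp2 N c \<omega> a b (snd c x))"
proof -
  have x: "x \<in> points N" by (rule charts_at_points[OF N c])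
  have inv: "chart_inv c (snd c x) = x" by (rule chart_inv_left[OF mfd_chart[OF N c] charts_at_in(1)[OF c]])
  let ?e = "\<lambda>a. coord_vec N c a x"
  have e: "?e a \<in> tangent_space N x" if "a < mdim N" for a by (rule coord_vec(1)[OF N c that])
  have "\<omega> x v w = - \<omega> x w v" using form2_anti[OF \<omega> x v w] by simp
  also have "\<dots> = - (\<Sum>a<mdim N. v c a * \<omega> x w (?e a))" using cotangent_expand[OF N c v form2_cot[OF \<omega> x w]] by simp
  also have "\<dots> = (\<Sum>a<mdim N. v c a * \<omega> x (?e a) w)"
    unfolding sum_negf[symmetric] by (intro sum.cong refl) (use form2_anti[OF \<omega> x w e] in simp)
  also have "\<dots> = (\<Sum>a<mdim N. \<Sum>b<mdim N. v c a * w c b * comp2 N c \<omega> a b (snd c x))"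
    by (intro sum.cong refl)
       (simp add: cotangent_expand[OF N c w form2_cot[OF \<omega> x e]] sum_distrib_left comp2_def inv mult.assoc)
  finally show ?thesis .
qed

lemma partial_sum_germ:
  assumes "\<And>a. a \<in> A \<Longrightarrow> smooth_germ n y (f a)" "i < n"
  shows "partial i (\<lambda>z. \<Sum>a\<in>A. f a z) y = (\<Sum>a\<in>A. partial i (f a) y)"
  by (rule partialI) (rule DERIV_sum, rule smooth_germ_has_partial[OF assms(1) assms(2)])

lemma partial_mult_germ:
  assumes f: "smooth_germ n y f" and g: "smooth_germ n y g" and i: "i < n"
  shows "partial i (\<lambda>z. f z * g z) y = partial i f y * g y + f y * partial i g y"
proof (rule partialI)
  show "((\<lambda>t. f (y(i := t)) * g (y(i := t))) has_real_derivative partial i f y * g y + f y * partial i g y) (at (y i))"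
    using DERIV_mult[OF smooth_germ_has_partial[OF f i] smooth_germ_has_partial[OF g i]]
    unfolding fun_upd_triv by (simp only: mult.commute)
qed

text \<open>
  The exterior derivative commutes with pullback. In the derivative of a pulled back component the second derivatives
  \<open>A\<close> of the map appear in two sums that are exchanged by antisymmetry of \<open>W\<close> (the terms \<open>T\<close>);
  in the cyclic sum they cancel by symmetry of \<open>A\<close>, and what is left (the terms \<open>U\<close>) is the pullback of \<open>dW\<close>.
\<close>

lemma pullback_coordinates:
  assumes \<Theta>: "vgerm n m y \<Theta>" and W: "\<And>a b. a < m \<Longrightarrow> b < m \<Longrightarrow> smooth_germ m (\<Theta> y) (W a b)"
    and anti: "\<And>a b. a < m \<Longrightarrow> b < m \<Longrightarrow> W a b (\<Theta> y) = - W b a (\<Theta> y)"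
    and closed: "\<And>a b c. a < m \<Longrightarrow> b < m \<Longrightarrow> c < m \<Longrightarrow>
       partial a (W b c) (\<Theta> y) + partial b (W c a) (\<Theta> y) + partial c (W a b) (\<Theta> y) = 0"
  defines "E \<equiv> \<lambda>i j z. \<Sum>a<m. \<Sum>b<m. partial i (\<lambda>z. \<Theta> z a) z * partial j (\<lambda>z. \<Theta> z b) z * W a b (\<Theta> z)"
  shows "i < n \<Longrightarrow> j < n \<Longrightarrow> smooth_germ n y (E i j)"
    "i < n \<Longrightarrow> j < n \<Longrightarrow> k < n \<Longrightarrow> partial i (E j k) y + partial j (E k i) y + partial k (E i j) y = 0"
proof -
  have y: "y \<in> ES n" by (rule vgerm_ES(1)[OF \<Theta>])
  have t: "smooth_germ n y (\<lambda>z. \<Theta> z a)" if "a < m" for a using \<Theta> that by (simp add: vgerm_def)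
  have pt: "smooth_germ n y (partial i (\<lambda>z. \<Theta> z a))" if "a < m" "i < n" for a i
    by (rule smooth_germ_partial[OF t[OF that(1)] that(2)])
  have Wt: "smooth_germ n y (\<lambda>z. W a b (\<Theta> z))" if "a < m" "b < m" for a b
    by (rule smooth_germ_compose[OF \<Theta> W[OF that]])
  have trm: "smooth_germ n y (\<lambda>z. partial i (\<lambda>z. \<Theta> z a) z * partial j (\<lambda>z. \<Theta> z b) z * W a b (\<Theta> z))"
    if "a < m" "b < m" "i < n" "j < n" for a b i j
    by (intro smooth_germ_mult pt Wt that)
  show "smooth_germ n y (E i j)" if "i < n" "j < n" for i j
    unfolding E_def by (intro smooth_germ_sum y trm that) auto
  define P where "P i a = partial i (\<lambda>z. \<Theta> z a) y" for i a
  define A where "A k i a = partial k (partial i (\<lambda>z. \<Theta> z a)) y" for k i a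
  define w where "w a b = W a b (\<Theta> y)" for a b
  define D where "D c a b = partial c (W a b) (\<Theta> y)" for c a b
  have Asym: "A k i a = A i k a" if "a < m" "i < n" "k < n" for k i a
    unfolding A_def by (rule partial_commute[OF t[OF that(1)] that(3,2)])
  define T where "T k i j = (\<Sum>a<m. \<Sum>b<m. A k i a * P j b * w a b)" for k i j
  define U where "U k i j = (\<Sum>a<m. \<Sum>b<m. \<Sum>c<m. P i a * P j b * P k c * D c a b)" for k i j
  have dE: "partial k (E i j) y = T k i j - T k j i + U k i j" if ijk: "i < n" "j < n" "k < n" for i j k
  proof -
    have 1: "partial k (\<lambda>z. partial i (\<lambda>z. \<Theta> z a) z * partial j (\<lambda>z. \<Theta> z b) z * W a b (\<Theta> z)) y =
       A k i a * P j b * w a b + P i a * A k j b * w a b + (\<Sum>c<m. P i a * P j b * P k c * D c a b)"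
      if ab: "a < m" "b < m" for a b
    proof -
      have "partial k (\<lambda>z. partial i (\<lambda>z. \<Theta> z a) z * partial j (\<lambda>z. \<Theta> z b) z * W a b (\<Theta> z)) y =
        partial k (\<lambda>z. partial i (\<lambda>z. \<Theta> z a) z * partial j (\<lambda>z. \<Theta> z b) z) y * w a b +
        (P i a * P j b) * partial k (\<lambda>z. W a b (\<Theta> z)) y"
        unfolding w_def P_def
        by (rule partial_mult_germ[OF smooth_germ_mult[OF pt[OF ab(1) ijk(1)] pt[OF ab(2) ijk(2)]] Wt[OF ab] ijk(3)])
      also have "partial k (\<lambda>z. partial i (\<lambda>z. \<Theta> z a) z * partial j (\<lambda>z. \<Theta> z b) z) y = A k i a * P j b + P i a * A k j b"
        unfolding A_def P_def by (rule partial_mult_germ[OF pt[OF ab(1) ijk(1)] pt[OF ab(2) ijk(2)] ijk(3)])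
      also have "partial k (\<lambda>z. W a b (\<Theta> z)) y = (\<Sum>c<m. P k c * D c a b)"
        unfolding P_def D_def by (rule partial_compose[OF \<Theta> W[OF ab] ijk(3)])
      finally show ?thesis by (simp add: algebra_simps sum_distrib_left)
    qed
    have "partial k (E i j) y = (\<Sum>a<m. \<Sum>b<m. partial k (\<lambda>z. partial i (\<lambda>z. \<Theta> z a) z * partial j (\<lambda>z. \<Theta> z b) z * W a b (\<Theta> z)) y)"
    proof -
      have "partial k (E i j) y = (\<Sum>a<m. partial k (\<lambda>z. \<Sum>b<m. partial i (\<lambda>z. \<Theta> z a) z * partial j (\<lambda>z. \<Theta> z b) z * W a b (\<Theta> z)) y)"
        unfolding E_def by (rule partial_sum_germ[OF _ ijk(3)]) (intro smooth_germ_sum y trm ijk; simp)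
      also have "\<dots> = (\<Sum>a<m. \<Sum>b<m. partial k (\<lambda>z. partial i (\<lambda>z. \<Theta> z a) z * partial j (\<lambda>z. \<Theta> z b) z * W a b (\<Theta> z)) y)"
        by (intro sum.cong refl partial_sum_germ[OF _ ijk(3)] trm ijk) auto
      finally show ?thesis .
    qed
    also have "\<dots> = (\<Sum>a<m. \<Sum>b<m. A k i a * P j b * w a b + P i a * A k j b * w a b + (\<Sum>c<m. P i a * P j b * P k c * D c a b))"
      by (intro sum.cong refl 1) auto
    also have "\<dots> = T k i j + (\<Sum>a<m. \<Sum>b<m. P i a * A k j b * w a b) + U k i j"
      by (simp add: sum.distrib T_def U_def)
    also have "(\<Sum>a<m. \<Sum>b<m. P i a * A k j b * w a b) = - T k j i"
    proof -
      have 2: "P i a * A k j b * w a b = - (A k j b * P i a * w b a)" if "a < m" "b < m" for a b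
        using anti[OF that] by (simp add: w_def)
      have "(\<Sum>a<m. \<Sum>b<m. P i a * A k j b * w a b) = (\<Sum>a<m. \<Sum>b<m. - (A k j b * P i a * w b a))"
        by (intro sum.cong refl 2) auto
      also have "\<dots> = (\<Sum>b<m. \<Sum>a<m. - (A k j b * P i a * w b a))"
        by (rule sum.swap)
      finally show ?thesis by (simp add: T_def sum_negf)
    qed
    finally show ?thesis by simp
  qed
  fix i j k assume ijk: "i < n" "j < n" "k < n"
  have Tsym: "T k i j = T i k j" if "i < n" "k < n" for i j k
    unfolding T_def
  proof (intro sum.cong refl)
    fix a b assume "a \<in> {..<m}"
    then have "A k i a = A i k a" using Asym[of a i k] that by simp
    then show "A k i a * P j b * w a b = A i k a * P j b * w a b" by simp
  qed
  have T1: "T j i k = T i j k" "T k i j = T i k j" "T k j i = T j k i"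
    using Tsym[OF ijk(1,2)] Tsym[OF ijk(1,3)] Tsym[OF ijk(2,3)] by simp_all
  have U1: "U i j k = (\<Sum>a<m. \<Sum>b<m. \<Sum>c<m. P i a * P j b * P k c * D a b c)"
  proof -
    have "U i j k = (\<Sum>b<m. \<Sum>c<m. \<Sum>a<m. P j b * P k c * P i a * D a b c)" by (simp add: U_def)
    also have "\<dots> = (\<Sum>b<m. \<Sum>a<m. \<Sum>c<m. P j b * P k c * P i a * D a b c)"
      by (rule sum.cong[OF refl]) (rule sum.swap)
    also have "\<dots> = (\<Sum>a<m. \<Sum>b<m. \<Sum>c<m. P j b * P k c * P i a * D a b c)" by (rule sum.swap)
    finally show ?thesis by (simp add: mult_ac)
  qed
  have U2: "U j k i = (\<Sum>a<m. \<Sum>b<m. \<Sum>c<m. P i a * P j b * P k c * D b c a)"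
  proof -
    have "U j k i = (\<Sum>c<m. \<Sum>a<m. \<Sum>b<m. P k c * P i a * P j b * D b c a)" by (simp add: U_def)
    also have "\<dots> = (\<Sum>a<m. \<Sum>c<m. \<Sum>b<m. P k c * P i a * P j b * D b c a)" by (rule sum.swap)
    also have "\<dots> = (\<Sum>a<m. \<Sum>b<m. \<Sum>c<m. P k c * P i a * P j b * D b c a)"
      by (rule sum.cong[OF refl]) (rule sum.swap)
    finally show ?thesis by (simp add: mult_ac)
  qed
  have "U i j k + U j k i + U k i j = (\<Sum>a<m. \<Sum>b<m. \<Sum>c<m. P i a * P j b * P k c * (D a b c + D b c a + D c a b))"
    unfolding U1 U2 U_def[of k i j] by (simp add: sum.distrib distrib_left)
  also have "\<dots> = 0" using closed by (intro sum.neutral ballI) (simp add: D_def)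
  finally have "U i j k + U j k i + U k i j = 0" .
  then show "partial i (E j k) y + partial j (E k i) y + partial k (E i j) y = 0"
    using dE[OF ijk(2,3,1)] dE[OF ijk(3,1,2)] dE[OF ijk] T1 by simp
qed

lemma closed_components:
  assumes N: "mfd N" and cl: "closed_form2 N \<omega>" and x: "x \<in> points N" and abc: "a < mdim N" "b < mdim N" "e < mdim N"
  defines "c \<equiv> some_chart N x"
  shows "partial a (comp2 N c \<omega> b e) (snd c x) + partial b (comp2 N c \<omega> e a) (snd c x) + partial e (comp2 N c \<omega> a b) (snd c x) = 0"
proof -
  have c: "c \<in> charts_at N x" unfolding c_def by (rule some_chart_in[OF N x])
  have "ext_d2 N \<omega> x (coord_vec N c a x) (coord_vec N c b x) (coord_vec N c e x) = 0"
    using cl x coord_vec(1)[OF N c] abc unfolding closed_form2_def by blast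
  then show ?thesis
    using abc coord_vec(2)[OF N c]
    by (simp add: ext_d2_def Let_def c_def[symmetric] if_distrib[of "\<lambda>x. x * _"] if_distrib[of "\<lambda>x. _ * x"] mult.assoc
        sum_distrib_left[symmetric] cong: if_cong)
qed

text \<open>
  A form \<open>\<eta>\<close> that equals the pullback of \<open>\<omega>\<close> by a local map inherits smoothness and closedness at the
  point. No smoothness of \<open>\<eta>\<close> is presupposed: its components are identified with those of \<open>pullback_coordinates\<close>.
\<close>

lemma local_pullback_form:
  assumes N: "mfd N" and X: "mfd X" and \<omega>: "is_form2 X \<omega>" and cl: "closed_form2 X \<omega>"
    and \<theta>: "smooth_at N X \<theta> x" and d: "d \<in> charts_at N x"
    and \<eta>: "eventually (\<lambda>x. \<forall>v\<in>tangent_space N x. \<forall>w\<in>tangent_space N x.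
        \<eta> x v w = \<omega> (\<theta> x) (tmap N X \<theta> x v) (tmap N X \<theta> x w)) (near N x)"
  shows "i < mdim N \<Longrightarrow> j < mdim N \<Longrightarrow> smooth_germ (mdim N) (snd d x) (comp2 N d \<eta> i j)"
    "i < mdim N \<Longrightarrow> j < mdim N \<Longrightarrow> k < mdim N \<Longrightarrow>
       partial i (comp2 N d \<eta> j k) (snd d x) + partial j (comp2 N d \<eta> k i) (snd d x) + partial k (comp2 N d \<eta> i j) (snd d x) = 0"
proof -
  note px = smooth_at_points[OF N X \<theta>]
  define c where "c = some_chart X (\<theta> x)"
  have c: "c \<in> charts_at X (\<theta> x)" unfolding c_def by (rule some_chart_in[OF X px(2)])
  note cc = mfd_chart[OF X c] charts_at_in[OF c] and dd = mfd_chart[OF N d] charts_at_in[OF d]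
  let ?n = "mdim N" and ?m = "mdim X" and ?y = "snd d x"
  define \<Theta> where "\<Theta> = chart_rep d c \<theta>"
  have \<Theta>: "vgerm ?n ?m ?y \<Theta>" using smooth_at_rep[OF N X \<theta> d c] by (simp add: smooth_rep_def \<Theta>_def)
  have \<Theta>y: "\<Theta> ?y = snd c (\<theta> x)" by (simp add: \<Theta>_def chart_rep_def chart_inv_left[OF dd(1,2)])
  define W where "W a b = comp2 X c \<omega> a b" for a b
  have W: "smooth_germ ?m (\<Theta> ?y) (W a b)" if "a < ?m" "b < ?m" for a b
    unfolding W_def \<Theta>y by (rule smooth_on_germ[OF form2_comp[OF \<omega> cc(3) that]]) (use cc(2) in blast)
  have anti: "W a b (\<Theta> ?y) = - W b a (\<Theta> ?y)" if "a < ?m" "b < ?m" for a b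
    unfolding W_def \<Theta>y comp2_def Let_def chart_inv_left[OF cc(1,2)]
    by (rule form2_anti[OF \<omega> px(2) coord_vec(1)[OF X c that(2)] coord_vec(1)[OF X c that(1)]])
  have closed: "partial a (W b e) (\<Theta> ?y) + partial b (W e a) (\<Theta> ?y) + partial e (W a b) (\<Theta> ?y) = 0"
    if "a < ?m" "b < ?m" "e < ?m" for a b e
    unfolding W_def \<Theta>y c_def by (rule closed_components[OF X cl px(2) that])
  define E where "E = (\<lambda>i j z. \<Sum>a<?m. \<Sum>b<?m. partial i (\<lambda>z. \<Theta> z a) z * partial j (\<lambda>z. \<Theta> z b) z * W a b (\<Theta> z))"
  have ev: "eventually (\<lambda>x'. x' \<in> fst d \<and> \<theta> x' \<in> fst c \<and> smooth_at N X \<theta> x' \<and>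
     (\<forall>v\<in>tangent_space N x'. \<forall>w\<in>tangent_space N x'. \<eta> x' v w = \<omega> (\<theta> x') (tmap N X \<theta> x' v) (tmap N X \<theta> x' w))) (near N x)"
    using \<eta> smooth_at_eventually[OF N X \<theta>] eventually_nhdsin_in[OF chart_dom_open[OF dd(1)] dd(2)]
      smooth_at_rep[OF N X \<theta> d c, unfolded smooth_rep_def, THEN conjunct2, THEN conjunct2, THEN conjunct1]
    by eventually_elim simp
  have cE: "eventually (\<lambda>z. E i j z = comp2 N d \<eta> i j z) (nhdsE ?n ?y)" if ij: "i < ?n" "j < ?n" for i j
    using chart_eventually2[OF dd(1,2) ev] chart_eventually_dom[OF dd(1,2)]
  proof eventually_elim
    case (elim z)
    define x' where "x' = chart_inv d z"
    have x': "x' \<in> fst d" "\<theta> x' \<in> fst c" "smooth_at N X \<theta> x'" "snd d x' = z" and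
      eta: "\<And>v w. v \<in> tangent_space N x' \<Longrightarrow> w \<in> tangent_space N x' \<Longrightarrow> \<eta> x' v w = \<omega> (\<theta> x') (tmap N X \<theta> x' v) (tmap N X \<theta> x' w)"
      using elim unfolding x'_def by blast+
    have d': "d \<in> charts_at N x'" and c': "c \<in> charts_at X (\<theta> x')" using x' cc dd by (simp_all add: charts_at_def)
    note cv = coord_vec[OF N d']
    have tm: "tmap N X \<theta> x' (coord_vec N d l x') c a = partial l (\<lambda>z. \<Theta> z a) z" if "l < ?n" for l a
      using tmap_chart[OF N X x'(3) cv(1)[OF that] d' c'] cv(2)[OF that] that x'(4)
      by (simp add: jacobian_def \<Theta>_def if_distrib[of "\<lambda>x. x * _"] cong: if_cong)
    have \<Theta>z: "\<Theta> z = snd c (\<theta> x')" by (simp add: \<Theta>_def chart_rep_def x'_def)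
    have "comp2 N d \<eta> i j z = \<omega> (\<theta> x') (tmap N X \<theta> x' (coord_vec N d i x')) (tmap N X \<theta> x' (coord_vec N d j x'))"
      using eta[OF cv(1)[OF ij(1)] cv(1)[OF ij(2)]] by (simp add: comp2_def Let_def x'_def[symmetric])
    also have "\<dots> = E i j z"
      unfolding form2_expand[OF X \<omega> c' tmap_in[OF N X x'(3) cv(1)[OF ij(1)]] tmap_in[OF N X x'(3) cv(1)[OF ij(2)]]]
      by (simp add: E_def tm ij \<Theta>z W_def)
    finally show ?case by simp
  qed
  have yE: "?y \<in> ES ?n" by (rule chart_ES[OF dd(1,2)])
  have pb1: "smooth_germ ?n ?y (E i j)" if "i < ?n" "j < ?n" for i j
    unfolding E_def by (rule pullback_coordinates(1)[OF \<Theta> W anti closed that])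
  have pb2: "partial i (E j k) ?y + partial j (E k i) ?y + partial k (E i j) ?y = 0" if "i < ?n" "j < ?n" "k < ?n" for i j k
    unfolding E_def by (rule pullback_coordinates(2)[OF \<Theta> W anti closed that])
  show "smooth_germ ?n ?y (comp2 N d \<eta> i j)" if "i < ?n" "j < ?n"
    by (rule smooth_germ_cong[OF cE[OF that] pb1[OF that]])
  have pe: "partial l (comp2 N d \<eta> i j) ?y = partial l (E i j) ?y" if "i < ?n" "j < ?n" "l < ?n" for i j l
    using partial_cong_germ[OF cE[OF that(1,2)] yE that(3)] by simp
  show "partial i (comp2 N d \<eta> j k) ?y + partial j (comp2 N d \<eta> k i) ?y + partial k (comp2 N d \<eta> i j) ?y = 0"
    if "i < ?n" "j < ?n" "k < ?n"
    using pb2[OF that] pe that by simp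
qed

section \<open>Multiplicative forms\<close>

context lie_gpd begin

lemma fst_at: "z \<in> composable G \<Longrightarrow> smooth_at Cmp Arr fst z"
  and snd_at: "z \<in> composable G \<Longrightarrow> smooth_at Cmp Arr snd z"
proof -
  assume z: "z \<in> composable G"
  let ?P = "prod_manifold Arr Arr"
  have P: "mfd ?P" by (rule mfd_prod[OF mfd_Arr mfd_Arr])
  obtain g h where gh: "z = (g, h)" "g \<in> points Arr" "h \<in> points Arr" using z by (auto simp: composable_def)
  have "smooth_at (submanifold ?P (composable G) (2 * mdim Arr - mdim Bas)) ?P (\<lambda>x. x) z"
    by (rule smooth_at_incl[OF P mfd_Cmp[unfolded composable_manifold_def] _ z]) (simp add: prod_manifold_simps gh)
  then have i: "smooth_at Cmp ?P (\<lambda>x. x) z" by (simp add: composable_manifold_def)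
  show "smooth_at Cmp Arr fst z"
    using smooth_at_compose[OF mfd_Cmp P mfd_Arr i] smooth_at_fst[OF mfd_Arr mfd_Arr gh(2,3)] gh(1) by simp
  show "smooth_at Cmp Arr snd z"
    using smooth_at_compose[OF mfd_Cmp P mfd_Arr i] smooth_at_snd[OF mfd_Arr mfd_Arr gh(2,3)] gh(1) by simp
qed

text \<open>
  Multiplicativity evaluated on the velocities of two families of composable pairs through the same pair. The families may be
  parametrized by different manifolds: below, one runs along an orbit and the other through arbitrary arrows.
\<close>

lemma mult_eval:
  assumes ml: "multiplicative G \<omega>" and W1: "mfd W1" and W2: "mfd W2"
    and a1: "smooth_at W1 Arr a1 w1" and b1: "smooth_at W1 Arr b1 w1"
    and c1: "eventually (\<lambda>w. src G (a1 w) = tgt G (b1 w)) (near W1 w1)"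
    and a2: "smooth_at W2 Arr a2 w2" and b2: "smooth_at W2 Arr b2 w2"
    and c2: "eventually (\<lambda>w. src G (a2 w) = tgt G (b2 w)) (near W2 w2)"
    and eq: "a1 w1 = a2 w2" "b1 w1 = b2 w2"
    and u1: "u1 \<in> tangent_space W1 w1" and u2: "u2 \<in> tangent_space W2 w2"
  shows "\<omega> (cmp G (a1 w1) (b1 w1)) (tmap W1 Arr (\<lambda>w. cmp G (a1 w) (b1 w)) w1 u1) (tmap W2 Arr (\<lambda>w. cmp G (a2 w) (b2 w)) w2 u2) =
    \<omega> (a1 w1) (tmap W1 Arr a1 w1 u1) (tmap W2 Arr a2 w2 u2) + \<omega> (b1 w1) (tmap W1 Arr b1 w1 u1) (tmap W2 Arr b2 w2 u2)"
proof -
  note p1 = pair_at[OF W1 a1 b1 c1] and p2 = pair_at[OF W2 a2 b2 c2]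
  let ?z = "(a1 w1, b1 w1)"
  have z: "?z \<in> points Cmp" "?z \<in> composable G" using smooth_at_points(2)[OF W1 mfd_Cmp p1] points_Cmp by auto
  have z2: "(a2 w2, b2 w2) = ?z" using eq by simp
  define v1 where "v1 = tmap W1 Cmp (\<lambda>w. (a1 w, b1 w)) w1 u1"
  define v2 where "v2 = tmap W2 Cmp (\<lambda>w. (a2 w, b2 w)) w2 u2"
  have v: "v1 \<in> tangent_space Cmp ?z" "v2 \<in> tangent_space Cmp ?z"
    using tmap_in[OF W1 mfd_Cmp p1 u1] tmap_in[OF W2 mfd_Cmp p2 u2] z2 by (auto simp: v1_def v2_def)
  note at = mult_at[OF z(2)] fst_at[OF z(2)] snd_at[OF z(2)]
  have z3: "(a2 w2, b2 w2) \<in> composable G" using z(2) z2 by simp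
  note at2 = mult_at[OF z3] fst_at[OF z3] snd_at[OF z3]
  have t1: "tmap Cmp Arr (\<lambda>(g, h). cmp G g h) ?z v1 = tmap W1 Arr (\<lambda>w. cmp G (a1 w) (b1 w)) w1 u1"
    "tmap Cmp Arr fst ?z v1 = tmap W1 Arr a1 w1 u1" "tmap Cmp Arr snd ?z v1 = tmap W1 Arr b1 w1 u1"
    using tmap_compose[OF W1 mfd_Cmp mfd_Arr p1 at(1) u1] tmap_compose[OF W1 mfd_Cmp mfd_Arr p1 at(2) u1]
      tmap_compose[OF W1 mfd_Cmp mfd_Arr p1 at(3) u1] by (simp_all add: v1_def)
  have t2: "tmap Cmp Arr (\<lambda>(g, h). cmp G g h) ?z v2 = tmap W2 Arr (\<lambda>w. cmp G (a2 w) (b2 w)) w2 u2"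
    "tmap Cmp Arr fst ?z v2 = tmap W2 Arr a2 w2 u2" "tmap Cmp Arr snd ?z v2 = tmap W2 Arr b2 w2 u2"
    using tmap_compose[OF W2 mfd_Cmp mfd_Arr p2 at2(1) u2] tmap_compose[OF W2 mfd_Cmp mfd_Arr p2 at2(2) u2]
      tmap_compose[OF W2 mfd_Cmp mfd_Arr p2 at2(3) u2] by (simp_all add: v2_def eq)
  have "form2_pullback Cmp Arr (\<lambda>(g, h). cmp G g h) \<omega> ?z v1 v2 =
     form2_pullback Cmp Arr fst \<omega> ?z v1 v2 + form2_pullback Cmp Arr snd \<omega> ?z v1 v2"
    using ml unfolding multiplicative_def Let_def by metis
  then show ?thesis using z v by (simp add: form2_pullback_def t1 t2)
qed

text \<open>
  A unit is the product of itself with itself, so the value is equal to its double.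
\<close>

lemma unit_isotropic:
  assumes ml: "multiplicative G \<omega>" and x: "x \<in> points Bas" and u: "u \<in> tangent_space Bas x" and v: "v \<in> tangent_space Bas x"
  shows "\<omega> (unit_arr G x) (tmap Bas Arr (unit_arr G) x u) (tmap Bas Arr (unit_arr G) x v) = 0"
proof -
  note un = unit_at[OF x]
  have e: "eventually (\<lambda>w. src G (unit_arr G w) = tgt G (unit_arr G w)) (near Bas x)"
    using points_near[OF x] by eventually_elim (simp add: unit_simps)
  have e2: "eventually (\<lambda>w. cmp G (unit_arr G w) (unit_arr G w) = unit_arr G w) (near Bas x)"
    using points_near[OF x] by eventually_elim (use inv_simps(1)[OF unit_in] unit_simps in simp)
  have s: "smooth_at Bas Arr (\<lambda>w. cmp G (unit_arr G w) (unit_arr G w)) x" by (rule cmp_at[OF mfd_Bas un un e])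
  have t: "tmap Bas Arr (\<lambda>w. cmp G (unit_arr G w) (unit_arr G w)) x = tmap Bas Arr (unit_arr G) x"
    by (rule tmap_cong[OF mfd_Bas s mfd_Arr e2])
  show ?thesis using mult_eval[OF ml mfd_Bas mfd_Bas un un e un un e refl refl u v] near_self[OF x e2] t by simp
qed

text \<open>
  The product of \<open>g\<close> and its inverse runs through units, and the form is zero on vectors tangent to the units.
\<close>

lemma inverse_anti:
  assumes ml: "multiplicative G \<omega>" and g: "g \<in> points Arr" and u: "u \<in> tangent_space Arr g" and v: "v \<in> tangent_space Arr g"
  shows "\<omega> (inv_arr G g) (tmap Arr Arr (inv_arr G) g u) (tmap Arr Arr (inv_arr G) g v) = - \<omega> g u v"
proof -
  note A = mfd_Arr and id = smooth_at_id[OF mfd_Arr g] and iv = inv_at[OF g] and tg = tgt_at[OF g]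
  have e: "eventually (\<lambda>w. src G w = tgt G (inv_arr G w)) (near Arr g)"
    using points_near[OF g] by eventually_elim (simp add: inv_simps)
  have e2: "eventually (\<lambda>w. cmp G w (inv_arr G w) = unit_arr G (tgt G w)) (near Arr g)"
    using points_near[OF g] by eventually_elim (simp add: inv_simps)
  have s: "smooth_at Arr Arr (\<lambda>w. cmp G w (inv_arr G w)) g" by (rule cmp_at[OF A id iv e])
  have t: "tmap Arr Arr (\<lambda>w. cmp G w (inv_arr G w)) g = tmap Arr Arr (\<lambda>w. unit_arr G (tgt G w)) g"
    by (rule tmap_cong[OF A s A e2])
  have t': "tmap Arr Arr (\<lambda>w. unit_arr G (tgt G w)) g u' = tmap Bas Arr (unit_arr G) (tgt G g) (tmap Arr Bas (tgt G) g u')"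
    if "u' \<in> tangent_space Arr g" for u'
    by (rule tmap_compose[OF A mfd_Bas A tg unit_at[OF tgt_in[OF g]] that])
  show ?thesis
    using mult_eval[OF ml A A id iv e id iv e refl refl u v] near_self[OF g e2] t t' u v tmap_id[OF A g]
      unit_isotropic[OF ml tgt_in[OF g] tmap_in[OF A mfd_Bas tg u] tmap_in[OF A mfd_Bas tg v]] by simp
qed

end

section \<open>Basic forms on the groupoid\<close>

locale form_quotient = groupoid_quotient G Q H M act B q \<Psi>
  for G :: "('g, 'm) groupoid_data" and Q :: "('g set, 'b) groupoid_data"
    and H :: "'h lie_group_data" and M :: "'m manifold" and act :: "'h \<Rightarrow> 'm \<Rightarrow> 'm" and B :: "'b manifold"
    and q :: "'m \<Rightarrow> 'b" and \<Psi> :: "'h \<times> 'm \<Rightarrow> 'g" +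
  fixes \<omega> :: "'g form2"
  assumes pre: "presymplectic_groupoid G \<omega>" and adm: "H_admissible H M act G \<omega> \<Psi>"
begin

lemma form: "is_form2 G.Arr \<omega>" and clos: "closed_form2 G.Arr \<omega>" and mlt: "multiplicative G \<omega>"
  and dims: "mdim G.Arr = 2 * mdim M"
  using pre bG by (auto simp: presymplectic_groupoid_def)

lemma psi_x_at: "x \<in> points M \<Longrightarrow> smooth_at K G.Arr (\<lambda>h. \<Psi> (h, x)) eH"
  by (rule psi_comp_at[OF mfd_K smooth_at_id[OF mfd_K one_in] smooth_at_const[OF mfd_K mfd_M one_in]])

text \<open>
  The infinitesimal morphism \<open>u \<mapsto> d\<Psi>(u)\<close> with values in the Lie algebroid at \<open>x\<close>.
\<close>

abbreviation "inf_psi x u \<equiv> tmap K G.Arr (\<lambda>h. \<Psi> (h, x)) eH u"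

lemma inf_psi_in: "x \<in> points M \<Longrightarrow> u \<in> tangent_space K eH \<Longrightarrow> inf_psi x u \<in> tangent_space G.Arr (unit_arr G x)"
  using tmap_in[OF mfd_K G.mfd_Arr psi_x_at] psi_one by simp

text \<open>
  By admissibility, this is the second component of \<open>\<delta>\<^sub>\<omega>(d\<Psi>(u)) = (u\<^sub>M, 0)\<close>.
\<close>

lemma mu_inf_psi:
  assumes x: "x \<in> points M" and u: "u \<in> tangent_space K eH"
  shows "mu_map G \<omega> x (inf_psi x u) = (\<lambda>_. 0)"
proof -
  let ?P = "prod_manifold K M"
  have P: "mfd ?P" by (rule mfd_prod[OF mfd_K mfd_M])
  have s: "smooth_at K ?P (\<lambda>h. (h, x)) eH"
    by (rule smooth_at_Pair[OF mfd_K mfd_K mfd_M smooth_at_id[OF mfd_K one_in] smooth_at_const[OF mfd_K mfd_M one_in x]])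
  have "tmap ?P G.Arr \<Psi> (eH, x) (tmap K ?P (\<lambda>h. (h, x)) eH u) = inf_psi x u"
    using tmap_compose[OF mfd_K P G.mfd_Arr s psi_at[OF one_in x] u] by simp
  moreover have "snd (delta_map G \<omega> x (tmap ?P G.Arr \<Psi> (eH, x) (tmap K ?P (\<lambda>h. (h, x)) eH u))) = (\<lambda>_. 0)"
    using adm x u by (simp add: H_admissible_def lie_algebra_def)
  ultimately show ?thesis by (simp add: delta_map_def)
qed

lemma mu_inf_psi_eval:
  assumes x: "x \<in> points M" and u: "u \<in> tangent_space K eH" and w: "w \<in> tangent_space M x"
  shows "\<omega> (unit_arr G x) (inf_psi x u) (tmap M G.Arr (unit_arr G) x w) = 0"
  using fun_cong[OF mu_inf_psi[OF x u], of w] w by (simp add: mu_map_def covec_pullback_def bG)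

lemma unit_tgt_at: "g \<in> points G.Arr \<Longrightarrow> smooth_at G.Arr G.Arr (\<lambda>g. unit_arr G (tgt G g)) g"
  and unit_src_at: "g \<in> points G.Arr \<Longrightarrow> smooth_at G.Arr G.Arr (\<lambda>g. unit_arr G (src G g)) g"
  using smooth_at_compose[OF G.mfd_Arr G.mfd_Bas G.mfd_Arr G.tgt_at G.unit_at[OF G.tgt_in]]
    smooth_at_compose[OF G.mfd_Arr G.mfd_Bas G.mfd_Arr G.src_at G.unit_at[OF G.src_in]] by auto

lemma HH_orbit_at:
  assumes g: "g \<in> points G.Arr"
  shows "smooth_at K G.Arr (\<lambda>h. HH h eH g) eH" "smooth_at K G.Arr (\<lambda>h. HH eH h g) eH"
proof -
  have cg: "smooth_at K G.Arr (\<lambda>_. g) eH" and c1: "smooth_at K K (\<lambda>_. eH) eH"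
    using smooth_at_const[OF mfd_K G.mfd_Arr one_in g] smooth_at_const[OF mfd_K mfd_K one_in one_in] by auto
  show "smooth_at K G.Arr (\<lambda>h. HH h eH g) eH" by (rule HH_at[OF mfd_K smooth_at_id[OF mfd_K one_in] c1 cg])
  show "smooth_at K G.Arr (\<lambda>h. HH eH h g) eH" by (rule HH_at[OF mfd_K c1 smooth_at_id[OF mfd_K one_in] cg])
qed

text \<open>
  Multiplicativity for the pairs \<open>(\<Psi>(h, t g), g)\<close> with \<open>h\<close> varying and \<open>(1, g)\<close> with \<open>g\<close> varying. In the first family the
  second component is constant, so only the contribution of \<open>\<Psi>\<close> paired with a vector tangent to the units is left.
\<close>

lemma left_orbit:
  assumes g: "g \<in> points G.Arr" and u: "u \<in> tangent_space K eH" and w: "w \<in> tangent_space G.Arr g"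
  shows "\<omega> g (tmap K G.Arr (\<lambda>h. HH h eH g) eH u) w = 0"
proof -
  note A = G.mfd_Arr
  define x where "x = tgt G g"
  have x: "x \<in> points M" using tgtM[OF g] by (simp add: x_def)
  have a1: "smooth_at K G.Arr (\<lambda>h. \<Psi> (h, x)) eH" by (rule psi_x_at[OF x])
  have b1: "smooth_at K G.Arr (\<lambda>_. g) eH" by (rule smooth_at_const[OF mfd_K A one_in g])
  have c1: "eventually (\<lambda>h. src G (\<Psi> (h, x)) = tgt G g) (near K eH)"
    using points_near[OF one_in] by eventually_elim (simp add: psi_src x x_def[symmetric])
  have c2: "eventually (\<lambda>g. src G (unit_arr G (tgt G g)) = tgt G g) (near G.Arr g)"
    using points_near[OF g] by eventually_elim (simp add: G.unit_simps G.tgt_in)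
  have e1: "eventually (\<lambda>h. cmp G (\<Psi> (h, x)) g = HH h eH g) (near K eH)"
    using points_near[OF one_in] by eventually_elim (simp add: HH_one1[OF _ g] x_def)
  have e2: "eventually (\<lambda>g. cmp G (unit_arr G (tgt G g)) g = g) (near G.Arr g)"
    using points_near[OF g] by eventually_elim (simp add: G.inv_simps)
  have t1: "tmap K G.Arr (\<lambda>h. cmp G (\<Psi> (h, x)) g) eH = tmap K G.Arr (\<lambda>h. HH h eH g) eH"
    by (rule tmap_cong[OF mfd_K G.cmp_at[OF mfd_K a1 b1 c1] A e1])
  have t2: "tmap G.Arr G.Arr (\<lambda>g. cmp G (unit_arr G (tgt G g)) g) g w = w" by (rule tmap_id_near[OF A g w e2])
  have tg: "tmap G.Arr G.Bas (tgt G) g w \<in> tangent_space M x"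
    using tmap_in[OF A G.mfd_Bas G.tgt_at[OF g] w] by (simp add: bG x_def)
  have t3: "tmap G.Arr G.Arr (\<lambda>g. unit_arr G (tgt G g)) g w = tmap M G.Arr (unit_arr G) x (tmap G.Arr G.Bas (tgt G) g w)"
    using tmap_compose[OF A G.mfd_Bas A G.tgt_at[OF g] G.unit_at[OF G.tgt_in[OF g]] w] by (simp add: bG x_def)
  have "\<omega> (cmp G (\<Psi> (eH, x)) g) (tmap K G.Arr (\<lambda>h. cmp G (\<Psi> (h, x)) g) eH u) (tmap G.Arr G.Arr (\<lambda>g. cmp G (unit_arr G (tgt G g)) g) g w)
    = \<omega> (\<Psi> (eH, x)) (inf_psi x u) (tmap G.Arr G.Arr (\<lambda>g. unit_arr G (tgt G g)) g w)
    + \<omega> g (tmap K G.Arr (\<lambda>_. g) eH u) (tmap G.Arr G.Arr (\<lambda>g. g) g w)"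
    by (rule G.mult_eval[OF mlt mfd_K A a1 b1 c1 unit_tgt_at[OF g] smooth_at_id[OF A g] c2 _ _ u w])
       (simp_all add: psi_one[OF tgtM[OF g]] x_def)
  then show ?thesis
    using t1 t2 t3 mu_inf_psi_eval[OF x u tg] form2_zero1[OF form g w w w] psi_one[OF x] G.inv_simps(1)[OF g]
    by (simp add: tmap_const tmap_id[OF A g w] x_def)
qed

text \<open>
  As for the left action, with the pairs \<open>(g, \<Psi>(h, s g)\<^sup>-\<^sup>1)\<close> and \<open>(g, 1)\<close>. Inversion fixes the units and
  reverses the sign of the form, so the contribution of the inverse of \<open>\<Psi>\<close> vanishes as well.
\<close>

lemma right_orbit:
  assumes g: "g \<in> points G.Arr" and u: "u \<in> tangent_space K eH" and w: "w \<in> tangent_space G.Arr g"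
  shows "\<omega> g (tmap K G.Arr (\<lambda>h. HH eH h g) eH u) w = 0"
proof -
  note A = G.mfd_Arr
  define x where "x = src G g"
  have x: "x \<in> points M" using srcM[OF g] by (simp add: x_def)
  have xB: "x \<in> points G.Bas" using x bG by simp
  let ?i = "inv_arr G"
  have ps: "smooth_at K G.Arr (\<lambda>h. \<Psi> (h, x)) eH" by (rule psi_x_at[OF x])
  have iu: "smooth_at G.Arr G.Arr ?i (\<Psi> (eH, x))" by (rule G.inv_at[OF psi_in[OF one_in x]])
  have b1: "smooth_at K G.Arr (\<lambda>h. ?i (\<Psi> (h, x))) eH" by (rule smooth_at_compose[OF mfd_K A A ps iu])
  have a1: "smooth_at K G.Arr (\<lambda>_. g) eH" by (rule smooth_at_const[OF mfd_K A one_in g])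
  have c1: "eventually (\<lambda>h. src G g = tgt G (?i (\<Psi> (h, x)))) (near K eH)"
    using points_near[OF one_in] by eventually_elim (simp add: psi_src psi_in G.inv_simps x x_def[symmetric])
  have c2: "eventually (\<lambda>g. src G g = tgt G (unit_arr G (src G g))) (near G.Arr g)"
    using points_near[OF g] by eventually_elim (simp add: G.unit_simps G.src_in)
  have e1: "eventually (\<lambda>h. cmp G g (?i (\<Psi> (h, x))) = HH eH h g) (near K eH)"
    using points_near[OF one_in] by eventually_elim (simp add: HH_one2[OF _ g] x_def)
  have e2: "eventually (\<lambda>g. cmp G g (unit_arr G (src G g)) = g) (near G.Arr g)"
    using points_near[OF g] by eventually_elim (simp add: G.inv_simps)
  have t1: "tmap K G.Arr (\<lambda>h. cmp G g (?i (\<Psi> (h, x)))) eH = tmap K G.Arr (\<lambda>h. HH eH h g) eH"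
    by (rule tmap_cong[OF mfd_K G.cmp_at[OF mfd_K a1 b1 c1] A e1])
  have t2: "tmap G.Arr G.Arr (\<lambda>g. cmp G g (unit_arr G (src G g))) g w = w" by (rule tmap_id_near[OF A g w e2])
  define y where "y = tmap G.Arr G.Bas (src G) g w"
  have y: "y \<in> tangent_space M x"
    using tmap_in[OF A G.mfd_Bas G.src_at[OF g] w] by (simp add: bG x_def y_def)
  have yB: "y \<in> tangent_space G.Bas x" using y bG by simp
  have t3: "tmap G.Arr G.Arr (\<lambda>g. unit_arr G (src G g)) g w = tmap M G.Arr (unit_arr G) x y"
    using tmap_compose[OF A G.mfd_Bas A G.src_at[OF g] G.unit_at[OF G.src_in[OF g]] w] by (simp add: bG x_def y_def)
  have t4: "tmap K G.Arr (\<lambda>h. ?i (\<Psi> (h, x))) eH u = tmap G.Arr G.Arr ?i (unit_arr G x) (inf_psi x u)"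
    using tmap_compose[OF mfd_K A A ps iu u] psi_one[OF x] by simp
  have t5: "tmap M G.Arr (unit_arr G) x y = tmap G.Arr G.Arr ?i (unit_arr G x) (tmap M G.Arr (unit_arr G) x y)"
  proof -
    have iu': "smooth_at G.Arr G.Arr ?i (unit_arr G x)" by (rule G.inv_at[OF G.unit_in[OF xB]])
    have ev: "eventually (\<lambda>x. unit_arr G x = ?i (unit_arr G x)) (near G.Bas x)"
      using points_near[OF xB] by eventually_elim (simp add: G.inv_unit)
    show ?thesis
      using tmap_compose[OF G.mfd_Bas A A G.unit_at[OF xB] iu' yB]
        tmap_cong[OF G.mfd_Bas G.unit_at[OF xB] A ev] by (simp add: bG)
  qed
  have d1: "tmap M G.Arr (unit_arr G) x y \<in> tangent_space G.Arr (unit_arr G x)"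
    using tmap_in[OF G.mfd_Bas A G.unit_at[OF xB] yB] bG by simp
  have "\<omega> (cmp G g (?i (\<Psi> (eH, x)))) (tmap K G.Arr (\<lambda>h. cmp G g (?i (\<Psi> (h, x)))) eH u) (tmap G.Arr G.Arr (\<lambda>g. cmp G g (unit_arr G (src G g))) g w)
    = \<omega> g (tmap K G.Arr (\<lambda>_. g) eH u) (tmap G.Arr G.Arr (\<lambda>g. g) g w)
    + \<omega> (?i (\<Psi> (eH, x))) (tmap K G.Arr (\<lambda>h. ?i (\<Psi> (h, x))) eH u) (tmap G.Arr G.Arr (\<lambda>g. unit_arr G (src G g)) g w)"
    by (rule G.mult_eval[OF mlt mfd_K A a1 b1 c1 smooth_at_id[OF A g] unit_src_at[OF g] c2 _ _ u w])
       (simp_all add: psi_one[OF x] G.inv_unit[OF xB] x_def[symmetric])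
  moreover have "\<omega> (unit_arr G x) (tmap G.Arr G.Arr ?i (unit_arr G x) (inf_psi x u)) (tmap M G.Arr (unit_arr G) x y) = 0"
  proof -
    have "\<omega> (?i (unit_arr G x)) (tmap G.Arr G.Arr ?i (unit_arr G x) (inf_psi x u)) (tmap G.Arr G.Arr ?i (unit_arr G x) (tmap M G.Arr (unit_arr G) x y)) = 0"
      using G.inverse_anti[OF mlt G.unit_in[OF xB] inf_psi_in[OF x u] d1] mu_inf_psi_eval[OF x u y] by simp
    then show ?thesis using t5 G.inv_unit[OF xB] by simp
  qed
  ultimately show ?thesis
    using t1 t2 t3 t4 form2_zero1[OF form g w w w] psi_one[OF x] G.inv_simps(2)[OF g] G.inv_unit[OF xB]
    by (simp add: tmap_const tmap_id[OF A g w] x_def)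
qed

lemma horizontal:
  assumes g: "g \<in> points G.Arr" and v: "v \<in> tangent_space G.Arr g" and pv: "tmap G.Arr Q.Arr p g v = tzero"
    and w: "w \<in> tangent_space G.Arr g"
  shows "\<omega> g v w = 0"
proof -
  obtain u1 u2 where u: "u1 \<in> tangent_space K eH" "u2 \<in> tangent_space K eH"
    "v = tadd (tmap K G.Arr (\<lambda>h. HH h eH g) eH u1) (tmap K G.Arr (\<lambda>h. HH eH h g) eH u2)"
    using p_vertical[OF g v pv] by blast
  have "tmap K G.Arr (\<lambda>h. HH h eH g) eH u1 \<in> tangent_space G.Arr g" "tmap K G.Arr (\<lambda>h. HH eH h g) eH u2 \<in> tangent_space G.Arr g"
    using tmap_in[OF mfd_K G.mfd_Arr HH_orbit_at(1)[OF g] u(1)] tmap_in[OF mfd_K G.mfd_Arr HH_orbit_at(2)[OF g] u(2)] HH_one[OF g] by auto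
  from form2_add1[OF form g w this] show ?thesis
    using left_orbit[OF g u(1) w] right_orbit[OF g u(2) w] u(3) by simp
qed

lemma tadd_cancel: "tadd (tadd v (tscale (-1) w)) w = v" "tadd w (tadd v (tscale (-1) w)) = v"
  by (intro ext, simp add: tadd_def tscale_def)+

lemma horizontal_eq:
  assumes g: "g \<in> points G.Arr" and v: "v \<in> tangent_space G.Arr g" "v' \<in> tangent_space G.Arr g"
    and pv: "tmap G.Arr Q.Arr p g v = tmap G.Arr Q.Arr p g v'" and w: "w \<in> tangent_space G.Arr g"
  shows "\<omega> g v w = \<omega> g v' w" "\<omega> g w v = \<omega> g w v'"
proof -
  let ?d = "tadd v (tscale (-1) v')"
  have d: "?d \<in> tangent_space G.Arr g" by (intro tangent_add tangent_scale v)
  have "tmap G.Arr Q.Arr p g ?d = tzero" by (simp add: tmap_add tmap_scale pv tadd_simps)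
  from horizontal[OF g d this w] have "\<omega> g ?d w = 0" .
  then show 1: "\<omega> g v w = \<omega> g v' w" using form2_add1[OF form g w d v(2)] tadd_cancel(1)[of v v'] by simp
  show "\<omega> g w v = \<omega> g w v'" using form2_anti[OF form g _ w] v 1 by simp
qed

text \<open>
  Two arrows over the same point differ by an element of \<open>H \<times> H\<close>. Invariance moves the vectors to the same arrow, where
  lifts of the same vector differ by a vector on which the form vanishes.
\<close>

lemma basic:
  assumes g: "g \<in> points G.Arr" "g' \<in> points G.Arr" "p g = p g'"
    and v: "v \<in> tangent_space G.Arr g" "v' \<in> tangent_space G.Arr g'" "tmap G.Arr Q.Arr p g v = tmap G.Arr Q.Arr p g' v'"
    and w: "w \<in> tangent_space G.Arr g" "w' \<in> tangent_space G.Arr g'" "tmap G.Arr Q.Arr p g w = tmap G.Arr Q.Arr p g' w'"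
  shows "\<omega> g v w = \<omega> g' v' w'"
proof -
  note A = G.mfd_Arr
  obtain h1 h2 where h: "h1 \<in> points K" "h2 \<in> points K" "g' = HH h1 h2 g" using p_eq[OF g(2,3)] by metis
  let ?L = "HH h1 h2"
  have L: "smooth_at G.Arr G.Arr ?L g"
    by (rule HH_at[OF A smooth_at_const[OF A mfd_K g(1) h(1)] smooth_at_const[OF A mfd_K g(1) h(2)] smooth_at_id[OF A g(1)]])
  have "form2_pullback G.Arr G.Arr ?L \<omega> = \<omega>" using adm h carr by (simp add: H_admissible_def)
  from fun_cong[OF fun_cong[OF fun_cong[OF this, of g], of v], of w]
  have 1: "\<omega> g v w = \<omega> g' (tmap G.Arr G.Arr ?L g v) (tmap G.Arr G.Arr ?L g w)"
    using g v w h by (simp add: form2_pullback_def)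
  have pL: "tmap G.Arr Q.Arr p g' (tmap G.Arr G.Arr ?L g u) = tmap G.Arr Q.Arr p g u" if u: "u \<in> tangent_space G.Arr g" for u
  proof -
    have pg': "smooth_at G.Arr Q.Arr p (?L g)" using p_at g h by simp
    have e: "eventually (\<lambda>y. p (?L y) = p y) (near G.Arr g)"
      using points_near[OF g(1)] by eventually_elim (rule p_HH[OF h(1,2)])
    show ?thesis
      using tmap_compose[OF A A Q.mfd_Arr L pg' u] tmap_cong[OF A smooth_at_compose[OF A A Q.mfd_Arr L pg'] Q.mfd_Arr e] h(3) by simp
  qed
  have Lv: "tmap G.Arr G.Arr ?L g v \<in> tangent_space G.Arr g'" "tmap G.Arr G.Arr ?L g w \<in> tangent_space G.Arr g'"
    using tmap_in[OF A A L] v w h by auto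
  have "\<omega> g' (tmap G.Arr G.Arr ?L g v) (tmap G.Arr G.Arr ?L g w) = \<omega> g' v' (tmap G.Arr G.Arr ?L g w)"
    by (rule horizontal_eq(1)[OF g(2) Lv(1) v(2) _ Lv(2)]) (simp add: pL[OF v(1)] v(3))
  also have "\<dots> = \<omega> g' v' w'"
    by (rule horizontal_eq(2)[OF g(2) Lv(2) w(2) _ v(2)]) (simp add: pL[OF w(1)] w(3))
  finally show ?thesis using 1 by simp
qed

section \<open>The descended form\<close>

text \<open>
  The value computed from lifts to \<open>G\<close>, and zero outside the domain of a form. By \<open>basic\<close> there is exactly one such value.
\<close>

definition descended :: "'g set form2" where
  "descended k v w = (if k \<in> points Q.Arr \<and> v \<in> tangent_space Q.Arr k \<and> w \<in> tangent_space Q.Arr k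
     then (SOME r. \<exists>g\<in>points G.Arr. \<exists>v'\<in>tangent_space G.Arr g. \<exists>w'\<in>tangent_space G.Arr g.
        p g = k \<and> tmap G.Arr Q.Arr p g v' = v \<and> tmap G.Arr Q.Arr p g w' = w \<and> r = \<omega> g v' w') else 0)"

lemma p_tangent: "g \<in> points G.Arr \<Longrightarrow> v \<in> tangent_space G.Arr g \<Longrightarrow> tmap G.Arr Q.Arr p g v \<in> tangent_space Q.Arr (p g)"
  using tmap_in[OF G.mfd_Arr Q.mfd_Arr p_at] .

lemma p_lift: assumes "g \<in> points G.Arr" "v \<in> tangent_space Q.Arr (p g)"
  obtains v' where "v' \<in> tangent_space G.Arr g" "tmap G.Arr Q.Arr p g v' = v"
  using p_surj[OF assms(1)] assms(2) by (metis imageE)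

lemma descended_eval:
  assumes g: "g \<in> points G.Arr" and v: "v \<in> tangent_space G.Arr g" and w: "w \<in> tangent_space G.Arr g"
  shows "descended (p g) (tmap G.Arr Q.Arr p g v) (tmap G.Arr Q.Arr p g w) = \<omega> g v w"
proof -
  let ?R = "\<lambda>r. \<exists>g'\<in>points G.Arr. \<exists>v'\<in>tangent_space G.Arr g'. \<exists>w'\<in>tangent_space G.Arr g'.
        p g' = p g \<and> tmap G.Arr Q.Arr p g' v' = tmap G.Arr Q.Arr p g v \<and> tmap G.Arr Q.Arr p g' w' = tmap G.Arr Q.Arr p g w \<and> r = \<omega> g' v' w'"
  have "?R (\<omega> g v w)" using g v w by blast
  moreover have "r = \<omega> g v w" if "?R r" for r
  proof -
    obtain g' v' w' where *: "g' \<in> points G.Arr" "v' \<in> tangent_space G.Arr g'" "w' \<in> tangent_space G.Arr g'" "p g' = p g"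
      "tmap G.Arr Q.Arr p g' v' = tmap G.Arr Q.Arr p g v" "tmap G.Arr Q.Arr p g' w' = tmap G.Arr Q.Arr p g w" "r = \<omega> g' v' w'"
      using \<open>?R r\<close> by blast
    show ?thesis unfolding *(7) by (rule basic[OF *(1) g *(4) *(2) v *(5) *(3) w *(6)])
  qed
  ultimately have "(SOME r. ?R r) = \<omega> g v w" by (rule some_equality)
  then show ?thesis using p_in[OF g] p_tangent[OF g v] p_tangent[OF g w] by (simp add: descended_def)
qed

lemma descended_off: "k \<notin> points Q.Arr \<or> v \<notin> tangent_space Q.Arr k \<or> w \<notin> tangent_space Q.Arr k \<Longrightarrow> descended k v w = 0"
  unfolding descended_def by auto

text \<open>
  Near each point the descended form is the pullback of \<open>\<omega>\<close> by a local section, as the differential of a section lifts vectors.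
\<close>

lemma descended_section:
  assumes k: "k \<in> points Q.Arr"
  obtains \<theta> where "smooth_at Q.Arr G.Arr \<theta> k" "eventually (\<lambda>x. \<forall>v\<in>tangent_space Q.Arr x. \<forall>w\<in>tangent_space Q.Arr x.
        descended x v w = \<omega> (\<theta> x) (tmap Q.Arr G.Arr \<theta> x v) (tmap Q.Arr G.Arr \<theta> x w)) (near Q.Arr k)"
proof -
  note A = G.mfd_Arr and AQ = Q.mfd_Arr
  obtain g where g: "g \<in> points G.Arr" "k = p g" using p_onto[OF k] by blast
  obtain \<theta> where \<theta>: "smooth_at Q.Arr G.Arr \<theta> (p g)" "\<theta> (p g) = g" "eventually (\<lambda>y. p (\<theta> y) = y) (near Q.Arr (p g))"
    using p_section[OF g(1)] by blast
  have "eventually (\<lambda>x. \<forall>v\<in>tangent_space Q.Arr x. \<forall>w\<in>tangent_space Q.Arr x.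
        descended x v w = \<omega> (\<theta> x) (tmap Q.Arr G.Arr \<theta> x v) (tmap Q.Arr G.Arr \<theta> x w)) (near Q.Arr (p g))"
    using smooth_at_eventually[OF AQ A \<theta>(1)] eventually_nhdsin_eventually[OF \<theta>(3)] points_near[OF p_in[OF g(1)]] \<theta>(3)
  proof eventually_elim
    case (elim x)
    have \<theta>x: "\<theta> x \<in> points G.Arr" by (rule smooth_at_points(2)[OF AQ A elim(1)])
    have px: "smooth_at G.Arr Q.Arr p (\<theta> x)" by (rule p_at[OF \<theta>x])
    have pt: "tmap G.Arr Q.Arr p (\<theta> x) (tmap Q.Arr G.Arr \<theta> x v) = v" if v: "v \<in> tangent_space Q.Arr x" for v
      using tmap_compose[OF AQ A AQ elim(1) px v] tmap_id_near[OF AQ elim(3) v elim(2)] by simp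
    show ?case
    proof (intro ballI)
      fix v w assume v: "v \<in> tangent_space Q.Arr x" and w: "w \<in> tangent_space Q.Arr x"
      show "descended x v w = \<omega> (\<theta> x) (tmap Q.Arr G.Arr \<theta> x v) (tmap Q.Arr G.Arr \<theta> x w)"
        using descended_eval[OF \<theta>x tmap_in[OF AQ A elim(1) v] tmap_in[OF AQ A elim(1) w]] pt[OF v] pt[OF w] elim(4) by simp
    qed
  qed
  then show thesis using that \<theta>(1) g(2) by blast
qed

lemma descended_form: "is_form2 Q.Arr descended"
  unfolding is_form2_def
proof (intro conjI allI impI ballI)
  show "descended x v w = 0" if "x \<notin> points Q.Arr \<or> v \<notin> tangent_space Q.Arr x \<or> w \<notin> tangent_space Q.Arr x" for x v w
    by (rule descended_off[OF that])
next
  fix k v assume k: "k \<in> points Q.Arr" and v: "v \<in> tangent_space Q.Arr k"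
  obtain g where g: "g \<in> points G.Arr" "k = p g" using p_onto[OF k] by blast
  obtain v' where v': "v' \<in> tangent_space G.Arr g" "tmap G.Arr Q.Arr p g v' = v" using p_lift[OF g(1)] v g(2) by blast
  show "descended k v \<in> cotangent_space Q.Arr k"
    unfolding cotangent_space_def
  proof (intro CollectI conjI allI impI ballI)
    show "descended k v w = 0" if "w \<notin> tangent_space Q.Arr k" for w using descended_off that by blast
    fix w assume w: "w \<in> tangent_space Q.Arr k"
    obtain w' where w': "w' \<in> tangent_space G.Arr g" "tmap G.Arr Q.Arr p g w' = w" using p_lift[OF g(1)] w g(2) by blast
    show "descended k v (tscale a w) = a * descended k v w" for a
      using descended_eval[OF g(1) v'(1) tangent_scale[OF w'(1)]] descended_eval[OF g(1) v'(1) w'(1)]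
        form2_scale2[OF form g(1) v'(1) w'(1) w'(1)] v'(2) w'(2) g(2) by (simp add: tmap_scale)
    fix u assume u: "u \<in> tangent_space Q.Arr k"
    obtain u' where u': "u' \<in> tangent_space G.Arr g" "tmap G.Arr Q.Arr p g u' = u" using p_lift[OF g(1)] u g(2) by blast
    show "descended k v (tadd w u) = descended k v w + descended k v u"
      using descended_eval[OF g(1) v'(1) tangent_add[OF w'(1) u'(1)]] descended_eval[OF g(1) v'(1) w'(1)] descended_eval[OF g(1) v'(1) u'(1)]
        form2_add2[OF form g(1) v'(1) w'(1) u'(1)] v'(2) w'(2) u'(2) g(2) by (simp add: tmap_add)
  qed
  fix w assume w: "w \<in> tangent_space Q.Arr k"
  obtain w' where w': "w' \<in> tangent_space G.Arr g" "tmap G.Arr Q.Arr p g w' = w" using p_lift[OF g(1)] w g(2) by blast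
  show "descended k w v = - descended k v w"
    using descended_eval[OF g(1) v'(1) w'(1)] descended_eval[OF g(1) w'(1) v'(1)] form2_anti[OF form g(1) v'(1) w'(1)] v'(2) w'(2) g(2) by simp
next
  fix c i j assume c: "c \<in> atlas Q.Arr" and i: "i < mdim Q.Arr" and j: "j < mdim Q.Arr"
  have cc: "chart_on (mtop Q.Arr) (mdim Q.Arr) c" using Q.mfd_Arr c by (simp add: mfd_def)
  show "smooth_on (mdim Q.Arr) (snd c ` fst c) (comp2 Q.Arr c descended i j)"
  proof (rule smooth_onI_germ[OF chart_im_open[OF cc]])
    fix y assume "y \<in> snd c ` fst c"
    then obtain k where k: "k \<in> fst c" "y = snd c k" by blast
    have ck: "c \<in> charts_at Q.Arr k" using c k(1) by (simp add: charts_at_def)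
    obtain \<theta> where \<theta>: "smooth_at Q.Arr G.Arr \<theta> k" "eventually (\<lambda>x. \<forall>v\<in>tangent_space Q.Arr x. \<forall>w\<in>tangent_space Q.Arr x.
        descended x v w = \<omega> (\<theta> x) (tmap Q.Arr G.Arr \<theta> x v) (tmap Q.Arr G.Arr \<theta> x w)) (near Q.Arr k)"
      using descended_section[OF charts_at_points[OF Q.mfd_Arr ck]] by blast
    show "smooth_germ (mdim Q.Arr) y (comp2 Q.Arr c descended i j)"
      unfolding k(2) by (rule local_pullback_form(1)[OF Q.mfd_Arr G.mfd_Arr form clos \<theta>(1) ck \<theta>(2) i j])
  qed
qed

lemma descended_closed: "closed_form2 Q.Arr descended"
  unfolding closed_form2_def
proof (intro ballI)
  fix k u v w assume k: "k \<in> points Q.Arr"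
  have c: "some_chart Q.Arr k \<in> charts_at Q.Arr k" by (rule some_chart_in[OF Q.mfd_Arr k])
  obtain \<theta> where \<theta>: "smooth_at Q.Arr G.Arr \<theta> k" "eventually (\<lambda>x. \<forall>v\<in>tangent_space Q.Arr x. \<forall>w\<in>tangent_space Q.Arr x.
        descended x v w = \<omega> (\<theta> x) (tmap Q.Arr G.Arr \<theta> x v) (tmap Q.Arr G.Arr \<theta> x w)) (near Q.Arr k)"
    using descended_section[OF k] by blast
  show "ext_d2 Q.Arr descended k u v w = 0"
    unfolding ext_d2_def Let_def
    by (intro sum.neutral ballI) (simp add: local_pullback_form(2)[OF Q.mfd_Arr G.mfd_Arr form clos \<theta>(1) c \<theta>(2)])
qed

lemma descended_pullback: "form2_pullback G.Arr Q.Arr p descended = \<omega>"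
  by (intro ext) (auto simp: form2_pullback_def descended_eval form2_off[OF form])

lemma pullback_eval:
  assumes "form2_pullback G.Arr Q.Arr p \<eta> = \<omega>" "g \<in> points G.Arr" "v \<in> tangent_space G.Arr g" "w \<in> tangent_space G.Arr g"
  shows "\<eta> (p g) (tmap G.Arr Q.Arr p g v) (tmap G.Arr Q.Arr p g w) = \<omega> g v w"
  using fun_cong[OF fun_cong[OF fun_cong[OF assms(1), of g], of v], of w] assms(2-4) by (simp add: form2_pullback_def)

lemma descended_unique:
  assumes \<eta>: "is_form2 Q.Arr \<eta>" "form2_pullback G.Arr Q.Arr p \<eta> = \<omega>"
  shows "\<eta> = descended"
proof (intro ext)
  fix k v w
  show "\<eta> k v w = descended k v w"
  proof (cases "k \<in> points Q.Arr \<and> v \<in> tangent_space Q.Arr k \<and> w \<in> tangent_space Q.Arr k")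
    case True
    obtain g where g: "g \<in> points G.Arr" "k = p g" using p_onto True by blast
    obtain v' where v': "v' \<in> tangent_space G.Arr g" "tmap G.Arr Q.Arr p g v' = v" using p_lift[OF g(1)] True g(2) by blast
    obtain w' where w': "w' \<in> tangent_space G.Arr g" "tmap G.Arr Q.Arr p g w' = w" using p_lift[OF g(1)] True g(2) by blast
    show ?thesis using pullback_eval[OF \<eta>(2) g(1) v'(1) w'(1)] descended_eval[OF g(1) v'(1) w'(1)] v' w' g by simp
  next
    case False
    then show ?thesis using form2_off[OF \<eta>(1)] descended_off by metis
  qed
qed

text \<open>
  Composable arrows of the quotient lift to composable arrows, smoothly near any pair. The local sections \<open>\<theta>1\<close> and \<open>\<theta>2\<close>
  of \<open>p\<close> give lifts with source and target in the same fibre of \<open>q\<close>; the difference \<open>\<eta>\<close> of their group coordinates, acting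
  from the left on the second lift, makes them match.
\<close>

lemma composable_lift:
  assumes z: "z \<in> composable Q"
  obtains \<gamma>1 \<gamma>2 where "smooth_at Q.Cmp G.Arr \<gamma>1 z" "smooth_at Q.Cmp G.Arr \<gamma>2 z"
    "eventually (\<lambda>y. src G (\<gamma>1 y) = tgt G (\<gamma>2 y)) (near Q.Cmp z)"
    "eventually (\<lambda>y. p (\<gamma>1 y) = fst y \<and> p (\<gamma>2 y) = snd y) (near Q.Cmp z)"
proof -
  note A = G.mfd_Arr and AQ = Q.mfd_Arr and C = Q.mfd_Cmp
  obtain k1 k2 where zz: "z = (k1, k2)" "k1 \<in> points Q.Arr" "k2 \<in> points Q.Arr" "src Q k1 = tgt Q k2"
    using z by (auto simp: composable_def)
  obtain g1 where g1: "g1 \<in> points G.Arr" "k1 = p g1" using p_onto[OF zz(2)] by blast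
  obtain g0 where g0: "g0 \<in> points G.Arr" "k2 = p g0" using p_onto[OF zz(3)] by blast
  have "q (tgt G g0) = q (src G g1)" using p_src[OF g1(1)] p_tgt[OF g0(1)] g1 g0 zz(4) by simp
  then obtain h where h: "h \<in> points K" "src G g1 = act h (tgt G g0)"
    using fibre_orbit[OF tgtM[OF g0(1)] srcM[OF g1(1)]] by blast
  \<comment> \<open>a lift of the second arrow that is composable with \<open>g1\<close>, so that both points lie in one trivialization\<close>
  define g2 where "g2 = HH h eH g0"
  have g2: "g2 \<in> points G.Arr" "k2 = p g2" "tgt G g2 = src G g1"
    using HH_facts[OF h(1) one_in g0(1)] p_HH[OF h(1) one_in g0(1)] g0(2) h(2) by (auto simp: g2_def)
  obtain \<theta>1 where \<theta>1: "smooth_at Q.Arr G.Arr \<theta>1 k1" "\<theta>1 k1 = g1" "eventually (\<lambda>y. p (\<theta>1 y) = y) (near Q.Arr k1)"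
    using p_section[OF g1(1)] g1(2) by blast
  obtain \<theta>2 where \<theta>2: "smooth_at Q.Arr G.Arr \<theta>2 k2" "\<theta>2 k2 = g2" "eventually (\<lambda>y. p (\<theta>2 y) = y) (near Q.Arr k2)"
    using p_section[OF g2(1)] g2(2) by blast
  note xM = srcM[OF g1(1)]
  obtain P \<kappa> where gc: "group_coordinate P \<kappa>" and xP: "src G g1 \<in> P" using local_trivialization[OF xM] by blast
  note P = group_coordinateD[OF gc]
  have sf: "smooth_at Q.Cmp Q.Arr fst z" and ss: "smooth_at Q.Cmp Q.Arr snd z" by (rule Q.fst_at[OF z], rule Q.snd_at[OF z])
  have s1: "smooth_at Q.Cmp G.Arr (\<lambda>y. \<theta>1 (fst y)) z" by (rule smooth_at_compose[OF C AQ A sf]) (simp add: zz \<theta>1)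
  have s2: "smooth_at Q.Cmp G.Arr (\<lambda>y. \<theta>2 (snd y)) z" by (rule smooth_at_compose[OF C AQ A ss]) (simp add: zz \<theta>2)
  have srcat: "smooth_at G.Arr M (src G) g1" and tgtat: "smooth_at G.Arr M (tgt G) g2"
    using G.src_at[OF g1(1)] G.tgt_at[OF g2(1)] bG by auto
  have x1: "smooth_at Q.Cmp M (\<lambda>y. src G (\<theta>1 (fst y))) z" by (rule smooth_at_compose[OF C A mfd_M s1]) (simp add: zz \<theta>1 srcat)
  have x2: "smooth_at Q.Cmp M (\<lambda>y. tgt G (\<theta>2 (snd y))) z" by (rule smooth_at_compose[OF C A mfd_M s2]) (simp add: zz \<theta>2 tgtat)
  define \<eta> where "\<eta> y = mul (\<kappa> (src G (\<theta>1 (fst y)))) (inv\<^bsub>H\<^esub> (\<kappa> (tgt G (\<theta>2 (snd y)))))" for y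
  have kx: "smooth_at Q.Cmp K (\<lambda>y. \<kappa> (src G (\<theta>1 (fst y)))) z"
    by (rule smooth_at_compose[OF C mfd_M mfd_K x1]) (simp add: zz \<theta>1 P(3)[OF xP])
  have kt: "smooth_at Q.Cmp K (\<lambda>y. \<kappa> (tgt G (\<theta>2 (snd y)))) z"
    by (rule smooth_at_compose[OF C mfd_M mfd_K x2]) (simp add: zz \<theta>2 g2(3) P(3)[OF xP])
  have \<eta>: "smooth_at Q.Cmp K \<eta> z" unfolding \<eta>_def by (intro mul_at ginv_at kx kt C)
  define \<gamma>1 where "\<gamma>1 y = \<theta>1 (fst y)" for y :: "'g set \<times> 'g set"
  define \<gamma>2 where "\<gamma>2 y = HH (\<eta> y) eH (\<theta>2 (snd y))" for y
  have zC: "z \<in> points Q.Cmp" using z Q.points_Cmp by simp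
  have s\<gamma>2: "smooth_at Q.Cmp G.Arr \<gamma>2 z"
    unfolding \<gamma>2_def by (rule HH_at[OF C \<eta> smooth_at_const[OF C mfd_K zC one_in] s2])
  have P1: "eventually (\<lambda>y. src G (\<theta>1 (fst y)) \<in> P) (near Q.Cmp z)"
    by (rule smooth_at_tendsto[OF C mfd_M x1]) (simp add: zz \<theta>1 eventually_nhdsin_in[OF P(1) xP])
  have P2: "eventually (\<lambda>y. tgt G (\<theta>2 (snd y)) \<in> P) (near Q.Cmp z)"
    by (rule smooth_at_tendsto[OF C mfd_M x2]) (simp add: zz \<theta>2 g2(3) eventually_nhdsin_in[OF P(1) xP])
  have E1: "eventually (\<lambda>y. p (\<theta>1 (fst y)) = fst y) (near Q.Cmp z)" by (rule smooth_at_tendsto[OF C AQ sf]) (simp add: zz \<theta>1)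
  have E2: "eventually (\<lambda>y. p (\<theta>2 (snd y)) = snd y) (near Q.Cmp z)" by (rule smooth_at_tendsto[OF C AQ ss]) (simp add: zz \<theta>2)
  have all: "eventually (\<lambda>y. src G (\<gamma>1 y) = tgt G (\<gamma>2 y) \<and> p (\<gamma>1 y) = fst y \<and> p (\<gamma>2 y) = snd y) (near Q.Cmp z)"
    using P1 P2 E1 E2 points_near[OF zC] smooth_at_eventually[OF C A s1] smooth_at_eventually[OF C A s2]
  proof eventually_elim
    case (elim y)
    let ?a = "\<theta>1 (fst y)" and ?b = "\<theta>2 (snd y)"
    have ab: "?a \<in> points G.Arr" "?b \<in> points G.Arr"
      using smooth_at_points(2)[OF C A elim(6)] smooth_at_points(2)[OF C A elim(7)] by auto
    have yc: "src Q (fst y) = tgt Q (snd y)" using elim(5) Q.points_Cmp by (auto simp: composable_def)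
    have h: "\<eta> y \<in> points K" unfolding \<eta>_def by (intro mul_in ginv_in P(4) elim(1,2))
    note f = HH_facts[OF h one_in ab(2)] p_HH[OF h one_in ab(2)]
    have "src G ?a = act (\<eta> y) (tgt G ?b)"
    proof (rule P(9)[OF P(5)[OF h elim(2)] srcM[OF ab(1)]])
      show "q (src G ?a) = q (act (\<eta> y) (tgt G ?b))"
        using P(6)[OF h elim(2)] p_src[OF ab(1)] p_tgt[OF ab(2)] elim(3,4) yc by simp
      show "\<kappa> (src G ?a) = \<kappa> (act (\<eta> y) (tgt G ?b))"
        using P(7)[OF h elim(2)] mul_cancel(2)[OF P(4)[OF elim(1)] P(4)[OF elim(2)]] by (simp add: \<eta>_def)
    qed
    then show ?case using f elim(3,4) by (simp add: \<gamma>1_def \<gamma>2_def)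
  qed
  show thesis
    by (rule that[of \<gamma>1 \<gamma>2]) (use s1 s\<gamma>2 all in \<open>auto simp: \<gamma>1_def[abs_def] elim: eventually_mono\<close>)
qed

text \<open>
  Both sides are computed on the lifted pair, where \<open>p\<close> is a morphism and \<open>\<omega>\<close> is multiplicative.
\<close>

lemma descended_multiplicative: "multiplicative Q descended"
  unfolding multiplicative_def Let_def
proof (intro ext)
  fix z V W
  note A = G.mfd_Arr and AQ = Q.mfd_Arr and C = Q.mfd_Cmp
  show "form2_pullback Q.Cmp Q.Arr (\<lambda>(g, h). cmp Q g h) descended z V W =
    form2_pullback Q.Cmp Q.Arr fst descended z V W + form2_pullback Q.Cmp Q.Arr snd descended z V W"
  proof (cases "z \<in> points Q.Cmp \<and> V \<in> tangent_space Q.Cmp z \<and> W \<in> tangent_space Q.Cmp z")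
    case False
    then show ?thesis by (auto simp: form2_pullback_def)
  next
    case True
    then have z: "z \<in> composable Q" and V: "V \<in> tangent_space Q.Cmp z" and W: "W \<in> tangent_space Q.Cmp z"
      using Q.points_Cmp by auto
    obtain \<gamma>1 \<gamma>2 where s1: "smooth_at Q.Cmp G.Arr \<gamma>1 z" and s2: "smooth_at Q.Cmp G.Arr \<gamma>2 z"
      and c: "eventually (\<lambda>y. src G (\<gamma>1 y) = tgt G (\<gamma>2 y)) (near Q.Cmp z)"
      and pe: "eventually (\<lambda>y. p (\<gamma>1 y) = fst y \<and> p (\<gamma>2 y) = snd y) (near Q.Cmp z)"
      using composable_lift[OF z] by blast
    have sm: "smooth_at Q.Cmp G.Arr (\<lambda>y. cmp G (\<gamma>1 y) (\<gamma>2 y)) z" by (rule G.cmp_at[OF C s1 s2 c])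
    have pm: "eventually (\<lambda>y. p (cmp G (\<gamma>1 y) (\<gamma>2 y)) = (\<lambda>(g, h). cmp Q g h) y) (near Q.Cmp z)"
      using pe c smooth_at_eventually[OF C A s1] smooth_at_eventually[OF C A s2]
    proof eventually_elim
      case (elim y)
      then show ?case using p_cmp[OF smooth_at_points(2)[OF C A elim(3)] smooth_at_points(2)[OF C A elim(4)] elim(2)]
        by (simp add: case_prod_unfold)
    qed
    have p1: "eventually (\<lambda>y. p (\<gamma>1 y) = fst y) (near Q.Cmp z)" and p2: "eventually (\<lambda>y. p (\<gamma>2 y) = snd y) (near Q.Cmp z)"
      using pe by (auto elim: eventually_mono)
    have key: "descended (f z) (tmap Q.Cmp Q.Arr f z V) (tmap Q.Cmp Q.Arr f z W) =
       \<omega> (\<gamma> z) (tmap Q.Cmp G.Arr \<gamma> z V) (tmap Q.Cmp G.Arr \<gamma> z W)"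
      if s: "smooth_at Q.Cmp G.Arr \<gamma> z" and e: "eventually (\<lambda>y. p (\<gamma> y) = f y) (near Q.Cmp z)" for \<gamma> f
    proof -
      have g: "\<gamma> z \<in> points G.Arr" by (rule smooth_at_points(2)[OF C A s])
      have "tmap Q.Cmp Q.Arr f z = tmap Q.Cmp Q.Arr (\<lambda>y. p (\<gamma> y)) z"
        using tmap_cong[OF C smooth_at_compose[OF C A AQ s p_at[OF g]] AQ e] by simp
      then have t: "tmap Q.Cmp Q.Arr f z U = tmap G.Arr Q.Arr p (\<gamma> z) (tmap Q.Cmp G.Arr \<gamma> z U)"
        if "U \<in> tangent_space Q.Cmp z" for U
        using tmap_compose[OF C A AQ s p_at[OF g] that] by simp
      have "p (\<gamma> z) = f z" using near_self[OF _ e] True by blast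
      then show ?thesis using descended_eval[OF g tmap_in[OF C A s V] tmap_in[OF C A s W]] t[OF V] t[OF W] by simp
    qed
    show ?thesis
      using True key[OF sm pm] key[OF s1 p1] key[OF s2 p2]
        G.mult_eval[OF mlt C C s1 s2 c s1 s2 c refl refl V W] by (simp add: form2_pullback_def)
  qed
qed

text \<open>
  \<open>dim G = dim Q + 2 dim H\<close>, \<open>dim M = dim B + dim H\<close> and \<open>dim G = 2 dim M\<close>.
\<close>

lemma quotient_dim: "mdim Q.Arr = 2 * mdim Q.Bas"
proof -
  have "points M \<noteq> {}" using G.lie_groupoid bG by (auto simp: lie_groupoid_def smooth_manifold_def smooth_atlas_def)
  then obtain x where x: "x \<in> points M" by blast
  have "unit_arr G x \<in> points G.Arr" using G.unit_in x bG by simp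
  from p_dim[OF this] q_dim[OF x] dims bQ show ?thesis by simp
qed

section \<open>The Dirac structure of the quotient\<close>

lemma algebroidD: "a \<in> algebroid G x \<Longrightarrow> a \<in> tangent_space G.Arr (unit_arr G x)"
  "a \<in> algebroid G x \<Longrightarrow> tmap G.Arr M (src G) (unit_arr G x) a = tzero"
  by (auto simp: algebroid_def bG)

lemma unit_facts: assumes "x \<in> points M"
  shows "unit_arr G x \<in> points G.Arr" "src G (unit_arr G x) = x" "tgt G (unit_arr G x) = x" "p (unit_arr G x) = unit_arr Q (q x)"
    "smooth_at G.Arr M (src G) (unit_arr G x)" "smooth_at G.Arr M (tgt G) (unit_arr G x)"
    "smooth_at Q.Arr B (src Q) (unit_arr Q (q x))" "smooth_at Q.Arr B (tgt Q) (unit_arr Q (q x))"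
proof -
  show 1: "unit_arr G x \<in> points G.Arr" "src G (unit_arr G x) = x" "tgt G (unit_arr G x) = x"
    using G.unit_in G.unit_simps assms bG by auto
  show 2: "p (unit_arr G x) = unit_arr Q (q x)" by (rule p_unit[OF assms])
  show "smooth_at G.Arr M (src G) (unit_arr G x)" "smooth_at G.Arr M (tgt G) (unit_arr G x)"
    using G.src_at[OF 1(1)] G.tgt_at[OF 1(1)] bG by auto
  have "unit_arr Q (q x) \<in> points Q.Arr" using p_in[OF 1(1)] 2 by simp
  from Q.src_at[OF this] Q.tgt_at[OF this]
  show "smooth_at Q.Arr B (src Q) (unit_arr Q (q x))" "smooth_at Q.Arr B (tgt Q) (unit_arr Q (q x))" using bQ by auto
qed

text \<open>
  The differentiated form of \<open>s \<circ> p = q \<circ> s\<close> and \<open>t \<circ> p = q \<circ> t\<close> at a unit.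
\<close>

lemma src_tgt_intertwine:
  assumes x: "x \<in> points M" and v: "v \<in> tangent_space G.Arr (unit_arr G x)"
  shows "tmap Q.Arr B (src Q) (unit_arr Q (q x)) (tmap G.Arr Q.Arr p (unit_arr G x) v) = tmap M B q x (tmap G.Arr M (src G) (unit_arr G x) v)"
    "tmap Q.Arr B (tgt Q) (unit_arr Q (q x)) (tmap G.Arr Q.Arr p (unit_arr G x) v) = tmap M B q x (tmap G.Arr M (tgt G) (unit_arr G x) v)"
proof -
  note u = unit_facts[OF x] and A = G.mfd_Arr and AQ = Q.mfd_Arr
  have sq: "smooth_at Q.Arr B (src Q) (p (unit_arr G x))" and tq: "smooth_at Q.Arr B (tgt Q) (p (unit_arr G x))" using u by simp_all
  have e1: "eventually (\<lambda>g. src Q (p g) = q (src G g)) (near G.Arr (unit_arr G x))"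
    using points_near[OF u(1)] by eventually_elim (rule p_src)
  have e2: "eventually (\<lambda>g. tgt Q (p g) = q (tgt G g)) (near G.Arr (unit_arr G x))"
    using points_near[OF u(1)] by eventually_elim (rule p_tgt)
  show "tmap Q.Arr B (src Q) (unit_arr Q (q x)) (tmap G.Arr Q.Arr p (unit_arr G x) v) = tmap M B q x (tmap G.Arr M (src G) (unit_arr G x) v)"
    using tmap_compose[OF A AQ mfd_B p_at[OF u(1)] sq v] tmap_compose[OF A mfd_M mfd_B u(5) _ v, of q] q_at[OF x] u
      tmap_cong[OF A smooth_at_compose[OF A AQ mfd_B p_at[OF u(1)] sq] mfd_B e1] by simp
  show "tmap Q.Arr B (tgt Q) (unit_arr Q (q x)) (tmap G.Arr Q.Arr p (unit_arr G x) v) = tmap M B q x (tmap G.Arr M (tgt G) (unit_arr G x) v)"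
    using tmap_compose[OF A AQ mfd_B p_at[OF u(1)] tq v] tmap_compose[OF A mfd_M mfd_B u(6) _ v, of q] q_at[OF x] u
      tmap_cong[OF A smooth_at_compose[OF A AQ mfd_B p_at[OF u(1)] tq] mfd_B e2] by simp
qed

lemma p_const_on_orbit:
  assumes g: "g \<in> points G.Arr" and u: "u \<in> tangent_space K eH" and f: "smooth_at K G.Arr f eH"
    and e: "\<And>h. h \<in> points K \<Longrightarrow> p (f h) = p g" and fe: "f eH = g"
  shows "tmap G.Arr Q.Arr p g (tmap K G.Arr f eH u) = tzero"
proof -
  have pf: "smooth_at G.Arr Q.Arr p (f eH)" using p_at[OF g] fe by simp
  have "eventually (\<lambda>h. p (f h) = p g) (near K eH)" using points_near[OF one_in] by eventually_elim (rule e)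
  from tmap_cong[OF mfd_K smooth_at_compose[OF mfd_K G.mfd_Arr Q.mfd_Arr f pf] Q.mfd_Arr this]
  show ?thesis using tmap_compose[OF mfd_K G.mfd_Arr Q.mfd_Arr f pf u] fe by (simp add: tmap_const)
qed

lemma algebroid_project:
  assumes x: "x \<in> points M" and a: "a \<in> algebroid G x"
  shows "tmap G.Arr Q.Arr p (unit_arr G x) a \<in> algebroid Q (q x)"
  using src_tgt_intertwine(1)[OF x algebroidD(1)[OF a]] algebroidD(2)[OF a]
    tmap_in[OF G.mfd_Arr Q.mfd_Arr p_at[OF unit_facts(1)[OF x]] algebroidD(1)[OF a]] unit_facts(4)[OF x]
  by (simp add: algebroid_def bQ tmap_zero)

text \<open>
  A lift \<open>w\<close> through the submersion \<open>p\<close> need not be tangent to a source fibre, but \<open>ds(w)\<close> is vertical for \<open>q\<close>. It is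
  compensated by a vector tangent to the orbit of the right action, which \<open>dp\<close> does not see.
\<close>

lemma algebroid_lift:
  assumes x: "x \<in> points M" and a': "a' \<in> algebroid Q (q x)"
  obtains a where "a \<in> algebroid G x" "tmap G.Arr Q.Arr p (unit_arr G x) a = a'"
proof -
  note u = unit_facts[OF x] and A = G.mfd_Arr
  let ?e = "unit_arr G x"
  have a't: "a' \<in> tangent_space Q.Arr (p ?e)" "tmap Q.Arr B (src Q) (unit_arr Q (q x)) a' = tzero"
    using a' u(4) by (auto simp: algebroid_def bQ)
  obtain w where w: "w \<in> tangent_space G.Arr ?e" "tmap G.Arr Q.Arr p ?e w = a'" using p_lift[OF u(1) a't(1)] by blast
  have sw: "tmap G.Arr M (src G) ?e w \<in> tangent_space M x" using tmap_in[OF A mfd_M u(5) w(1)] u(2) by simp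
  have "tmap M B q x (tmap G.Arr M (src G) ?e w) = tzero" using src_tgt_intertwine(1)[OF x w(1)] w(2) a't(2) by simp
  then obtain c where c: "c \<in> tangent_space K eH" "tmap G.Arr M (src G) ?e w = tmap K M (\<lambda>h. act h x) eH c"
    using q_vertical[OF x sw] by blast
  note hs = HH_orbit_at(2)[OF u(1)]
  let ?r = "tmap K G.Arr (\<lambda>h. HH eH h ?e) eH c"
  have h1: "HH eH eH ?e = ?e" by (rule HH_one[OF u(1)])
  have r: "?r \<in> tangent_space G.Arr ?e" using tmap_in[OF mfd_K A hs c(1)] h1 by simp
  have "tmap G.Arr M (src G) ?e ?r = tmap K M (\<lambda>h. act h x) eH c"
  proof -
    have sr: "smooth_at G.Arr M (src G) (HH eH eH ?e)" using u(5) h1 by simp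
    have "eventually (\<lambda>h. src G (HH eH h ?e) = act h x) (near K eH)"
      using points_near[OF one_in] by eventually_elim (simp add: HH_src[OF one_in _ u(1)] u(2))
    from tmap_cong[OF mfd_K smooth_at_compose[OF mfd_K A mfd_M hs sr] mfd_M this]
    show ?thesis using tmap_compose[OF mfd_K A mfd_M hs sr c(1)] h1 by simp
  qed
  moreover have "tmap G.Arr Q.Arr p ?e ?r = tzero"
    by (rule p_const_on_orbit[OF u(1) c(1) hs p_HH[OF one_in _ u(1)] h1])
  moreover have "tadd v (tscale (-1) tzero) = v" for v :: "'g set tvec" by (simp add: tadd_def tscale_def tzero_def)
  ultimately have "tadd w (tscale (-1) ?r) \<in> algebroid G x" "tmap G.Arr Q.Arr p ?e (tadd w (tscale (-1) ?r)) = a'"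
    using tangent_add[OF w(1) tangent_scale[OF r]] c(2) w(2) by (simp_all add: algebroid_def bG tmap_add tmap_scale tadd_simps)
  then show thesis using that by blast
qed

lemma anchor_project:
  assumes x: "x \<in> points M" and a: "a \<in> algebroid G x"
  shows "anchor Q (q x) (tmap G.Arr Q.Arr p (unit_arr G x) a) = tmap M B q x (anchor G x a)"
  using src_tgt_intertwine(2)[OF x algebroidD(1)[OF a]] by (simp add: anchor_def bG bQ)

lemma mu_project:
  assumes \<eta>: "form2_pullback G.Arr Q.Arr p \<eta> = \<omega>" and x: "x \<in> points M" and a: "a \<in> algebroid G x"
    and v: "v \<in> tangent_space M x"
  shows "mu_map Q \<eta> (q x) (tmap G.Arr Q.Arr p (unit_arr G x) a) (tmap M B q x v) = mu_map G \<omega> x a v"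
proof -
  note u = unit_facts[OF x] and A = G.mfd_Arr and AQ = Q.mfd_Arr
  have un: "smooth_at M G.Arr (unit_arr G) x" using G.unit_at[of x] x bG by simp
  have unQ: "smooth_at B Q.Arr (unit_arr Q) (q x)" using Q.unit_at[of "q x"] q_in[OF x] bQ by simp
  have e: "eventually (\<lambda>y. p (unit_arr G y) = unit_arr Q (q y)) (near M x)"
    using points_near[OF x] by eventually_elim (rule p_unit)
  have t: "tmap B Q.Arr (unit_arr Q) (q x) (tmap M B q x v) = tmap G.Arr Q.Arr p (unit_arr G x) (tmap M G.Arr (unit_arr G) x v)"
    using tmap_compose[OF mfd_M mfd_B AQ q_at[OF x] unQ v] tmap_compose[OF mfd_M A AQ un p_at[OF u(1)] v]
      tmap_cong[OF mfd_M smooth_at_compose[OF mfd_M A AQ un p_at[OF u(1)]] AQ e] by simp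
  have qv: "tmap M B q x v \<in> tangent_space B (q x)" by (rule tmap_in[OF mfd_M mfd_B q_at[OF x] v])
  have "mu_map Q \<eta> (q x) (tmap G.Arr Q.Arr p (unit_arr G x) a) (tmap M B q x v)
    = \<eta> (p (unit_arr G x)) (tmap G.Arr Q.Arr p (unit_arr G x) a) (tmap G.Arr Q.Arr p (unit_arr G x) (tmap M G.Arr (unit_arr G) x v))"
    using qv t u(4) by (simp add: mu_map_def covec_pullback_def bQ)
  also have "\<dots> = \<omega> (unit_arr G x) a (tmap M G.Arr (unit_arr G) x v)"
    by (rule pullback_eval[OF \<eta> u(1) algebroidD(1)[OF a] tmap_in[OF mfd_M A un v]])
  finally show ?thesis using v by (simp add: mu_map_def covec_pullback_def bG)
qed

lemma q_point: assumes "b \<in> points B" obtains x where "x \<in> points M" "b = q x"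
proof -
  have "unit_arr Q b \<in> points Q.Arr" using Q.unit_in assms bQ by simp
  then obtain g where g: "g \<in> points G.Arr" "unit_arr Q b = p g" using p_onto by blast
  have "b = q (src G g)" using p_src[OF g(1)] g(2) Q.unit_simps(1)[of b] assms bQ by simp
  then show thesis using that srcM[OF g(1)] by blast
qed

text \<open>
  Given elements with the same image, lift both. Their anchors differ by a vector \<open>u\<^sub>M\<close> of the action, so adding \<open>d\<Psi>(u)\<close>, on
  which \<open>\<mu>\<^sub>\<omega>\<close> is zero, to one lift makes the images under \<open>\<delta>\<^sub>\<omega>\<close> equal. Hence the lifts coincide, and \<open>dp\<close> kills
  \<open>d\<Psi>(u)\<close>.
\<close>

lemma quotient_delta_inj:
  assumes \<eta>: "form2_pullback G.Arr Q.Arr p \<eta> = \<omega>" and b: "b \<in> points Q.Bas"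
  shows "inj_on (delta_map Q \<eta> b) (algebroid Q b)"
proof (rule inj_onI)
  fix a1' a2' assume a1': "a1' \<in> algebroid Q b" and a2': "a2' \<in> algebroid Q b" and eq: "delta_map Q \<eta> b a1' = delta_map Q \<eta> b a2'"
  obtain x where x: "x \<in> points M" "b = q x" using q_point b bQ by metis
  note u = unit_facts[OF x(1)] and A = G.mfd_Arr
  let ?e = "unit_arr G x"
  obtain a1 where a1: "a1 \<in> algebroid G x" "tmap G.Arr Q.Arr p ?e a1 = a1'" using algebroid_lift[OF x(1)] a1' x(2) by blast
  obtain a2 where a2: "a2 \<in> algebroid G x" "tmap G.Arr Q.Arr p ?e a2 = a2'" using algebroid_lift[OF x(1)] a2' x(2) by blast
  have anc: "tmap M B q x (anchor G x a1) = tmap M B q x (anchor G x a2)"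
    using anchor_project[OF x(1) a1(1)] anchor_project[OF x(1) a2(1)] a1(2) a2(2) eq x(2) by (simp add: delta_map_def)
  have mu: "mu_map G \<omega> x a1 = mu_map G \<omega> x a2"
  proof
    fix v show "mu_map G \<omega> x a1 v = mu_map G \<omega> x a2 v"
    proof (cases "v \<in> tangent_space M x")
      case True
      show ?thesis using mu_project[OF \<eta> x(1) a1(1) True] mu_project[OF \<eta> x(1) a2(1) True] a1(2) a2(2) eq x(2) by (simp add: delta_map_def)
    qed (simp add: mu_map_def covec_pullback_def bG)
  qed
  have anin: "anchor G x a \<in> tangent_space M x" if "a \<in> algebroid G x" for a
    using tmap_in[OF A mfd_M u(6) algebroidD(1)[OF that]] u(3) by (simp add: anchor_def bG)
  let ?d = "tadd (anchor G x a1) (tscale (-1) (anchor G x a2))"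
  have d: "?d \<in> tangent_space M x" by (intro tangent_add tangent_scale anin a1 a2)
  have "tmap M B q x ?d = tzero" by (simp add: tmap_add tmap_scale anc tadd_simps)
  then obtain c where c: "c \<in> tangent_space K eH" "?d = tmap K M (\<lambda>h. act h x) eH c" using q_vertical[OF x(1) d] by blast
  let ?s = "inf_psi x c"
  have s: "?s \<in> tangent_space G.Arr ?e" by (rule inf_psi_in[OF x(1) c(1)])
  note ps = psi_x_at[OF x(1)] and p1 = psi_one[OF x(1)]
  have t1: "tmap G.Arr M (src G) ?e ?s = tzero"
  proof -
    have sr: "smooth_at G.Arr M (src G) (\<Psi> (eH, x))" using u(5) p1 by simp
    have "eventually (\<lambda>h. src G (\<Psi> (h, x)) = x) (near K eH)"
      using points_near[OF one_in] by eventually_elim (simp add: psi_src x(1))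
    from tmap_cong[OF mfd_K smooth_at_compose[OF mfd_K A mfd_M ps sr] mfd_M this]
    show ?thesis using tmap_compose[OF mfd_K A mfd_M ps sr c(1)] p1 by (simp add: tmap_const)
  qed
  have t2: "tmap G.Arr M (tgt G) ?e ?s = ?d"
  proof -
    have sr: "smooth_at G.Arr M (tgt G) (\<Psi> (eH, x))" using u(6) p1 by simp
    have "eventually (\<lambda>h. tgt G (\<Psi> (h, x)) = act h x) (near K eH)"
      using points_near[OF one_in] by eventually_elim (simp add: psi_tgt x(1))
    from tmap_cong[OF mfd_K smooth_at_compose[OF mfd_K A mfd_M ps sr] mfd_M this]
    show ?thesis using tmap_compose[OF mfd_K A mfd_M ps sr c(1)] p1 c(2) by simp
  qed
  have t3: "tmap G.Arr Q.Arr p ?e ?s = tzero"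
  proof (rule p_const_on_orbit[OF u(1) c(1) ps _ p1])
    fix h assume h: "h \<in> points K"
    have "HH h eH ?e = \<Psi> (h, x)"
      using HH_one1[OF h u(1)] u(3) G.inv_simps(2)[OF psi_in[OF h x(1)]] psi_src[OF h x(1)] by simp
    then show "p (\<Psi> (h, x)) = p ?e" using p_HH[OF h one_in u(1)] by simp
  qed
  \<comment> \<open>the second lift, corrected so that its anchor is that of the first\<close>
  let ?a = "tadd a2 ?s"
  have a: "?a \<in> algebroid G x"
    using tangent_add[OF algebroidD(1)[OF a2(1)] s] algebroidD(2)[OF a2(1)] t1 by (simp add: algebroid_def bG tmap_add tadd_simps)
  have "anchor G x ?a = anchor G x a1"
    using t2 tadd_cancel(2)[of "anchor G x a2" "anchor G x a1"] by (simp add: anchor_def bG tmap_add)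
  moreover have "mu_map G \<omega> x ?a = mu_map G \<omega> x a1"
  proof
    fix v show "mu_map G \<omega> x ?a v = mu_map G \<omega> x a1 v"
    proof (cases "v \<in> tangent_space M x")
      case True
      have dv: "tmap M G.Arr (unit_arr G) x v \<in> tangent_space G.Arr ?e"
        using tmap_in[OF mfd_M A _ True, of "unit_arr G"] G.unit_at[of x] x(1) bG by simp
      have "\<omega> ?e ?a (tmap M G.Arr (unit_arr G) x v) = \<omega> ?e a2 (tmap M G.Arr (unit_arr G) x v)"
        using form2_add1[OF form u(1) dv algebroidD(1)[OF a2(1)] s] mu_inf_psi_eval[OF x(1) c(1) True] by simp
      then have "mu_map G \<omega> x ?a v = mu_map G \<omega> x a2 v" using True by (simp add: mu_map_def covec_pullback_def bG)
      then show ?thesis using mu by simp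
    qed (simp add: mu_map_def covec_pullback_def bG)
  qed
  ultimately have "delta_map G \<omega> x ?a = delta_map G \<omega> x a1" by (simp add: delta_map_def)
  moreover have "inj_on (delta_map G \<omega> x) (algebroid G x)" using pre x(1) bG by (simp add: presymplectic_groupoid_def)
  ultimately have "?a = a1" using a a1(1) by (simp add: inj_on_eq_iff)
  then have "a1' = tadd a2' tzero" using a1(2) a2(2) t3 tmap_add[of G.Arr Q.Arr p ?e a2 ?s] by metis
  then show "a1' = a2'" by (simp add: tadd_simps)
qed

text \<open>
  The fibres of \<open>F\<close> and of \<open>q\<^sup>!F\<close> determine each other because \<open>dq\<close> is surjective: an element \<open>(Y, \<beta>)\<close> of \<open>F\<close> is lifted to
  \<open>(X, q\<^sup>*\<beta>) = \<delta>\<^sub>\<omega>(a)\<close> and its image is \<open>\<delta>(dp(a))\<close>; conversely each element of the algebroid of the quotient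
  lifts to some \<open>a\<close>.
\<close>

lemma quotient_dirac:
  assumes \<eta>: "form2_pullback G.Arr Q.Arr p \<eta> = \<omega>" and F: "lagrangian B F"
    and E: "\<And>x. x \<in> points M \<Longrightarrow> dirac_pullback M B q F x = delta_map G \<omega> x ` algebroid G x"
    and b: "b \<in> points B"
  shows "F b = delta_map Q \<eta> b ` algebroid Q b"
proof -
  obtain x where x: "x \<in> points M" "b = q x" using q_point[OF b] by metis
  have Fin: "Y \<in> tangent_space B b \<and> \<beta> \<in> cotangent_space B b" if "(Y, \<beta>) \<in> F b" for Y \<beta>
  proof -
    have "F b \<subseteq> generalized_tangent B b" using F b unfolding lagrangian_def by blast
    then show ?thesis using that by (auto simp: generalized_tangent_def)
  qed
  have mu_eq: "mu_map Q \<eta> b (tmap G.Arr Q.Arr p (unit_arr G x) a) = \<beta>"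
    if a: "a \<in> algebroid G x" and mu: "mu_map G \<omega> x a = covec_pullback M B q x \<beta>" and \<beta>: "\<beta> \<in> cotangent_space B b" for a \<beta>
  proof
    fix y
    show "mu_map Q \<eta> b (tmap G.Arr Q.Arr p (unit_arr G x) a) y = \<beta> y"
    proof (cases "y \<in> tangent_space B b")
      case True
      then obtain v where v: "v \<in> tangent_space M x" "y = tmap M B q x v" using q_surj[OF x(1)] x(2) by blast
      show ?thesis using mu_project[OF \<eta> x(1) a v(1)] mu v x(2) by (simp add: covec_pullback_def)
    next
      case False
      then show ?thesis using \<beta> by (simp add: mu_map_def covec_pullback_def bQ cotangent_space_def)
    qed
  qed
  show ?thesis
  proof
    show "F b \<subseteq> delta_map Q \<eta> b ` algebroid Q b"
    proof
      fix e assume e: "e \<in> F b"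
      obtain Y \<beta> where Y: "e = (Y, \<beta>)" by fastforce
      have Y': "Y \<in> tangent_space B b" "\<beta> \<in> cotangent_space B b" using Fin e Y by auto
      obtain X where X: "X \<in> tangent_space M x" "Y = tmap M B q x X" using q_surj[OF x(1)] x(2) Y'(1) by blast
      have "(X, covec_pullback M B q x \<beta>) \<in> dirac_pullback M B q F x"
        using X Y' e Y x(2) unfolding dirac_pullback_def by blast
      then obtain a where a: "a \<in> algebroid G x" "(X, covec_pullback M B q x \<beta>) = delta_map G \<omega> x a" using E[OF x(1)] by blast
      have "delta_map Q \<eta> b (tmap G.Arr Q.Arr p (unit_arr G x) a) = e"
        using anchor_project[OF x(1) a(1)] mu_eq[OF a(1) _ Y'(2)] a(2) X(2) x(2) Y by (simp add: delta_map_def)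
      then show "e \<in> delta_map Q \<eta> b ` algebroid Q b" using algebroid_project[OF x(1) a(1)] x(2) by blast
    qed
    show "delta_map Q \<eta> b ` algebroid Q b \<subseteq> F b"
    proof
      fix e assume "e \<in> delta_map Q \<eta> b ` algebroid Q b"
      then obtain a' where a': "a' \<in> algebroid Q b" "e = delta_map Q \<eta> b a'" by blast
      obtain a where a: "a \<in> algebroid G x" "tmap G.Arr Q.Arr p (unit_arr G x) a = a'" using algebroid_lift[OF x(1)] a'(1) x(2) by blast
      have "delta_map G \<omega> x a \<in> dirac_pullback M B q F x" using E[OF x(1)] a(1) by blast
      then obtain X \<beta> where X: "delta_map G \<omega> x a = (X, covec_pullback M B q x \<beta>)" "\<beta> \<in> cotangent_space B b" "(tmap M B q x X, \<beta>) \<in> F b"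
        using x(2) unfolding dirac_pullback_def by blast
      have "e = (tmap M B q x X, \<beta>)"
        using a'(2) a(2) anchor_project[OF x(1) a(1)] mu_eq[OF a(1) _ X(2)] X(1) x(2) by (simp add: delta_map_def)
      then show "e \<in> F b" using X(3) by simp
    qed
  qed
qed

lemma descended_presymplectic: "presymplectic_groupoid Q descended"
  using Q.lie_groupoid descended_form descended_closed descended_multiplicative quotient_dim quotient_delta_inj[OF descended_pullback]
  by (simp add: presymplectic_groupoid_def)

end

theorem theorem4p7:
  fixes H :: "'h lie_group_data" and M :: "'m manifold" and B :: "'b manifold"
    and act :: "'h \<Rightarrow> 'm \<Rightarrow> 'm" and q :: "'m \<Rightarrow> 'b" and F :: "'b family"
    and G :: "('g, 'm) groupoid_data" and \<omega> :: "'g form2" and \<Psi> :: "'h \<times> 'm \<Rightarrow> 'g"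
    and Q :: "('g set, 'b) groupoid_data"
  defines "p \<equiv> orbit_map H G \<Psi>"
  assumes "lie_group H"
    and "principal_bundle H M act B q"
    and "dirac_structure B F"
    and "base G = M"
    and "integrates G \<omega> (dirac_pullback M B q F)"
    and "H_admissible H M act G \<omega> \<Psi>"
    and "quotient_groupoid H G \<Psi> B q Q"
  shows "(\<exists>!\<omega>'. presymplectic_groupoid Q \<omega>' \<and> form2_pullback (arrows G) (arrows Q) p \<omega>' = \<omega>) \<and>
         (\<forall>\<omega>'. presymplectic_groupoid Q \<omega>' \<and> form2_pullback (arrows G) (arrows Q) p \<omega>' = \<omega>
            \<longrightarrow> integrates Q \<omega>' F)"
proof -
  have pre: "presymplectic_groupoid G \<omega>"
    and E: "\<And>x. x \<in> points M \<Longrightarrow> dirac_pullback M B q F x = delta_map G \<omega> x ` algebroid G x"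
    using assms(5,6) by (auto simp: integrates_def)
  interpret form_quotient G Q H M act B q \<Psi> \<omega>
    using assms(2,3,5,7,8) pre
    by unfold_locales (simp_all add: presymplectic_groupoid_def quotient_groupoid_def H_admissible_def)
  have F: "lagrangian B F" using assms(4) by (simp add: dirac_structure_def)
  show ?thesis
  proof (intro conjI allI impI)
    show "\<exists>!\<omega>'. presymplectic_groupoid Q \<omega>' \<and> form2_pullback (arrows G) (arrows Q) p \<omega>' = \<omega>"
    proof (rule ex1I[of _ descended])
      show "presymplectic_groupoid Q descended \<and> form2_pullback (arrows G) (arrows Q) p descended = \<omega>"
        unfolding p_def using descended_presymplectic descended_pullback by simp
      show "\<eta> = descended" if "presymplectic_groupoid Q \<eta> \<and> form2_pullback (arrows G) (arrows Q) p \<eta> = \<omega>" for \<eta>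
        by (rule descended_unique) (use that in \<open>simp_all add: presymplectic_groupoid_def p_def\<close>)
    qed
    fix \<eta> assume \<eta>: "presymplectic_groupoid Q \<eta> \<and> form2_pullback (arrows G) (arrows Q) p \<eta> = \<omega>"
    then have "F b = delta_map Q \<eta> b ` algebroid Q b" if "b \<in> points B" for b
      using quotient_dirac[OF _ F E that] unfolding p_def by blast
    then show "integrates Q \<eta> F" using \<eta> bQ by (simp add: integrates_def)
  qed
qed

end
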